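(* Let $a\in C^1([0,\infty))$ with $a>0$ and let $b\in C([0,\infty))$. Put $B(x)=\int_0^x\frac{b(y)}{a(y)}\,dy$. Let $$H_D=-\frac12\frac{d}{dx}a\frac{d}{dx}-b\frac{d}{dx}=-\frac12 e^{-2B}\frac{d}{dx}a\,e^{2B}\frac{d}{dx}$$ be the self-adjoint diffusion operator on $L^2((0,\infty),e^{2B}dx)$ with the Dirichlet boundary condition at $0$. If moreover $b\in C^1((0,\infty))$, $\frac{b^2}{a}+b'$ is bounded from below and $\int^\infty a(x)\,dx=\infty$, let also $$H_S=-\frac12\frac{d}{dx}a\frac{d}{dx}+\frac12\Big(\frac{b^2}{a}+b'\Big)$$ be the self-adjoint Schrödinger-type operator on $L^2((0,\infty))$ with the Dirichlet boundary condition at $0$. Define $\Omega^+(b,a),\hat\Omega^+(b,a)\in[0,\infty]$ as follows. (A) If $\int^\infty\frac{1}{a(x)}e^{-2B(x)}dx=\infty$, set $$\Omega^+(b,a)=\sup_{x>0}\Big(\int_0^x\frac{1}{a(y)}e^{-2B(y)}dy\Big)\Big(\int_x^\infty e^{2B(y)}dy\Big),$$ $$\hat\Omega^+(b,a)=\limsup_{x\to\infty}\Big(\int_0^x\frac{1}{a(y)}e^{-2B(y)}dy\Big)\Big(\int_x^\infty e^{2B(y)}dy\Big).$$ (B) If $\int^\infty\frac{1}{a(x)}e^{-2B(x)}dx<\infty$, set $h_{b,a}(x)=\int_x^\infty\frac{1}{a(y)}e^{-2B(y)}dy$ and $$\Omega^+(b,a)=\sup_{x>0}\Big(\int_0^x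 h_{b,a}^{-2}(y)\frac{1}{a(y)}e^{-2B(y)}dy\Big)\Big(\int_x^\infty h_{b,a}^2(y)e^{2B(y)}dy\Big)=\sup_{x>0}\big(h_{b,a}^{-1}(x)-h_{b,a}^{-1}(0)\big)\int_x^\infty h_{b,a}^2(y)e^{2B(y)}dy,$$ $$\hat\Omega^+(b,a)=\limsup_{x\to\infty}\Big(\int_0^x h_{b,a}^{-2}(y)\frac{1}{a(y)}e^{-2B(y)}dy\Big)\Big(\int_x^\infty h_{b,a}^2(y)e^{2B(y)}dy\Big)=\limsup_{x\to\infty}\big(h_{b,a}^{-1}(x)-h_{b,a}^{-1}(0)\big)\int_x^\infty h_{b,a}^2(y)e^{2B(y)}dy.$$ Then $$\frac{1}{8\,\Omega^+(b,a)}\le\inf\sigma(H_D)=\inf\sigma(H_S)\le\frac{1}{2\,\Omega^+(b,a)}$$ and $$\frac{1}{8\,\hat\Omega^+(b,a)}\le\inf\sigma_{\rm ess}(H_D)=\inf\sigma_{\rm ess}(H_S)\le\frac{1}{2\,\hat\Omega^+(b,a)}$$ (the assertions about $H_S$ being made when $H_S$ is defined, i.e. under the additional assumptions above). In particular, $H_D$ and $H_S$ possess compact resolvents if and only if $\hat\Omega^+(b,a)=0$.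
   Context: $H_D$ is the non-negative self-adjoint operator on $L^2((0,\infty),e^{2B}dx)$ given by the Friedrichs extension, i.e. the operator associated with the closure of the form $Q_D(f,g)=\frac12\int_0^\infty a f'g'\,e^{2B}dx$, $f,g\in C_0^1((0,\infty))$ ($C^1$ functions with compact support in the open half-line $(0,\infty)$). $H_S$ is the self-adjoint operator on $L^2((0,\infty))$ associated with the closure of the semi-bounded form $Q_S(f,g)=\frac12\int_0^\infty a f'g'\,dx+\int_0^\infty \frac12\big(\frac{b^2}{a}+b'\big)fg\,dx$, $f,g\in C_0^1((0,\infty))$. $\sigma$ and $\sigma_{\rm ess}$ denote spectrum and essential spectrum. Conventions: $\inf\emptyset=\infty$, $1/0=\infty$, $1/\infty=0$, and (positive)$\cdot\infty=\infty$. $\int^\infty$ means the integral over a neighbourhood $[c,\infty)$ of infinity. *)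

theory Defs
  imports "HOL-Analysis.Analysis"
begin

section \<open>Unbounded operators and forms on complex \<open>L\<^sup>2\<close> spaces\<close>

text \<open>
  Elements of \<open>L\<^sup>2(M)\<close> are represented by functions; all notions below are invariant under
  changes on null sets.  An unbounded operator is given by its graph, a set of pairs \<open>(u, T u)\<close>
  of representatives.
\<close>

definition L2 :: "'x measure \<Rightarrow> ('x \<Rightarrow> complex) set" where
  "L2 M = {f \<in> borel_measurable M. integrable M (\<lambda>x. (cmod (f x))\<^sup>2)}"

definition L2_inner :: "'x measure \<Rightarrow> ('x \<Rightarrow> complex) \<Rightarrow> ('x \<Rightarrow> complex) \<Rightarrow> complex" where
  "L2_inner M f g = (LINT x|M. f x * cnj (g x))"

definition L2_norm :: "'x measure \<Rightarrow> ('x \<Rightarrow> complex) \<Rightarrow> real" where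
  "L2_norm M f = sqrt (LINT x|M. (cmod (f x))\<^sup>2)"

definition L2_tendsto :: "'x measure \<Rightarrow> (nat \<Rightarrow> 'x \<Rightarrow> complex) \<Rightarrow> ('x \<Rightarrow> complex) \<Rightarrow> bool" where
  "L2_tendsto M us u \<longleftrightarrow> u \<in> L2 M \<and> (\<lambda>n. L2_norm M (\<lambda>x. us n x - u x)) \<longlonglongrightarrow> 0"

type_synonym 'x form = "('x \<Rightarrow> complex) \<Rightarrow> ('x \<Rightarrow> complex) \<Rightarrow> complex"
type_synonym 'x operator = "(('x \<Rightarrow> complex) \<times> ('x \<Rightarrow> complex)) set"

text \<open>
  Convergence with respect to a semi-bounded form \<open>q\<close> with domain \<open>D\<close>: since the sequence
  converges in \<open>L\<^sup>2\<close>, being Cauchy for \<open>q\<close> is the same as being Cauchy for the form norm.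
\<close>

definition form_tendsto ::
    "'x measure \<Rightarrow> ('x \<Rightarrow> complex) set \<Rightarrow> 'x form \<Rightarrow> (nat \<Rightarrow> 'x \<Rightarrow> complex) \<Rightarrow> ('x \<Rightarrow> complex) \<Rightarrow> bool" where
  "form_tendsto M D q us u \<longleftrightarrow>
     (\<forall>n. us n \<in> D) \<and> L2_tendsto M us u \<and>
     (\<forall>e>0. \<exists>N. \<forall>m\<ge>N. \<forall>n\<ge>N.
        cmod (q (\<lambda>x. us m x - us n x) (\<lambda>x. us m x - us n x)) < e)"

definition closure_dom :: "'x measure \<Rightarrow> ('x \<Rightarrow> complex) set \<Rightarrow> 'x form \<Rightarrow> ('x \<Rightarrow> complex) set" where
  "closure_dom M D q = {u. \<exists>us. form_tendsto M D q us u}"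

text \<open>The value of the closure; the limit exists and is unique when \<open>q\<close> is closable.\<close>

definition closure_form :: "'x measure \<Rightarrow> ('x \<Rightarrow> complex) set \<Rightarrow> 'x form \<Rightarrow> 'x form" where
  "closure_form M D q u v =
     (THE c. \<forall>us vs. form_tendsto M D q us u \<longrightarrow> form_tendsto M D q vs v \<longrightarrow>
        (\<lambda>n. q (us n) (vs n)) \<longlonglongrightarrow> c)"

definition form_operator :: "'x measure \<Rightarrow> ('x \<Rightarrow> complex) set \<Rightarrow> 'x form \<Rightarrow> 'x operator" where
  "form_operator M D q =
     {(u, f). u \<in> closure_dom M D q \<and> f \<in> L2 M \<and>
        (\<forall>v\<in>closure_dom M D q. closure_form M D q u v = L2_inner M f v)}"

text \<open>\<open>T - z\<close> is a bijection from the domain onto \<open>L\<^sup>2\<close> with bounded inverse.\<close>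

definition resolvent_set :: "'x measure \<Rightarrow> 'x operator \<Rightarrow> complex set" where
  "resolvent_set M T =
     {z. (\<forall>f\<in>L2 M. \<exists>(u, g)\<in>T. AE x in M. g x - z * u x = f x) \<and>
         (\<exists>C. \<forall>(u, g)\<in>T. L2_norm M u \<le> C * L2_norm M (\<lambda>x. g x - z * u x))}"

definition spectrum :: "'x measure \<Rightarrow> 'x operator \<Rightarrow> complex set" where
  "spectrum M T = - resolvent_set M T"

definition eigenspace :: "'x measure \<Rightarrow> 'x operator \<Rightarrow> complex \<Rightarrow> ('x \<Rightarrow> complex) set" where
  "eigenspace M T z = {u. \<exists>g. (u, g) \<in> T \<and> (AE x in M. g x = z * u x)}"

definition finite_dim_AE :: "'x measure \<Rightarrow> ('x \<Rightarrow> complex) set \<Rightarrow> bool" where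
  "finite_dim_AE M V \<longleftrightarrow>
     (\<exists>F. finite F \<and> F \<subseteq> V \<and> (\<forall>u\<in>V. \<exists>c. AE x in M. u x = (\<Sum>v\<in>F. c v * v x)))"

definition discrete_spectrum :: "'x measure \<Rightarrow> 'x operator \<Rightarrow> complex set" where
  "discrete_spectrum M T =
     {z. z isolated_in spectrum M T \<and>
         (\<exists>u\<in>eigenspace M T z. \<not> (AE x in M. u x = 0)) \<and>
         finite_dim_AE M (eigenspace M T z)}"

definition ess_spectrum :: "'x measure \<Rightarrow> 'x operator \<Rightarrow> complex set" where
  "ess_spectrum M T = spectrum M T - discrete_spectrum M T"

text \<open>The spectrum of a self-adjoint operator is real, so \<open>Re\<close> is only a coercion here.\<close>

definition inf_real :: "complex set \<Rightarrow> ereal" where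
  "inf_real S = (INF z\<in>S. ereal (Re z))"

definition compact_resolvent :: "'x measure \<Rightarrow> 'x operator \<Rightarrow> bool" where
  "compact_resolvent M T \<longleftrightarrow>
     (\<exists>z\<in>resolvent_set M T. \<forall>us gs.
        (\<forall>n. (us (n::nat), gs n) \<in> T) \<and> (\<exists>C. \<forall>n. L2_norm M (\<lambda>x. gs n x - z * us n x) \<le> C) \<longrightarrow>
        (\<exists>(r :: nat \<Rightarrow> nat) u. strict_mono r \<and> L2_tendsto M (us \<circ> r) u))"

section \<open>The diffusion and Schroedinger operators\<close>

definition C1_on :: "real set \<Rightarrow> (real \<Rightarrow> 'v::real_normed_vector) \<Rightarrow> bool" where
  "C1_on S f \<longleftrightarrow>
     (\<exists>f'. (\<forall>x\<in>S. (f has_vector_derivative f' x) (at x within S)) \<and> continuous_on S f')"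

definition C1_compact_support :: "(real \<Rightarrow> complex) set" where
  "C1_compact_support =
     {f. C1_on {0<..} f \<and> (\<exists>K. compact K \<and> K \<subseteq> {0<..} \<and> (\<forall>x\<in>{0<..} - K. f x = 0))}"

definition BB :: "(real \<Rightarrow> real) \<Rightarrow> (real \<Rightarrow> real) \<Rightarrow> real \<Rightarrow> real" where
  "BB a b x = integral {0..x} (\<lambda>y. b y / a y)"

definition M_D :: "(real \<Rightarrow> real) \<Rightarrow> (real \<Rightarrow> real) \<Rightarrow> real measure" where
  "M_D a b = density (restrict_space lborel {0<..}) (\<lambda>x. ennreal (exp (2 * BB a b x)))"

definition M_S :: "real measure" where
  "M_S = restrict_space lborel {0<..}"

text \<open>The forms are the sesquilinear extensions of the bilinear forms on real functions.\<close>

definition Q_D :: "(real \<Rightarrow> real) \<Rightarrow> (real \<Rightarrow> real) \<Rightarrow> real form" where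
  "Q_D a b f g = 1/2 * (LINT x:{0<..}|lborel.
     of_real (a x) * vector_derivative f (at x) * cnj (vector_derivative g (at x))
       * of_real (exp (2 * BB a b x)))"

definition V_S :: "(real \<Rightarrow> real) \<Rightarrow> (real \<Rightarrow> real) \<Rightarrow> real \<Rightarrow> real" where
  "V_S a b x = (b x)\<^sup>2 / a x + deriv b x"

definition Q_S :: "(real \<Rightarrow> real) \<Rightarrow> (real \<Rightarrow> real) \<Rightarrow> real form" where
  "Q_S a b f g =
     1/2 * (LINT x:{0<..}|lborel.
       of_real (a x) * vector_derivative f (at x) * cnj (vector_derivative g (at x)))
     + (LINT x:{0<..}|lborel. of_real (1/2 * V_S a b x) * f x * cnj (g x))"

definition H_D :: "(real \<Rightarrow> real) \<Rightarrow> (real \<Rightarrow> real) \<Rightarrow> real operator" where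
  "H_D a b = form_operator (M_D a b) C1_compact_support (Q_D a b)"

definition H_S :: "(real \<Rightarrow> real) \<Rightarrow> (real \<Rightarrow> real) \<Rightarrow> real operator" where
  "H_S a b = form_operator M_S C1_compact_support (Q_S a b)"

section \<open>The quantities \<open>\<Omega>\<^sup>+\<close> and its limsup analogue\<close>

text \<open>\<open>f\<close> (nonnegative) has infinite integral over every neighbourhood of infinity.\<close>

definition tail_infinite :: "(real \<Rightarrow> real) \<Rightarrow> bool" where
  "tail_infinite f \<longleftrightarrow> (\<forall>c>0. (\<integral>\<^sup>+x\<in>{c..}. ennreal (f x) \<partial>lborel) = \<infinity>)"

definition scale_dens :: "(real \<Rightarrow> real) \<Rightarrow> (real \<Rightarrow> real) \<Rightarrow> real \<Rightarrow> real" where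
  "scale_dens a b x = 1 / a x * exp (- 2 * BB a b x)"

definition hh :: "(real \<Rightarrow> real) \<Rightarrow> (real \<Rightarrow> real) \<Rightarrow> real \<Rightarrow> real" where
  "hh a b x = (LINT y:{x..}|lborel. scale_dens a b y)"

definition Omega_fun :: "(real \<Rightarrow> real) \<Rightarrow> (real \<Rightarrow> real) \<Rightarrow> real \<Rightarrow> ennreal" where
  "Omega_fun a b x =
     (if tail_infinite (scale_dens a b)
      then (\<integral>\<^sup>+y\<in>{0..x}. ennreal (scale_dens a b y) \<partial>lborel) *
           (\<integral>\<^sup>+y\<in>{x..}. ennreal (exp (2 * BB a b y)) \<partial>lborel)
      else (\<integral>\<^sup>+y\<in>{0..x}. ennreal (1 / (hh a b y)\<^sup>2 * scale_dens a b y) \<partial>lborel) *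
           (\<integral>\<^sup>+y\<in>{x..}. ennreal ((hh a b y)\<^sup>2 * exp (2 * BB a b y)) \<partial>lborel))"

definition Omega :: "(real \<Rightarrow> real) \<Rightarrow> (real \<Rightarrow> real) \<Rightarrow> ennreal" where
  "Omega a b = (SUP x\<in>{0<..}. Omega_fun a b x)"

definition Omega_hat :: "(real \<Rightarrow> real) \<Rightarrow> (real \<Rightarrow> real) \<Rightarrow> ennreal" where
  "Omega_hat a b = Limsup at_top (Omega_fun a b)"

end

theory Submission
  imports Defs "HOL-Complex_Analysis.Great_Picard" "HOL-Library.Diagonal_Subsequence"
begin

text \<open>
  Let \<open>s\<close> be the scale density, and let \<open>h\<close> be \<open>1\<close> if \<open>s\<close> has infinite integral and the tail integral
  of \<open>s\<close> otherwise.  In both cases \<open>h\<close> is harmonic, \<open>P(x) = \<integral>\<^sub>0\<^sup>x s / h\<^sup>2\<close> is unbounded and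
  \<open>\<Omega>\<^sup>+ = sup P(x) \<integral>\<^sub>x\<^sup>\<infinity> h\<^sup>2 e\<^sup>2\<^sup>B\<close>.  If this product is at most \<open>A\<close> on \<open>[l, \<infinity>)\<close>, an explicit solution of a
  Riccati inequality bounds the form from below by \<open>1/(8A)\<close> there, up to a boundary term at \<open>l\<close>.  With
  \<open>l \<rightarrow> 0\<close> this bounds the spectrum; for fixed \<open>l\<close> the boundary term and the part of the form on \<open>(0, l)\<close>
  are relatively compact, which bounds the essential spectrum.  Conversely, wherever the product exceeds
  \<open>A\<close>, a test function \<open>h \<phi>(P)\<close> with a piecewise linear (smoothed) trapezoid \<open>\<phi>\<close> has Rayleigh
  quotient at most \<open>1/(2A)\<close>, and if the limit superior exceeds \<open>A\<close>, infinitely many of them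
  with disjoint supports exist.  They force essential spectrum below \<open>1/(2A)\<close>: otherwise finitely many
  eigenspaces could be split off, and the infimum of the Rayleigh quotient over their complement would be
  one more spectral value.  Multiplication by \<open>e\<^sup>B\<close> intertwines the two forms, so \<open>H_D\<close> and \<open>H_S\<close> are
  unitarily equivalent.
\<close>

section \<open>Semi-inner products on spaces of functions\<close>

text \<open>The passage to \<open>h\<close> is forced by compact support. A test function has to
  return to zero near infinity at arbitrarily little cost; measured in the scale \<open>P\<close>, a
  descent costs the reciprocal of the distance covered, so \<open>P\<close> must be unbounded. An
  integrable scale density has a bounded primitive. Dividing by the harmonic function that vanishes
  at infinity produces the scale \<open>1/h - 1/h(0)\<close>, which is unbounded again, at the price
  of the extra weight \<open>h^2\<close>. The gap between the two constants is the factor 4 in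
  Muckenhoupt's form of Hardy's inequality; the common factor 2 stems from the 1/2 in the forms. On
  the abstract side only the graph of the operator is given. Riesz's theorem inverts
  \<open>T + 1\<close>, and closed-range arguments together with quantitative resolvent estimates
  take the place of a functional calculus. The essential spectrum is reached from below by a
  compactness condition on differences of form-bounded sequences, which can be verified by calculus
  on the core alone.\<close>

definition ip_complete :: "('x \<Rightarrow> complex) set \<Rightarrow> 'x form \<Rightarrow> bool" where
  "ip_complete V ip \<longleftrightarrow> (\<forall>us :: nat \<Rightarrow> 'x \<Rightarrow> complex. (\<forall>n. us n \<in> V) \<longrightarrow>
     (\<forall>e>0. \<exists>N. \<forall>m\<ge>N. \<forall>n\<ge>N. Re (ip (\<lambda>x. us m x - us n x) (\<lambda>x. us m x - us n x)) < e) \<longrightarrow>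
     (\<exists>u\<in>V. (\<lambda>n. Re (ip (\<lambda>x. us n x - u x) (\<lambda>x. us n x - u x))) \<longlonglongrightarrow> 0))"

text \<open>Vectors are functions and not classes, so definiteness is not demanded and vectors of
  square zero are carried along. L2, the form, its closure, the form norm, kernels, ranges and the
  shifted form in \<open>rayleigh_above\<close> are all instances.\<close>

locale semi_ip =
  fixes V :: "('x \<Rightarrow> complex) set" and ip :: "'x form"
  assumes nonempty: "V \<noteq> {}"
    and lin: "\<And>f g c. f \<in> V \<Longrightarrow> g \<in> V \<Longrightarrow> (\<lambda>x. f x + c * g x) \<in> V"
    and ip_lin: "\<And>f g h c. f \<in> V \<Longrightarrow> g \<in> V \<Longrightarrow> h \<in> V \<Longrightarrow>
      ip (\<lambda>x. f x + c * g x) h = ip f h + c * ip g h"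
    and ip_sym: "\<And>f g. f \<in> V \<Longrightarrow> g \<in> V \<Longrightarrow> ip g f = cnj (ip f g)"
    and ip_nonneg: "\<And>f. f \<in> V \<Longrightarrow> 0 \<le> Re (ip f f)"
begin

abbreviation sq :: "('x \<Rightarrow> complex) \<Rightarrow> real" where "sq f \<equiv> Re (ip f f)"

lemma add: "f \<in> V \<Longrightarrow> g \<in> V \<Longrightarrow> (\<lambda>x. f x + g x) \<in> V"
  using lin[of f g 1] by simp

lemma diff: "f \<in> V \<Longrightarrow> g \<in> V \<Longrightarrow> (\<lambda>x. f x - g x) \<in> V"
  using lin[of f g "-1"] by simp

lemma zero: "(\<lambda>x. 0) \<in> V"
proof -
  obtain f where "f \<in> V" using nonempty by blast
  from diff[OF this this] show ?thesis by simp
qed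

lemma scale: "f \<in> V \<Longrightarrow> (\<lambda>x. c * f x) \<in> V"
  using lin[OF zero, of f c] by simp

lemma ip_zero_left: "g \<in> V \<Longrightarrow> ip (\<lambda>x. 0) g = 0"
  using ip_lin[OF zero zero, of g 1] by simp

lemma ip_scale_left: "f \<in> V \<Longrightarrow> g \<in> V \<Longrightarrow> ip (\<lambda>x. c * f x) g = c * ip f g"
  using ip_lin[OF zero, of f g c] ip_zero_left[of g] by simp

lemma ip_add_left: "f \<in> V \<Longrightarrow> g \<in> V \<Longrightarrow> h \<in> V \<Longrightarrow> ip (\<lambda>x. f x + g x) h = ip f h + ip g h"
  using ip_lin[of f g h 1] by simp

lemma ip_diff_left: "f \<in> V \<Longrightarrow> g \<in> V \<Longrightarrow> h \<in> V \<Longrightarrow> ip (\<lambda>x. f x - g x) h = ip f h - ip g h"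
  using ip_lin[of f g h "-1"] by simp

lemma ip_lin_right: "f \<in> V \<Longrightarrow> g \<in> V \<Longrightarrow> h \<in> V \<Longrightarrow>
    ip h (\<lambda>x. f x + c * g x) = ip h f + cnj c * ip h g"
  by (subst ip_sym[OF lin]) (auto simp: ip_lin ip_sym[of f h] ip_sym[of g h])

lemma ip_scale_right: "f \<in> V \<Longrightarrow> g \<in> V \<Longrightarrow> ip g (\<lambda>x. c * f x) = cnj c * ip g f"
  by (subst ip_sym[OF scale]) (auto simp: ip_scale_left ip_sym[of f g])

lemma ip_add_right: "f \<in> V \<Longrightarrow> g \<in> V \<Longrightarrow> h \<in> V \<Longrightarrow> ip h (\<lambda>x. f x + g x) = ip h f + ip h g"
  using ip_lin_right[of f g h 1] by simp

lemma ip_diff_right: "f \<in> V \<Longrightarrow> g \<in> V \<Longrightarrow> h \<in> V \<Longrightarrow> ip h (\<lambda>x. f x - g x) = ip h f - ip h g"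
  using ip_lin_right[of f g h "-1"] by simp

lemma ip_self: "f \<in> V \<Longrightarrow> ip f f = of_real (sq f)"
  using ip_sym[of f f] by (simp add: complex_eq_iff)

lemma sq_lin:
  assumes "f \<in> V" "g \<in> V"
  shows "sq (\<lambda>x. f x + c * g x) = sq f + 2 * Re (cnj c * ip f g) + (cmod c)\<^sup>2 * sq g"
proof -
  have "ip (\<lambda>x. f x + c * g x) (\<lambda>x. f x + c * g x) =
      ip f f + cnj c * ip f g + c * (cnj (ip f g) + cnj c * ip g g)"
    using assms by (simp add: ip_lin lin ip_lin_right ip_sym[of f g] algebra_simps)
  also have "\<dots> = ip f f + (cnj c * ip f g + cnj (cnj c * ip f g)) + (c * cnj c) * of_real (sq g)"
    using assms ip_self[of g] by (simp add: algebra_simps)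
  also have "Re \<dots> = sq f + 2 * Re (cnj c * ip f g) + (cmod c)\<^sup>2 * sq g"
    unfolding complex_norm_square[symmetric] by (simp flip: of_real_power of_real_mult)
  finally show ?thesis .
qed

lemma sq_add: "f \<in> V \<Longrightarrow> g \<in> V \<Longrightarrow> sq (\<lambda>x. f x + g x) = sq f + 2 * Re (ip f g) + sq g"
  using sq_lin[of f g 1] by simp

lemma sq_diff: "f \<in> V \<Longrightarrow> g \<in> V \<Longrightarrow> sq (\<lambda>x. f x - g x) = sq f - 2 * Re (ip f g) + sq g"
  using sq_lin[of f g "-1"] by simp

lemma sq_scale: "f \<in> V \<Longrightarrow> sq (\<lambda>x. c * f x) = (cmod c)\<^sup>2 * sq f"
  using sq_lin[OF zero, of f c] by (simp add: ip_zero_left zero)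

lemma sq_diff_commute: "f \<in> V \<Longrightarrow> g \<in> V \<Longrightarrow> sq (\<lambda>x. f x - g x) = sq (\<lambda>x. g x - f x)"
  by (simp add: sq_diff ip_sym[of g f])

lemma Re_cnj_neg_mult_self: "Re (cnj (- (of_real t * w)) * w) = - t * (cmod w)\<^sup>2"
  unfolding cmod_power2 by (simp add: algebra_simps power2_eq_square)

text \<open>For \<open>sq g = 0\<close> the usual minimiser does not exist. The square of
  \<open>f - t * ip f g * g\<close> is then affine in \<open>t\<close>, and an affine function stays
  non-negative only if its slope vanishes.\<close>

lemma cauchy_schwarz:
  assumes f: "f \<in> V" and g: "g \<in> V"
  shows "(cmod (ip f g))\<^sup>2 \<le> sq f * sq g"
proof (cases "sq g = 0")
  case True
  have *: "0 \<le> sq f - 2 * t * (cmod (ip f g))\<^sup>2" for t :: real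
  proof -
    have "0 \<le> sq (\<lambda>x. f x + (- (of_real t * ip f g)) * g x)"
      by (intro ip_nonneg lin f g)
    also have "\<dots> = sq f - 2 * t * (cmod (ip f g))\<^sup>2"
      unfolding sq_lin[OF f g] Re_cnj_neg_mult_self using True by simp
    finally show ?thesis .
  qed
  have "cmod (ip f g) = 0"
  proof (rule ccontr)
    assume "cmod (ip f g) \<noteq> 0"
    then have "2 * ((sq f + 1) / (cmod (ip f g))\<^sup>2) * (cmod (ip f g))\<^sup>2 = 2 * (sq f + 1)" by simp
    with *[of "(sq f + 1) / (cmod (ip f g))\<^sup>2"] have "0 \<le> sq f - 2 * (sq f + 1)" by (simp only:)
    then have "sq f \<le> - 2" by (simp add: algebra_simps)
    then show False using ip_nonneg[OF f] by simp
  qed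
  then show ?thesis using True by simp
next
  case False
  then have p: "sq g > 0" using ip_nonneg[OF g] by linarith
  define t where "t = 1 / sq g"
  have "0 \<le> sq (\<lambda>x. f x + (- (of_real t * ip f g)) * g x)"
    by (intro ip_nonneg lin f g)
  also have "\<dots> = sq f - 2 * t * (cmod (ip f g))\<^sup>2 + t\<^sup>2 * (cmod (ip f g))\<^sup>2 * sq g"
    unfolding sq_lin[OF f g] Re_cnj_neg_mult_self by (simp add: norm_mult power_mult_distrib)
  also have "\<dots> = sq f - (cmod (ip f g))\<^sup>2 / sq g"
    using p by (simp add: t_def field_simps power2_eq_square)
  finally show ?thesis using p by (simp add: field_simps)
qed

lemma cauchy_schwarz_sqrt:
  assumes f: "f \<in> V" and g: "g \<in> V"
  shows "cmod (ip f g) \<le> sqrt (sq f) * sqrt (sq g)"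
  using cauchy_schwarz[OF assms] by (metis real_le_rsqrt real_sqrt_mult)

lemma triangle:
  assumes f: "f \<in> V" and g: "g \<in> V"
  shows "sqrt (sq (\<lambda>x. f x + g x)) \<le> sqrt (sq f) + sqrt (sq g)"
proof -
  have "Re (ip f g) \<le> sqrt (sq f) * sqrt (sq g)"
    using cauchy_schwarz_sqrt[OF f g] complex_Re_le_cmod[of "ip f g"] by linarith
  then have "sq (\<lambda>x. f x + g x) \<le> (sqrt (sq f) + sqrt (sq g))\<^sup>2"
    using ip_nonneg[OF f] ip_nonneg[OF g] by (simp add: sq_add[OF f g] power2_sum)
  then show ?thesis
    using ip_nonneg[OF f] ip_nonneg[OF g] by (intro real_le_lsqrt) auto
qed

lemma triangle_diff:
  assumes f: "f \<in> V" and g: "g \<in> V"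
  shows "sqrt (sq (\<lambda>x. f x - g x)) \<le> sqrt (sq f) + sqrt (sq g)"
  using triangle[OF f scale[OF g, of "-1"]] sq_scale[OF g, of "-1"] by simp

lemma sq_triangle:
  assumes f: "f \<in> V" and g: "g \<in> V" and h: "h \<in> V"
  shows "sq (\<lambda>x. f x - h x) \<le> 2 * sq (\<lambda>x. f x - g x) + 2 * sq (\<lambda>x. g x - h x)"
proof -
  have "(\<lambda>x. (f x - g x) - (g x - h x)) \<in> V" by (intro diff f g h)
  from ip_nonneg[OF this]
  have "2 * Re (ip (\<lambda>x. f x - g x) (\<lambda>x. g x - h x)) \<le> sq (\<lambda>x. f x - g x) + sq (\<lambda>x. g x - h x)"
    by (subst (asm) sq_diff) (auto intro: diff f g h)
  moreover have "(\<lambda>x. f x - h x) = (\<lambda>x. (f x - g x) + (g x - h x))" by auto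
  ultimately show ?thesis
    by (simp only: sq_add[OF diff[OF f g] diff[OF g h]])
qed

lemma sq_diff_le: "f \<in> V \<Longrightarrow> g \<in> V \<Longrightarrow> sq (\<lambda>x. f x - g x) \<le> 2 * sq f + 2 * sq g"
  using sq_triangle[OF _ zero, of f g] sq_scale[of g "-1"] by simp

lemma sq_add_le: "f \<in> V \<Longrightarrow> g \<in> V \<Longrightarrow> sq (\<lambda>x. f x + g x) \<le> 2 * sq f + 2 * sq g"
  using sq_diff_le[OF _ scale, of f g "-1"] sq_scale[of g "-1"] by simp

lemma ip_tendsto:
  assumes us: "\<And>n. us n \<in> V" and u: "u \<in> V" and lu: "(\<lambda>n. sq (\<lambda>x. us n x - u x)) \<longlonglongrightarrow> 0"
    and vs: "\<And>n. vs n \<in> V" and v: "v \<in> V" and lv: "(\<lambda>n. sq (\<lambda>x. vs n x - v x)) \<longlonglongrightarrow> 0"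
  shows "(\<lambda>n. ip (us n) (vs n)) \<longlonglongrightarrow> ip u v"
proof -
  let ?du = "\<lambda>n x. us n x - u x" and ?dv = "\<lambda>n x. vs n x - v x"
  have eq: "ip (us n) (vs n) - ip u v = ip (?du n) (?dv n) + ip (?du n) v + ip u (?dv n)" for n
    using us u vs v by (simp add: ip_diff_left ip_diff_right diff)
  have su: "(\<lambda>n. sqrt (sq (?du n))) \<longlonglongrightarrow> 0" and sv: "(\<lambda>n. sqrt (sq (?dv n))) \<longlonglongrightarrow> 0"
    using tendsto_real_sqrt[OF lu] tendsto_real_sqrt[OF lv] by simp_all
  have l1: "(\<lambda>n. ip (?du n) (?dv n)) \<longlonglongrightarrow> 0"
    by (rule Lim_null_comparison[of _ "\<lambda>n. sqrt (sq (?du n)) * sqrt (sq (?dv n))"])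
      (use tendsto_mult[OF su sv] cauchy_schwarz_sqrt us u vs v in \<open>auto simp: diff\<close>)
  have l2: "(\<lambda>n. ip (?du n) v) \<longlonglongrightarrow> 0"
    by (rule Lim_null_comparison[of _ "\<lambda>n. sqrt (sq (?du n)) * sqrt (sq v)"])
      (use tendsto_mult[OF su tendsto_const[of "sqrt (sq v)"]] cauchy_schwarz_sqrt us u vs v in \<open>auto simp: diff\<close>)
  have l3: "(\<lambda>n. ip u (?dv n)) \<longlonglongrightarrow> 0"
    by (rule Lim_null_comparison[of _ "\<lambda>n. sqrt (sq u) * sqrt (sq (?dv n))"])
      (use tendsto_mult[OF tendsto_const[of "sqrt (sq u)"] sv] cauchy_schwarz_sqrt us u vs v in \<open>auto simp: diff\<close>)
  have "(\<lambda>n. ip (us n) (vs n) - ip u v) \<longlonglongrightarrow> 0"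
    unfolding eq using tendsto_add[OF tendsto_add[OF l1 l2] l3] by simp
  then show ?thesis by (rule LIM_zero_cancel)
qed

lemma sq_tendsto:
  assumes "\<And>n. us n \<in> V" "u \<in> V" "(\<lambda>n. sq (\<lambda>x. us n x - u x)) \<longlonglongrightarrow> 0"
  shows "(\<lambda>n. sq (us n)) \<longlonglongrightarrow> sq u"
  by (intro tendsto_Re ip_tendsto assms)

text \<open>The representing vector minimises \<open>v \<mapsto> \<parallel>v\<parallel>\<^sup>2 - 2 Re (\<phi> v)\<close>.\<close>

lemma riesz:
  assumes compl: "ip_complete V ip"
    and phi_lin: "\<And>f g c. f \<in> V \<Longrightarrow> g \<in> V \<Longrightarrow> \<phi> (\<lambda>x. f x + c * g x) = \<phi> f + c * \<phi> g"
    and phi_bd: "\<And>f. f \<in> V \<Longrightarrow> (cmod (\<phi> f))\<^sup>2 \<le> C * sq f"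
  shows "\<exists>u\<in>V. \<forall>v\<in>V. \<phi> v = ip v u"
proof -
  define J where "J v = sq v - 2 * Re (\<phi> v)" for v
  have J_ge: "- max C 0 \<le> J v" if "v \<in> V" for v
  proof -
    have "Re (\<phi> v) \<le> cmod (\<phi> v)" by (rule complex_Re_le_cmod)
    also have "cmod (\<phi> v) \<le> sqrt (max C 0 * sq v)"
      using phi_bd[OF that] ip_nonneg[OF that]
      by (intro real_le_rsqrt) (smt (verit) mult_right_mono)
    also have "sqrt (max C 0 * sq v) = sqrt (max C 0) * sqrt (sq v)" by (rule real_sqrt_mult)
    also have "2 * \<dots> \<le> max C 0 + sq v"
      using sum_squares_bound[of "sqrt (max C 0)" "sqrt (sq v)"] ip_nonneg[OF that] by simp
    finally show ?thesis unfolding J_def by simp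
  qed
  define d where "d = Inf (J ` V)"
  have bdd: "bdd_below (J ` V)" using J_ge by (intro bdd_belowI2[where m = "- max C 0"]) auto
  have d_le: "d \<le> J v" if "v \<in> V" for v
    unfolding d_def using bdd that by (intro cInf_lower) auto
  have "\<exists>u\<in>V. J u < d + 1 / Suc n" for n
    using cInf_lessD[of "J ` V" "d + 1 / Suc n"] nonempty unfolding d_def by auto
  then obtain us where us: "\<And>n. us n \<in> V" and Jus: "\<And>n. J (us n) < d + 1 / Suc n" by metis
  have "sq (\<lambda>x. us m x - us n x) < 2 * (1 / Suc m + 1 / Suc n)" for m n
  proof -
    \<comment> \<open>Parallelogram identity: the midpoint of two almost minimising vectors cannot
      lie below the infimum \<open>d\<close>, so the two vectors are close.\<close>
    define w where "w = (\<lambda>x. (1/2) * (us m x + 1 * us n x))"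
    have wV: "w \<in> V" unfolding w_def by (intro scale lin us)
    have sw: "sq w = 1/4 * (sq (us m) + 2 * Re (ip (us m) (us n)) + sq (us n))"
      unfolding w_def by (subst sq_scale) (use sq_add[OF us us, of m n] lin[OF us us] add us in \<open>auto simp: power2_eq_square\<close>)
    have pw: "\<phi> w = 1/2 * (\<phi> (us m) + \<phi> (us n))"
    proof -
      have "\<phi> (\<lambda>x. 0) = 0" using phi_lin[OF zero zero, of 1] by simp
      then show ?thesis
        using phi_lin[OF zero lin[OF us us], of "1/2" m 1 n] phi_lin[OF us us, of m 1 n] unfolding w_def by simp
    qed
    have "sq (\<lambda>x. us m x - us n x) = 2 * (J (us m) + J (us n) - 2 * J w)"
      unfolding J_def sw pw sq_diff[OF us us] by (simp add: algebra_simps)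
    also have "\<dots> < 2 * (1 / Suc m + 1 / Suc n)"
      using d_le[OF wV] Jus[of m] Jus[of n] by (simp add: algebra_simps)
    finally show ?thesis .
  qed
  note cau = this
  have "\<exists>N. \<forall>m\<ge>N. \<forall>n\<ge>N. sq (\<lambda>x. us m x - us n x) < e" if e: "e > 0" for e
  proof -
    obtain N where N: "inverse (real (Suc N)) < e / 4"
      using reals_Archimedean[of "e / 4"] e by auto
    have "sq (\<lambda>x. us m x - us n x) < e" if "m \<ge> N" "n \<ge> N" for m n
    proof -
      have "1 / real (Suc m) \<le> 1 / real (Suc N)" "1 / real (Suc n) \<le> 1 / real (Suc N)"
        using that by (auto intro!: divide_left_mono)
      then show ?thesis using cau[of m n] N by (simp add: inverse_eq_divide)
    qed
    then show ?thesis by blast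
  qed
  then obtain u where u: "u \<in> V" and lim: "(\<lambda>n. sq (\<lambda>x. us n x - u x)) \<longlonglongrightarrow> 0"
    using compl us unfolding ip_complete_def by blast
  have "\<phi> v = ip v u" if v: "v \<in> V" for v
  proof -
    define w where "w n = ip v (us n) - \<phi> v" for n
    define w' where "w' = ip v u - \<phi> v"
    have wl: "w \<longlonglongrightarrow> w'" unfolding w_def w'_def
      by (intro tendsto_diff tendsto_const ip_tendsto us u lim v) (simp add: zero ip_zero_left)
    \<comment> \<open>Moving \<open>us n\<close> by \<open>t * v\<close> lowers \<open>J\<close> by
      at most the defect \<open>1 / Suc n\<close>. The direction of \<open>t\<close> is chosen such
      that the linear term becomes \<open>-2 * s * |w n|^2\<close>.\<close>
    have *: "-2 * s * (cmod (w n))\<^sup>2 + s\<^sup>2 * (cmod (w n))\<^sup>2 * sq v \<ge> - (1 / Suc n)" for s :: real and n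
    proof -
      define t where "t = - (of_real s * cnj (w n))"
      have "d \<le> J (\<lambda>x. us n x + t * v x)" by (intro d_le lin us v)
      also have "\<dots> = J (us n) + 2 * Re (cnj t * ip (us n) v) - 2 * Re (t * \<phi> v) + (cmod t)\<^sup>2 * sq v"
        unfolding J_def phi_lin[OF us v] sq_lin[OF us v] by simp
      also have "Re (cnj t * ip (us n) v) = Re (t * ip v (us n))"
        unfolding ip_sym[OF v us] by simp
      also have "2 * Re (t * ip v (us n)) = 2 * Re (t * w n) + 2 * Re (t * \<phi> v)"
        unfolding w_def by (simp add: algebra_simps)
      also have "Re (t * w n) = - s * (cmod (w n))\<^sup>2"
        using Re_cnj_neg_mult_self[of s "w n"] unfolding t_def by simp
      also have "(cmod t)\<^sup>2 = s\<^sup>2 * (cmod (w n))\<^sup>2"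
        unfolding t_def by (simp add: norm_mult power_mult_distrib)
      finally show ?thesis using Jus[of n] by simp
    qed
    have ge: "-2 * s * (cmod w')\<^sup>2 + s\<^sup>2 * (cmod w')\<^sup>2 * sq v \<ge> 0" for s :: real
    proof (rule tendsto_le[OF _ _ _ always_eventually[OF allI[OF *[where s = s]]]])
      show "(\<lambda>n. - 2 * s * (cmod (w n))\<^sup>2 + s\<^sup>2 * (cmod (w n))\<^sup>2 * sq v) \<longlonglongrightarrow>
          - 2 * s * (cmod w')\<^sup>2 + s\<^sup>2 * (cmod w')\<^sup>2 * sq v"
        by (intro tendsto_intros wl)
      show "(\<lambda>n. - (1 / real (Suc n))) \<longlonglongrightarrow> 0"
        using LIMSEQ_inverse_real_of_nat tendsto_minus by (force simp: inverse_eq_divide)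
    qed simp
    \<comment> \<open>Small enough for the quadratic term to be at most half of the linear
      one.\<close>
    define s where "s = 1 / (sq v + 1)"
    have s: "s > 0" "s * sq v \<le> 1" using ip_nonneg[OF v] by (auto simp: s_def field_simps)
    have "0 \<le> s * (cmod w')\<^sup>2 * (s * sq v - 2)"
      using ge[of s] by (simp add: algebra_simps power2_eq_square)
    moreover have "s * sq v - 2 < 0" using s by simp
    ultimately have "s * (cmod w')\<^sup>2 \<le> 0"
      by (smt (verit, best) mult_pos_neg)
    then have "w' = 0" using s by (simp add: mult_le_0_iff)
    then show ?thesis by (simp add: w'_def)
  qed
  with u show ?thesis by blast
qed

end

lemma semi_ip_subspace:
  assumes "semi_ip V ip" "U \<subseteq> V" "U \<noteq> {}"
    and "\<And>f g c. f \<in> U \<Longrightarrow> g \<in> U \<Longrightarrow> (\<lambda>x. f x + c * g x) \<in> U"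
  shows "semi_ip U ip"
proof -
  interpret semi_ip V ip by fact
  show ?thesis
  proof
    show "U \<noteq> {}" by fact
    show "(\<lambda>x. f x + c * g x) \<in> U" if "f \<in> U" "g \<in> U" for f g c using that by (rule assms(4))
    show "ip (\<lambda>x. f x + c * g x) h = ip f h + c * ip g h" if "f \<in> U" "g \<in> U" "h \<in> U" for f g h c
      using that assms(2) by (intro ip_lin) auto
    show "ip g f = cnj (ip f g)" if "f \<in> U" "g \<in> U" for f g
      using that assms(2) by (intro ip_sym) auto
    show "0 \<le> Re (ip f f)" if "f \<in> U" for f
      using that assms(2) by (intro ip_nonneg) auto
  qed
qed

section \<open>The space of square integrable functions\<close>

lemma borel_measurable_cnj [measurable (raw)]:
  "f \<in> borel_measurable M \<Longrightarrow> (\<lambda>x. cnj (f x)) \<in> borel_measurable M"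
  by (rule borel_measurable_continuous_on[where f = cnj]) (intro continuous_intros)

lemma L2_measurable: "f \<in> L2 M \<Longrightarrow> f \<in> borel_measurable M"
  by (simp add: L2_def)

lemma L2_integrable: "f \<in> L2 M \<Longrightarrow> integrable M (\<lambda>x. (cmod (f x))\<^sup>2)"
  by (simp add: L2_def)

lemma L2_lin:
  assumes f: "f \<in> L2 M" and g: "g \<in> L2 M"
  shows "(\<lambda>x. f x + c * g x) \<in> L2 M"
proof -
  have [measurable]: "f \<in> borel_measurable M" "g \<in> borel_measurable M"
    using f g by (auto intro: L2_measurable)
  have "integrable M (\<lambda>x. (cmod (f x + c * g x))\<^sup>2)"
  proof (rule Bochner_Integration.integrable_bound[of _ "\<lambda>x. 2 * (cmod (f x))\<^sup>2 + 2 * (cmod c)\<^sup>2 * (cmod (g x))\<^sup>2"])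
    show "integrable M (\<lambda>x. 2 * (cmod (f x))\<^sup>2 + 2 * (cmod c)\<^sup>2 * (cmod (g x))\<^sup>2)"
      using f g by (auto simp: L2_def)
    have "(cmod (f x + c * g x))\<^sup>2 \<le> 2 * (cmod (f x))\<^sup>2 + 2 * (cmod c)\<^sup>2 * (cmod (g x))\<^sup>2" for x
    proof -
      have "(cmod (f x + c * g x))\<^sup>2 \<le> (cmod (f x) + cmod c * cmod (g x))\<^sup>2"
        using norm_triangle_ineq[of "f x" "c * g x"] by (intro power_mono) (auto simp: norm_mult)
      also have "\<dots> \<le> 2 * (cmod (f x))\<^sup>2 + 2 * (cmod c * cmod (g x))\<^sup>2"
        using sum_squares_bound[of "cmod (f x)" "cmod c * cmod (g x)"] by (simp add: power2_sum)
      finally show ?thesis by (simp add: power_mult_distrib)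
    qed
    then show "AE x in M. norm ((cmod (f x + c * g x))\<^sup>2) \<le> norm (2 * (cmod (f x))\<^sup>2 + 2 * (cmod c)\<^sup>2 * (cmod (g x))\<^sup>2)"
      by (intro AE_I2) (simp add: order_trans[OF _ abs_ge_self])
  qed simp
  then show ?thesis by (simp add: L2_def)
qed

lemma L2_mult_integrable:
  assumes f: "f \<in> L2 M" and g: "g \<in> L2 M"
  shows "integrable M (\<lambda>x. f x * cnj (g x))"
proof -
  have [measurable]: "f \<in> borel_measurable M" "g \<in> borel_measurable M"
    using f g by (auto intro: L2_measurable)
  show ?thesis
  proof (rule Bochner_Integration.integrable_bound[of _ "\<lambda>x. (cmod (f x))\<^sup>2 + (cmod (g x))\<^sup>2"])
    show "integrable M (\<lambda>x. (cmod (f x))\<^sup>2 + (cmod (g x))\<^sup>2)"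
      using f g by (auto simp: L2_def)
    have "cmod (f x) * cmod (g x) \<le> (cmod (f x))\<^sup>2 + (cmod (g x))\<^sup>2" for x
      using sum_squares_bound[of "cmod (f x)" "cmod (g x)"]
        mult_nonneg_nonneg[OF norm_ge_zero[of "f x"] norm_ge_zero[of "g x"]] by linarith
    then show "AE x in M. norm (f x * cnj (g x)) \<le> norm ((cmod (f x))\<^sup>2 + (cmod (g x))\<^sup>2)"
      by (intro AE_I2) (simp add: norm_mult)
  qed simp
qed

lemma L2_inner_self: "L2_inner M f f = of_real (LINT x|M. (cmod (f x))\<^sup>2)"
  unfolding L2_inner_def complex_norm_square[symmetric] by (rule integral_complex_of_real)

lemma L2_norm_power2: "(L2_norm M f)\<^sup>2 = Re (L2_inner M f f)"
  unfolding L2_norm_def L2_inner_self by simp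

lemma L2_norm_eq: "L2_norm M f = sqrt (Re (L2_inner M f f))"
  unfolding L2_norm_def L2_inner_self by simp

interpretation L2: semi_ip "L2 M" "L2_inner M" for M
proof
  show "L2 M \<noteq> {}" by (auto simp: L2_def intro!: exI[of _ "\<lambda>_. 0"])
  show "(\<lambda>x. f x + c * g x) \<in> L2 M" if "f \<in> L2 M" "g \<in> L2 M" for f g c
    using that by (rule L2_lin)
  show "L2_inner M (\<lambda>x. f x + c * g x) h = L2_inner M f h + c * L2_inner M g h"
    if "f \<in> L2 M" "g \<in> L2 M" "h \<in> L2 M" for f g h c
  proof -
    have "L2_inner M (\<lambda>x. f x + c * g x) h = (LINT x|M. f x * cnj (h x) + c * (g x * cnj (h x)))"
      unfolding L2_inner_def by (simp add: algebra_simps)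
    also have "\<dots> = L2_inner M f h + c * L2_inner M g h"
      unfolding L2_inner_def
      by (subst Bochner_Integration.integral_add) (use that in \<open>auto intro: L2_mult_integrable\<close>)
    finally show ?thesis .
  qed
  show "L2_inner M g f = cnj (L2_inner M f g)" for f g
    unfolding L2_inner_def Bochner_Integration.integral_cnj[symmetric] by (simp add: mult.commute)
  show "0 \<le> Re (L2_inner M f f)" for f
    unfolding L2_inner_self by simp
qed

lemma L2_null_iff:
  assumes "f \<in> L2 M"
  shows "Re (L2_inner M f f) = 0 \<longleftrightarrow> (AE x in M. f x = 0)"
  unfolding L2_inner_self
  using integral_nonneg_eq_0_iff_AE[OF L2_integrable[OF assms]] by simp

lemma L2_inner_cong_AE:
  assumes "AE x in M. f x = f' x" "AE x in M. g x = g' x"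
    and "f \<in> L2 M" "f' \<in> L2 M" "g \<in> L2 M" "g' \<in> L2 M"
  shows "L2_inner M f g = L2_inner M f' g'"
proof -
  have [measurable]: "f \<in> borel_measurable M" "g \<in> borel_measurable M"
       "f' \<in> borel_measurable M" "g' \<in> borel_measurable M"
    using assms by (auto intro: L2_measurable)
  show ?thesis unfolding L2_inner_def
    by (rule integral_cong_AE) (measurable, use assms(1,2) in auto)
qed


lemma L2I:
  assumes "f \<in> borel_measurable M" "(\<integral>\<^sup>+x. ennreal ((cmod (f x))\<^sup>2) \<partial>M) < \<infinity>"
  shows "f \<in> L2 M"
  using assms by (auto simp: L2_def integrable_iff_bounded)

lemma L2_nn_integral:
  assumes "f \<in> L2 M"
  shows "(\<integral>\<^sup>+x. ennreal ((cmod (f x))\<^sup>2) \<partial>M) = ennreal (Re (L2_inner M f f))"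
  unfolding L2_inner_self using L2_integrable[OF assms] by (subst nn_integral_eq_integral) auto

lemma term_le_suminf_ennreal: "g k \<le> (\<Sum>k. g k :: ennreal)"
  using sum_le_suminf[of g "{k}"] by simp

text \<open>Riesz-Fischer for representatives: a rapidly converging subsequence converges almost
  everywhere, and Fatou's lemma turns the Cauchy bound into a bound for the distance to that
  limit.\<close>

lemma L2_complete: "ip_complete (L2 M) (L2_inner M)"
  unfolding ip_complete_def
proof (intro allI impI)
  fix us :: "nat \<Rightarrow> 'a \<Rightarrow> complex"
  let ?sq = "\<lambda>f. Re (L2_inner M f f)"
  assume us: "\<forall>n. us n \<in> L2 M"
    and cau: "\<forall>e>0. \<exists>N. \<forall>m\<ge>N. \<forall>n\<ge>N. ?sq (\<lambda>x. us m x - us n x) < e"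
  have [measurable]: "us n \<in> borel_measurable M" for n using us by (auto intro: L2_measurable)
  have "\<forall>k. \<exists>N. \<forall>m\<ge>N. \<forall>n\<ge>N. ?sq (\<lambda>x. us m x - us n x) < (1/8)^k" using cau by simp
  then obtain N where N: "\<And>k m n. m \<ge> N k \<Longrightarrow> n \<ge> N k \<Longrightarrow> ?sq (\<lambda>x. us m x - us n x) < (1/8)^k"
    by metis
  define r where "r k = k + sum N {..k}" for k
  have rN: "r k \<ge> N k" for k
    using member_le_sum[of k "{..k}" N] by (simp add: r_def)
  have rSN: "r (Suc k) \<ge> N k" for k
    using rN[of k] by (simp add: r_def)
  have rk: "r k \<ge> k" for k by (simp add: r_def)
  \<comment> \<open>The weights \<open>4^k\<close> below are affordable because the squared norms
    decrease like \<open>(1/8)^k\<close>. Finiteness of the weighted sum almost everywhere then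
    bounds \<open>cmod (\<Delta> k x)\<close> by a multiple of \<open>(1/2)^k\<close>.\<close>
  define \<Delta> where "\<Delta> k x = us (r (Suc k)) x - us (r k) x" for k x
  have \<Delta>L2: "\<Delta> k \<in> L2 M" for k unfolding \<Delta>_def using us by (intro L2.diff) auto
  have [measurable]: "\<Delta> k \<in> borel_measurable M" for k using \<Delta>L2 by (rule L2_measurable)
  have "(\<integral>\<^sup>+x. (\<Sum>k. ennreal (4^k * (cmod (\<Delta> k x))\<^sup>2)) \<partial>M) = (\<Sum>k. \<integral>\<^sup>+x. ennreal (4^k * (cmod (\<Delta> k x))\<^sup>2) \<partial>M)"
    by (rule nn_integral_suminf) simp
  also have "\<dots> \<le> (\<Sum>k. ennreal ((1/2)^k))"
  proof (intro suminf_le summableI)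
    fix k
    have "(\<integral>\<^sup>+x. ennreal (4^k * (cmod (\<Delta> k x))\<^sup>2) \<partial>M) = ennreal (4^k) * (\<integral>\<^sup>+x. ennreal ((cmod (\<Delta> k x))\<^sup>2) \<partial>M)"
      by (simp add: ennreal_mult nn_integral_cmult)
    also have "\<dots> = ennreal (4^k * ?sq (\<Delta> k))"
      unfolding L2_nn_integral[OF \<Delta>L2] by (simp add: ennreal_mult L2.ip_nonneg[OF \<Delta>L2])
    also have "\<dots> \<le> ennreal (4^k * (1/8)^k)"
      using N[OF rSN rN, of k] unfolding \<Delta>_def by (intro ennreal_leI mult_left_mono) auto
    also have "4^k * (1/8)^k = (1/2::real)^k" by (simp flip: power_mult_distrib)
    finally show "(\<integral>\<^sup>+x. ennreal (4^k * (cmod (\<Delta> k x))\<^sup>2) \<partial>M) \<le> ennreal ((1/2)^k)" .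
  qed
  also have "\<dots> = ennreal (\<Sum>k. (1/2)^k)"
    by (rule suminf_ennreal2) auto
  also have "\<dots> < \<infinity>" by simp
  finally have "(\<integral>\<^sup>+x. (\<Sum>k. ennreal (4^k * (cmod (\<Delta> k x))\<^sup>2)) \<partial>M) \<noteq> \<infinity>" by simp
  then have AE_fin: "AE x in M. (\<Sum>k. ennreal (4^k * (cmod (\<Delta> k x))\<^sup>2)) \<noteq> \<infinity>"
    by (intro nn_integral_noteq_infinite) auto
  \<comment> \<open>Where the subsequence diverges, \<open>lim\<close> is an arbitrary value; this
    concerns a null set only and does not affect measurability.\<close>
  define f where "f = (\<lambda>x. lim (\<lambda>k. us (r k) x))"
  have f_meas [measurable]: "f \<in> borel_measurable M" unfolding f_def
  proof (rule borel_measurable_lim_metric)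
    show "us (r i) \<in> borel_measurable M" for i using us by (simp add: L2_measurable)
  qed
  have AE_lim: "AE x in M. (\<lambda>k. us (r k) x) \<longlonglongrightarrow> f x"
    using AE_fin
  proof eventually_elim
    case (elim x)
    define S where "S = enn2real (\<Sum>k. ennreal (4^k * (cmod (\<Delta> k x))\<^sup>2))"
    have le: "4^k * (cmod (\<Delta> k x))\<^sup>2 \<le> S" for k
    proof -
      have "ennreal (4^k * (cmod (\<Delta> k x))\<^sup>2) \<le> (\<Sum>k. ennreal (4^k * (cmod (\<Delta> k x))\<^sup>2))"
        by (rule term_le_suminf_ennreal)
      then show ?thesis unfolding S_def using elim
        by (intro enn2real_mono[of "ennreal (4^k * (cmod (\<Delta> k x))\<^sup>2)", simplified]) (auto simp: less_top)
    qed
    have bd: "cmod (\<Delta> k x) \<le> sqrt S * (1/2)^k" for k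
    proof -
      have "(2^k * cmod (\<Delta> k x))\<^sup>2 \<le> S"
        using le[of k] power_mult_distrib[of 2 "2::real" k]
        by (simp add: power_mult_distrib power_even_eq power2_eq_square[of "2^k"])
      then have "2^k * cmod (\<Delta> k x) \<le> sqrt S" by (rule real_le_rsqrt)
      then show ?thesis by (simp add: field_simps power_one_over)
    qed
    have "summable (\<lambda>k. sqrt S * (1/2)^k)" by (intro summable_mult summable_geometric) simp
    then have "summable (\<lambda>k. \<Delta> k x)"
      by (rule summable_comparison_test'[where N = 0]) (rule bd)
    then have "(\<lambda>n. \<Sum>k<n. \<Delta> k x) \<longlonglongrightarrow> (\<Sum>k. \<Delta> k x)" by (rule summable_LIMSEQ)
    then have "(\<lambda>n. us (r 0) x + (\<Sum>k<n. \<Delta> k x)) \<longlonglongrightarrow> us (r 0) x + (\<Sum>k. \<Delta> k x)" by (intro tendsto_intros)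
    moreover have "(\<Sum>k<n. \<Delta> k x) = us (r n) x - us (r 0) x" for n
      unfolding \<Delta>_def by (rule sum_lessThan_telescope)
    ultimately have "convergent (\<lambda>k. us (r k) x)" by (auto simp: convergent_def)
    then show ?case unfolding f_def by (simp add: convergent_LIMSEQ_iff)
  qed
  have fatou: "(\<integral>\<^sup>+x. ennreal ((cmod (us m x - f x))\<^sup>2) \<partial>M) \<le> ennreal e"
    if e: "\<And>m n. m \<ge> N0 \<Longrightarrow> n \<ge> N0 \<Longrightarrow> ?sq (\<lambda>x. us m x - us n x) < e" and m: "m \<ge> N0" for m N0 e
  proof -
    have "(\<integral>\<^sup>+x. ennreal ((cmod (us m x - f x))\<^sup>2) \<partial>M)
        = (\<integral>\<^sup>+x. liminf (\<lambda>k. ennreal ((cmod (us m x - us (r k) x))\<^sup>2)) \<partial>M)"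
    proof (rule nn_integral_cong_AE)
      show "AE x in M. ennreal ((cmod (us m x - f x))\<^sup>2) = liminf (\<lambda>k. ennreal ((cmod (us m x - us (r k) x))\<^sup>2))"
        using AE_lim
      proof eventually_elim
        case (elim x)
        have "(\<lambda>k. ennreal ((cmod (us m x - us (r k) x))\<^sup>2)) \<longlonglongrightarrow> ennreal ((cmod (us m x - f x))\<^sup>2)"
          by (intro tendsto_ennrealI tendsto_power tendsto_norm tendsto_diff tendsto_const elim)
        then show ?case by (intro lim_imp_Liminf[symmetric]) auto
      qed
    qed
    also have "\<dots> \<le> liminf (\<lambda>k. \<integral>\<^sup>+x. ennreal ((cmod (us m x - us (r k) x))\<^sup>2) \<partial>M)"
      by (rule nn_integral_liminf) simp
    also have "\<dots> \<le> liminf (\<lambda>k. ennreal e)"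
    proof (intro Liminf_mono eventually_sequentiallyI[of N0])
      fix k assume "k \<ge> N0"
      then have "r k \<ge> N0" using rk[of k] by simp
      then show "(\<integral>\<^sup>+x. ennreal ((cmod (us m x - us (r k) x))\<^sup>2) \<partial>M) \<le> ennreal e"
        using e[OF m, of "r k"] us by (subst L2_nn_integral) (auto intro!: L2.diff ennreal_leI)
    qed
    also have "\<dots> = ennreal e" by (simp add: Liminf_const)
    finally show ?thesis .
  qed
  obtain N1 where N1: "\<And>m n. m \<ge> N1 \<Longrightarrow> n \<ge> N1 \<Longrightarrow> ?sq (\<lambda>x. us m x - us n x) < 1"
    using cau by (metis zero_less_one)
  have "(\<lambda>x. us N1 x - f x) \<in> L2 M"
  proof (rule L2I)
    have "(\<integral>\<^sup>+x. ennreal ((cmod (us N1 x - f x))\<^sup>2) \<partial>M) \<le> ennreal 1"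
      by (rule fatou[where ?N0.0 = N1]) (use N1 in auto)
    then show "(\<integral>\<^sup>+x. ennreal ((cmod (us N1 x - f x))\<^sup>2) \<partial>M) < \<infinity>"
      using le_less_trans by fastforce
  qed simp
  then have f: "f \<in> L2 M"
    using L2.diff[of "us N1" M "\<lambda>x. us N1 x - f x"] us by simp
  have "(\<lambda>n. ?sq (\<lambda>x. us n x - f x)) \<longlonglongrightarrow> 0"
  proof (rule LIMSEQ_I)
    fix e :: real assume e: "e > 0"
    then obtain N0 where N0: "\<And>m n. m \<ge> N0 \<Longrightarrow> n \<ge> N0 \<Longrightarrow> ?sq (\<lambda>x. us m x - us n x) < e/2"
      using cau by (metis half_gt_zero)
    have "norm (?sq (\<lambda>x. us n x - f x) - 0) < e" if "n \<ge> N0" for n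
    proof -
      have d: "(\<lambda>x. us n x - f x) \<in> L2 M" using us f by (intro L2.diff) auto
      have "ennreal (?sq (\<lambda>x. us n x - f x)) \<le> ennreal (e/2)"
        unfolding L2_nn_integral[OF d, symmetric] by (rule fatou[where ?N0.0 = N0]) (use N0 that in auto)
      then have "?sq (\<lambda>x. us n x - f x) \<le> e/2" using e by (simp add: ennreal_le_iff)
      then show ?thesis using e L2.ip_nonneg[OF d] by simp
    qed
    then show "\<exists>no. \<forall>n\<ge>no. norm (?sq (\<lambda>x. us n x - f x) - 0) < e" by blast
  qed
  then show "\<exists>u\<in>L2 M. (\<lambda>n. ?sq (\<lambda>x. us n x - u x)) \<longlonglongrightarrow> 0" using f by blast
qed

section \<open>Closable non-negative forms\<close>

context semi_ip
begin

lemma sq_diff_abs: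
  assumes f: "f \<in> V" and g: "g \<in> V"
  shows "\<bar>sq f - sq g\<bar> \<le> sqrt (sq (\<lambda>x. f x - g x)) * (sqrt (sq f) + sqrt (sq g))"
proof -
  have d: "(\<lambda>x. f x - g x) \<in> V" by (intro diff f g)
  have "ip f f - ip g g = ip (\<lambda>x. f x - g x) f + ip g (\<lambda>x. f x - g x)"
    using f g by (simp add: ip_diff_left ip_diff_right)
  then have "sq f - sq g = Re (ip (\<lambda>x. f x - g x) f + ip g (\<lambda>x. f x - g x))"
    by (metis minus_complex.sel(1))
  then have "\<bar>sq f - sq g\<bar> \<le> cmod (ip (\<lambda>x. f x - g x) f + ip g (\<lambda>x. f x - g x))"
    using abs_Re_le_cmod by metis
  also have "\<dots> \<le> cmod (ip (\<lambda>x. f x - g x) f) + cmod (ip g (\<lambda>x. f x - g x))"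
    by (rule norm_triangle_ineq)
  finally show ?thesis
    using cauchy_schwarz_sqrt[OF d f] cauchy_schwarz_sqrt[OF g d] by (simp add: algebra_simps)
qed

end

text \<open>Closability is tested on null sequences: a \<open>q\<close>-Cauchy sequence that tends
  to 0 in L2 must tend to 0 in form. This makes the limit in \<open>closure_form\<close> independent
  of the approximating sequences.\<close>

locale closable_form = form: semi_ip D q
  for D :: "('x \<Rightarrow> complex) set" and q :: "'x form" +
  fixes M :: "'x measure"
  assumes D_L2: "D \<subseteq> L2 M"
    and closable: "\<And>us. (\<And>n. us n \<in> D) \<Longrightarrow> (\<lambda>n. Re (L2_inner M (us n) (us n))) \<longlonglongrightarrow> 0 \<Longrightarrow>
      (\<forall>e>0. \<exists>N. \<forall>m\<ge>N. \<forall>n\<ge>N. Re (q (\<lambda>x. us m x - us n x) (\<lambda>x. us m x - us n x)) < e) \<Longrightarrow>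
      (\<lambda>n. Re (q (us n) (us n))) \<longlonglongrightarrow> 0"
begin

abbreviation N2 :: "('x \<Rightarrow> complex) \<Rightarrow> real" where "N2 f \<equiv> Re (L2_inner M f f)"
abbreviation conv where "conv \<equiv> form_tendsto M D q"
abbreviation V where "V \<equiv> closure_dom M D q"
abbreviation cf where "cf \<equiv> closure_form M D q"

lemma conv_iff:
  "conv us u \<longleftrightarrow> (\<forall>n. us n \<in> D) \<and> u \<in> L2 M \<and> (\<lambda>n. N2 (\<lambda>x. us n x - u x)) \<longlonglongrightarrow> 0 \<and>
     (\<forall>e>0. \<exists>N. \<forall>m\<ge>N. \<forall>n\<ge>N. form.sq (\<lambda>x. us m x - us n x) < e)"
proof -
  have "cmod (q (\<lambda>x. us m x - us n x) (\<lambda>x. us m x - us n x)) = form.sq (\<lambda>x. us m x - us n x)"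
    if "\<forall>n. us n \<in> D" for m n
    using form.ip_self[OF form.diff, of "us m" "us n"] form.ip_nonneg[OF form.diff, of "us m" "us n"] that
    by (metis norm_of_real abs_of_nonneg)
  moreover have "(\<lambda>n. L2_norm M (\<lambda>x. us n x - u x)) \<longlonglongrightarrow> 0 \<longleftrightarrow> (\<lambda>n. N2 (\<lambda>x. us n x - u x)) \<longlonglongrightarrow> 0"
  proof
    show "(\<lambda>n. N2 (\<lambda>x. us n x - u x)) \<longlonglongrightarrow> 0" if "(\<lambda>n. L2_norm M (\<lambda>x. us n x - u x)) \<longlonglongrightarrow> 0"
      using tendsto_power[OF that, of 2] by (simp add: L2_norm_power2)
    show "(\<lambda>n. L2_norm M (\<lambda>x. us n x - u x)) \<longlonglongrightarrow> 0" if "(\<lambda>n. N2 (\<lambda>x. us n x - u x)) \<longlonglongrightarrow> 0"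
      using tendsto_real_sqrt[OF that] by (simp add: L2_norm_eq)
  qed
  ultimately show ?thesis unfolding form_tendsto_def L2_tendsto_def by (cases "\<forall>n. us n \<in> D") (simp, blast)
qed

lemma convD:
  assumes "conv us u"
  shows "us n \<in> D" "us n \<in> L2 M" "u \<in> L2 M" "(\<lambda>n. N2 (\<lambda>x. us n x - u x)) \<longlonglongrightarrow> 0"
    "\<And>e. e > 0 \<Longrightarrow> \<exists>N. \<forall>m\<ge>N. \<forall>n\<ge>N. form.sq (\<lambda>x. us m x - us n x) < e"
  using assms D_L2 unfolding conv_iff by auto

lemma conv_lin:
  assumes u: "conv us u" and v: "conv vs v"
  shows "conv (\<lambda>n x. us n x + c * vs n x) (\<lambda>x. u x + c * v x)"
  unfolding conv_iff
proof (intro conjI allI impI)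
  let ?k = "(cmod c)\<^sup>2"
  show "(\<lambda>x. us n x + c * vs n x) \<in> D" for n using convD[OF u] convD[OF v] by (intro form.lin)
  show "(\<lambda>x. u x + c * v x) \<in> L2 M" using convD[OF u] convD[OF v] by (intro L2.lin)
  have le: "N2 (\<lambda>x. (us n x + c * vs n x) - (u x + c * v x)) \<le> 2 * N2 (\<lambda>x. us n x - u x) + 2 * (?k * N2 (\<lambda>x. vs n x - v x))" for n
  proof -
    have a: "(\<lambda>x. us n x - u x) \<in> L2 M" and b: "(\<lambda>x. vs n x - v x) \<in> L2 M"
      using convD[OF u] convD[OF v] by (auto intro: L2.diff)
    have "(\<lambda>x. (us n x + c * vs n x) - (u x + c * v x)) = (\<lambda>x. (us n x - u x) + c * (vs n x - v x))"
      by (simp add: algebra_simps)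
    then show ?thesis using L2.sq_add_le[OF a L2.scale[OF b, of c]] L2.sq_scale[OF b, of c] by simp
  qed
  show "(\<lambda>n. N2 (\<lambda>x. (us n x + c * vs n x) - (u x + c * v x))) \<longlonglongrightarrow> 0"
  proof (rule tendsto_sandwich[OF _ _ tendsto_const])
    show "(\<lambda>n. 2 * N2 (\<lambda>x. us n x - u x) + 2 * (?k * N2 (\<lambda>x. vs n x - v x))) \<longlonglongrightarrow> 0"
      using tendsto_add[OF tendsto_mult[OF tendsto_const[of 2] convD(4)[OF u]]
          tendsto_mult[OF tendsto_const[of "2 * ?k"] convD(4)[OF v]]]
      by (simp add: mult.assoc)
    show "\<forall>\<^sub>F n in sequentially. 0 \<le> N2 (\<lambda>x. (us n x + c * vs n x) - (u x + c * v x))"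
      using convD[OF u] convD[OF v] by (intro always_eventually allI L2.ip_nonneg L2.diff L2.lin)
  qed (use le in auto)
  fix e :: real assume e: "e > 0"
  have e': "e / 4 > 0" "e / (4 * (?k + 1)) > 0"
    using e by (auto intro!: divide_pos_pos add_nonneg_pos)
  obtain N1 where N1: "\<And>m n. m \<ge> N1 \<Longrightarrow> n \<ge> N1 \<Longrightarrow> form.sq (\<lambda>x. us m x - us n x) < e / 4"
    using convD(5)[OF u e'(1)] by blast
  obtain N2 where N2: "\<And>m n. m \<ge> N2 \<Longrightarrow> n \<ge> N2 \<Longrightarrow> form.sq (\<lambda>x. vs m x - vs n x) < e / (4 * (?k + 1))"
    using convD(5)[OF v e'(2)] by blast
  have "form.sq (\<lambda>x. (us m x + c * vs m x) - (us n x + c * vs n x)) < e"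
    if "m \<ge> max N1 N2" "n \<ge> max N1 N2" for m n
  proof -
    have a: "(\<lambda>x. us m x - us n x) \<in> D" and b: "(\<lambda>x. vs m x - vs n x) \<in> D"
      using convD[OF u] convD[OF v] by (auto intro: form.diff)
    have "(\<lambda>x. (us m x + c * vs m x) - (us n x + c * vs n x)) = (\<lambda>x. (us m x - us n x) + c * (vs m x - vs n x))"
      by (simp add: algebra_simps)
    then have "form.sq (\<lambda>x. (us m x + c * vs m x) - (us n x + c * vs n x)) \<le>
        2 * form.sq (\<lambda>x. us m x - us n x) + 2 * (?k * form.sq (\<lambda>x. vs m x - vs n x))"
      using form.sq_add_le[OF a form.scale[OF b, of c]] form.sq_scale[OF b, of c] by simp
    also have "2 * form.sq (\<lambda>x. us m x - us n x) < e / 2" using N1[of m n] that by simp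
    also have "?k * form.sq (\<lambda>x. vs m x - vs n x) \<le> (?k + 1) * (e / (4 * (?k + 1)))"
      using N2[of m n] that form.ip_nonneg[OF b] by (intro mult_mono) auto
    also have "\<dots> = e / 4"
    proof -
      have "?k + 1 \<noteq> 0" using zero_le_power2[of "cmod c"] by linarith
      then show ?thesis by (simp add: field_simps)
    qed
    finally show ?thesis by simp
  qed
  then show "\<exists>N. \<forall>m\<ge>N. \<forall>n\<ge>N. form.sq (\<lambda>x. (us m x + c * vs m x) - (us n x + c * vs n x)) < e" by blast
qed

lemma conv_diff: "conv us u \<Longrightarrow> conv vs v \<Longrightarrow> conv (\<lambda>n x. us n x - vs n x) (\<lambda>x. u x - v x)"
  using conv_lin[of us u vs v "-1"] by simp

lemma conv_bounded:
  assumes "conv us u"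
  shows "\<exists>C>0. \<forall>\<^sub>F n in sequentially. sqrt (form.sq (us n)) \<le> C"
proof -
  obtain N where N: "\<And>m n. m \<ge> N \<Longrightarrow> n \<ge> N \<Longrightarrow> form.sq (\<lambda>x. us m x - us n x) < 1"
    using convD(5)[OF assms, of 1] by auto
  have "sqrt (form.sq (us n)) \<le> sqrt (form.sq (us N)) + 1" if "n \<ge> N" for n
  proof -
    have "us n = (\<lambda>x. us N x + (us n x - us N x))" by auto
    then have "sqrt (form.sq (us n)) \<le> sqrt (form.sq (us N)) + sqrt (form.sq (\<lambda>x. us n x - us N x))"
      using form.triangle[OF convD(1)[OF assms] form.diff[OF convD(1,1)[OF assms]], of N n N] by simp
    also have "sqrt (form.sq (\<lambda>x. us n x - us N x)) \<le> 1"
      using N[OF that order_refl] by simp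
    finally show ?thesis by simp
  qed
  moreover have "sqrt (form.sq (us N)) + 1 > 0"
    using form.ip_nonneg[OF convD(1)[OF assms]] by (simp add: add_nonneg_pos)
  ultimately show ?thesis using eventually_sequentially by blast
qed

lemma conv_null:
  assumes u: "conv us u" and z: "N2 u = 0"
  shows "(\<lambda>n. form.sq (us n)) \<longlonglongrightarrow> 0"
proof (rule closable)
  show "us n \<in> D" for n by (rule convD(1)[OF u])
  show "\<forall>e>0. \<exists>N. \<forall>m\<ge>N. \<forall>n\<ge>N. form.sq (\<lambda>x. us m x - us n x) < e" using convD(5)[OF u] by blast
  show "(\<lambda>n. N2 (us n)) \<longlonglongrightarrow> 0"
    using L2.sq_tendsto[OF convD(2)[OF u] convD(3)[OF u] convD(4)[OF u]] z by simp
qed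

lemma q_tendsto_zero:
  assumes "\<And>n. us n \<in> D" "(\<lambda>n. form.sq (us n)) \<longlonglongrightarrow> 0"
    and "\<And>n. vs n \<in> D" "\<forall>\<^sub>F n in sequentially. sqrt (form.sq (vs n)) \<le> C"
  shows "(\<lambda>n. q (us n) (vs n)) \<longlonglongrightarrow> 0" "(\<lambda>n. q (vs n) (us n)) \<longlonglongrightarrow> 0"
proof -
  have l: "(\<lambda>n. sqrt (form.sq (us n)) * C) \<longlonglongrightarrow> 0"
    using tendsto_mult[OF tendsto_real_sqrt[OF assms(2)] tendsto_const[of C]] by simp
  show 1: "(\<lambda>n. q (us n) (vs n)) \<longlonglongrightarrow> 0"
  proof (rule Lim_null_comparison[OF _ l])
    show "\<forall>\<^sub>F n in sequentially. norm (q (us n) (vs n)) \<le> sqrt (form.sq (us n)) * C"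
      using assms(4)
    proof eventually_elim
      case (elim n)
      have "sqrt (form.sq (us n)) * sqrt (form.sq (vs n)) \<le> sqrt (form.sq (us n)) * C"
        by (intro mult_left_mono elim) (use form.ip_nonneg assms(1) in auto)
      then show ?case using form.cauchy_schwarz_sqrt[OF assms(1) assms(3), of n n] by linarith
    qed
  qed
  show "(\<lambda>n. q (vs n) (us n)) \<longlonglongrightarrow> 0"
    using tendsto_cnj[OF 1] form.ip_sym[OF assms(1) assms(3)] by simp
qed

lemma conv_unique:
  assumes u: "conv us u" and u': "conv us' u" and v: "conv vs v" and v': "conv vs' v"
  shows "(\<lambda>n. q (us n) (vs n) - q (us' n) (vs' n)) \<longlonglongrightarrow> 0"
proof -
  have z: "N2 (\<lambda>x. u x - u x) = 0" "N2 (\<lambda>x. v x - v x) = 0"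
    by (simp_all add: L2_inner_def)
  have 1: "(\<lambda>n. form.sq (\<lambda>x. us n x - us' n x)) \<longlonglongrightarrow> 0" by (rule conv_null[OF conv_diff[OF u u'] z(1)])
  have 2: "(\<lambda>n. form.sq (\<lambda>x. vs n x - vs' n x)) \<longlonglongrightarrow> 0" by (rule conv_null[OF conv_diff[OF v v'] z(2)])
  obtain C where C: "\<forall>\<^sub>F n in sequentially. sqrt (form.sq (vs n)) \<le> C" using conv_bounded[OF v] by blast
  obtain C' where C': "\<forall>\<^sub>F n in sequentially. sqrt (form.sq (us' n)) \<le> C'" using conv_bounded[OF u'] by blast
  note D = convD(1)[OF u] convD(1)[OF u'] convD(1)[OF v] convD(1)[OF v']
  have "(\<lambda>n. q (\<lambda>x. us n x - us' n x) (vs n) + q (us' n) (\<lambda>x. vs n x - vs' n x)) \<longlonglongrightarrow> 0 + 0"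
    by (intro tendsto_add q_tendsto_zero[OF _ 1 _ C] q_tendsto_zero(2)[OF _ 2 _ C'] form.diff D)
  then show ?thesis by (simp add: form.ip_diff_left form.ip_diff_right D)
qed

lemma conv_convergent:
  assumes u: "conv us u" and v: "conv vs v"
  shows "convergent (\<lambda>n. q (us n) (vs n))"
proof -
  note D = convD(1)[OF u] convD(1)[OF v]
  obtain C where C: "C > 0" "\<forall>\<^sub>F n in sequentially. sqrt (form.sq (vs n)) \<le> C" using conv_bounded[OF v] by blast
  obtain C' where C': "C' > 0" "\<forall>\<^sub>F n in sequentially. sqrt (form.sq (us n)) \<le> C'" using conv_bounded[OF u] by blast
  have "Cauchy (\<lambda>n. q (us n) (vs n))"
  proof (rule CauchyI)
    fix e :: real assume e: "e > 0"
    obtain K where K: "\<And>n. n \<ge> K \<Longrightarrow> sqrt (form.sq (vs n)) \<le> C" using C(2) eventually_sequentially by auto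
    obtain K' where K': "\<And>n. n \<ge> K' \<Longrightarrow> sqrt (form.sq (us n)) \<le> C'" using C'(2) eventually_sequentially by auto
    obtain N1 where N1: "\<And>m n. m \<ge> N1 \<Longrightarrow> n \<ge> N1 \<Longrightarrow> form.sq (\<lambda>x. us m x - us n x) < (e / (4 * C))\<^sup>2"
      using convD(5)[OF u, of "(e / (4 * C))\<^sup>2"] e C by auto
    obtain N2 where N2: "\<And>m n. m \<ge> N2 \<Longrightarrow> n \<ge> N2 \<Longrightarrow> form.sq (\<lambda>x. vs m x - vs n x) < (e / (4 * C'))\<^sup>2"
      using convD(5)[OF v, of "(e / (4 * C'))\<^sup>2"] e C' by auto
    have "norm (q (us m) (vs m) - q (us n) (vs n)) < e"
      if "m \<ge> Max {K, K', N1, N2}" "n \<ge> Max {K, K', N1, N2}" for m n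
    proof -
      have "q (us m) (vs m) - q (us n) (vs n) = q (\<lambda>x. us m x - us n x) (vs m) + q (us n) (\<lambda>x. vs m x - vs n x)"
        by (simp add: form.ip_diff_left form.ip_diff_right D)
      then have "norm (q (us m) (vs m) - q (us n) (vs n)) \<le>
          sqrt (form.sq (\<lambda>x. us m x - us n x)) * sqrt (form.sq (vs m)) + sqrt (form.sq (us n)) * sqrt (form.sq (\<lambda>x. vs m x - vs n x))"
        using norm_triangle_ineq[of "q (\<lambda>x. us m x - us n x) (vs m)" "q (us n) (\<lambda>x. vs m x - vs n x)"]
          form.cauchy_schwarz_sqrt[OF form.diff[OF D(1) D(1)] D(2), of m n m]
          form.cauchy_schwarz_sqrt[OF D(1) form.diff[OF D(2) D(2)], of n m n] by simp
      also have "\<dots> \<le> (e / (4 * C)) * C + C' * (e / (4 * C'))"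
      proof (intro add_mono mult_mono)
        show "sqrt (form.sq (\<lambda>x. us m x - us n x)) \<le> e / (4 * C)"
          using N1[of m n] that e C by (intro real_le_lsqrt) auto
        show "sqrt (form.sq (\<lambda>x. vs m x - vs n x)) \<le> e / (4 * C')"
          using N2[of m n] that e C' by (intro real_le_lsqrt) auto
      qed (use K[of m] K'[of n] that e C C' in \<open>auto intro!: form.ip_nonneg form.diff D\<close>)
      also have "\<dots> < e" using e C(1) C'(1) by simp
      finally show ?thesis .
    qed
    then show "\<exists>N. \<forall>m\<ge>N. \<forall>n\<ge>N. norm (q (us m) (vs m) - q (us n) (vs n)) < e" by blast
  qed
  then show ?thesis by (rule Cauchy_convergent)
qed

lemma cf_tendsto:
  assumes u: "conv us u" and v: "conv vs v"
  shows "(\<lambda>n. q (us n) (vs n)) \<longlonglongrightarrow> cf u v"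
proof -
  obtain c where c: "(\<lambda>n. q (us n) (vs n)) \<longlonglongrightarrow> c"
    using conv_convergent[OF u v] by (auto simp: convergent_def)
  have all: "(\<lambda>n. q (us' n) (vs' n)) \<longlonglongrightarrow> c" if "conv us' u" "conv vs' v" for us' vs'
    using tendsto_diff[OF c conv_unique[OF u that(1) v that(2)]] by simp
  have "cf u v = c"
    unfolding closure_form_def
  proof (rule the_equality)
    show "\<forall>us vs. conv us u \<longrightarrow> conv vs v \<longrightarrow> (\<lambda>n. q (us n) (vs n)) \<longlonglongrightarrow> c" using all by blast
    show "c' = c" if "\<forall>us vs. conv us u \<longrightarrow> conv vs v \<longrightarrow> (\<lambda>n. q (us n) (vs n)) \<longlonglongrightarrow> c'" for c'
      using that u v c LIMSEQ_unique by blast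
  qed
  with c show ?thesis by simp
qed

lemma V_iff: "u \<in> V \<longleftrightarrow> (\<exists>us. conv us u)"
  by (simp add: closure_dom_def)

lemma V_L2: "u \<in> V \<Longrightarrow> u \<in> L2 M"
  using V_iff convD(3) by blast

lemma conv_const: "u \<in> D \<Longrightarrow> conv (\<lambda>_. u) u"
  using D_L2 by (auto simp: conv_iff form.ip_zero_left[OF form.zero] L2.ip_zero_left[OF L2.zero])

lemma D_V: "u \<in> D \<Longrightarrow> u \<in> V"
  using conv_const V_iff by blast

lemma cf_D: "u \<in> D \<Longrightarrow> v \<in> D \<Longrightarrow> cf u v = q u v"
  using cf_tendsto[OF conv_const conv_const, of u v] by (simp add: LIMSEQ_const_iff)

sublocale cl: semi_ip V cf
proof
  show "V \<noteq> {}" using form.nonempty D_V by blast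
  show "(\<lambda>x. f x + c * g x) \<in> V" if "f \<in> V" "g \<in> V" for f g c
    using that conv_lin unfolding V_iff by blast
  show "cf (\<lambda>x. f x + c * g x) h = cf f h + c * cf g h" if V: "f \<in> V" "g \<in> V" "h \<in> V" for f g h c
  proof -
    obtain fs gs hs where *: "conv fs f" "conv gs g" "conv hs h" using V V_iff by blast
    have "(\<lambda>n. q (fs n) (hs n) + c * q (gs n) (hs n)) \<longlonglongrightarrow> cf f h + c * cf g h"
      by (intro tendsto_intros cf_tendsto *)
    moreover have "(\<lambda>n. q (fs n) (hs n) + c * q (gs n) (hs n)) \<longlonglongrightarrow> cf (\<lambda>x. f x + c * g x) h"
      using cf_tendsto[OF conv_lin[OF *(1,2)] *(3), of c] by (simp add: form.ip_lin convD(1)[OF *(1)] convD(1)[OF *(2)] convD(1)[OF *(3)])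
    ultimately show ?thesis by (rule LIMSEQ_unique[symmetric])
  qed
  show "cf g f = cnj (cf f g)" if V: "f \<in> V" "g \<in> V" for f g
  proof -
    obtain fs gs where *: "conv fs f" "conv gs g" using V V_iff by blast
    have "(\<lambda>n. q (gs n) (fs n)) \<longlonglongrightarrow> cnj (cf f g)"
      using tendsto_cnj[OF cf_tendsto[OF *]] by (simp add: form.ip_sym[symmetric] convD(1)[OF *(1)] convD(1)[OF *(2)])
    then show ?thesis using cf_tendsto[OF *(2,1)] LIMSEQ_unique by blast
  qed
  show "0 \<le> Re (cf f f)" if f: "f \<in> V" for f
  proof -
    obtain fs where *: "conv fs f" using f V_iff by blast
    show ?thesis
      by (rule LIMSEQ_le_const[OF tendsto_Re[OF cf_tendsto[OF * *]]]) (use form.ip_nonneg[OF convD(1)[OF *]] in auto)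
  qed
qed

lemma conv_cf:
  assumes u: "conv us u"
  shows "(\<lambda>n. cl.sq (\<lambda>x. us n x - u x)) \<longlonglongrightarrow> 0"
proof (rule LIMSEQ_I)
  fix e :: real assume e: "e > 0"
  obtain N where N: "\<And>m n. m \<ge> N \<Longrightarrow> n \<ge> N \<Longrightarrow> form.sq (\<lambda>x. us m x - us n x) < e / 2"
    using convD(5)[OF u, of "e/2"] e by auto
  have V: "us n \<in> V" "u \<in> V" for n using D_V[OF convD(1)[OF u]] u V_iff by auto
  have "norm (cl.sq (\<lambda>x. us n x - u x) - 0) < e" if n: "n \<ge> N" for n
  proof -
    have c: "conv (\<lambda>m x. us n x - us m x) (\<lambda>x. us n x - u x)"
      by (intro conv_diff conv_const convD(1)[OF u] u)
    have "cl.sq (\<lambda>x. us n x - u x) \<le> e / 2"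
      by (rule LIMSEQ_le_const2[OF tendsto_Re[OF cf_tendsto[OF c c]]])
        (use N[OF n] in \<open>auto intro!: exI[of _ N] less_imp_le\<close>)
    then show ?thesis using e cl.ip_nonneg[OF cl.diff[OF V]] by simp
  qed
  then show "\<exists>no. \<forall>n\<ge>no. norm (cl.sq (\<lambda>x. us n x - u x) - 0) < e" by blast
qed

lemma conv_cong_AE:
  assumes u: "conv us u" and u': "u' \<in> L2 M" and eq: "AE x in M. u' x = u x"
  shows "conv us u'"
proof -
  have "N2 (\<lambda>x. us n x - u' x) = N2 (\<lambda>x. us n x - u x)" for n
    by (rule arg_cong[where f = Re], rule L2_inner_cong_AE) (use eq u' convD[OF u] in \<open>auto intro: L2.diff\<close>)
  then show ?thesis using u u' unfolding conv_iff by simp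
qed

lemma V_cong_AE: "u \<in> V \<Longrightarrow> u' \<in> L2 M \<Longrightarrow> AE x in M. u' x = u x \<Longrightarrow> u' \<in> V"
  using conv_cong_AE V_iff by blast

lemma cf_cong_AE:
  assumes "u \<in> V" "u' \<in> L2 M" "AE x in M. u' x = u x" "v \<in> V"
  shows "cf u' v = cf u v"
proof -
  obtain us vs where *: "conv us u" "conv vs v" using assms V_iff by blast
  show ?thesis
    using cf_tendsto[OF conv_cong_AE[OF *(1) assms(2,3)] *(2)] cf_tendsto[OF *] LIMSEQ_unique by blast
qed

text \<open>The inner product of the form domain. The L2 part makes \<open>V\<close> complete, and
  \<open>a1\<close> is the form of \<open>T + 1\<close>, so that Riesz's theorem inverts this
  operator.\<close>

definition a1 :: "'x form" where "a1 f g = cf f g + L2_inner M f g"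

sublocale a1: semi_ip V a1
proof
  show "V \<noteq> {}" by (rule cl.nonempty)
  show "(\<lambda>x. f x + c * g x) \<in> V" if "f \<in> V" "g \<in> V" for f g c using that by (rule cl.lin)
  show "a1 (\<lambda>x. f x + c * g x) h = a1 f h + c * a1 g h" if "f \<in> V" "g \<in> V" "h \<in> V" for f g h c
    using that by (simp add: a1_def cl.ip_lin L2.ip_lin V_L2 algebra_simps)
  show "a1 g f = cnj (a1 f g)" if "f \<in> V" "g \<in> V" for f g
    using that cl.ip_sym[of f g] L2.ip_sym[of f M g] by (simp add: a1_def V_L2)
  show "0 \<le> Re (a1 f f)" if "f \<in> V" for f
    using that cl.ip_nonneg[of f] L2.ip_nonneg[of f M] by (simp add: a1_def V_L2)
qed

lemma a1_sq: "a1.sq f = cl.sq f + N2 f"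
  by (simp add: a1_def)

lemma cl_le_a1: "f \<in> V \<Longrightarrow> cl.sq f \<le> a1.sq f"
  using L2.ip_nonneg[OF V_L2, of f] by (simp add: a1_sq)

lemma N2_le_a1: "f \<in> V \<Longrightarrow> N2 f \<le> a1.sq f"
  using cl.ip_nonneg[of f] by (simp add: a1_sq)

lemma D_dense:
  assumes u: "u \<in> V" and e: "e > 0"
  shows "\<exists>f\<in>D. a1.sq (\<lambda>x. f x - u x) < e"
proof -
  obtain us where us: "conv us u" using u V_iff by blast
  have "(\<lambda>n. a1.sq (\<lambda>x. us n x - u x)) \<longlonglongrightarrow> 0 + 0"
    unfolding a1_sq by (intro tendsto_add conv_cf us convD(4)[OF us])
  then have "\<forall>\<^sub>F n in sequentially. a1.sq (\<lambda>x. us n x - u x) < e"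
    using e by (intro order_tendstoD) auto
  then obtain n where "a1.sq (\<lambda>x. us n x - u x) < e" using eventually_happens' sequentially_bot by blast
  then show ?thesis using convD(1)[OF us] by blast
qed

text \<open>The definition of the closure provides limits only for sequences in \<open>D\<close>, so
  each vector is first replaced by a vector of \<open>D\<close> whose squared distance is below
  \<open>1 / Suc n\<close>.\<close>

lemma a1_complete: "ip_complete V a1"
  unfolding ip_complete_def
proof (intro allI impI)
  fix us :: "nat \<Rightarrow> 'x \<Rightarrow> complex" assume us: "\<forall>n. us n \<in> V"
    and cau: "\<forall>e>0. \<exists>N. \<forall>m\<ge>N. \<forall>n\<ge>N. a1.sq (\<lambda>x. us m x - us n x) < e"
  have "\<exists>f\<in>D. a1.sq (\<lambda>x. f x - us n x) < 1 / Suc n" for n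
    by (rule D_dense) (use us in auto)
  then obtain fs where fs: "\<And>n. fs n \<in> D" and fu: "\<And>n. a1.sq (\<lambda>x. fs n x - us n x) < 1 / Suc n" by metis
  have fV: "fs n \<in> V" for n by (rule D_V[OF fs])
  have lim: "(\<lambda>n. a1.sq (\<lambda>x. us n x - fs n x)) \<longlonglongrightarrow> 0"
  proof (rule tendsto_sandwich[OF _ _ tendsto_const])
    show "(\<lambda>n. 1 / real (Suc n)) \<longlonglongrightarrow> 0" using LIMSEQ_inverse_real_of_nat by (simp add: inverse_eq_divide)
    show "\<forall>\<^sub>F n in sequentially. 0 \<le> a1.sq (\<lambda>x. us n x - fs n x)"
      using us fV by (intro always_eventually allI a1.ip_nonneg a1.diff) auto
    show "\<forall>\<^sub>F n in sequentially. a1.sq (\<lambda>x. us n x - fs n x) \<le> 1 / real (Suc n)"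
      using fu us fV by (intro always_eventually allI) (subst a1.sq_diff_commute, auto intro: less_imp_le)
  qed
  have fcau: "\<exists>N. \<forall>m\<ge>N. \<forall>n\<ge>N. a1.sq (\<lambda>x. fs m x - fs n x) < e" if e: "e > 0" for e
  proof -
    obtain N1 where N1: "\<And>m n. m \<ge> N1 \<Longrightarrow> n \<ge> N1 \<Longrightarrow> a1.sq (\<lambda>x. us m x - us n x) < e/12"
      using cau e by (metis divide_pos_pos zero_less_numeral)
    have "\<forall>\<^sub>F n in sequentially. a1.sq (\<lambda>x. us n x - fs n x) < e/12"
      using lim e by (intro order_tendstoD) auto
    then obtain N2 where N2: "\<And>n. n \<ge> N2 \<Longrightarrow> a1.sq (\<lambda>x. us n x - fs n x) < e/12"
      using eventually_sequentially by auto
    have "a1.sq (\<lambda>x. fs m x - fs n x) < e" if "m \<ge> max N1 N2" "n \<ge> max N1 N2" for m n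
    proof -
      have "a1.sq (\<lambda>x. fs m x - fs n x) \<le> 2 * a1.sq (\<lambda>x. fs m x - us m x) + 2 * a1.sq (\<lambda>x. us m x - fs n x)"
        using us fV by (intro a1.sq_triangle) auto
      also have "a1.sq (\<lambda>x. us m x - fs n x) \<le> 2 * a1.sq (\<lambda>x. us m x - us n x) + 2 * a1.sq (\<lambda>x. us n x - fs n x)"
        using us fV by (intro a1.sq_triangle) auto
      also have "a1.sq (\<lambda>x. fs m x - us m x) = a1.sq (\<lambda>x. us m x - fs m x)"
        using us fV by (intro a1.sq_diff_commute) auto
      finally show ?thesis using N1[of m n] N2[of m] N2[of n] that e by simp
    qed
    then show ?thesis by blast
  qed
  have "\<forall>e>0. \<exists>N. \<forall>m\<ge>N. \<forall>n\<ge>N. N2 (\<lambda>x. fs m x - fs n x) < e"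
    using fcau N2_le_a1[OF cl.diff[OF fV fV]] by (meson le_less_trans)
  then obtain f where f: "f \<in> L2 M" "(\<lambda>n. N2 (\<lambda>x. fs n x - f x)) \<longlonglongrightarrow> 0"
    using L2_complete[of M] V_L2[OF fV] unfolding ip_complete_def by blast
  have "form.sq (\<lambda>x. fs m x - fs n x) \<le> a1.sq (\<lambda>x. fs m x - fs n x)" for m n
    using cl_le_a1[OF cl.diff[OF fV fV], of m n] cf_D[OF form.diff[OF fs fs] form.diff[OF fs fs], of m n m n] by simp
  then have "\<exists>N. \<forall>m\<ge>N. \<forall>n\<ge>N. form.sq (\<lambda>x. fs m x - fs n x) < e" if "e > 0" for e
    using fcau[OF that] le_less_trans by blast
  then have c: "conv fs f" using f fs unfolding conv_iff by blast
  then have fV': "f \<in> V" using V_iff by blast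
  have l2: "(\<lambda>n. a1.sq (\<lambda>x. fs n x - f x)) \<longlonglongrightarrow> 0"
    using tendsto_add[OF conv_cf[OF c] f(2)] by (simp add: a1_sq)
  have "(\<lambda>n. a1.sq (\<lambda>x. us n x - f x)) \<longlonglongrightarrow> 0"
  proof (rule tendsto_sandwich[OF _ _ tendsto_const])
    show "(\<lambda>n. 2 * a1.sq (\<lambda>x. us n x - fs n x) + 2 * a1.sq (\<lambda>x. fs n x - f x)) \<longlonglongrightarrow> 0"
      using tendsto_add[OF tendsto_mult[OF tendsto_const[of 2] lim] tendsto_mult[OF tendsto_const[of 2] l2]] by simp
    show "\<forall>\<^sub>F n in sequentially. 0 \<le> a1.sq (\<lambda>x. us n x - f x)"
      using us fV' by (intro always_eventually allI a1.ip_nonneg a1.diff) auto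
    show "\<forall>\<^sub>F n in sequentially. a1.sq (\<lambda>x. us n x - f x) \<le> 2 * a1.sq (\<lambda>x. us n x - fs n x) + 2 * a1.sq (\<lambda>x. fs n x - f x)"
      using us fV fV' by (intro always_eventually allI a1.sq_triangle) auto
  qed
  then show "\<exists>u\<in>V. (\<lambda>n. a1.sq (\<lambda>x. us n x - u x)) \<longlonglongrightarrow> 0" using fV' by blast
qed

end

section \<open>The operator associated with a form\<close>

text \<open>A lower bound modulo relatively compact errors, phrased without operators: such an error
  disappears on differences along a suitable subsequence of any form-bounded sequence. Only
  \<open>D\<close> occurs, so the condition is accessible to calculus.\<close>

definition ess_lower :: "'x measure \<Rightarrow> ('x \<Rightarrow> complex) set \<Rightarrow> 'x form \<Rightarrow> real \<Rightarrow> bool" where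
  "ess_lower M D q \<nu> \<longleftrightarrow>
     (\<forall>f :: nat \<Rightarrow> 'x \<Rightarrow> complex. (\<forall>n. f n \<in> D) \<longrightarrow>
        (\<exists>C. \<forall>n. Re (q (f n) (f n)) + Re (L2_inner M (f n) (f n)) \<le> C) \<longrightarrow>
        (\<exists>r :: nat \<Rightarrow> nat. strict_mono r \<and> (\<forall>e>0. \<exists>N. \<forall>m\<ge>N. \<forall>n\<ge>N.
           \<nu> * Re (L2_inner M (\<lambda>x. f (r m) x - f (r n) x) (\<lambda>x. f (r m) x - f (r n) x)) \<le>
             Re (q (\<lambda>x. f (r m) x - f (r n) x) (\<lambda>x. f (r m) x - f (r n) x)) + e)))"

context closable_form
begin

abbreviation ip :: "'x form" where "ip \<equiv> L2_inner M"
abbreviation T :: "'x operator" where "T \<equiv> form_operator M D q"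

lemma N2_null_cong:
  assumes "f \<in> L2 M" "g \<in> L2 M" "N2 (\<lambda>x. f x - g x) = 0"
  shows "AE x in M. f x = g x"
  using L2_null_iff[OF L2.diff[OF assms(1,2)]] assms(3) by simp

lemma T_iff: "(u, f) \<in> T \<longleftrightarrow> u \<in> V \<and> f \<in> L2 M \<and> (\<forall>v\<in>V. cf u v = ip f v)"
  by (simp add: form_operator_def)

text \<open>\<open>Sh z u w\<close> says that \<open>w\<close> is a value of \<open>T - z\<close> at \<open>u\<close>; the graph may be multivalued, since
  \<open>D\<close> is not assumed to be dense.\<close>

definition Sh :: "complex \<Rightarrow> ('x \<Rightarrow> complex) \<Rightarrow> ('x \<Rightarrow> complex) \<Rightarrow> bool" where
  "Sh z u w \<longleftrightarrow> (u, \<lambda>x. w x + z * u x) \<in> T"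

lemma Sh_V: "Sh z u w \<Longrightarrow> u \<in> V"
  by (simp add: Sh_def T_iff)

lemma Sh_L2: "Sh z u w \<Longrightarrow> u \<in> L2 M"
  using Sh_V V_L2 by blast

lemma Sh_L2': assumes "Sh z u w" shows "w \<in> L2 M"
proof -
  have "(\<lambda>x. w x + z * u x) \<in> L2 M" using assms by (simp add: Sh_def T_iff)
  from L2.lin[OF this Sh_L2[OF assms], of "- z"] show ?thesis by simp
qed

lemma Sh_iff: "Sh z u w \<longleftrightarrow> u \<in> V \<and> w \<in> L2 M \<and> (\<forall>v\<in>V. cf u v = ip w v + z * ip u v)"
proof
  assume S: "Sh z u w"
  have "cf u v = ip w v + z * ip u v" if "v \<in> V" for v
    using S that L2.ip_lin[OF Sh_L2'[OF S] Sh_L2[OF S] V_L2[OF that], of z] by (simp add: Sh_def T_iff)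
  then show "u \<in> V \<and> w \<in> L2 M \<and> (\<forall>v\<in>V. cf u v = ip w v + z * ip u v)"
    using S Sh_V Sh_L2' by blast
next
  assume *: "u \<in> V \<and> w \<in> L2 M \<and> (\<forall>v\<in>V. cf u v = ip w v + z * ip u v)"
  then show "Sh z u w"
    by (simp add: Sh_def T_iff L2.lin V_L2 L2.ip_lin)
qed

lemma Sh_shift: "Sh z u w \<Longrightarrow> Sh (z + c) u (\<lambda>x. w x - c * u x)"
  unfolding Sh_def by (simp add: algebra_simps)

lemma T_Sh: "(u, g) \<in> T \<Longrightarrow> Sh z u (\<lambda>x. g x - z * u x)"
  by (simp add: Sh_def)

lemma Sh_lin: "Sh z u w \<Longrightarrow> Sh z v y \<Longrightarrow> Sh z (\<lambda>x. u x + c * v x) (\<lambda>x. w x + c * y x)"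
  unfolding Sh_iff by (simp add: cl.lin L2.lin cl.ip_lin L2.ip_lin V_L2 algebra_simps)

lemma Sh_diff: "Sh z u w \<Longrightarrow> Sh z v y \<Longrightarrow> Sh z (\<lambda>x. u x - v x) (\<lambda>x. w x - y x)"
  using Sh_lin[of z u w v y "-1"] by simp

lemma Sh_zero: "Sh z (\<lambda>x. 0) (\<lambda>x. 0)"
  unfolding Sh_iff by (simp add: cl.zero L2.zero cl.ip_zero_left L2.ip_zero_left V_L2)

lemma Sh_scale: "Sh z u w \<Longrightarrow> Sh z (\<lambda>x. c * u x) (\<lambda>x. c * w x)"
  using Sh_lin[OF Sh_zero, of z u w c] by simp

lemma Sh_cong:
  assumes S: "Sh z u w" and u': "u' \<in> L2 M" "AE x in M. u' x = u x" and w': "w' \<in> L2 M" "AE x in M. w' x = w x"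
  shows "Sh z u' w'"
proof -
  have "ip w' v = ip w v" "ip u' v = ip u v" if "v \<in> V" for v
    by (rule L2_inner_cong_AE; use S u' w' that Sh_L2 Sh_L2' V_L2 in auto)+
  then show ?thesis
    using S u' w' V_cong_AE[OF Sh_V[OF S] u'] cf_cong_AE[OF Sh_V[OF S] u'] unfolding Sh_iff by simp
qed

lemma Sh_sym:
  assumes "Sh z u w" "Sh (cnj z) v y"
  shows "ip w v = ip u y"
proof -
  have V: "u \<in> V" "v \<in> V" using assms Sh_V by auto
  have "ip w v + z * ip u v = cf u v" using assms V by (simp add: Sh_iff)
  also have "\<dots> = cnj (cf v u)" using cl.ip_sym V by blast
  also have "\<dots> = cnj (ip y u + cnj z * ip v u)" using assms V by (simp add: Sh_iff)
  also have "\<dots> = ip u y + z * ip u v"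
    using L2.ip_sym[OF Sh_L2[OF assms(1)] Sh_L2'[OF assms(2)]] L2.ip_sym[OF V_L2[OF V(1)] V_L2[OF V(2)]] by simp
  finally show ?thesis by simp
qed

lemma Sh_sq: "Sh z u w \<Longrightarrow> cl.sq u = Re (ip w u) + Re z * N2 u"
  using arg_cong[OF L2.ip_self[OF Sh_L2, of z u w], of Im] by (simp add: Sh_iff)

lemma resolvent_iff:
  "z \<in> resolvent_set M T \<longleftrightarrow> (\<forall>f\<in>L2 M. \<exists>u. Sh z u f) \<and> (\<exists>C. \<forall>u w. Sh z u w \<longrightarrow> L2_norm M u \<le> C * L2_norm M w)"
proof -
  have "(\<exists>(u, g)\<in>T. AE x in M. g x - z * u x = f x) \<longleftrightarrow> (\<exists>u. Sh z u f)" if f: "f \<in> L2 M" for f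
  proof
    assume "\<exists>(u, g)\<in>T. AE x in M. g x - z * u x = f x"
    then obtain u g where ug: "(u, g) \<in> T" "AE x in M. g x - z * u x = f x" by blast
    have "AE x in M. f x = g x - z * u x" using ug(2) by eventually_elim simp
    from Sh_cong[OF T_Sh[OF ug(1)] Sh_L2[OF T_Sh[OF ug(1), of z]] _ f this] show "\<exists>u. Sh z u f" by auto
  next
    assume "\<exists>u. Sh z u f"
    then obtain u where "(u, \<lambda>x. f x + z * u x) \<in> T" unfolding Sh_def by blast
    then show "\<exists>(u, g)\<in>T. AE x in M. g x - z * u x = f x" by (rule rev_bexI) simp
  qed
  moreover have "(\<forall>(u, g)\<in>T. L2_norm M u \<le> C * L2_norm M (\<lambda>x. g x - z * u x)) \<longleftrightarrow>
      (\<forall>u w. Sh z u w \<longrightarrow> L2_norm M u \<le> C * L2_norm M w)" for C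
  proof
    assume *: "\<forall>(u, g)\<in>T. L2_norm M u \<le> C * L2_norm M (\<lambda>x. g x - z * u x)"
    show "\<forall>u w. Sh z u w \<longrightarrow> L2_norm M u \<le> C * L2_norm M w"
      using * unfolding Sh_def by fastforce
  next
    assume "\<forall>u w. Sh z u w \<longrightarrow> L2_norm M u \<le> C * L2_norm M w"
    then show "\<forall>(u, g)\<in>T. L2_norm M u \<le> C * L2_norm M (\<lambda>x. g x - z * u x)" using T_Sh by blast
  qed
  ultimately show ?thesis unfolding resolvent_set_def by simp
qed

lemma resolvent_bound:
  assumes "z \<in> resolvent_set M T"
  shows "\<exists>C>0. \<forall>u w. Sh z u w \<longrightarrow> N2 u \<le> C * N2 w"
proof -
  obtain C where C: "\<And>u w. Sh z u w \<Longrightarrow> L2_norm M u \<le> C * L2_norm M w" using assms resolvent_iff by blast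
  have "N2 u \<le> (C\<^sup>2 + 1) * N2 w" if S: "Sh z u w" for u w
  proof -
    have "(L2_norm M u)\<^sup>2 \<le> (C * L2_norm M w)\<^sup>2"
      using C[OF S] by (intro power_mono) (simp_all add: L2_norm_def)
    then have "N2 u \<le> C\<^sup>2 * N2 w" by (simp add: L2_norm_power2 power_mult_distrib)
    then show ?thesis using L2.ip_nonneg[OF Sh_L2'[OF S]] by (simp add: algebra_simps)
  qed
  moreover have "C\<^sup>2 + 1 > 0" by (simp add: add_nonneg_pos)
  ultimately show ?thesis by blast
qed

lemma resolventI:
  assumes "\<And>f. f \<in> L2 M \<Longrightarrow> \<exists>u. Sh z u f" and "\<And>u w. Sh z u w \<Longrightarrow> N2 u \<le> C * N2 w"
  shows "z \<in> resolvent_set M T"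
proof -
  have "L2_norm M u \<le> sqrt (max C 0) * L2_norm M w" if S: "Sh z u w" for u w
  proof -
    have "N2 u \<le> max C 0 * N2 w"
      using assms(2)[OF S] L2.ip_nonneg[OF Sh_L2'[OF S]] by (smt (verit) mult_right_mono)
    then show ?thesis unfolding L2_norm_eq real_sqrt_mult[symmetric] by simp
  qed
  then show ?thesis using assms(1) resolvent_iff by blast
qed

text \<open>Riesz's theorem for \<open>a1\<close> represents the functional that sends
  \<open>v\<close> to \<open>ip v g\<close>; the representing vector solves
  \<open>(T + 1) u = g\<close>.\<close>

lemma exists_K:
  assumes g: "g \<in> L2 M"
  shows "\<exists>u. Sh (-1) u g"
proof -
  have "\<exists>u\<in>V. \<forall>v\<in>V. ip v g = a1 v u"
  proof (rule a1.riesz[OF a1_complete, where C = "N2 g"])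
    show "ip (\<lambda>x. f x + c * h x) g = ip f g + c * ip h g" if "f \<in> V" "h \<in> V" for f h c
      using that g by (simp add: L2.ip_lin V_L2)
    show "(cmod (ip f g))\<^sup>2 \<le> N2 g * a1.sq f" if "f \<in> V" for f
      using L2.cauchy_schwarz[OF V_L2[OF that] g] mult_left_mono[OF N2_le_a1[OF that] L2.ip_nonneg[OF g]]
      by (simp add: mult.commute)
  qed
  then obtain u where u: "u \<in> V" "\<And>v. v \<in> V \<Longrightarrow> ip v g = a1 v u" by blast
  have "cf u v = ip g v + (-1) * ip u v" if v: "v \<in> V" for v
  proof -
    have "ip g v = a1 u v"
      using u(2)[OF v] a1.ip_sym[OF v u(1)] L2.ip_sym[OF V_L2[OF v] g] by simp
    then show ?thesis by (simp add: a1_def)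
  qed
  then show ?thesis using u g unfolding Sh_iff by blast
qed

lemma Sh_neg1_a1: "Sh (-1) u g \<Longrightarrow> v \<in> V \<Longrightarrow> a1 u v = ip g v"
  by (simp add: Sh_iff a1_def)

lemma Sh_neg1_bound:
  assumes "Sh (-1) u g"
  shows "N2 u \<le> N2 g"
proof -
  have V: "u \<in> V" using assms by (rule Sh_V)
  have "N2 u \<le> Re (ip g u)" using N2_le_a1[OF V] Sh_neg1_a1[OF assms V] by simp
  then have "N2 u \<le> sqrt (N2 g) * sqrt (N2 u)"
    using L2.cauchy_schwarz_sqrt[OF Sh_L2'[OF assms] V_L2[OF V]] complex_Re_le_cmod[of "ip g u"] by linarith
  moreover have "N2 u = sqrt (N2 u) * sqrt (N2 u)" using L2.ip_nonneg[OF V_L2[OF V]] by simp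
  ultimately have "sqrt (N2 u) * sqrt (N2 u) \<le> sqrt (N2 g) * sqrt (N2 u)" by linarith
  moreover have "0 \<le> sqrt (N2 u)" "0 \<le> sqrt (N2 g)"
    using L2.ip_nonneg[OF V_L2[OF V]] L2.ip_nonneg[OF Sh_L2'[OF assms]] by auto
  ultimately have "sqrt (N2 u) \<le> sqrt (N2 g)"
    by (metis mult_right_le_imp_le order_le_less)
  then show ?thesis by simp
qed

lemma neg1_resolvent: "-1 \<in> resolvent_set M T"
  by (rule resolventI[where C = 1]) (use exists_K Sh_neg1_bound in auto)

text \<open>The graph norm dominates the form norm, so the arguments also converge in form, to some
  \<open>v\<close>. This \<open>v\<close> agrees with the given L2 limit only almost everywhere and
  is exchanged for it at the end.\<close>

lemma Sh_closed:
  assumes S: "\<And>n. Sh z (us n) (ws n)" and u: "u \<in> L2 M" "(\<lambda>n. N2 (\<lambda>x. us n x - u x)) \<longlonglongrightarrow> 0"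
    and w: "w \<in> L2 M" "(\<lambda>n. N2 (\<lambda>x. ws n x - w x)) \<longlonglongrightarrow> 0"
  shows "Sh z u w"
proof -
  \<comment> \<open>Enough for \<open>|Re z|\<close> from the shift, 1 from \<open>a1\<close>, and
    1/2 from splitting the inner product of argument and value.\<close>
  define K where "K = \<bar>Re z\<bar> + 2"
  note us = Sh_V[OF S] and uL = Sh_L2[OF S] and wL = Sh_L2'[OF S]
  have le: "a1.sq (\<lambda>x. us m x - us n x) \<le> N2 (\<lambda>x. ws m x - ws n x) + K * N2 (\<lambda>x. us m x - us n x)" for m n
  proof -
    let ?u = "\<lambda>x. us m x - us n x" and ?w = "\<lambda>x. ws m x - ws n x"
    have L: "?u \<in> L2 M" "?w \<in> L2 M" by (auto intro: L2.diff uL wL)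
    have "2 * Re (ip ?w ?u) \<le> N2 ?w + N2 ?u"
      using L2.ip_nonneg[OF L2.diff[OF L(2,1)]] L2.sq_diff[OF L(2,1)] by linarith
    moreover have "Re z * N2 ?u \<le> \<bar>Re z\<bar> * N2 ?u" by (intro mult_right_mono L2.ip_nonneg L) auto
    ultimately show ?thesis
      using Sh_sq[OF Sh_diff[OF S S], of m n] L2.ip_nonneg[OF L(1)] L2.ip_nonneg[OF L(2)] by (simp add: a1_sq K_def algebra_simps)
  qed
  have cauN: "\<exists>N. \<forall>m\<ge>N. \<forall>n\<ge>N. N2 (\<lambda>x. fs m x - fs n x) < e"
    if "e > 0" and fs: "\<And>n. fs n \<in> L2 M" and f: "f \<in> L2 M" "(\<lambda>n. N2 (\<lambda>x. fs n x - f x)) \<longlonglongrightarrow> 0" for e fs f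
  proof -
    have "\<forall>\<^sub>F n in sequentially. N2 (\<lambda>x. fs n x - f x) < e / 4" using f(2) \<open>e > 0\<close> by (intro order_tendstoD) auto
    then obtain N where N: "\<And>n. n \<ge> N \<Longrightarrow> N2 (\<lambda>x. fs n x - f x) < e / 4" using eventually_sequentially by auto
    have "N2 (\<lambda>x. fs m x - fs n x) < e" if "m \<ge> N" "n \<ge> N" for m n
      using L2.sq_triangle[OF fs f(1) fs, of m n] L2.sq_diff_commute[OF fs f(1), of n] N[OF that(1)] N[OF that(2)] by linarith
    then show ?thesis by blast
  qed
  have "\<exists>N. \<forall>m\<ge>N. \<forall>n\<ge>N. a1.sq (\<lambda>x. us m x - us n x) < e" if e: "e > 0" for e
  proof -
    have k: "K > 0" by (simp add: K_def)
    obtain N1 where N1: "\<And>m n. m \<ge> N1 \<Longrightarrow> n \<ge> N1 \<Longrightarrow> N2 (\<lambda>x. ws m x - ws n x) < e/2"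
      using cauN[of "e/2" ws w] e wL w by auto
    obtain N2' where N2': "\<And>m n. m \<ge> N2' \<Longrightarrow> n \<ge> N2' \<Longrightarrow> N2 (\<lambda>x. us m x - us n x) < e/2 / K"
      using cauN[of "e/2 / K" us u] e k uL u by auto
    have "a1.sq (\<lambda>x. us m x - us n x) < e" if "m \<ge> max N1 N2'" "n \<ge> max N1 N2'" for m n
    proof -
      have "K * N2 (\<lambda>x. us m x - us n x) < e/2"
        using mult_strict_left_mono[OF N2'[of m n] k] that k by simp
      moreover have "N2 (\<lambda>x. ws m x - ws n x) < e/2" using N1[of m n] that by simp
      ultimately show ?thesis using le[of m n] by linarith
    qed
    then show ?thesis by blast
  qed
  then obtain v where v: "v \<in> V" "(\<lambda>n. a1.sq (\<lambda>x. us n x - v x)) \<longlonglongrightarrow> 0"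
    using a1_complete us unfolding ip_complete_def by blast
  have lim0: "(\<lambda>n. g (\<lambda>x. us n x - v x)) \<longlonglongrightarrow> 0"
    if "\<And>f. f \<in> V \<Longrightarrow> 0 \<le> g f" "\<And>f. f \<in> V \<Longrightarrow> g f \<le> a1.sq f" for g :: "_ \<Rightarrow> real"
    by (rule tendsto_sandwich[OF _ _ tendsto_const v(2)]) (use that cl.diff[OF us v(1)] in auto)
  have Nv: "(\<lambda>n. N2 (\<lambda>x. us n x - v x)) \<longlonglongrightarrow> 0"
    by (rule lim0) (use L2.ip_nonneg[OF V_L2] N2_le_a1 in auto)
  have cv: "(\<lambda>n. cl.sq (\<lambda>x. us n x - v x)) \<longlonglongrightarrow> 0"
    by (rule lim0) (use cl.ip_nonneg cl_le_a1 in auto)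
  have "N2 (\<lambda>x. u x - v x) \<le> 0"
  proof (rule LIMSEQ_le_const)
    show "(\<lambda>n. 2 * N2 (\<lambda>x. us n x - u x) + 2 * N2 (\<lambda>x. us n x - v x)) \<longlonglongrightarrow> 0"
      using tendsto_add[OF tendsto_mult[OF tendsto_const[of 2] u(2)] tendsto_mult[OF tendsto_const[of 2] Nv]] by simp
    show "\<exists>N. \<forall>n\<ge>N. N2 (\<lambda>x. u x - v x) \<le> 2 * N2 (\<lambda>x. us n x - u x) + 2 * N2 (\<lambda>x. us n x - v x)"
      using L2.sq_triangle[OF u(1) uL V_L2[OF v(1)]] L2.sq_diff_commute[OF u(1) uL] by auto
  qed
  then have "N2 (\<lambda>x. u x - v x) = 0"
    using L2.ip_nonneg[OF L2.diff[OF u(1) V_L2[OF v(1)]]] by simp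
  then have ae: "AE x in M. u x = v x" by (intro N2_null_cong u V_L2 v)
  have "cf v y = ip w y + z * ip v y" if y: "y \<in> V" for y
  proof -
    have z: "(\<lambda>n. cl.sq (\<lambda>x. y x - y x)) \<longlonglongrightarrow> 0" "(\<lambda>n. N2 (\<lambda>x. y x - y x)) \<longlonglongrightarrow> 0"
      using cl.ip_zero_left[OF cl.zero] by (simp_all add: L2_inner_def)
    have "(\<lambda>n. cf (us n) y) \<longlonglongrightarrow> cf v y"
      by (rule cl.ip_tendsto[OF us v(1) cv y y z(1)])
    moreover have "(\<lambda>n. ip (ws n) y + z * ip (us n) y) \<longlonglongrightarrow> ip w y + z * ip v y"
      by (intro tendsto_add tendsto_mult tendsto_const L2.ip_tendsto[OF wL w(1) w(2) V_L2[OF y] V_L2[OF y] z(2)]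
          L2.ip_tendsto[OF uL V_L2[OF v(1)] Nv V_L2[OF y] V_L2[OF y] z(2)])
    moreover have "cf (us n) y = ip (ws n) y + z * ip (us n) y" for n using S[of n] y by (simp add: Sh_iff)
    ultimately show ?thesis using LIMSEQ_unique by fastforce
  qed
  then have "Sh z v w" using v w unfolding Sh_iff by blast
  then show ?thesis by (rule Sh_cong) (use u w ae in auto)
qed

text \<open>Self-adjointness, reduced to the symmetry of the inverse of \<open>T + 1\<close>. With
  \<open>k\<close> the image of \<open>d\<close> under that inverse it suffices that
  \<open>d = (1 + cnj z) * k\<close> almost everywhere; applying the orthogonality to the solution
  \<open>h\<close> for the defect \<open>?e\<close> itself yields
  \<open>ip ?e ?e = 0\<close>.\<close>

lemma Sh_adjoint:
  assumes d: "d \<in> L2 M" and orth: "\<And>u w. Sh z u w \<Longrightarrow> ip w d = 0"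
  shows "Sh (cnj z) d (\<lambda>x. 0)"
proof -
  obtain k where k: "Sh (-1) k d" using exists_K[OF d] by blast
  have kL: "k \<in> L2 M" by (rule Sh_L2[OF k])
  define c where "c = 1 + cnj z"
  have ckL: "(\<lambda>x. c * k x) \<in> L2 M" by (rule L2.scale[OF kL])
  let ?e = "\<lambda>x. d x - c * k x"
  have eL: "?e \<in> L2 M" by (intro L2.diff d ckL)
  obtain h where h: "Sh (-1) h ?e" using exists_K[OF eL] by blast
  have hL: "h \<in> L2 M" by (rule Sh_L2[OF h])
  have "Sh (-1 + (z + 1)) h (\<lambda>x. ?e x - (z + 1) * h x)" by (rule Sh_shift[OF h])
  then have "Sh z h (\<lambda>x. ?e x - (z + 1) * h x)" by simp
  from orth[OF this] have "ip ?e d = (z + 1) * ip h d"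
    using L2.ip_diff_left[OF eL L2.scale[OF hL] d, of "z + 1"] L2.ip_scale_left[OF hL d, of "z + 1"] by simp
  also have "ip h d = ip ?e k"
    using Sh_sym[OF h, of k d] k by simp
  finally have "ip ?e ?e = 0"
    using L2.ip_diff_right[OF d ckL eL] L2.ip_scale_right[OF kL eL, of c] by (simp add: c_def algebra_simps)
  then have ae: "AE x in M. d x = c * k x" by (intro N2_null_cong d ckL) simp
  have "Sh (-1 + (1 + cnj z)) k (\<lambda>x. d x - (1 + cnj z) * k x)" by (rule Sh_shift[OF k])
  then have "Sh (cnj z) k ?e" unfolding c_def by simp
  then have "Sh (cnj z) (\<lambda>x. c * k x) (\<lambda>x. c * ?e x)" by (rule Sh_scale)
  then show ?thesis
    by (rule Sh_cong) (use d ae L2.zero in auto)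
qed

lemma complete_limits:
  assumes "\<And>n. us n \<in> L2 M" "\<And>e. e > 0 \<Longrightarrow> \<exists>N. \<forall>m\<ge>N. \<forall>n\<ge>N. N2 (\<lambda>x. us m x - us n x) < e"
  obtains u where "u \<in> L2 M" "(\<lambda>n. N2 (\<lambda>x. us n x - u x)) \<longlonglongrightarrow> 0"
  using L2_complete[of M] assms unfolding ip_complete_def by blast

abbreviation ker :: "complex \<Rightarrow> ('x \<Rightarrow> complex) set" where "ker z \<equiv> {e. Sh z e (\<lambda>x. 0)}"
abbreviation orth_to :: "('x \<Rightarrow> complex) \<Rightarrow> ('x \<Rightarrow> complex) set \<Rightarrow> bool" where
  "orth_to u E \<equiv> \<forall>e\<in>E. ip u e = 0"

lemma ip_lim:
  assumes "\<And>n. us n \<in> L2 M" "u \<in> L2 M" "(\<lambda>n. N2 (\<lambda>x. us n x - u x)) \<longlonglongrightarrow> 0" "y \<in> L2 M"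
  shows "(\<lambda>n. ip (us n) y) \<longlonglongrightarrow> ip u y"
  by (rule L2.ip_tendsto[OF assms(1,2,3,4,4)]) (simp add: L2_inner_def)

text \<open>Kernels are complete because the graph is closed, so Riesz's theorem inside the kernel
  supplies the orthogonal projection.\<close>

lemma proj_ker:
  assumes u: "u \<in> L2 M"
  shows "\<exists>e\<in>ker z. orth_to (\<lambda>x. u x - e x) (ker z)"
proof -
  have sub: "ker z \<subseteq> L2 M" using Sh_L2 by blast
  have lin: "(\<lambda>x. f x + c * g x) \<in> ker z" if "f \<in> ker z" "g \<in> ker z" for f g c
    using Sh_lin[of z f "\<lambda>x. 0" g "\<lambda>x. 0" c] that by simp
  interpret k: semi_ip "ker z" ip
    by (rule semi_ip_subspace[OF L2.semi_ip_axioms sub]) (use Sh_zero lin in auto)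
  have "ip_complete (ker z) ip"
    unfolding ip_complete_def
  proof (intro allI impI)
    fix us :: "nat \<Rightarrow> 'x \<Rightarrow> complex" assume us: "\<forall>n. us n \<in> ker z" and cau: "\<forall>e>0. \<exists>N. \<forall>m\<ge>N. \<forall>n\<ge>N. N2 (\<lambda>x. us m x - us n x) < e"
    obtain v where v: "v \<in> L2 M" "(\<lambda>n. N2 (\<lambda>x. us n x - v x)) \<longlonglongrightarrow> 0"
      using complete_limits[of us] us cau sub by blast
    have "Sh z v (\<lambda>x. 0)"
      by (rule Sh_closed[where us = us and ws = "\<lambda>n x. 0"]) (use us v L2.zero in \<open>auto simp: L2_inner_def\<close>)
    then show "\<exists>u\<in>ker z. (\<lambda>n. N2 (\<lambda>x. us n x - u x)) \<longlonglongrightarrow> 0" using v by blast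
  qed
  then have "\<exists>e\<in>ker z. \<forall>v\<in>ker z. ip v u = ip v e"
  proof (rule k.riesz[where C = "N2 u"])
    show "ip (\<lambda>x. f x + c * g x) u = ip f u + c * ip g u" if "f \<in> ker z" "g \<in> ker z" for f g c
      using that sub u by (intro L2.ip_lin) auto
    show "(cmod (ip f u))\<^sup>2 \<le> N2 u * N2 f" if "f \<in> ker z" for f
      using L2.cauchy_schwarz[of f M u] that sub u by (auto simp: mult.commute)
  qed
  then obtain e where e: "e \<in> ker z" "\<And>v. v \<in> ker z \<Longrightarrow> ip v u = ip v e" by blast
  have "ip (\<lambda>x. u x - e x) v = 0" if v: "v \<in> ker z" for v
    using e(2)[OF v] L2.ip_sym[of v M u] L2.ip_sym[of v M e] L2.ip_diff_left[of u M e v] u v e(1) sub by auto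
  then show ?thesis using e by blast
qed

text \<open>Closed range: the lower bound off the kernel makes the range complete, so
  \<open>f\<close> can be projected onto it. The remainder lies in the kernel of the adjoint, to
  which \<open>f\<close> is orthogonal.\<close>

lemma Sh_surj:
  assumes bd: "\<And>v w. Sh z v w \<Longrightarrow> orth_to v (ker z) \<Longrightarrow> N2 v \<le> C * N2 w"
    and f: "f \<in> L2 M" and fo: "orth_to f (ker (cnj z))"
  shows "\<exists>v. Sh z v f \<and> orth_to v (ker z)"
proof -
  \<comment> \<open>Restricting to arguments orthogonal to the kernel loses nothing of the range,
    since the projection onto the kernel can be subtracted from any argument.\<close>
  define R where "R = {w. \<exists>v. Sh z v w \<and> orth_to v (ker z)}"
  have RI: "w \<in> R" if "Sh z v w" "orth_to v (ker z)" for v w using that by (auto simp: R_def)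
  have sub: "R \<subseteq> L2 M" using Sh_L2' by (auto simp: R_def)
  have klin: "orth_to (\<lambda>x. v x + c * v' x) (ker z)"
    if "orth_to v (ker z)" "orth_to v' (ker z)" "v \<in> L2 M" "v' \<in> L2 M" for v v' c
    using that Sh_L2 by (auto simp: L2.ip_lin)
  have lin: "(\<lambda>x. w x + c * w' x) \<in> R" if w: "w \<in> R" "w' \<in> R" for w w' c
  proof -
    obtain v v' where v: "Sh z v w" "orth_to v (ker z)" "Sh z v' w'" "orth_to v' (ker z)"
      using w unfolding R_def by blast
    show ?thesis by (rule RI[OF Sh_lin[OF v(1,3)] klin[OF v(2,4) Sh_L2[OF v(1)] Sh_L2[OF v(3)]]])
  qed
  have zero: "(\<lambda>x. 0) \<in> R" by (rule RI[OF Sh_zero]) (auto simp: L2_inner_def)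
  interpret R: semi_ip R ip
    by (rule semi_ip_subspace[OF L2.semi_ip_axioms sub]) (use zero lin in auto)
  have "ip_complete R ip"
    unfolding ip_complete_def
  proof (intro allI impI)
    fix ws :: "nat \<Rightarrow> 'x \<Rightarrow> complex" assume ws: "\<forall>n. ws n \<in> R" and cau: "\<forall>e>0. \<exists>N. \<forall>m\<ge>N. \<forall>n\<ge>N. N2 (\<lambda>x. ws m x - ws n x) < e"
    obtain vs where vs: "\<And>n. Sh z (vs n) (ws n)" "\<And>n. orth_to (vs n) (ker z)" using ws unfolding R_def mem_Collect_eq by metis
    obtain w where w: "w \<in> L2 M" "(\<lambda>n. N2 (\<lambda>x. ws n x - w x)) \<longlonglongrightarrow> 0"
      using complete_limits[of ws] ws cau sub by blast
    have le: "N2 (\<lambda>x. vs m x - vs n x) \<le> (max C 0 + 1) * N2 (\<lambda>x. ws m x - ws n x)" for m n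
    proof -
      have "N2 (\<lambda>x. vs m x - vs n x) \<le> C * N2 (\<lambda>x. ws m x - ws n x)"
        using bd[OF Sh_diff[OF vs(1) vs(1)], of m n] klin[OF vs(2) vs(2) Sh_L2[OF vs(1)] Sh_L2[OF vs(1)], where c = "-1"] by simp
      also have "\<dots> \<le> (max C 0 + 1) * N2 (\<lambda>x. ws m x - ws n x)"
        using Sh_L2'[OF vs(1)] by (intro mult_right_mono L2.ip_nonneg L2.diff) auto
      finally show ?thesis .
    qed
    have k: "max C 0 + 1 > 0" by linarith
    have "\<exists>N. \<forall>m\<ge>N. \<forall>n\<ge>N. N2 (\<lambda>x. vs m x - vs n x) < e" if e: "e > 0" for e
    proof -
      obtain N where N: "\<And>m n. m \<ge> N \<Longrightarrow> n \<ge> N \<Longrightarrow> N2 (\<lambda>x. ws m x - ws n x) < e / (max C 0 + 1)"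
        using cau e k by (metis divide_pos_pos)
      have "N2 (\<lambda>x. vs m x - vs n x) < e" if "m \<ge> N" "n \<ge> N" for m n
      proof -
        have "(max C 0 + 1) * N2 (\<lambda>x. ws m x - ws n x) < e"
          using N[OF that] k by (simp add: pos_less_divide_eq mult.commute)
        then show ?thesis using le[of m n] by linarith
      qed
      then show ?thesis by blast
    qed
    then obtain v where v: "v \<in> L2 M" "(\<lambda>n. N2 (\<lambda>x. vs n x - v x)) \<longlonglongrightarrow> 0"
      using complete_limits[of vs] Sh_L2[OF vs(1)] by blast
    have "Sh z v w" by (rule Sh_closed[OF vs(1) v w])
    moreover have "orth_to v (ker z)"
    proof
      fix e assume e: "e \<in> ker z"
      then have "e \<in> L2 M" using Sh_L2 by blast
      from ip_lim[OF Sh_L2[OF vs(1)] v this] vs(2) e have "(\<lambda>n. 0) \<longlonglongrightarrow> ip v e" by simp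
      then show "ip v e = 0" by (simp add: LIMSEQ_const_iff)
    qed
    ultimately show "\<exists>u\<in>R. (\<lambda>n. N2 (\<lambda>x. ws n x - u x)) \<longlonglongrightarrow> 0" using w RI by blast
  qed
  then have "\<exists>r\<in>R. \<forall>w\<in>R. ip w f = ip w r"
  proof (rule R.riesz[where C = "N2 f"])
    show "ip (\<lambda>x. w x + c * g x) f = ip w f + c * ip g f" if "w \<in> R" "g \<in> R" for w g c
      using that sub f by (intro L2.ip_lin) auto
    show "(cmod (ip w f))\<^sup>2 \<le> N2 f * N2 w" if "w \<in> R" for w
      using L2.cauchy_schwarz[of w M f] that sub f by (auto simp: mult.commute)
  qed
  then obtain r where r: "r \<in> R" "\<And>w. w \<in> R \<Longrightarrow> ip w f = ip w r" by blast
  have rL: "r \<in> L2 M" using r sub by blast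
  let ?d = "\<lambda>x. f x - r x"
  have dL: "?d \<in> L2 M" by (intro L2.diff f rL)
  have dR: "ip w ?d = 0" if "w \<in> R" for w
    using r(2)[OF that] L2.ip_diff_right[OF f rL, of w] that sub by auto
  have "Sh (cnj z) ?d (\<lambda>x. 0)"
  proof (rule Sh_adjoint[OF dL])
    fix u w assume S: "Sh z u w"
    obtain e where e: "e \<in> ker z" "orth_to (\<lambda>x. u x - e x) (ker z)" using proj_ker[OF Sh_L2[OF S]] by blast
    have "Sh z (\<lambda>x. u x - e x) w" using Sh_diff[OF S, of e "\<lambda>x. 0"] e by simp
    then show "ip w ?d = 0" using dR RI e(2) by blast
  qed
  then have "ip f ?d = 0" using fo by blast
  moreover have "ip r ?d = 0" using dR r by blast
  ultimately have "N2 ?d = 0" using L2.ip_diff_left[OF f rL dL] by simp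
  then have "AE x in M. f x = r x" by (intro N2_null_cong f rL)
  moreover obtain v where "Sh z v r" "orth_to v (ker z)" using r unfolding R_def by blast
  ultimately show ?thesis using Sh_cong[OF _ Sh_L2 _ f, of z v r z v r] by auto
qed

lemma ker_nonreal:
  assumes e: "e \<in> ker z" and n: "N2 e \<noteq> 0"
  shows "Im z = 0" "0 \<le> Re z"
proof -
  have S: "Sh z e (\<lambda>x. 0)" using e by simp
  have "cf e e = z * ip e e" using S Sh_V[OF S] by (simp add: Sh_iff L2.ip_zero_left Sh_L2[OF S])
  then have *: "complex_of_real (cl.sq e) = z * of_real (N2 e)"
    using cl.ip_self[OF Sh_V[OF S]] L2.ip_self[OF Sh_L2[OF S]] by simp
  from arg_cong[OF *, of Im] show "Im z = 0" using n by simp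
  from arg_cong[OF *, of Re] have "cl.sq e = Re z * N2 e" by simp
  then show "0 \<le> Re z"
    using cl.ip_nonneg[OF Sh_V[OF S]] L2.ip_nonneg[OF Sh_L2[OF S]] n by (metis less_eq_real_def zero_le_mult_iff not_le)
qed

lemma ker_orth:
  assumes e: "e \<in> ker z" and e': "e' \<in> ker z'" and ne: "z \<noteq> z'"
  shows "ip e e' = 0"
proof (cases "N2 e = 0 \<or> N2 e' = 0")
  case True
  have L: "e \<in> L2 M" "e' \<in> L2 M" using e e' Sh_L2 by auto
  have "cmod (ip e e') \<le> 0" using L2.cauchy_schwarz[OF L] True by auto
  then show ?thesis by simp
next
  case False
  then have r: "cnj z' = z'" using ker_nonreal[OF e'] by (simp add: complex_eq_iff)
  have S: "Sh z e (\<lambda>x. 0)" "Sh z' e' (\<lambda>x. 0)" using e e' by auto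
  have "Sh z e' (\<lambda>x. (z' - z) * e' x)"
    using Sh_shift[OF S(2), of "z - z'"] by (simp add: left_diff_distrib)
  moreover have "cnj z = z" using False ker_nonreal[OF e] by (simp add: complex_eq_iff)
  ultimately have "ip (\<lambda>x. 0) e' = ip e (\<lambda>x. (z' - z) * e' x)"
    using Sh_sym[OF S(1), of e'] by simp
  then have "cnj (z' - z) * ip e e' = 0"
    using L2.ip_scale_right[OF Sh_L2[OF S(2)] Sh_L2[OF S(1)], of "z' - z"] L2.ip_zero_left[OF Sh_L2[OF S(2)]] by simp
  then show ?thesis using ne by simp
qed

lemma ker_null_resolvent:
  assumes "z \<in> resolvent_set M T" "e \<in> ker z"
  shows "N2 e = 0"
proof -
  obtain C where "N2 e \<le> C * N2 (\<lambda>x. 0)" using resolvent_bound[OF assms(1)] assms(2) by blast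
  then show ?thesis using L2.ip_nonneg[OF Sh_L2, of z e "\<lambda>x. 0"] assms(2) by (simp add: L2_inner_def)
qed

lemma ip_null: "e \<in> L2 M \<Longrightarrow> N2 e = 0 \<Longrightarrow> f \<in> L2 M \<Longrightarrow> ip f e = 0"
  using L2.cauchy_schwarz[of f M e] by simp

text \<open>Surjectivity involves the kernel at \<open>cnj z\<close>; a non-null vector there would
  force \<open>z\<close> to be real and hence lie in the kernel at \<open>z\<close>.\<close>

lemma resolventI2:
  assumes bd: "\<And>v w. Sh z v w \<Longrightarrow> orth_to v (ker z) \<Longrightarrow> N2 v \<le> C * N2 w"
    and nul: "\<And>e. e \<in> ker z \<Longrightarrow> N2 e = 0"
  shows "z \<in> resolvent_set M T"
proof (rule resolventI[where C = C])
  have o: "orth_to v (ker z)" if "v \<in> L2 M" for v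
    using that nul ip_null Sh_L2 by blast
  have o': "orth_to v (ker (cnj z))" if v: "v \<in> L2 M" for v
  proof
    fix e assume e: "e \<in> ker (cnj z)"
    have "N2 e = 0"
    proof (rule ccontr)
      assume n: "N2 e \<noteq> 0"
      from ker_nonreal(1)[OF e n] have "cnj z = z" by (simp add: complex_eq_iff)
      then show False using n nul e by simp
    qed
    then show "ip v e = 0" using ip_null[OF _ _ v] Sh_L2 e by blast
  qed
  show "N2 u \<le> C * N2 w" if "Sh z u w" for u w using bd[OF that] o[OF Sh_L2[OF that]] by blast
  show "\<exists>u. Sh z u f" if "f \<in> L2 M" for f using Sh_surj[OF bd that o'[OF that]] by blast
qed

text \<open>The form is real on the diagonal, so the imaginary part of \<open>ip w v\<close> is
  \<open>- Im z * N2 v\<close>; Cauchy-Schwarz turns this into a lower bound for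
  \<open>w\<close>.\<close>

lemma nonreal_resolvent:
  assumes z: "Im z \<noteq> 0"
  shows "z \<in> resolvent_set M T"
proof (rule resolventI2[where C = "1 / (Im z)\<^sup>2"])
  show "N2 e = 0" if "e \<in> ker z" for e using ker_nonreal(1)[OF that] z by blast
  fix v w assume S: "Sh z v w"
  have L: "v \<in> L2 M" "w \<in> L2 M" using Sh_L2[OF S] Sh_L2'[OF S] .
  have "ip w v + z * ip v v = of_real (cl.sq v)"
    using S cl.ip_self[OF Sh_V[OF S]] Sh_V[OF S] by (simp add: Sh_iff)
  then have "ip w v + z * of_real (N2 v) = of_real (cl.sq v)" using L2.ip_self[OF L(1)] by simp
  from arg_cong[OF this, of Im] have "Im (ip w v) = - Im z * N2 v" by simp
  then have "\<bar>Im z\<bar> * N2 v \<le> cmod (ip w v)"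
    using abs_Im_le_cmod[of "ip w v"] L2.ip_nonneg[OF L(1)] by (simp add: abs_mult)
  then have "(\<bar>Im z\<bar> * N2 v)\<^sup>2 \<le> (cmod (ip w v))\<^sup>2"
    using L2.ip_nonneg[OF L(1)] by (intro power_mono) auto
  also have "\<dots> \<le> N2 w * N2 v" by (rule L2.cauchy_schwarz[OF L(2,1)])
  finally have *: "(Im z)\<^sup>2 * N2 v * N2 v \<le> N2 w * N2 v" by (simp add: power2_eq_square mult_ac)
  have "(Im z)\<^sup>2 * N2 v \<le> N2 w"
  proof (cases "N2 v = 0")
    case True then show ?thesis using L2.ip_nonneg[OF L(2)] by simp
  next
    case False
    then have "N2 v > 0" using L2.ip_nonneg[OF L(1)] by simp
    then show ?thesis using * by (metis mult_right_le_imp_le)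
  qed
  then show "N2 v \<le> 1 / (Im z)\<^sup>2 * N2 w" using z by (simp add: field_simps)
qed

end

section \<open>Finite orthogonal sums and underdetermined linear systems\<close>

context semi_ip
begin

lemma sum_mem:
  assumes "finite I" "\<And>i. i \<in> I \<Longrightarrow> f i \<in> V"
  shows "(\<lambda>x. \<Sum>i\<in>I. c i * f i x) \<in> V"
  using assms
proof (induction I)
  case empty then show ?case by (simp add: zero)
next
  case (insert i I)
  then show ?case using lin[of "\<lambda>x. \<Sum>i\<in>I. c i * f i x" "f i" "c i"] by (simp add: add.commute)
qed

lemma ip_sum_left:
  assumes "finite I" "\<And>i. i \<in> I \<Longrightarrow> f i \<in> V" "g \<in> V"
  shows "ip (\<lambda>x. \<Sum>i\<in>I. c i * f i x) g = (\<Sum>i\<in>I. c i * ip (f i) g)"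
  using assms
proof (induction I)
  case empty then show ?case by (simp add: ip_zero_left)
next
  case (insert i I)
  then show ?case
    using ip_lin[OF sum_mem[of I f c], of "f i" g "c i"] by (simp add: add.commute)
qed

lemma ip_sum_right:
  assumes "finite I" "\<And>i. i \<in> I \<Longrightarrow> f i \<in> V" "g \<in> V"
  shows "ip g (\<lambda>x. \<Sum>i\<in>I. c i * f i x) = (\<Sum>i\<in>I. cnj (c i) * ip g (f i))"
proof -
  have "ip g (\<lambda>x. \<Sum>i\<in>I. c i * f i x) = cnj (\<Sum>i\<in>I. c i * ip (f i) g)"
    using ip_sym[OF sum_mem[of I f c] assms(3)] ip_sum_left[of I f g c] assms by simp
  also have "\<dots> = (\<Sum>i\<in>I. cnj (c i) * ip g (f i))"
    unfolding cnj_sum using assms ip_sym[of _ g] by (intro sum.cong) auto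
  finally show ?thesis .
qed

lemma sq_sum_orth:
  assumes I: "finite I" and f: "\<And>i. i \<in> I \<Longrightarrow> f i \<in> V"
    and orth: "\<And>i j. i \<in> I \<Longrightarrow> j \<in> I \<Longrightarrow> i \<noteq> j \<Longrightarrow> ip (f i) (f j) = 0"
  shows "sq (\<lambda>x. \<Sum>i\<in>I. c i * f i x) = (\<Sum>i\<in>I. (cmod (c i))\<^sup>2 * sq (f i))"
proof -
  have "ip (\<lambda>x. \<Sum>i\<in>I. c i * f i x) (\<lambda>x. \<Sum>i\<in>I. c i * f i x)
      = (\<Sum>i\<in>I. c i * (\<Sum>j\<in>I. cnj (c j) * ip (f i) (f j)))"
    using ip_sum_left[OF I f sum_mem[OF I f, where c = c], where c = c] ip_sum_right[OF I f f] by simp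
  also have "\<dots> = (\<Sum>i\<in>I. of_real ((cmod (c i))\<^sup>2 * sq (f i)))"
  proof (rule sum.cong[OF refl])
    fix i assume i: "i \<in> I"
    have "(\<Sum>j\<in>I. cnj (c j) * ip (f i) (f j)) = (\<Sum>j\<in>I. if j = i then cnj (c i) * ip (f i) (f i) else 0)"
      by (rule sum.cong) (use orth i in auto)
    also have "\<dots> = cnj (c i) * of_real (sq (f i))" using I i ip_self[OF f[OF i]] by simp
    finally show "c i * (\<Sum>j\<in>I. cnj (c j) * ip (f i) (f j)) = of_real ((cmod (c i))\<^sup>2 * sq (f i))"
      by (simp only: of_real_mult complex_norm_square mult.assoc)
  qed
  finally show ?thesis unfolding of_real_sum[symmetric] by (simp only: Re_complex_of_real)
qed

end

text \<open>Elimination: the equation \<open>g\<close> is solved for a pivot unknown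
  \<open>k\<close> and substituted into the others, which removes one equation and one
  unknown.\<close>

lemma homogeneous_system:
  fixes A :: "'g \<Rightarrow> 'i \<Rightarrow> complex"
  assumes "finite G" "finite I" "card G < card I"
  shows "\<exists>c. (\<exists>i\<in>I. c i \<noteq> 0) \<and> (\<forall>g\<in>G. (\<Sum>i\<in>I. c i * A g i) = 0)"
  using assms
proof (induction G arbitrary: I A rule: finite_induct)
  case empty
  then have "I \<noteq> {}" by auto
  then show ?case by (auto intro!: exI[of _ "\<lambda>_. 1"])
next
  case (insert g G)
  show ?case
  proof (cases "\<forall>i\<in>I. A g i = 0")
    case True
    obtain c where "\<exists>i\<in>I. c i \<noteq> 0" "\<forall>g\<in>G. (\<Sum>i\<in>I. c i * A g i) = 0"
      using insert.IH[of I A] insert.prems insert.hyps by auto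
    then show ?thesis using True by (intro exI[of _ c]) auto
  next
    case False
    then obtain k where k: "k \<in> I" "A g k \<noteq> 0" by blast
    define I' where "I' = I - {k}"
    have I': "finite I'" "card G < card I'" "k \<notin> I'" "I = insert k I'"
      using insert.prems insert.hyps k by (auto simp: I'_def card_Diff_singleton)
    obtain c where c: "\<exists>i\<in>I'. c i \<noteq> 0" "\<And>h. h \<in> G \<Longrightarrow> (\<Sum>i\<in>I'. c i * (A h i - A h k * A g i / A g k)) = 0"
      using insert.IH[OF I'(1,2), of "\<lambda>h i. A h i - A h k * A g i / A g k"] by blast
    define s where "s = (\<Sum>i\<in>I'. c i * A g i)"
    define d where "d i = (if i = k then - s / A g k else c i)" for i
    have ds: "(\<Sum>i\<in>I. d i * A h i) = - s / A g k * A h k + (\<Sum>i\<in>I'. c i * A h i)" for h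
    proof -
      have "(\<Sum>i\<in>I'. d i * A h i) = (\<Sum>i\<in>I'. c i * A h i)"
        using I'(3) by (intro sum.cong) (auto simp: d_def)
      then show ?thesis unfolding I'(4) using I'(1,3) by (simp add: d_def)
    qed
    have "(\<Sum>i\<in>I. d i * A h i) = 0" if "h \<in> G" for h
    proof -
      have "(\<Sum>i\<in>I'. c i * A h i) - A h k / A g k * s = 0"
        using c(2)[OF that] unfolding s_def sum_distrib_left
        by (simp add: algebra_simps sum_subtractf)
      then show ?thesis unfolding ds by (simp add: algebra_simps)
    qed
    moreover have "(\<Sum>i\<in>I. d i * A g i) = 0" unfolding ds using k(2) by (simp flip: s_def)
    moreover have "\<exists>i\<in>I. d i \<noteq> 0" using c(1) I'(3,4) by (auto simp: d_def)
    ultimately show ?thesis by (intro exI[of _ d]) auto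
  qed
qed

section \<open>The lower edge of the spectrum\<close>

context closable_form
begin

lemma eigenspace_ker: "eigenspace M T z = ker z"
proof (intro set_eqI iffI)
  fix u assume "u \<in> eigenspace M T z"
  then obtain g where g: "(u, g) \<in> T" "AE x in M. g x = z * u x" by (auto simp: eigenspace_def)
  have "AE x in M. 0 = g x - z * u x" using g(2) by eventually_elim simp
  from Sh_cong[OF T_Sh[OF g(1)] Sh_L2[OF T_Sh[OF g(1), of z]] _ L2.zero this]
  show "u \<in> ker z" by simp
next
  fix u assume "u \<in> ker z"
  then have "(u, \<lambda>x. z * u x) \<in> T" by (simp add: Sh_def)
  then show "u \<in> eigenspace M T z" by (auto simp: eigenspace_def)
qed

lemma ker_L2: "e \<in> ker z \<Longrightarrow> e \<in> L2 M"
  using Sh_L2 by blast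

lemma ker_V: "e \<in> ker z \<Longrightarrow> e \<in> V"
  using Sh_V by blast

lemma ker_cf: "e \<in> ker z \<Longrightarrow> v \<in> V \<Longrightarrow> cf e v = z * ip e v"
  using L2.ip_zero_left[of v M] V_L2[of v] by (simp add: Sh_iff)

lemma ker_normalise:
  assumes "e \<in> ker z" "N2 e \<noteq> 0"
  shows "\<exists>e'\<in>ker z. N2 e' = 1"
proof
  let ?c = "complex_of_real (1 / sqrt (N2 e))"
  show "(\<lambda>x. ?c * e x) \<in> ker z" using Sh_scale[of z e "\<lambda>x. 0" ?c] assms by simp
  have "N2 e > 0" using assms L2.ip_nonneg[OF ker_L2[OF assms(1)]] by linarith
  then show "N2 (\<lambda>x. ?c * e x) = 1"
    unfolding L2.sq_scale[OF ker_L2[OF assms(1)]] by (simp add: power_divide norm_divide)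
qed

lemma young:
  assumes "f \<in> L2 M" "g \<in> L2 M"
  shows "2 * t * Re (ip f g) \<le> N2 f + t\<^sup>2 * N2 g"
  using L2.sq_lin[OF assms, of "- of_real t"] L2.ip_nonneg[OF L2.lin[OF assms, of "- of_real t"]] by simp

text \<open>Approximation from \<open>D\<close> in the form norm changes both sides of the
  inequality by quantities tending to 0, so the subsequence found for the approximants serves. The
  fact \<open>close\<close> speaks of a generic square because it is applied to \<open>N2\<close>
  and to \<open>cl.sq\<close>.\<close>

lemma ess_lower_V:
  assumes el: "ess_lower M D q \<nu>" and us: "\<And>n. us n \<in> V" and bd: "\<And>n. a1.sq (us n) \<le> C"
  shows "\<exists>r :: nat \<Rightarrow> nat. strict_mono r \<and> (\<forall>e>0. \<exists>N. \<forall>m\<ge>N. \<forall>n\<ge>N.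
     \<nu> * N2 (\<lambda>x. us (r m) x - us (r n) x) \<le> cl.sq (\<lambda>x. us (r m) x - us (r n) x) + e)"
proof -
  have "\<exists>f\<in>D. a1.sq (\<lambda>x. f x - us n x) < (1 / real (Suc n))\<^sup>2" for n
    by (rule D_dense[OF us]) simp
  then obtain f where f: "\<And>n. f n \<in> D" and fu: "\<And>n. a1.sq (\<lambda>x. f n x - us n x) < (1 / real (Suc n))\<^sup>2" by metis
  have fV: "f n \<in> V" for n by (rule D_V[OF f])
  have C0: "C \<ge> 0" using bd[of 0] a1.ip_nonneg[OF us, of 0] by linarith
  have fb: "a1.sq (f n) \<le> 2 * C + 2" for n
  proof -
    have "a1.sq (\<lambda>x. (f n x - us n x) + us n x) \<le> 2 * a1.sq (\<lambda>x. f n x - us n x) + 2 * a1.sq (us n)"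
      by (intro a1.sq_add_le a1.diff fV us)
    moreover have "(1 / real (Suc n))\<^sup>2 \<le> 1" by (simp add: power_le_one)
    ultimately show ?thesis using fu[of n] bd[of n] by simp
  qed
  have "\<exists>C. \<forall>n. Re (q (f n) (f n)) + N2 (f n) \<le> C"
    using fb cf_D[OF f f] by (auto simp: a1_sq intro!: exI[of _ "2 * C + 2"])
  then obtain r :: "nat \<Rightarrow> nat" where r: "strict_mono r"
    and R: "\<And>e. e > 0 \<Longrightarrow> \<exists>N. \<forall>m\<ge>N. \<forall>n\<ge>N. \<nu> * N2 (\<lambda>x. f (r m) x - f (r n) x) \<le> form.sq (\<lambda>x. f (r m) x - f (r n) x) + e"
    using el f unfolding ess_lower_def by blast
  \<comment> \<open>All differences have form norm at most \<open>2 * sqrt (2 * C + 2)\<close>, and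
    two such norms are added in \<open>close\<close>.\<close>
  define B where "B = 4 * sqrt (2 * C + 2)"
  have B: "B > 0" using C0 by (simp add: B_def)
  have sub: "a1.sq (\<lambda>x. g m x - g n x) \<le> 4 * (2 * C + 2)" if "\<And>n. g n \<in> V" "\<And>n. a1.sq (g n) \<le> 2 * C + 2" for g :: "nat \<Rightarrow> 'x \<Rightarrow> complex" and m n
    using a1.sq_diff_le[OF that(1) that(1), of m n] that(2)[of m] that(2)[of n] by argo
  have close: "\<bar>sqf (\<lambda>x. us m x - us n x) - sqf (\<lambda>x. f m x - f n x)\<bar> \<le> (1 / Suc m + 1 / Suc n) * B"
    if sq: "\<And>u v. u \<in> V \<Longrightarrow> v \<in> V \<Longrightarrow> \<bar>sqf u - sqf v\<bar> \<le> sqrt (sqf (\<lambda>x. u x - v x)) * (sqrt (sqf u) + sqrt (sqf v))"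
      and le: "\<And>u. u \<in> V \<Longrightarrow> 0 \<le> sqf u \<and> sqf u \<le> a1.sq u" for sqf :: "('x \<Rightarrow> complex) \<Rightarrow> real" and m n
  proof -
    let ?u = "\<lambda>x. us m x - us n x" and ?f = "\<lambda>x. f m x - f n x"
    have V: "?u \<in> V" "?f \<in> V" "(\<lambda>x. ?u x - ?f x) \<in> V" by (intro a1.diff us fV)+
    have "\<bar>sqf ?u - sqf ?f\<bar> \<le> sqrt (sqf (\<lambda>x. ?u x - ?f x)) * (sqrt (sqf ?u) + sqrt (sqf ?f))"
      by (rule sq[OF V(1,2)])
    also have "\<dots> \<le> (1 / Suc m + 1 / Suc n) * B"
    proof (intro mult_mono)
      have s: "sqrt (a1.sq (\<lambda>x. f k x - us k x)) \<le> 1 / Suc k" for k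
        using fu[of k] by (intro real_le_lsqrt) auto
      have eq: "(\<lambda>x. ?u x - ?f x) = (\<lambda>x. (f n x - us n x) - (f m x - us m x))" by auto
      have "sqrt (sqf (\<lambda>x. ?u x - ?f x)) \<le> sqrt (a1.sq (\<lambda>x. ?u x - ?f x))" using le[OF V(3)] by simp
      also have "\<dots> \<le> sqrt (a1.sq (\<lambda>x. f n x - us n x)) + sqrt (a1.sq (\<lambda>x. f m x - us m x))"
        unfolding eq by (intro a1.triangle_diff a1.diff fV us)
      also have "\<dots> \<le> 1 / Suc m + 1 / Suc n" using s[of n] s[of m] by linarith
      finally show "sqrt (sqf (\<lambda>x. ?u x - ?f x)) \<le> 1 / Suc m + 1 / Suc n" .
      have "sqrt (4 * (2 * C + 2)) = 2 * sqrt (2 * C + 2)" unfolding real_sqrt_mult[of 4] by simp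
      moreover have "sqrt (sqf ?u) \<le> sqrt (4 * (2 * C + 2))"
        using le[OF V(1)] sub[of us m n] us bd C0 by (smt (verit) real_sqrt_le_iff)
      moreover have "sqrt (sqf ?f) \<le> sqrt (4 * (2 * C + 2))"
        using le[OF V(2)] sub[of f m n] fV fb by (smt (verit) real_sqrt_le_iff)
      ultimately show "sqrt (sqf ?u) + sqrt (sqf ?f) \<le> B" by (simp add: B_def)
    qed (use le[OF V(1)] le[OF V(2)] in \<open>auto simp: add_nonneg_nonneg\<close>)
    finally show ?thesis .
  qed
  have "\<exists>N. \<forall>m\<ge>N. \<forall>n\<ge>N. \<nu> * N2 (\<lambda>x. us (r m) x - us (r n) x) \<le> cl.sq (\<lambda>x. us (r m) x - us (r n) x) + e" if e: "e > 0" for e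
  proof -
    obtain N1 where N1: "\<And>m n. m \<ge> N1 \<Longrightarrow> n \<ge> N1 \<Longrightarrow> \<nu> * N2 (\<lambda>x. f (r m) x - f (r n) x) \<le> form.sq (\<lambda>x. f (r m) x - f (r n) x) + e / 2"
      using R[of "e/2"] e by auto
    define L where "L = \<bar>\<nu>\<bar> + 1"
    have L: "L > 0" by (simp add: L_def)
    define \<eta> where "\<eta> = e / (4 * L * B)"
    have \<eta>: "\<eta> > 0" using e B L by (simp add: \<eta>_def)
    obtain N2' where N2': "inverse (real (Suc N2')) < \<eta>" using reals_Archimedean[OF \<eta>] by auto
    have "\<nu> * N2 (\<lambda>x. us (r m) x - us (r n) x) \<le> cl.sq (\<lambda>x. us (r m) x - us (r n) x) + e"
      if mn: "m \<ge> max N1 N2'" "n \<ge> max N1 N2'" for m n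
    proof -
      let ?u = "\<lambda>x. us (r m) x - us (r n) x" and ?f = "\<lambda>x. f (r m) x - f (r n) x"
      have small: "1 / real (Suc (r k)) \<le> \<eta>" if "k \<ge> N2'" for k
      proof -
        have "N2' \<le> r k" using seq_suble[OF r, of k] that by linarith
        then have "1 / real (Suc (r k)) \<le> 1 / real (Suc N2')" by (intro divide_left_mono) auto
        then show ?thesis using N2' by (simp add: inverse_eq_divide)
      qed
      have s: "(1 / Suc (r m) + 1 / Suc (r n)) * B \<le> 2 * \<eta> * B"
        using small[of m] small[of n] mn B by (intro mult_right_mono) auto
      have 1: "\<bar>N2 ?u - N2 ?f\<bar> \<le> 2 * \<eta> * B"
      proof (rule order_trans[OF close[of N2 "r m" "r n"] s])
        show "\<bar>N2 u - N2 v\<bar> \<le> sqrt (N2 (\<lambda>x. u x - v x)) * (sqrt (N2 u) + sqrt (N2 v))" if "u \<in> V" "v \<in> V" for u v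
          by (rule L2.sq_diff_abs[OF V_L2[OF that(1)] V_L2[OF that(2)]])
        show "0 \<le> N2 u \<and> N2 u \<le> a1.sq u" if "u \<in> V" for u
          using L2.ip_nonneg[OF V_L2[OF that]] N2_le_a1[OF that] by simp
      qed
      have 2: "\<bar>cl.sq ?u - cl.sq ?f\<bar> \<le> 2 * \<eta> * B"
      proof (rule order_trans[OF close[of cl.sq "r m" "r n"] s])
        show "\<bar>cl.sq u - cl.sq v\<bar> \<le> sqrt (cl.sq (\<lambda>x. u x - v x)) * (sqrt (cl.sq u) + sqrt (cl.sq v))" if "u \<in> V" "v \<in> V" for u v
          by (rule cl.sq_diff_abs[OF that])
        show "0 \<le> cl.sq u \<and> cl.sq u \<le> a1.sq u" if "u \<in> V" for u
          using cl.ip_nonneg[OF that] cl_le_a1[OF that] by simp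
      qed
      have "\<nu> * (N2 ?u - N2 ?f) \<le> \<bar>\<nu>\<bar> * \<bar>N2 ?u - N2 ?f\<bar>" by (subst abs_mult[symmetric]) (rule abs_ge_self)
      also have "\<dots> \<le> \<bar>\<nu>\<bar> * (2 * \<eta> * B)" by (intro mult_left_mono 1) simp
      finally have 3: "\<nu> * (N2 ?u - N2 ?f) \<le> \<bar>\<nu>\<bar> * (2 * \<eta> * B)" .
      have "L * (2 * \<eta> * B) = e / 2" using B L by (simp add: \<eta>_def)
      then have 4: "\<bar>\<nu>\<bar> * (2 * \<eta> * B) + 2 * \<eta> * B = e / 2" by (simp add: L_def algebra_simps)
      have 5: "\<nu> * N2 ?f \<le> cl.sq ?f + e / 2"
        using N1[of m n] mn cf_D[OF form.diff[OF f f] form.diff[OF f f], of "r m" "r n" "r m" "r n"] by simp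
      have 6: "\<nu> * (N2 ?u - N2 ?f) = \<nu> * N2 ?u - \<nu> * N2 ?f" by (rule right_diff_distrib)
      show ?thesis using 2 3 4 5 6 by argo
    qed
    then show ?thesis by blast
  qed
  then show ?thesis using r by blast
qed

text \<open>Otherwise there are unit vectors orthogonal to the kernel with images tending to 0.
  Below \<open>\<nu>\<close> the essential lower bound makes a subsequence Cauchy, and its limit
  would be a unit vector that lies in the kernel and is orthogonal to it.\<close>

lemma bound_below_ess:
  assumes el: "ess_lower M D q \<nu>" and z: "Re z < \<nu>"
  shows "\<exists>C. \<forall>v w. Sh z v w \<longrightarrow> orth_to v (ker z) \<longrightarrow> N2 v \<le> C * N2 w"
proof (rule ccontr)
  assume neg: "\<not> ?thesis"
  have "\<exists>v w. Sh z v w \<and> orth_to v (ker z) \<and> N2 v = 1 \<and> N2 w \<le> 1 / Suc n" for n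
  proof -
    obtain v w where vw: "Sh z v w" "orth_to v (ker z)" "N2 v > real (Suc n) * N2 w" using neg by (metis not_le)
    have L: "v \<in> L2 M" "w \<in> L2 M" using Sh_L2[OF vw(1)] Sh_L2'[OF vw(1)] .
    have p: "N2 v > 0" using vw(3) L2.ip_nonneg[OF L(2)] by (smt (verit) mult_nonneg_nonneg of_nat_0_le_iff)
    let ?c = "complex_of_real (1 / sqrt (N2 v))"
    have c: "(cmod ?c)\<^sup>2 = 1 / N2 v" using p by (simp add: power_divide norm_divide)
    have "Sh z (\<lambda>x. ?c * v x) (\<lambda>x. ?c * w x)" by (rule Sh_scale[OF vw(1)])
    moreover have "orth_to (\<lambda>x. ?c * v x) (ker z)"
    proof
      fix e assume e: "e \<in> ker z"
      show "ip (\<lambda>x. ?c * v x) e = 0" unfolding L2.ip_scale_left[OF L(1) ker_L2[OF e]] using vw(2) e by simp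
    qed
    moreover have "N2 (\<lambda>x. ?c * v x) = 1" unfolding L2.sq_scale[OF L(1)] c using p by simp
    moreover have "N2 (\<lambda>x. ?c * w x) \<le> 1 / Suc n"
      unfolding L2.sq_scale[OF L(2)] c using vw(3) p by (simp add: field_simps)
    ultimately show ?thesis by blast
  qed
  then obtain vs ws where S: "\<And>n. Sh z (vs n) (ws n)" and o: "\<And>n. orth_to (vs n) (ker z)"
    and v1: "\<And>n. N2 (vs n) = 1" and w1: "\<And>n. N2 (ws n) \<le> 1 / Suc n" by metis
  note vL = Sh_L2[OF S] and wL = Sh_L2'[OF S]
  have w1': "N2 (ws n) \<le> 1" for n using w1[of n] order_trans[of _ "1 / real (Suc n)" 1] by simp
  have bd: "a1.sq (vs n) \<le> 3 + \<bar>Re z\<bar>" for n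
    using young[OF wL vL, of 1 n n] Sh_sq[OF S, of n] v1[of n] w1'[of n] by (simp add: a1_sq)
  from ess_lower_V[OF el, of vs, OF Sh_V[OF S] bd] obtain r :: "nat \<Rightarrow> nat" where r: "strict_mono r"
    and R': "\<forall>e>0. \<exists>N. \<forall>m\<ge>N. \<forall>n\<ge>N. \<nu> * N2 (\<lambda>x. vs (r m) x - vs (r n) x) \<le> cl.sq (\<lambda>x. vs (r m) x - vs (r n) x) + e" by (elim exE conjE)
  note R = R'[THEN spec, THEN mp]
  define \<gamma> where "\<gamma> = \<nu> - Re z"
  have \<gamma>: "\<gamma> > 0" using z by (simp add: \<gamma>_def)
  have "\<exists>N. \<forall>m\<ge>N. \<forall>n\<ge>N. N2 (\<lambda>x. vs (r m) x - vs (r n) x) < e" if e: "e > 0" for e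
  proof -
    obtain N1 where N1: "\<And>m n. m \<ge> N1 \<Longrightarrow> n \<ge> N1 \<Longrightarrow> \<nu> * N2 (\<lambda>x. vs (r m) x - vs (r n) x) \<le> cl.sq (\<lambda>x. vs (r m) x - vs (r n) x) + \<gamma> * e / 8"
      using R[of "\<gamma> * e / 8"] e \<gamma> by auto
    obtain K where K: "inverse (real (Suc K)) < \<gamma>\<^sup>2 * e / 16"
      using reals_Archimedean[of "\<gamma>\<^sup>2 * e / 16"] e \<gamma> by auto
    have "N2 (\<lambda>x. vs (r m) x - vs (r n) x) < e" if mn: "m \<ge> max N1 K" "n \<ge> max N1 K" for m n
    proof -
      let ?v = "\<lambda>x. vs (r m) x - vs (r n) x" and ?w = "\<lambda>x. ws (r m) x - ws (r n) x"
      have L: "?v \<in> L2 M" "?w \<in> L2 M" by (intro L2.diff vL wL)+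
      have wk: "N2 (ws (r k)) < \<gamma>\<^sup>2 * e / 16" if "k \<ge> K" for k
      proof -
        have "K \<le> r k" using seq_suble[OF r, of k] that by linarith
        then have "1 / real (Suc (r k)) \<le> 1 / real (Suc K)" by (intro divide_left_mono) auto
        then show ?thesis using K w1[of "r k"] by (simp add: inverse_eq_divide)
      qed
      have "N2 ?w \<le> 2 * N2 (ws (r m)) + 2 * N2 (ws (r n))" by (intro L2.sq_diff_le wL)
      then have w2: "N2 ?w < \<gamma>\<^sup>2 * e / 4" using wk[of m] wk[of n] mn by simp
      \<comment> \<open>Inserting \<open>cl.sq ?v = Re (ip ?w ?v) + Re z * N2 ?v\<close> turns the
        essential lower bound into control of \<open>?v\<close> by the small images
        \<open>?w\<close>.\<close>
      have 1: "\<gamma> * N2 ?v \<le> Re (ip ?w ?v) + \<gamma> * e / 8"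
        using N1[of m n] mn Sh_sq[OF Sh_diff[OF S S], of "r m" "r n"] by (simp add: \<gamma>_def algebra_simps)
      then have "\<gamma> * (\<gamma> * N2 ?v) \<le> \<gamma> * (Re (ip ?w ?v) + \<gamma> * e / 8)" using \<gamma> by simp
      then have "2 * (\<gamma>\<^sup>2 * N2 ?v) \<le> 2 * \<gamma> * Re (ip ?w ?v) + \<gamma>\<^sup>2 * e / 4"
        by (simp add: algebra_simps power2_eq_square)
      also have "2 * \<gamma> * Re (ip ?w ?v) \<le> N2 ?w + \<gamma>\<^sup>2 * N2 ?v" by (rule young[OF L(2,1)])
      finally have "\<gamma>\<^sup>2 * N2 ?v < \<gamma>\<^sup>2 * e / 2" using w2 by linarith
      then show ?thesis using \<gamma> e by (simp add: field_simps)
    qed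
    then show ?thesis by blast
  qed
  then obtain v where v: "v \<in> L2 M" "(\<lambda>n. N2 (\<lambda>x. vs (r n) x - v x)) \<longlonglongrightarrow> 0"
    using complete_limits[of "\<lambda>n. vs (r n)"] vL by blast
  have w0: "(\<lambda>n. N2 (\<lambda>x. ws (r n) x - 0)) \<longlonglongrightarrow> 0"
  proof (rule tendsto_sandwich[OF _ _ tendsto_const])
    show "(\<lambda>n. inverse (real (Suc n))) \<longlonglongrightarrow> 0" by (rule LIMSEQ_inverse_real_of_nat)
    have "N2 (ws (r n)) \<le> inverse (real (Suc n))" for n
      using w1[of "r n"] seq_suble[OF r, of n] order_trans[OF w1[of "r n"], of "inverse (real (Suc n))"]
      by (simp add: field_simps)
    then show "\<forall>\<^sub>F n in sequentially. N2 (\<lambda>x. ws (r n) x - 0) \<le> inverse (real (Suc n))" by simp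
    show "\<forall>\<^sub>F n in sequentially. 0 \<le> N2 (\<lambda>x. ws (r n) x - 0)" using L2.ip_nonneg[OF wL] by simp
  qed
  have k: "v \<in> ker z"
    using Sh_closed[OF S v L2.zero w0] by simp
  have "(\<lambda>n. ip (vs (r n)) v) \<longlonglongrightarrow> ip v v" by (rule ip_lim[OF vL v v(1)])
  then have "ip v v = 0" using o k by (simp add: LIMSEQ_const_iff)
  moreover have "(\<lambda>n. N2 (vs (r n))) \<longlonglongrightarrow> N2 v" by (rule L2.sq_tendsto[OF vL v])
  then have "N2 v = 1" using v1 by (simp add: LIMSEQ_const_iff)
  ultimately show False by simp
qed

lemma eigenvalue_below_ess:
  assumes el: "ess_lower M D q \<nu>" and z: "Re z < \<nu>" "z \<in> spectrum M T"
  shows "\<exists>e\<in>ker z. N2 e = 1"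
proof (rule ccontr)
  assume "\<not> ?thesis"
  then have nul: "N2 e = 0" if "e \<in> ker z" for e using ker_normalise[OF that] by blast
  obtain C where C: "\<And>v w. Sh z v w \<Longrightarrow> orth_to v (ker z) \<Longrightarrow> N2 v \<le> C * N2 w"
    using bound_below_ess[OF el z(1)] by blast
  have "z \<in> resolvent_set M T" by (rule resolventI2[OF C nul])
  then show False using z(2) by (simp add: spectrum_def)
qed

text \<open>Differences of orthonormal eigenvectors have squared norm 2 and form at most
  \<open>2 * \<nu>'\<close>, so they never satisfy the essential lower bound with error
  \<open>\<nu> - \<nu>'\<close>.\<close>

lemma no_orthonormal_eigenvectors:
  assumes el: "ess_lower M D q \<nu>" and l: "\<nu>' < \<nu>"
    and e: "\<And>n. e n \<in> ker (z n)" "\<And>n. Re (z n) \<le> \<nu>'" "\<And>n. N2 (e n) = 1"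
    and o: "\<And>m n :: nat. m < n \<Longrightarrow> ip (e n) (e m) = 0"
  shows False
proof -
  note eV = ker_V[OF e(1)] and eL = ker_L2[OF e(1)]
  have o': "ip (e n) (e m) = 0" if "m \<noteq> n" for m n
    using o[of m n] o[of n m] that L2.ip_sym[OF eL eL, of m n] by (cases "m < n") auto
  have sq: "cl.sq (e n) \<le> \<nu>'" for n
    using ker_cf[OF e(1) eV, of n n] L2.ip_self[OF eL, of n] e(2,3)[of n] by simp
  have bd: "a1.sq (e n) \<le> \<nu>' + 1" for n using sq[of n] e(3)[of n] by (simp add: a1_sq)
  from ess_lower_V[OF el, of e, OF eV bd] obtain r :: "nat \<Rightarrow> nat" where r: "strict_mono r"
    and R': "\<forall>e'>0. \<exists>N. \<forall>m\<ge>N. \<forall>n\<ge>N. \<nu> * N2 (\<lambda>x. e (r m) x - e (r n) x) \<le> cl.sq (\<lambda>x. e (r m) x - e (r n) x) + e'" by (elim exE conjE)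
  note R = R'[THEN spec, THEN mp]
  obtain N where N: "\<And>m n. m \<ge> N \<Longrightarrow> n \<ge> N \<Longrightarrow> \<nu> * N2 (\<lambda>x. e (r m) x - e (r n) x) \<le> cl.sq (\<lambda>x. e (r m) x - e (r n) x) + (\<nu> - \<nu>')"
    using R[of "\<nu> - \<nu>'"] l by auto
  have ne: "r (Suc N) \<noteq> r N" using r by (metis strict_monoD lessI less_irrefl)
  have "N2 (\<lambda>x. e (r (Suc N)) x - e (r N) x) = 2"
    using L2.sq_diff[OF eL eL, of "r (Suc N)" "r N"] o'[of "r N" "r (Suc N)"] e(3) ne by simp
  moreover have "cl.sq (\<lambda>x. e (r (Suc N)) x - e (r N) x) \<le> 2 * \<nu>'"
    using cl.sq_diff[OF eV eV, of "r (Suc N)" "r N"] ker_cf[OF e(1) eV, of "r (Suc N)" "r N"] o'[of "r N" "r (Suc N)"] ne sq[of "r N"] sq[of "r (Suc N)"] by simp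
  ultimately show False using N[of "Suc N" N] l by simp
qed

lemma finite_spectrum_below_ess:
  assumes el: "ess_lower M D q \<nu>" and l: "\<nu>' < \<nu>"
  shows "finite {z \<in> spectrum M T. Re z \<le> \<nu>'}"
proof (rule ccontr)
  assume "infinite {z \<in> spectrum M T. Re z \<le> \<nu>'}"
  then obtain z :: "nat \<Rightarrow> complex" where z: "inj z" "range z \<subseteq> {z \<in> spectrum M T. Re z \<le> \<nu>'}"
    using infinite_countable_subset by blast
  have zs: "z n \<in> spectrum M T" "Re (z n) \<le> \<nu>'" for n using z(2) by auto
  have "\<exists>e\<in>ker (z n). N2 e = 1" for n
    by (rule eigenvalue_below_ess[OF el]) (use zs[of n] l in auto)
  then obtain e where e: "\<And>n. e n \<in> ker (z n)" "\<And>n. N2 (e n) = 1" by metis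
  show False
    by (rule no_orthonormal_eigenvectors[OF el l, of e z])
      (use e zs(2) ker_orth[OF e(1) e(1)] z(1) in \<open>auto simp: inj_eq\<close>)
qed

lemma finite_dim_ker:
  assumes el: "ess_lower M D q \<nu>" and z: "Re z < \<nu>"
  shows "finite_dim_AE M (ker z)"
proof (rule ccontr)
  assume neg: "\<not> ?thesis"
  \<comment> \<open>Gram-Schmidt by dependent choice: \<open>P f n e\<close> expresses that
    \<open>e\<close> may follow the first \<open>n\<close> vectors of \<open>f\<close>.\<close>
  define P where "P f n e \<longleftrightarrow> e \<in> ker z \<and> N2 e = 1 \<and> (\<forall>m<n. ip e (f m) = 0)" for f :: "nat \<Rightarrow> 'x \<Rightarrow> complex" and n e
  have "\<exists>e. \<forall>n. P e n (e n)"
  proof (rule dependent_wellorder_choice)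
    show "P f n e = P g n e" if "\<And>m. m < n \<Longrightarrow> f m = g m" for e f g n
      using that by (auto simp: P_def)
    fix n :: nat and f assume IH: "\<And>m. m < n \<Longrightarrow> P f m (f m)"
    have fk: "f m \<in> ker z" "N2 (f m) = 1" if "m < n" for m using IH[OF that] by (auto simp: P_def)
    have fL: "f m \<in> L2 M" if "m < n" for m by (rule ker_L2[OF fk(1)[OF that]])
    have fo: "ip (f m) (f k) = 0" if "m < n" "k < n" "m \<noteq> k" for m k
      using IH[OF that(1)] IH[OF that(2)] that(3) L2.ip_sym[OF fL[OF that(2)] fL[OF that(1)]]
      by (cases "m < k") (auto simp: P_def)
    have inj: "inj_on f {..<n}"
    proof (rule inj_onI, rule ccontr)
      fix m k assume "m \<in> {..<n}" "k \<in> {..<n}" "f m = f k" "m \<noteq> k"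
      then show False using fo[of m k] fk(2)[of k] by auto
    qed
    have "\<exists>u\<in>ker z. \<forall>c. \<not> (AE x in M. u x = (\<Sum>v\<in>f ` {..<n}. c v * v x))"
    proof (rule ccontr)
      assume "\<not> ?thesis"
      then have "\<forall>u\<in>ker z. \<exists>c. AE x in M. u x = (\<Sum>v\<in>f ` {..<n}. c v * v x)" by blast
      moreover have "finite (f ` {..<n})" "f ` {..<n} \<subseteq> ker z" using fk(1) by auto
      ultimately have "finite_dim_AE M (ker z)" unfolding finite_dim_AE_def by (intro exI[of _ "f ` {..<n}"] conjI)
      with neg show False by contradiction
    qed
    then obtain u where u: "u \<in> ker z" and un: "\<And>c. \<not> (AE x in M. u x = (\<Sum>v\<in>f ` {..<n}. c v * v x))" by blast
    \<comment> \<open>The projection of \<open>u\<close> onto the span of the vectors chosen so far.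
      The remainder is not null, since \<open>u\<close> is not almost everywhere equal to any
      combination of them.\<close>
    define s where "s = (\<lambda>x. \<Sum>m<n. ip u (f m) * f m x)"
    have sL: "s \<in> L2 M" unfolding s_def by (intro L2.sum_mem) (auto intro: fL)
    have sk: "s \<in> ker z"
    proof -
      interpret k: semi_ip "ker z" ip
        by (rule semi_ip_subspace[OF L2.semi_ip_axioms])
          (use ker_L2 Sh_zero in \<open>auto dest: Sh_lin\<close>)
      show ?thesis unfolding s_def by (intro k.sum_mem) (auto intro: fk(1)[simplified])
    qed
    let ?e = "\<lambda>x. u x - s x"
    have ek: "?e \<in> ker z" using Sh_diff[of z u "\<lambda>x. 0" s "\<lambda>x. 0"] u sk by simp
    have eo: "ip ?e (f k) = 0" if k: "k < n" for k
    proof -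
      have "ip s (f k) = (\<Sum>m<n. ip u (f m) * ip (f m) (f k))"
        unfolding s_def by (rule L2.ip_sum_left) (auto intro: fL k)
      also have "\<dots> = (\<Sum>m<n. if m = k then ip u (f k) else 0)"
        using fo k fk(2)[OF k] L2.ip_self[OF fL[OF k]] by (intro sum.cong) auto
      also have "\<dots> = ip u (f k)" using k by simp
      finally show ?thesis using L2.ip_diff_left[OF ker_L2[OF u] sL fL[OF k]] by simp
    qed
    have "N2 ?e \<noteq> 0"
    proof
      assume "N2 ?e = 0"
      then have "AE x in M. u x = s x" by (intro N2_null_cong ker_L2[OF u] sL)
      moreover have "s x = (\<Sum>v\<in>f ` {..<n}. ip u v * v x)" for x
        unfolding s_def using inj by (simp add: sum.reindex)
      ultimately show False using un[of "ip u"] by simp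
    qed
    then have p: "N2 ?e > 0" using L2.ip_nonneg[OF ker_L2[OF ek]] by linarith
    let ?c = "complex_of_real (1 / sqrt (N2 ?e))"
    have "P f n (\<lambda>x. ?c * ?e x)"
      unfolding P_def
    proof (intro conjI allI impI)
      show "(\<lambda>x. ?c * ?e x) \<in> ker z" using Sh_scale[of z ?e "\<lambda>x. 0" ?c] ek by simp
      show "N2 (\<lambda>x. ?c * ?e x) = 1"
        unfolding L2.sq_scale[OF ker_L2[OF ek]] using p by (simp add: power_divide norm_divide)
      show "ip (\<lambda>x. ?c * ?e x) (f m) = 0" if "m < n" for m
        unfolding L2.ip_scale_left[OF ker_L2[OF ek] fL[OF that]] using eo[OF that] by simp
    qed
    then show "\<exists>e. P f n e" by blast
  qed
  then obtain e where e: "\<And>n. P e n (e n)" by blast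
  show False
    by (rule no_orthonormal_eigenvectors[OF el z, of e "\<lambda>_. z"]) (use e in \<open>auto simp: P_def\<close>)
qed

text \<open>Below \<open>\<nu>\<close> every spectral value is an eigenvalue of finite multiplicity,
  and only finitely many lie below any smaller level, which isolates each of them.\<close>

theorem ess_spectrum_lower:
  assumes el: "ess_lower M D q \<nu>" and z: "z \<in> ess_spectrum M T"
  shows "\<nu> \<le> Re z"
proof (rule ccontr)
  assume "\<not> \<nu> \<le> Re z"
  then have lt: "Re z < \<nu>" by simp
  have zs: "z \<in> spectrum M T" using z by (simp add: ess_spectrum_def)
  obtain e where e: "e \<in> ker z" "N2 e = 1" using eigenvalue_below_ess[OF el lt zs] by blast
  have "z isolated_in spectrum M T"
    unfolding isolated_in_islimpt_iff
  proof
    show "\<not> z islimpt spectrum M T"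
    proof
      assume lp: "z islimpt spectrum M T"
      define l where "l = (Re z + \<nu>) / 2"
      have l: "Re z < l" "l < \<nu>" using lt by (auto simp: l_def)
      have "spectrum M T \<inter> ball z (l - Re z) \<subseteq> {w \<in> spectrum M T. Re w \<le> l}"
      proof
        fix w assume w: "w \<in> spectrum M T \<inter> ball z (l - Re z)"
        then have "Re w - Re z < l - Re z"
          using complex_Re_le_cmod[of "w - z"] by (auto simp: dist_norm norm_minus_commute)
        then show "w \<in> {w \<in> spectrum M T. Re w \<le> l}" using w by simp
      qed
      then have "finite (spectrum M T \<inter> ball z (l - Re z))"
        using finite_spectrum_below_ess[OF el l(2)] finite_subset by blast
      then show False using lp l(1) unfolding islimpt_eq_infinite_ball by auto
    qed
  qed (rule zs)
  moreover have "\<exists>u\<in>eigenspace M T z. \<not> (AE x in M. u x = 0)"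
    unfolding eigenspace_ker using e L2_null_iff[OF ker_L2[OF e(1)]] by fastforce
  moreover have "finite_dim_AE M (eigenspace M T z)"
    unfolding eigenspace_ker by (rule finite_dim_ker[OF el lt])
  ultimately have "z \<in> discrete_spectrum M T" by (simp add: discrete_spectrum_def)
  then show False using z by (simp add: ess_spectrum_def)
qed

lemma form_lower_V:
  assumes lo: "\<And>f. f \<in> D \<Longrightarrow> \<nu> * Re (L2_inner M f f) \<le> Re (q f f)" and u: "u \<in> V"
  shows "\<nu> * N2 u \<le> cl.sq u"
proof -
  obtain us where us: "conv us u" using u V_iff by blast
  have "(\<lambda>n. \<nu> * N2 (us n)) \<longlonglongrightarrow> \<nu> * N2 u"
    by (intro tendsto_mult tendsto_const L2.sq_tendsto convD[OF us])
  moreover have "(\<lambda>n. form.sq (us n)) \<longlonglongrightarrow> cl.sq u" by (intro tendsto_Re cf_tendsto us)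
  ultimately show ?thesis
    by (rule LIMSEQ_le) (use lo convD(1)[OF us] in auto)
qed

text \<open>A global bound fulfils \<open>ess_lower\<close> along the full sequence, so a spectral
  value below \<open>\<nu>\<close> would have an eigenvector; the form value of that eigenvector
  contradicts the bound.\<close>

theorem spectrum_lower:
  assumes lo: "\<And>f. f \<in> D \<Longrightarrow> \<nu> * Re (L2_inner M f f) \<le> Re (q f f)" and z: "z \<in> spectrum M T"
  shows "\<nu> \<le> Re z"
proof (rule ccontr)
  assume "\<not> \<nu> \<le> Re z"
  then have lt: "Re z < \<nu>" by simp
  have "ess_lower M D q \<nu>"
    unfolding ess_lower_def
  proof (intro allI impI exI[of _ "\<lambda>n. n"] conjI)
    fix f :: "nat \<Rightarrow> 'x \<Rightarrow> complex" and e :: real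
    assume f: "\<forall>n. f n \<in> D" and e: "0 < e"
    have "\<nu> * N2 (\<lambda>x. f m x - f n x) \<le> form.sq (\<lambda>x. f m x - f n x) + e" for m n
      using lo[OF form.diff, of "f m" "f n"] f e by force
    then show "\<exists>N. \<forall>m\<ge>N. \<forall>n\<ge>N. \<nu> * N2 (\<lambda>x. f m x - f n x) \<le> form.sq (\<lambda>x. f m x - f n x) + e" by blast
  qed (simp add: strict_mono_def)
  then obtain e where e: "e \<in> ker z" "N2 e = 1" using eigenvalue_below_ess[OF _ lt z] by blast
  have "cl.sq e = Re z" using ker_cf[OF e(1) ker_V[OF e(1)]] L2.ip_self[OF ker_L2[OF e(1)]] e(2) by simp
  then show False using form_lower_V[OF lo ker_V[OF e(1)]] e(2) lt by simp
qed

lemma spectrum_real: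
  assumes "z \<in> spectrum M T"
  shows "Im z = 0" "0 \<le> Re z"
  using nonreal_resolvent[of z] spectrum_lower[OF _ assms, of 0] form.ip_nonneg assms by (auto simp: spectrum_def)

end

section \<open>Resolvent estimates in spectral gaps and upper bounds from test functions\<close>

context closable_form
begin

text \<open>For a bounded self-adjoint \<open>R = (T - c)\<^sup>-\<^sup>1\<close> with norm \<open>\<rho>\<close>, almost maximising vectors \<open>w\<close> satisfy
  \<open>(R - \<rho>)(R + \<rho>) w \<approx> 0\<close>, so that \<open>\<rho>\<close> or \<open>-\<rho>\<close> belongs to the spectrum of \<open>R\<close>.\<close>

lemma gap_bound:
  fixes c r :: real
  assumes r: "r > 0" and res: "\<And>t. \<bar>t\<bar> < r \<Longrightarrow> complex_of_real (c + t) \<in> resolvent_set M T"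
    and S0: "Sh (of_real c) u0 w0"
  shows "r\<^sup>2 * N2 u0 \<le> N2 w0"
proof (rule ccontr)
  assume neg: "\<not> ?thesis"
  have c: "complex_of_real c \<in> resolvent_set M T" using res[of 0] r by simp
  obtain C where C: "C > 0" "\<And>u w. Sh (of_real c) u w \<Longrightarrow> N2 u \<le> C * N2 w" using resolvent_bound[OF c] by blast
  \<comment> \<open>The supremum \<open>\<sigma>\<close> of these quotients is the squared norm of
    \<open>R\<close>. Under the negated claim its root \<open>\<rho>\<close> exceeds
    \<open>1 / r\<close>, so with \<open>\<kappa> = 1 / \<rho>\<close> both
    \<open>c + \<kappa>\<close> and \<open>c - \<kappa>\<close> still belong to the resolvent
    set.\<close>
  define X where "X = {N2 u / N2 w | u w. Sh (of_real c) u w \<and> N2 w > 0}"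
  define \<sigma> where "\<sigma> = Sup X"
  have bdd: "bdd_above X"
    unfolding X_def using C(2) by (intro bdd_aboveI[of _ C]) (auto simp: pos_divide_le_eq)
  have N0: "N2 w0 > 0"
  proof (rule ccontr)
    assume "\<not> N2 w0 > 0"
    then have "N2 w0 = 0" using L2.ip_nonneg[OF Sh_L2'[OF S0]] by simp
    then show False using C(2)[OF S0] neg r L2.ip_nonneg[OF Sh_L2[OF S0]] by simp
  qed
  have X0: "N2 u0 / N2 w0 \<in> X" unfolding X_def using S0 N0 by blast
  have ub: "N2 u \<le> \<sigma> * N2 w" if S: "Sh (of_real c) u w" for u w
  proof (cases "N2 w > 0")
    case True
    then have "N2 u / N2 w \<le> \<sigma>" unfolding \<sigma>_def using bdd S by (intro cSup_upper) (auto simp: X_def)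
    then show ?thesis using True by (simp add: pos_divide_le_eq)
  next
    case False
    then have "N2 w = 0" using L2.ip_nonneg[OF Sh_L2'[OF S]] by simp
    then show ?thesis using C(2)[OF S] by simp
  qed
  have "1 / r\<^sup>2 < N2 u0 / N2 w0" using neg N0 r by (simp add: field_simps)
  also have "\<dots> \<le> \<sigma>" unfolding \<sigma>_def by (intro cSup_upper X0 bdd)
  finally have sr: "1 / r\<^sup>2 < \<sigma>" .
  have s0: "\<sigma> > 0" using sr zero_le_power2[of r] by (smt (verit) divide_nonneg_nonneg)
  define \<rho> where "\<rho> = sqrt \<sigma>"
  define \<kappa> where "\<kappa> = 1 / \<rho>"
  have rho: "\<rho> > 0" "\<rho> * \<rho> = \<sigma>" "\<rho>\<^sup>2 = \<sigma>" using s0 by (auto simp: \<rho>_def)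
  have kap: "\<kappa> > 0" "\<kappa> * \<rho> = 1" "\<kappa>\<^sup>2 * \<sigma> = 1" using rho by (auto simp: \<kappa>_def power_divide)
  have "sqrt (1 / r\<^sup>2) < \<rho>" unfolding \<rho>_def using sr by (rule real_sqrt_less_mono)
  then have "1 / r < \<rho>" using r by (simp add: real_sqrt_divide)
  then have kr: "\<kappa> < r" using r rho by (simp add: \<kappa>_def field_simps)
  obtain C1 where C1: "C1 > 0" "\<And>u w. Sh (of_real (c + \<kappa>)) u w \<Longrightarrow> N2 u \<le> C1 * N2 w"
    using resolvent_bound[OF res[of \<kappa>]] kap(1) kr by auto
  obtain C2 where C2: "C2 > 0" "\<And>u w. Sh (of_real (c + - \<kappa>)) u w \<Longrightarrow> N2 u \<le> C2 * N2 w"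
    using resolvent_bound[OF res[of "- \<kappa>"]] kap(1) kr by auto
  \<comment> \<open>The total amplification by the resolvents at \<open>c + \<kappa>\<close> and
    \<open>c - \<kappa>\<close>, through which the defect \<open>\<epsilon>\<close> reaches
    \<open>N2 u\<close>. The choice of \<open>\<epsilon>\<close> gives
    \<open>L * \<epsilon> = \<sigma> - \<epsilon>\<close>, just too little for an almost maximising
    \<open>u\<close>.\<close>
  define L where "L = C2 * (\<kappa>\<^sup>2 * (\<kappa>\<^sup>2 * (2 * C1 + 2 * \<sigma>)))"
  have L: "L > 0" unfolding L_def using C1(1) C2(1) kap(1) s0 by (intro mult_pos_pos add_pos_pos) auto
  define \<epsilon> where "\<epsilon> = \<sigma> / (L + 1)"
  have eps: "\<epsilon> > 0" "\<epsilon> * (L + 1) = \<sigma>" using s0 L by (auto simp: \<epsilon>_def)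
  obtain y where "y \<in> X" "\<sigma> - \<epsilon> < y"
    using less_cSupD[of X "\<sigma> - \<epsilon>"] X0 eps(1) unfolding \<sigma>_def by auto
  then obtain u1 w1 where S1: "Sh (of_real c) u1 w1" and p1: "N2 w1 > 0" and big1: "\<sigma> - \<epsilon> < N2 u1 / N2 w1"
    unfolding X_def by blast
  define s where "s = complex_of_real (1 / sqrt (N2 w1))"
  define u where "u = (\<lambda>x. s * u1 x)"
  define w where "w = (\<lambda>x. s * w1 x)"
  have s2: "(cmod s)\<^sup>2 = 1 / N2 w1" using p1 by (simp add: s_def power_divide norm_divide)
  have S: "Sh (of_real c) u w" unfolding u_def w_def by (rule Sh_scale[OF S1])
  have w1': "N2 w = 1" unfolding w_def L2.sq_scale[OF Sh_L2'[OF S1]] s2 using p1 by simp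
  have ubig: "\<sigma> - \<epsilon> < N2 u" unfolding u_def L2.sq_scale[OF Sh_L2[OF S1]] s2 using big1 by simp
  have uL: "u \<in> L2 M" and wL: "w \<in> L2 M" using Sh_L2[OF S] Sh_L2'[OF S] .
  obtain v where Sv: "Sh (of_real c) v u" using c uL resolvent_iff by blast
  have vL: "v \<in> L2 M" using Sh_L2[OF Sv] .
  have dL: "(\<lambda>x. v x - of_real \<sigma> * w x) \<in> L2 M" (is "?d \<in> _") by (intro L2.diff vL L2.scale wL)
  have d: "N2 ?d \<le> \<sigma> * \<epsilon>"
  proof -
    have "ip u u = ip v w" using Sh_sym[OF Sv, of u w] S by simp
    then have "N2 ?d = N2 v - 2 * \<sigma> * N2 u + \<sigma>\<^sup>2"
      using L2.sq_lin[OF vL wL, of "- of_real \<sigma>"] w1' by simp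
    also have "\<dots> \<le> \<sigma> * (\<sigma> - N2 u)" using ub[OF Sv] by (simp add: algebra_simps power2_eq_square)
    also have "\<dots> \<le> \<sigma> * \<epsilon>" using ubig s0 by (intro mult_left_mono) auto
    finally show ?thesis .
  qed
  \<comment> \<open>With \<open>u = R w\<close> and \<open>v = R u\<close>, the vector
    \<open>?x\<close> is \<open>(R + \<rho>) w\<close> and \<open>?y\<close> is \<open>R ?x\<close>.
    Then \<open>T - c - \<kappa>\<close> maps \<open>?y\<close> to a multiple of the small
    \<open>?d\<close>, and \<open>T - c + \<kappa>\<close> maps \<open>u\<close> to a multiple of
    \<open>?x\<close>.\<close>
  let ?y = "\<lambda>x. v x + of_real \<rho> * u x" and ?x = "\<lambda>x. u x + of_real \<rho> * w x"
  have yL: "?y \<in> L2 M" by (rule L2.lin[OF vL uL])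
  have xL: "?x \<in> L2 M" by (rule L2.lin[OF uL wL])
  have "Sh (of_real c) ?y ?x" by (rule Sh_lin[OF Sv S])
  then have "Sh (of_real c + of_real \<kappa>) ?y (\<lambda>x. ?x x - of_real \<kappa> * ?y x)" by (rule Sh_shift)
  moreover have "(\<lambda>x. ?x x - of_real \<kappa> * ?y x) = (\<lambda>x. (- of_real \<kappa>) * ?d x)"
  proof
    fix x
    have k: "complex_of_real \<kappa> * of_real \<rho> = 1" using kap(2) by (metis of_real_1 of_real_mult)
    have k2: "complex_of_real \<kappa> * of_real \<sigma> = of_real \<rho>" using kap(2) rho(2) by (metis mult.assoc mult.left_neutral of_real_mult)
    have "of_real \<kappa> * ?y x = of_real \<kappa> * v x + (of_real \<kappa> * of_real \<rho>) * u x" by (simp add: algebra_simps)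
    moreover have "(- of_real \<kappa>) * ?d x = (of_real \<kappa> * of_real \<sigma>) * w x - of_real \<kappa> * v x" by (simp add: algebra_simps)
    ultimately show "?x x - of_real \<kappa> * ?y x = (- of_real \<kappa>) * ?d x" unfolding k k2 by simp
  qed
  ultimately have "N2 ?y \<le> C1 * N2 (\<lambda>x. (- of_real \<kappa>) * ?d x)" using C1(2)[of ?y] by simp
  also have "N2 (\<lambda>x. (- of_real \<kappa>) * ?d x) = \<kappa>\<^sup>2 * N2 ?d" unfolding L2.sq_scale[OF dL] by simp
  also have "C1 * (\<kappa>\<^sup>2 * N2 ?d) \<le> C1 * (\<kappa>\<^sup>2 * (\<sigma> * \<epsilon>))" using d C1(1) by (intro mult_left_mono) auto
  also have "\<kappa>\<^sup>2 * (\<sigma> * \<epsilon>) = \<epsilon>" using kap(3) by (simp flip: mult.assoc)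
  finally have y: "N2 ?y \<le> C1 * \<epsilon>" .
  have "(\<lambda>x. of_real \<rho> * ?x x) = (\<lambda>x. ?y x - ?d x)"
    using rho(2) by (auto simp: algebra_simps simp flip: of_real_mult mult.assoc)
  then have "N2 (\<lambda>x. of_real \<rho> * ?x x) \<le> 2 * N2 ?y + 2 * N2 ?d"
    using L2.sq_diff_le[OF yL dL] by simp
  then have "\<sigma> * N2 ?x \<le> 2 * N2 ?y + 2 * N2 ?d"
    unfolding L2.sq_scale[OF xL] using rho by (simp add: power2_eq_square)
  also have "\<dots> \<le> (2 * C1 + 2 * \<sigma>) * \<epsilon>" using y d by (simp add: algebra_simps)
  finally have "\<kappa>\<^sup>2 * (\<sigma> * N2 ?x) \<le> \<kappa>\<^sup>2 * ((2 * C1 + 2 * \<sigma>) * \<epsilon>)" by (intro mult_left_mono) auto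
  then have x: "N2 ?x \<le> \<kappa>\<^sup>2 * (2 * C1 + 2 * \<sigma>) * \<epsilon>" using kap(3) by (simp flip: mult.assoc)
  have "Sh (of_real c + - of_real \<kappa>) u (\<lambda>x. w x - (- of_real \<kappa>) * u x)" by (rule Sh_shift[OF S])
  moreover have "(\<lambda>x. w x - (- of_real \<kappa>) * u x) = (\<lambda>x. of_real \<kappa> * ?x x)"
    using kap(2) by (auto simp: algebra_simps simp flip: of_real_mult mult.assoc)
  ultimately have "N2 u \<le> C2 * N2 (\<lambda>x. of_real \<kappa> * ?x x)" using C2(2)[of u] by simp
  also have "N2 (\<lambda>x. of_real \<kappa> * ?x x) = \<kappa>\<^sup>2 * N2 ?x" unfolding L2.sq_scale[OF xL] by simp
  also have "C2 * (\<kappa>\<^sup>2 * N2 ?x) \<le> C2 * (\<kappa>\<^sup>2 * (\<kappa>\<^sup>2 * (2 * C1 + 2 * \<sigma>) * \<epsilon>))"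
    using x C2(1) by (intro mult_left_mono) auto
  also have "\<dots> = L * \<epsilon>" by (simp add: L_def)
  finally have "N2 u \<le> L * \<epsilon>" .
  then show False using ubig eps(2) by (simp add: algebra_simps)
qed

text \<open>The closure of the range is complete, and what remains of \<open>v\<close> after
  projecting onto it lies in the kernel of the adjoint. Without a lower bound the range need not be
  closed, so only approximate solutions result.\<close>

lemma range_dense:
  assumes v: "v \<in> L2 M" and o: "orth_to v (ker (cnj z))" and e: "\<epsilon> > 0"
  shows "\<exists>u w. Sh z u w \<and> N2 (\<lambda>x. w x - v x) < \<epsilon>"
proof -
  define R where "R = {w \<in> L2 M. \<forall>e>0. \<exists>u w'. Sh z u w' \<and> N2 (\<lambda>x. w' x - w x) < e}"
  have RL: "R \<subseteq> L2 M" by (auto simp: R_def)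
  have RD: "\<exists>u w'. Sh z u w' \<and> N2 (\<lambda>x. w' x - w x) < e" if "w \<in> R" "e > 0" for w e
    using that by (auto simp: R_def)
  have Ri: "w \<in> R" if "Sh z u w" for u w
  proof -
    have "N2 (\<lambda>x. w x - w x) = 0" by (simp add: L2_inner_def)
    then show ?thesis unfolding R_def using that Sh_L2'[OF that]
      by (intro CollectI conjI allI impI exI[of _ u] exI[of _ w]) simp_all
  qed
  have lin: "(\<lambda>x. f x + c * g x) \<in> R" if f: "f \<in> R" and g: "g \<in> R" for f g c
    unfolding R_def
  proof (intro CollectI conjI allI impI)
    have L: "f \<in> L2 M" "g \<in> L2 M" using f g RL by auto
    show "(\<lambda>x. f x + c * g x) \<in> L2 M" by (rule L2.lin[OF L])
    fix e :: real assume e: "e > 0"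
    define k where "k = (cmod c)\<^sup>2 + 1"
    have k: "k > 0" by (simp add: k_def add_nonneg_pos)
    obtain u1 w1 where 1: "Sh z u1 w1" "N2 (\<lambda>x. w1 x - f x) < e / 4" using RD[OF f, of "e/4"] e by auto
    obtain u2 w2 where 2: "Sh z u2 w2" "N2 (\<lambda>x. w2 x - g x) < e / 4 / k" using RD[OF g, of "e / 4 / k"] e k by auto
    have a: "(\<lambda>x. w1 x - f x) \<in> L2 M" "(\<lambda>x. w2 x - g x) \<in> L2 M"
      using Sh_L2'[OF 1(1)] Sh_L2'[OF 2(1)] L by (auto intro: L2.diff)
    have "N2 (\<lambda>x. (w1 x + c * w2 x) - (f x + c * g x)) = N2 (\<lambda>x. (w1 x - f x) + c * (w2 x - g x))"
      by (simp add: algebra_simps)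
    also have "\<dots> \<le> 2 * N2 (\<lambda>x. w1 x - f x) + 2 * ((cmod c)\<^sup>2 * N2 (\<lambda>x. w2 x - g x))"
      using L2.sq_add_le[OF a(1) L2.scale[OF a(2), of c]] L2.sq_scale[OF a(2), of c] by simp
    also have "(cmod c)\<^sup>2 * N2 (\<lambda>x. w2 x - g x) \<le> k * (e / 4 / k)"
      using 2(2) k L2.ip_nonneg[OF a(2)] by (intro mult_mono) (auto simp: k_def)
    also have "k * (e / 4 / k) = e / 4" using k by simp
    finally have "N2 (\<lambda>x. (w1 x + c * w2 x) - (f x + c * g x)) < e" using 1(2) by linarith
    then show "\<exists>u w'. Sh z u w' \<and> N2 (\<lambda>x. w' x - (f x + c * g x)) < e" using Sh_lin[OF 1(1) 2(1), of c] by blast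
  qed
  interpret R: semi_ip R ip
    by (rule semi_ip_subspace[OF L2.semi_ip_axioms RL]) (use Ri[OF Sh_zero] lin in auto)
  have "ip_complete R ip"
    unfolding ip_complete_def
  proof (intro allI impI)
    fix ws :: "nat \<Rightarrow> 'x \<Rightarrow> complex" assume ws: "\<forall>n. ws n \<in> R" and cau: "\<forall>e>0. \<exists>N. \<forall>m\<ge>N. \<forall>n\<ge>N. N2 (\<lambda>x. ws m x - ws n x) < e"
    have wL: "ws n \<in> L2 M" for n using ws RL by blast
    obtain w where w: "w \<in> L2 M" "(\<lambda>n. N2 (\<lambda>x. ws n x - w x)) \<longlonglongrightarrow> 0"
      using complete_limits[of ws] wL cau by blast
    have "w \<in> R"
      unfolding R_def
    proof (intro CollectI conjI allI impI w)
      fix e :: real assume e: "e > 0"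
      have "\<forall>\<^sub>F n in sequentially. N2 (\<lambda>x. ws n x - w x) < e / 4" using w(2) e by (intro order_tendstoD) auto
      then obtain n where n: "N2 (\<lambda>x. ws n x - w x) < e / 4" using eventually_happens' sequentially_bot by blast
      obtain u w' where S: "Sh z u w'" and w': "N2 (\<lambda>x. w' x - ws n x) < e / 4" using RD[of "ws n" "e/4"] ws e by auto
      have "N2 (\<lambda>x. w' x - w x) < e" using L2.sq_triangle[OF Sh_L2'[OF S] wL w(1), of n] n w' by linarith
      then show "\<exists>u w'. Sh z u w' \<and> N2 (\<lambda>x. w' x - w x) < e" using S by blast
    qed
    then show "\<exists>u\<in>R. (\<lambda>n. N2 (\<lambda>x. ws n x - u x)) \<longlonglongrightarrow> 0" using w by blast
  qed
  then have "\<exists>r\<in>R. \<forall>w\<in>R. ip w v = ip w r"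
  proof (rule R.riesz[where C = "N2 v"])
    show "ip (\<lambda>x. w x + c * g x) v = ip w v + c * ip g v" if "w \<in> R" "g \<in> R" for w g c
      using that RL v by (intro L2.ip_lin) auto
    show "(cmod (ip w v))\<^sup>2 \<le> N2 v * N2 w" if "w \<in> R" for w
      using L2.cauchy_schwarz[of w M v] that RL v by (auto simp: mult.commute)
  qed
  then obtain r where r: "r \<in> R" "\<And>w. w \<in> R \<Longrightarrow> ip w v = ip w r" by blast
  have rL: "r \<in> L2 M" using r RL by blast
  let ?d = "\<lambda>x. v x - r x"
  have dL: "?d \<in> L2 M" by (intro L2.diff v rL)
  have dR: "ip w ?d = 0" if "w \<in> R" for w
    using r(2)[OF that] L2.ip_diff_right[OF v rL, of w] that RL by auto
  have "Sh (cnj z) ?d (\<lambda>x. 0)" by (rule Sh_adjoint[OF dL]) (use dR Ri in blast)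
  then have "ip v ?d = 0" using o by blast
  then have d0: "N2 ?d = 0" using L2.ip_diff_left[OF v rL dL] dR[OF r(1)] by simp
  obtain u w where S: "Sh z u w" and w: "N2 (\<lambda>x. w x - r x) < \<epsilon> / 2" using RD[OF r(1), of "\<epsilon>/2"] e by auto
  have "N2 (\<lambda>x. w x - v x) < \<epsilon>"
    using L2.sq_triangle[OF Sh_L2'[OF S] rL v] w d0 L2.sq_diff_commute[OF rL v] by linarith
  then show ?thesis using S by blast
qed

text \<open>\<open>gap_bound\<close> at the midpoints \<open>c + \<delta>\<close> and
  \<open>c - \<delta>\<close> of the two adjacent gaps gives Temple's inequality; polarising it and
  inserting images that approximate \<open>v\<close> bounds \<open>v\<close> by
  \<open>y\<close>.\<close>

lemma isolated_bound:
  fixes c \<delta> :: real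
  assumes d: "\<delta> > 0" and res: "\<And>t. t \<noteq> 0 \<Longrightarrow> \<bar>t\<bar> < 2 * \<delta> \<Longrightarrow> complex_of_real (c + t) \<in> resolvent_set M T"
    and S: "Sh (of_real c) v y" and o: "orth_to v (ker (of_real c))"
  shows "N2 v \<le> 1 / (4 * \<delta>\<^sup>2) * N2 y"
proof -
  \<comment> \<open>In spectral terms: every value \<open>\<mu>\<close> of \<open>T - c\<close> is 0
    or at least \<open>2 * \<delta>\<close> in modulus, whence
    \<open>2 * \<delta> * |\<mu>| \<le> \<mu>^2\<close>.\<close>
  have temple: "2 * \<delta> * \<bar>Re (ip w u)\<bar> \<le> N2 w" if S: "Sh (of_real c) u w" for u w
  proof -
    have uL: "u \<in> L2 M" and wL: "w \<in> L2 M" using Sh_L2[OF S] Sh_L2'[OF S] .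
    have "\<delta>\<^sup>2 * N2 u \<le> N2 (\<lambda>x. w x - of_real s * u x)" if s: "\<bar>s\<bar> = \<delta>" for s
    proof (rule gap_bound[OF d])
      show "Sh (of_real (c + s)) u (\<lambda>x. w x - of_real s * u x)" using Sh_shift[OF S, of "of_real s"] by simp
      show "complex_of_real (c + s + t) \<in> resolvent_set M T" if "\<bar>t\<bar> < \<delta>" for t
        using res[of "s + t"] s that d by (auto simp: add.assoc)
    qed
    moreover have "N2 (\<lambda>x. w x - of_real s * u x) = N2 w - 2 * s * Re (ip w u) + s\<^sup>2 * N2 u" for s :: real
      using L2.sq_lin[OF wL uL, of "- of_real s"] by simp
    ultimately have "\<delta>\<^sup>2 * N2 u \<le> N2 w - 2 * s * Re (ip w u) + s\<^sup>2 * N2 u" if "\<bar>s\<bar> = \<delta>" for s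
      using that by metis
    from this[of \<delta>] this[of "- \<delta>"] show ?thesis using d by (simp add: abs_if)
  qed
  have yL: "y \<in> L2 M" and vL: "v \<in> L2 M" using Sh_L2[OF S] Sh_L2'[OF S] by auto
  have polar: "4 * \<delta> * Re (ip w v) \<le> N2 w + N2 y" if S': "Sh (of_real c) u w" for u w
  proof -
    have L: "u \<in> L2 M" "w \<in> L2 M" using Sh_L2[OF S'] Sh_L2'[OF S'] .
    have p: "Sh (of_real c) (\<lambda>x. u x + v x) (\<lambda>x. w x + y x)" using Sh_lin[OF S' S, of 1] by simp
    have m: "Sh (of_real c) (\<lambda>x. u x - v x) (\<lambda>x. w x - y x)" by (rule Sh_diff[OF S' S])
    have sym: "Re (ip y u) = Re (ip w v)"
      using Sh_sym[OF S', of v y] S L2.ip_sym[OF yL L(1)] by simp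
    have "Re (ip (\<lambda>x. w x + y x) (\<lambda>x. u x + v x)) = Re (ip w u) + 2 * Re (ip w v) + Re (ip y v)"
      using sym L yL vL by (simp add: L2.ip_add_left L2.ip_add_right L2.add)
    moreover have "Re (ip (\<lambda>x. w x - y x) (\<lambda>x. u x - v x)) = Re (ip w u) - 2 * Re (ip w v) + Re (ip y v)"
      using sym L yL vL by (simp add: L2.ip_diff_left L2.ip_diff_right L2.diff)
    ultimately have "4 * Re (ip w v) \<le> \<bar>Re (ip (\<lambda>x. w x + y x) (\<lambda>x. u x + v x))\<bar> + \<bar>Re (ip (\<lambda>x. w x - y x) (\<lambda>x. u x - v x))\<bar>"
      by linarith
    then have "2 * \<delta> * (4 * Re (ip w v)) \<le> 2 * \<delta> * (\<bar>Re (ip (\<lambda>x. w x + y x) (\<lambda>x. u x + v x))\<bar> + \<bar>Re (ip (\<lambda>x. w x - y x) (\<lambda>x. u x - v x))\<bar>)"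
      using d by (intro mult_left_mono) auto
    also have "\<dots> \<le> N2 (\<lambda>x. w x + y x) + N2 (\<lambda>x. w x - y x)"
      using temple[OF p] temple[OF m] by (simp add: distrib_left)
    also have "\<dots> = 2 * (N2 w + N2 y)" by (simp add: L2.sq_add[OF L(2) yL] L2.sq_diff[OF L(2) yL])
    finally show ?thesis by simp
  qed
  have "\<exists>u w. Sh (of_real c) u w \<and> N2 (\<lambda>x. w x - v x) < 1 / Suc n" for n :: nat
    by (rule range_dense[OF vL]) (use o in auto)
  then obtain us ws where S': "\<And>n. Sh (of_real c) (us n) (ws n)" and w: "\<And>n. N2 (\<lambda>x. ws n x - v x) < 1 / Suc n" by metis
  note wL = Sh_L2'[OF S']
  have lim: "(\<lambda>n. N2 (\<lambda>x. ws n x - v x)) \<longlonglongrightarrow> 0"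
  proof (rule tendsto_sandwich[OF _ _ tendsto_const])
    show "(\<lambda>n. 1 / real (Suc n)) \<longlonglongrightarrow> 0" using LIMSEQ_inverse_real_of_nat by (simp add: inverse_eq_divide)
    show "\<forall>\<^sub>F n in sequentially. 0 \<le> N2 (\<lambda>x. ws n x - v x)" using L2.ip_nonneg[OF L2.diff[OF wL vL]] by simp
    show "\<forall>\<^sub>F n in sequentially. N2 (\<lambda>x. ws n x - v x) \<le> 1 / real (Suc n)" using less_imp_le[OF w] by simp
  qed
  \<comment> \<open>The scaling by \<open>2 * \<delta>\<close> optimises the result: in the limit
    \<open>8 * \<delta>^2 * N2 v\<close> stands against
    \<open>4 * \<delta>^2 * N2 v + N2 y\<close>.\<close>
  have le: "4 * \<delta> * (2 * \<delta> * Re (ip (ws n) v)) \<le> (2 * \<delta>)\<^sup>2 * N2 (ws n) + N2 y" for n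
  proof -
    have "Sh (of_real c) (\<lambda>x. of_real (2 * \<delta>) * us n x) (\<lambda>x. of_real (2 * \<delta>) * ws n x)" by (rule Sh_scale[OF S'])
    from polar[OF this] show ?thesis
      unfolding L2.sq_scale[OF wL] L2.ip_scale_left[OF wL vL] using d by (simp add: mult_ac)
  qed
  have "4 * \<delta> * (2 * \<delta> * Re (ip v v)) \<le> (2 * \<delta>)\<^sup>2 * N2 v + N2 y"
  proof (rule LIMSEQ_le)
    show "(\<lambda>n. 4 * \<delta> * (2 * \<delta> * Re (ip (ws n) v))) \<longlonglongrightarrow> 4 * \<delta> * (2 * \<delta> * Re (ip v v))"
      by (intro tendsto_mult tendsto_const tendsto_Re ip_lim wL vL lim)
    show "(\<lambda>n. (2 * \<delta>)\<^sup>2 * N2 (ws n) + N2 y) \<longlonglongrightarrow> (2 * \<delta>)\<^sup>2 * N2 v + N2 y"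
      by (intro tendsto_add tendsto_mult tendsto_const L2.sq_tendsto wL vL lim)
  qed (use le in blast)
  then have "4 * \<delta>\<^sup>2 * N2 v \<le> N2 y" by (simp add: power2_eq_square algebra_simps)
  then show ?thesis using d by (simp add: field_simps)
qed

text \<open>Subtracting the projections onto finitely many eigenspaces.\<close>

lemma proj_finite:
  assumes "finite Z" and v: "v \<in> V"
  shows "\<exists>v'\<in>V. (\<forall>z\<in>Z. orth_to v' (ker z)) \<and> N2 v' \<le> N2 v \<and>
    (\<forall>y\<in>V. (\<forall>z\<in>Z. orth_to y (ker z)) \<longrightarrow> cf v' y = cf v y \<and> ip v' y = ip v y)"
  using assms(1)
proof (induction Z)
  case empty
  then show ?case using v by auto
next
  case (insert z Z)
  then obtain v' where v': "v' \<in> V" "\<forall>z\<in>Z. orth_to v' (ker z)" "N2 v' \<le> N2 v"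
    "\<And>y. y \<in> V \<Longrightarrow> \<forall>z\<in>Z. orth_to y (ker z) \<Longrightarrow> cf v' y = cf v y \<and> ip v' y = ip v y" by blast
  have vL: "v' \<in> L2 M" by (rule V_L2[OF v'(1)])
  obtain e where e: "e \<in> ker z" "orth_to (\<lambda>x. v' x - e x) (ker z)" using proj_ker[OF vL] by blast
  have eV: "e \<in> V" and eL: "e \<in> L2 M" using ker_V[OF e(1)] ker_L2[OF e(1)] .
  let ?v = "\<lambda>x. v' x - e x"
  have V: "?v \<in> V" by (intro cl.diff v' eV)
  have o: "orth_to ?v (ker z')" if "z' \<in> insert z Z" for z'
  proof (cases "z' = z")
    case True then show ?thesis using e by simp
  next
    case False
    then have z': "z' \<in> Z" using that by simp
    show ?thesis
    proof
      fix e' assume e': "e' \<in> ker z'"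
      have "ip e e' = 0" using False by (intro ker_orth[OF e(1) e']) auto
      then show "ip ?v e' = 0" using v'(2) z' e' L2.ip_diff_left[OF vL eL ker_L2[OF e']] by simp
    qed
  qed
  have "N2 (\<lambda>x. ?v x + e x) = N2 ?v + N2 e"
    using L2.sq_add[OF V_L2[OF V] eL] e by simp
  then have N: "N2 ?v \<le> N2 v" using v'(3) L2.ip_nonneg[OF eL] by simp
  have "cf ?v y = cf v y \<and> ip ?v y = ip v y" if y: "y \<in> V" "\<forall>z'\<in>insert z Z. orth_to y (ker z')" for y
  proof -
    have "ip y e = 0" using y(2) e(1) by blast
    then have ey: "ip e y = 0" using L2.ip_sym[OF V_L2[OF y(1)] eL] by simp
    then have "cf e y = 0" using ker_cf[OF e(1) y(1)] by simp
    then show ?thesis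
      using ey v'(4)[OF y(1)] y cl.ip_diff_left[OF v'(1) eV y(1)] L2.ip_diff_left[OF vL eL V_L2[OF y(1)]] by simp
  qed
  then show ?case using V o N by blast
qed

text \<open>At the infimum \<open>\<lambda>\<close> of the Rayleigh quotient over the complement of finitely many eigenspaces,
  solving \<open>(T - \<lambda>) v = u\<close> boundedly is incompatible with the existence of a minimising sequence.\<close>

lemma rayleigh_above:
  assumes Z: "finite Z"
    and bd: "\<And>c. c \<le> \<mu> \<Longrightarrow> \<exists>C. \<forall>v w. Sh (of_real c) v w \<longrightarrow> orth_to v (ker (of_real c)) \<longrightarrow> N2 v \<le> C * N2 w"
    and nul: "\<And>c e. c \<le> \<mu> \<Longrightarrow> complex_of_real c \<notin> Z \<Longrightarrow> e \<in> ker (of_real c) \<Longrightarrow> N2 e = 0"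
    and u: "u \<in> V" "\<forall>z\<in>Z. orth_to u (ker z)" "N2 u \<noteq> 0"
  shows "\<mu> * N2 u < cl.sq u"
proof (rule ccontr)
  assume neg: "\<not> ?thesis"
  define E where "E = {u \<in> V. \<forall>z\<in>Z. orth_to u (ker z)}"
  define X where "X = {cl.sq u / N2 u | u. u \<in> E \<and> N2 u > 0}"
  define l where "l = Inf X"
  have EV: "E \<subseteq> V" by (auto simp: E_def)
  have EL: "u \<in> L2 M" if "u \<in> E" for u using that EV V_L2 by blast
  have pos: "N2 u > 0" using u L2.ip_nonneg[OF V_L2[OF u(1)]] by simp
  have uX: "cl.sq u / N2 u \<in> X" unfolding X_def using u pos by (auto simp: E_def)
  have bdd: "bdd_below X"
    by (intro bdd_belowI[of _ 0]) (use cl.ip_nonneg EV in \<open>auto simp: X_def subset_iff\<close>)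
  have "l \<le> cl.sq u / N2 u" unfolding l_def by (intro cInf_lower uX bdd)
  also have "\<dots> \<le> \<mu>" using neg pos by (simp add: pos_divide_le_eq)
  finally have l: "l \<le> \<mu>" .
  have lE: "l * N2 y \<le> cl.sq y" if y: "y \<in> E" for y
  proof (cases "N2 y > 0")
    case True
    then have "l \<le> cl.sq y / N2 y" unfolding l_def using bdd y by (intro cInf_lower) (auto simp: X_def)
    then show ?thesis using True by (simp add: pos_le_divide_eq)
  next
    case False
    then have "N2 y = 0" using L2.ip_nonneg[OF EL[OF y]] by simp
    then show ?thesis using cl.ip_nonneg[of y] y EV by auto
  qed
  define a where "a f g = cf f g - of_real l * ip f g" for f g
  have aE: "Re (a f f) = cl.sq f - l * N2 f" for f by (simp add: a_def)
  interpret a: semi_ip E a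
  proof
    have "orth_to (\<lambda>x. 0) F" for F by (simp add: L2_inner_def)
    then show "E \<noteq> {}" using cl.zero by (auto simp: E_def)
    show "(\<lambda>x. f x + c * g x) \<in> E" if "f \<in> E" "g \<in> E" for f g c
      using that cl.lin[of f g c] by (auto simp: E_def L2.ip_lin V_L2 ker_L2 Sh_L2)
    show "a (\<lambda>x. f x + c * g x) h = a f h + c * a g h" if "f \<in> E" "g \<in> E" "h \<in> E" for f g h c
      using that EV unfolding a_def by (subst cl.ip_lin, auto, subst L2.ip_lin, auto simp: V_L2 algebra_simps)
    show "a g f = cnj (a f g)" if "f \<in> E" "g \<in> E" for f g
    proof -
      have "f \<in> V" "g \<in> V" using that EV by auto
      then show ?thesis unfolding a_def using cl.ip_sym[of f g] L2.ip_sym[OF V_L2[of f] V_L2[of g]] by simp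
    qed
    show "0 \<le> Re (a f f)" if "f \<in> E" for f using lE[OF that] by (simp add: aE)
  qed
  obtain C where C: "\<And>v w. Sh (of_real l) v w \<Longrightarrow> orth_to v (ker (of_real l)) \<Longrightarrow> N2 v \<le> C * N2 w"
    using bd[OF l] by blast
  \<comment> \<open>Solve \<open>(T - l) v = y\<close> and let \<open>v'\<close> be \<open>v\<close>
    without its components in the split-off eigenspaces. Then \<open>a v' y = N2 y\<close>, and
    Cauchy-Schwarz for the non-negative form \<open>a\<close> bounds \<open>N2 y\<close> by a
    multiple of \<open>a y y\<close>.\<close>
  have key: "N2 y \<le> sqrt (max C 0) * Re (a y y)" if y: "y \<in> E" for y
  proof (cases "N2 y = 0")
    case True then show ?thesis using a.ip_nonneg[OF y] by simp
  next
    case False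
    then have yp: "N2 y > 0" using L2.ip_nonneg[OF EL[OF y]] by simp
    have yV: "y \<in> V" using y EV by blast
    have oy: "orth_to y (ker (cnj (of_real l)))"
    proof (cases "complex_of_real l \<in> Z")
      case True then show ?thesis using y by (auto simp: E_def)
    next
      case False
      show ?thesis using ip_null[OF ker_L2 nul[OF l False] EL[OF y]] by simp
    qed
    obtain v where v: "Sh (of_real l) v y" "orth_to v (ker (of_real l))" using Sh_surj[OF C EL[OF y] oy] by blast
    have vV: "v \<in> V" by (rule Sh_V[OF v(1)])
    obtain v' where v': "v' \<in> V" "\<forall>z\<in>Z. orth_to v' (ker z)" "N2 v' \<le> N2 v"
      "\<And>y. y \<in> V \<Longrightarrow> \<forall>z\<in>Z. orth_to y (ker z) \<Longrightarrow> cf v' y = cf v y \<and> ip v' y = ip v y"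
      using proj_finite[OF Z vV] by blast
    have v'E: "v' \<in> E" using v' by (auto simp: E_def)
    have av: "a v x = ip y x" if "x \<in> V" for x using v(1) that by (simp add: Sh_iff a_def)
    have av': "a v' x = ip y x" if "x \<in> E" for x
      using v'(4)[of x] av[of x] that EV by (auto simp: a_def E_def)
    have "(cmod (a v' y))\<^sup>2 \<le> Re (a v' v') * Re (a y y)" by (rule a.cauchy_schwarz[OF v'E y])
    also have "a v' y = of_real (N2 y)" using av'[OF y] L2.ip_self[OF EL[OF y]] by simp
    also have "Re (a v' v') = Re (ip y v')" using av'[OF v'E] by simp
    finally have 1: "N2 y * N2 y \<le> Re (ip y v') * Re (a y y)" using yp by (simp add: power2_eq_square)
    have "Re (ip y v') \<le> sqrt (N2 y) * sqrt (N2 v')"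
      using L2.cauchy_schwarz_sqrt[OF EL[OF y] V_L2[OF v'(1)]] complex_Re_le_cmod[of "ip y v'"] by linarith
    also have "\<dots> \<le> sqrt (N2 y) * (sqrt (max C 0) * sqrt (N2 y))"
    proof (intro mult_left_mono)
      have "C * N2 y \<le> max C 0 * N2 y" using yp by (intro mult_right_mono) auto
      then have "N2 v' \<le> max C 0 * N2 y" using v'(3) C[OF v] by linarith
      then show "sqrt (N2 v') \<le> sqrt (max C 0) * sqrt (N2 y)" unfolding real_sqrt_mult[symmetric] by simp
    qed (use yp in simp)
    also have "\<dots> = sqrt (max C 0) * N2 y" using yp by simp
    finally have "Re (ip y v') * Re (a y y) \<le> (sqrt (max C 0) * N2 y) * Re (a y y)"
      by (intro mult_right_mono a.ip_nonneg[OF y])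
    with 1 have "N2 y * N2 y \<le> N2 y * (sqrt (max C 0) * Re (a y y))" by (simp add: mult_ac)
    then show ?thesis using yp by simp
  qed
  \<comment> \<open>Strictly larger than the constant in \<open>key\<close>, so that a Rayleigh
    quotient below \<open>l + 1 / K\<close> is contradictory.\<close>
  define K where "K = sqrt (max C 0) + 1"
  have K: "K > 0" by (simp add: K_def add_nonneg_pos)
  obtain t where "t \<in> X" "t < l + 1 / K"
    using cInf_lessD[of X "l + 1 / K"] uX K unfolding l_def by auto
  then obtain y where y: "y \<in> E" "N2 y > 0" "cl.sq y / N2 y < l + 1 / K" by (auto simp: X_def)
  have "Re (a y y) < 1 / K * N2 y" using y(2,3) by (simp add: aE pos_divide_less_eq algebra_simps)
  then have "K * Re (a y y) < K * (1 / K * N2 y)" using K by (intro mult_strict_left_mono)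
  then have "K * Re (a y y) < N2 y" using K by simp
  moreover have "sqrt (max C 0) * Re (a y y) \<le> K * Re (a y y)"
    by (intro mult_right_mono a.ip_nonneg y) (simp add: K_def)
  ultimately show False using key[OF y(1)] by linarith
qed

text \<open>Without spectrum up to \<open>\<mu>\<close> nothing has to be split off, and
  \<open>rayleigh_above\<close> with empty \<open>Z\<close> contradicts the quotient of
  \<open>f\<close>.\<close>

theorem spectrum_upper:
  assumes f: "f \<in> D" "N2 f \<noteq> 0" "form.sq f \<le> \<mu> * N2 f"
  shows "\<exists>z\<in>spectrum M T. Re z \<le> \<mu>"
proof (rule ccontr)
  assume "\<not> ?thesis"
  then have res: "complex_of_real c \<in> resolvent_set M T" if "c \<le> \<mu>" for c
    using that by (force simp: spectrum_def)
  have "\<mu> * N2 f < cl.sq f"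
  proof (rule rayleigh_above[where Z = "{}"])
    show "\<exists>C. \<forall>v w. Sh (of_real c) v w \<longrightarrow> orth_to v (ker (of_real c)) \<longrightarrow> N2 v \<le> C * N2 w" if "c \<le> \<mu>" for c
      using resolvent_bound[OF res[OF that]] by blast
    show "N2 e = 0" if "c \<le> \<mu>" "e \<in> ker (of_real c)" for c e by (rule ker_null_resolvent[OF res[OF that(1)] that(2)])
  qed (use f D_V in auto)
  then show False using f cf_D[OF f(1) f(1)] by simp
qed

theorem ess_spectrum_upper:
  fixes f :: "nat \<Rightarrow> 'x \<Rightarrow> complex"
  assumes f: "\<And>n. f n \<in> D" "\<And>n. N2 (f n) = 1" "\<And>n. form.sq (f n) \<le> \<mu>"
    and o: "\<And>m n. m \<noteq> n \<Longrightarrow> ip (f m) (f n) = 0" "\<And>m n. m \<noteq> n \<Longrightarrow> q (f m) (f n) = 0"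
  shows "\<exists>z\<in>ess_spectrum M T. Re z \<le> \<mu>"
proof (rule ccontr)
  assume neg: "\<not> ?thesis"
  have fL: "f n \<in> L2 M" for n using f(1) D_L2 by blast
  define Z where "Z = {z \<in> spectrum M T. Re z \<le> \<mu>}"
  have disc: "z isolated_in spectrum M T" "finite_dim_AE M (ker z)" if "z \<in> Z" for z
  proof -
    have "z \<in> discrete_spectrum M T" using neg that by (auto simp: Z_def ess_spectrum_def)
    then show "z isolated_in spectrum M T" "finite_dim_AE M (ker z)"
      by (auto simp: discrete_spectrum_def eigenspace_ker)
  qed
  \<comment> \<open>The spectrum up to \<open>\<mu>\<close> lies in a compact interval, so
    infinitely many points would accumulate. Eigenvectors to nearby eigenvalues keep the
    accumulation point out of the resolvent set, and isolation keeps it out of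
    \<open>Z\<close>.\<close>
  have finZ: "finite Z"
  proof (rule ccontr)
    assume inf: "infinite Z"
    define S where "S = complex_of_real ` {0..\<mu>}"
    have "compact S" unfolding S_def by (intro compact_continuous_image continuous_intros compact_Icc)
    moreover have sub: "Z \<subseteq> S"
    proof
      fix z assume z: "z \<in> Z"
      then have "z = of_real (Re z)" "Re z \<in> {0..\<mu>}"
        using spectrum_real[of z] by (auto simp: Z_def complex_eq_iff)
      then show "z \<in> S" unfolding S_def by blast
    qed
    ultimately obtain p where p: "p \<in> S" "p islimpt Z" using inf compact_eq_Bolzano_Weierstrass by blast
    have "p \<in> spectrum M T"
    proof (rule ccontr)
      assume "p \<notin> spectrum M T"
      then have pr: "p \<in> resolvent_set M T" by (simp add: spectrum_def)
      obtain C where C: "C > 0" "\<And>u w. Sh p u w \<Longrightarrow> N2 u \<le> C * N2 w" using resolvent_bound[OF pr] by blast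
      have "1 / sqrt (2 * C) > 0" using C by simp
      then obtain z where z: "z \<in> Z" "dist z p < 1 / sqrt (2 * C)"
        using p(2) unfolding islimpt_approachable by blast
      have zs: "z \<in> discrete_spectrum M T" using neg z by (auto simp: Z_def ess_spectrum_def)
      then obtain e where e: "e \<in> ker z" "\<not> (AE x in M. e x = 0)"
        by (auto simp: discrete_spectrum_def eigenspace_ker)
      then have n: "N2 e > 0" using L2_null_iff[OF ker_L2[OF e(1)]] L2.ip_nonneg[OF ker_L2[OF e(1)]] by auto
      have "Sh (z + (p - z)) e (\<lambda>x. 0 - (p - z) * e x)" using e(1) by (intro Sh_shift) simp
      then have "Sh p e (\<lambda>x. (z - p) * e x)" by (simp add: left_diff_distrib)
      from C(2)[OF this] have "N2 e \<le> C * ((cmod (z - p))\<^sup>2 * N2 e)" unfolding L2.sq_scale[OF ker_L2[OF e(1)]] .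
      then have "1 \<le> C * (cmod (z - p))\<^sup>2" using n by (simp flip: mult.assoc)
      moreover have "(cmod (z - p))\<^sup>2 < (1 / sqrt (2 * C))\<^sup>2"
        using z(2) by (intro power_strict_mono) (auto simp: dist_norm)
      then have "C * (cmod (z - p))\<^sup>2 < C * (1 / (2 * C))" using C(1) by (intro mult_strict_left_mono) (auto simp: power_divide)
      ultimately show False using C(1) by simp
    qed
    moreover have "Re p \<le> \<mu>" using p(1) by (auto simp: S_def)
    ultimately have "p \<in> Z" by (simp add: Z_def)
    moreover have "p islimpt spectrum M T" using p(2) by (rule islimpt_subset) (auto simp: Z_def)
    ultimately show False using disc(1)[of p] by (simp add: isolated_in_islimpt_iff)
  qed
  have "\<forall>z\<in>Z. \<exists>F. finite F \<and> F \<subseteq> ker z \<and> (\<forall>u\<in>ker z. \<exists>c. AE x in M. u x = (\<Sum>v\<in>F. c v * v x))"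
    using disc(2) unfolding finite_dim_AE_def by blast
  from bchoice[OF this] obtain F where "\<forall>z\<in>Z. finite (F z) \<and> F z \<subseteq> ker z \<and>
      (\<forall>u\<in>ker z. \<exists>c. AE x in M. u x = (\<Sum>v\<in>F z. c v * v x))" ..
  then have F: "\<And>z. z \<in> Z \<Longrightarrow> finite (F z)" "\<And>z. z \<in> Z \<Longrightarrow> F z \<subseteq> ker z"
    "\<And>z u. z \<in> Z \<Longrightarrow> u \<in> ker z \<Longrightarrow> \<exists>c. AE x in M. u x = (\<Sum>v\<in>F z. c v * v x)" by simp_all
  define G where "G = (\<Union>z\<in>Z. F z)"
  have finG: "finite G" unfolding G_def using finZ F(1) by blast
  \<comment> \<open>The indices from 0 to \<open>card G\<close>: one more than there are
    orthogonality conditions.\<close>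
  define I where "I = {..card G}"
  obtain c where c: "\<exists>i\<in>I. c i \<noteq> 0" "\<And>g. g \<in> G \<Longrightarrow> (\<Sum>i\<in>I. c i * ip (f i) g) = 0"
    using homogeneous_system[OF finG, of I "\<lambda>g i. ip (f i) g"] by (auto simp: I_def)
  have I: "finite I" by (simp add: I_def)
  define h where "h = (\<lambda>x. \<Sum>i\<in>I. c i * f i x)"
  have hD: "h \<in> D" unfolding h_def by (intro form.sum_mem I f)
  have Nh: "N2 h = (\<Sum>i\<in>I. (cmod (c i))\<^sup>2)"
    unfolding h_def using L2.sq_sum_orth[OF I, of f M c] fL o(1) f(2) by simp
  have qh: "form.sq h \<le> \<mu> * N2 h"
  proof -
    have "form.sq h = (\<Sum>i\<in>I. (cmod (c i))\<^sup>2 * form.sq (f i))"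
      unfolding h_def using form.sq_sum_orth[OF I, of f c] f(1) o(2) by simp
    also have "\<dots> \<le> (\<Sum>i\<in>I. (cmod (c i))\<^sup>2 * \<mu>)" by (intro sum_mono mult_left_mono f(3)) auto
    also have "\<dots> = \<mu> * N2 h" unfolding Nh by (simp add: sum_distrib_left mult.commute)
    finally show ?thesis .
  qed
  have Nh0: "N2 h \<noteq> 0"
    unfolding Nh using c(1) I by (subst sum_nonneg_eq_0_iff) auto
  have ho: "orth_to h (ker z)" if z: "z \<in> Z" for z
  proof
    fix e assume e: "e \<in> ker z"
    obtain k where k: "AE x in M. e x = (\<Sum>v\<in>F z. k v * v x)" using F(3)[OF z e] by blast
    have FL: "v \<in> L2 M" if "v \<in> F z" for v using F(2)[OF z] that ker_L2 by blast
    have hL: "h \<in> L2 M" using hD D_L2 by blast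
    have "ip h e = ip h (\<lambda>x. \<Sum>v\<in>F z. k v * v x)"
      by (rule L2_inner_cong_AE) (use k hL ker_L2[OF e] L2.sum_mem[OF F(1)[OF z] FL] in auto)
    also have "\<dots> = (\<Sum>v\<in>F z. cnj (k v) * ip h v)"
      by (rule L2.ip_sum_right[OF F(1)[OF z] FL hL])
    also have "\<dots> = 0"
    proof (rule sum.neutral, rule ballI)
      fix v assume v: "v \<in> F z"
      have "ip h v = (\<Sum>i\<in>I. c i * ip (f i) v)"
        unfolding h_def by (rule L2.ip_sum_left[OF I fL FL[OF v]])
      also have "\<dots> = 0" using v z by (intro c(2)) (auto simp: G_def)
      finally show "cnj (k v) * ip h v = 0" by simp
    qed
    finally show "ip h e = 0" .
  qed
  have "\<mu> * N2 h < cl.sq h"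
  proof (rule rayleigh_above[OF finZ])
    fix t :: real assume t: "t \<le> \<mu>"
    show "N2 e = 0" if "complex_of_real t \<notin> Z" "e \<in> ker (of_real t)" for e
      using ker_null_resolvent[OF _ that(2)] that(1) t by (auto simp: Z_def spectrum_def)
    show "\<exists>C. \<forall>v w. Sh (of_real t) v w \<longrightarrow> orth_to v (ker (of_real t)) \<longrightarrow> N2 v \<le> C * N2 w"
    proof (cases "complex_of_real t \<in> Z")
      case False
      then have "complex_of_real t \<in> resolvent_set M T" using t by (auto simp: Z_def spectrum_def)
      then show ?thesis using resolvent_bound by blast
    next
      \<comment> \<open>The kernel may be non-trivial here; the bound off the kernel comes from
        isolation.\<close>
      case True
      obtain e where e: "e > 0" "\<And>y. y \<in> spectrum M T \<Longrightarrow> dist (of_real t) y < e \<Longrightarrow> y = of_real t"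
        using disc(1)[OF True] unfolding isolated_in_dist_Ex_iff by blast
      have "complex_of_real (t + s) \<in> resolvent_set M T" if "s \<noteq> 0" "\<bar>s\<bar> < 2 * (e / 2)" for s
      proof (rule ccontr)
        assume "\<not> ?thesis"
        then have "complex_of_real (t + s) \<in> spectrum M T" by (simp add: spectrum_def)
        moreover have "dist (of_real t) (complex_of_real (t + s)) < e" using that(2) by (simp add: dist_norm)
        ultimately have "complex_of_real (t + s) = of_real t" by (rule e(2))
        then show False using that(1) by (simp only: of_real_eq_iff)
      qed
      note ib = isolated_bound[OF _ this, of "e/2"]
      show ?thesis by (intro exI[of _ "1 / (4 * (e / 2)\<^sup>2)"] allI impI ib) (use e(1) in auto)
    qed
  qed (use hD D_V ho Nh0 in auto)
  then show False using qh cf_D[OF hD hD] by simp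
qed

section \<open>Compactness of the resolvent\<close>

text \<open>On differences along a subsequence, \<open>k * N2\<close> stays below a constant
  independent of \<open>k\<close>; the diagonal sequence over all \<open>k\<close> is therefore
  Cauchy.\<close>

lemma compact_resolventI:
  assumes el: "\<And>k :: nat. ess_lower M D q (real k)"
  shows "compact_resolvent M T"
  unfolding compact_resolvent_def
proof (intro bexI[OF _ neg1_resolvent] allI impI, elim conjE exE)
  fix us gs C
  assume T: "\<forall>n::nat. (us n, gs n) \<in> T" and C: "\<forall>n. L2_norm M (\<lambda>x. gs n x - (-1) * us n x) \<le> C"
  define ws where "ws n = (\<lambda>x. gs n x - (-1) * us n x)" for n
  have S: "Sh (-1) (us n) (ws n)" for n unfolding ws_def using T by (intro T_Sh) auto
  have uV: "us n \<in> V" for n by (rule Sh_V[OF S])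
  have bd: "a1.sq (us n) \<le> C\<^sup>2" for n
  proof -
    have "(L2_norm M (ws n))\<^sup>2 \<le> C\<^sup>2" using C by (intro power_mono) (auto simp: ws_def L2_norm_def)
    then have w: "N2 (ws n) \<le> C\<^sup>2" by (simp add: L2_norm_power2)
    have "a1.sq (us n) = Re (ip (ws n) (us n))" using Sh_neg1_a1[OF S uV, of n n] by simp
    also have "\<dots> \<le> sqrt (N2 (ws n)) * sqrt (N2 (us n))"
      using L2.cauchy_schwarz_sqrt[OF Sh_L2'[OF S] Sh_L2[OF S], of n n] complex_Re_le_cmod[of "ip (ws n) (us n)"] by linarith
    also have "\<dots> \<le> sqrt (N2 (ws n)) * sqrt (N2 (ws n))"
      using Sh_neg1_bound[OF S, of n] L2.ip_nonneg[OF Sh_L2'[OF S], of n] by (intro mult_left_mono) auto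
    also have "\<dots> = N2 (ws n)" using L2.ip_nonneg[OF Sh_L2'[OF S], of n] by simp
    finally show ?thesis using w by linarith
  qed
  define P where "P k s \<longleftrightarrow> (\<exists>N. \<forall>m\<ge>N. \<forall>n\<ge>N. real k * N2 (\<lambda>x. us (s m) x - us (s n) x) \<le> 4 * C\<^sup>2 + 1)" for k and s :: "nat \<Rightarrow> nat"
  interpret subseqs P
  proof
    fix k and s :: "nat \<Rightarrow> nat" assume "strict_mono s"
    obtain r :: "nat \<Rightarrow> nat" where r: "strict_mono r" "\<forall>e>0. \<exists>N. \<forall>m\<ge>N. \<forall>n\<ge>N.
        real k * N2 (\<lambda>x. us (s (r m)) x - us (s (r n)) x) \<le> cl.sq (\<lambda>x. us (s (r m)) x - us (s (r n)) x) + e"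
      using ess_lower_V[OF el[of k], of "\<lambda>n. us (s n)", OF uV bd] by (elim exE conjE)
    obtain N where N: "\<forall>m\<ge>N. \<forall>n\<ge>N.
        real k * N2 (\<lambda>x. us (s (r m)) x - us (s (r n)) x) \<le> cl.sq (\<lambda>x. us (s (r m)) x - us (s (r n)) x) + 1"
      using r(2)[THEN spec, of 1] by auto
    have c4: "cl.sq (\<lambda>x. us m x - us n x) \<le> 4 * C\<^sup>2" for m n
      using cl.sq_diff_le[OF uV uV, of m n] cl_le_a1[OF uV, of m] cl_le_a1[OF uV, of n] bd[of m] bd[of n] by argo
    have "real k * N2 (\<lambda>x. us (s (r m)) x - us (s (r n)) x) \<le> 4 * C\<^sup>2 + 1" if "m \<ge> N" "n \<ge> N" for m n
      using N[THEN spec, THEN mp, OF that(1), THEN spec, THEN mp, OF that(2)] c4[of "s (r m)" "s (r n)"] by linarith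
    then show "\<exists>r. strict_mono r \<and> P k (s \<circ> r)" using r(1) unfolding P_def by auto
  qed
  \<comment> \<open>Only from index \<open>Suc k\<close> on is the diagonal sequence known to run
    inside the subsequence selected for \<open>k\<close>.\<close>
  have P: "P k (diagseq \<circ> (+) (Suc k))" for k
  proof (rule diagseq_holds)
    fix r s :: "nat \<Rightarrow> nat" and n assume r: "strict_mono r" and p: "P n s"
    obtain N where N: "\<And>m l. m \<ge> N \<Longrightarrow> l \<ge> N \<Longrightarrow> real n * N2 (\<lambda>x. us (s m) x - us (s l) x) \<le> 4 * C\<^sup>2 + 1"
      using p unfolding P_def by blast
    have "real n * N2 (\<lambda>x. us (s (r m)) x - us (s (r l)) x) \<le> 4 * C\<^sup>2 + 1" if "m \<ge> N" "l \<ge> N" for m l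
      by (rule N) (use seq_suble[OF r, of m] seq_suble[OF r, of l] that in auto)
    then show "P n (s \<circ> r)" unfolding P_def by auto
  qed
  have "\<exists>N. \<forall>m\<ge>N. \<forall>n\<ge>N. N2 (\<lambda>x. us (diagseq m) x - us (diagseq n) x) < e" if e: "e > 0" for e
  proof -
    obtain k :: nat where k: "(4 * C\<^sup>2 + 1) / e < real k" using reals_Archimedean2 by blast
    have "(4 * C\<^sup>2 + 1) / e > 0" using e by (intro divide_pos_pos add_nonneg_pos) auto
    then have k0: "real k > 0" using k by linarith
    obtain N where N: "\<And>m n. m \<ge> N \<Longrightarrow> n \<ge> N \<Longrightarrow> real k * N2 (\<lambda>x. us (diagseq (Suc k + m)) x - us (diagseq (Suc k + n)) x) \<le> 4 * C\<^sup>2 + 1"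
      using P[of k] unfolding P_def comp_def by blast
    have "N2 (\<lambda>x. us (diagseq m) x - us (diagseq n) x) < e" if "m \<ge> N + Suc k" "n \<ge> N + Suc k" for m n
    proof -
      have "real k * N2 (\<lambda>x. us (diagseq m) x - us (diagseq n) x) \<le> 4 * C\<^sup>2 + 1"
        using N[of "m - Suc k" "n - Suc k"] that by simp
      also have "\<dots> < real k * e" using k e by (simp add: pos_divide_less_eq)
      finally show ?thesis using k0 by simp
    qed
    then show ?thesis by blast
  qed
  then obtain u where u: "u \<in> L2 M" "(\<lambda>n. N2 (\<lambda>x. us (diagseq n) x - u x)) \<longlonglongrightarrow> 0"
    using complete_limits[of "\<lambda>n. us (diagseq n)"] Sh_L2[OF S] by blast
  have "L2_tendsto M (us \<circ> diagseq) u"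
    using u tendsto_real_sqrt[OF u(2)] by (simp add: L2_tendsto_def L2_norm_eq)
  then show "\<exists>r u. strict_mono r \<and> L2_tendsto M (us \<circ> r) u" using subseq_diagseq by blast
qed

text \<open>If the images of \<open>f n\<close> under the inverse of \<open>T + 1\<close> had a
  convergent subsequence, two of them would be so close that \<open>a1.sq ?u\<close> is tiny. But
  \<open>a1 ?u ?f\<close> has modulus 2 while \<open>a1.sq ?f\<close> is bounded, against
  Cauchy-Schwarz.\<close>

lemma not_compact_resolvent:
  fixes f :: "nat \<Rightarrow> 'x \<Rightarrow> complex"
  assumes f: "\<And>n. f n \<in> D" "\<And>n. N2 (f n) = 1" "\<And>n. form.sq (f n) \<le> \<mu>"
    and o: "\<And>m n. m \<noteq> n \<Longrightarrow> ip (f m) (f n) = 0"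
  shows "\<not> compact_resolvent M T"
proof
  assume "compact_resolvent M T"
  then obtain z where comp: "\<And>us gs C. (\<And>n::nat. (us n, gs n) \<in> T) \<Longrightarrow> (\<And>n. L2_norm M (\<lambda>x. gs n x - z * us n x) \<le> C) \<Longrightarrow>
      \<exists>r u. strict_mono r \<and> L2_tendsto M (us \<circ> r) u"
    unfolding compact_resolvent_def by blast
  have fV: "f n \<in> V" and fL: "f n \<in> L2 M" for n using D_V[OF f(1)] V_L2 by auto
  have "\<exists>u. Sh (-1) u (f n)" for n by (rule exists_K[OF fL])
  then obtain us where S: "\<And>n. Sh (-1) (us n) (f n)" by metis
  \<comment> \<open>The values of \<open>T\<close> at \<open>us n\<close>. Compactness is given at
    some \<open>z\<close> only, and \<open>gs n - z * us n\<close> is bounded for every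
    \<open>z\<close>.\<close>
  define gs where "gs n = (\<lambda>x. f n x + (-1) * us n x)" for n
  note uV = Sh_V[OF S] and uL = Sh_L2[OF S]
  have u1: "N2 (us n) \<le> 1" for n using Sh_neg1_bound[OF S, of n] f(2)[of n] by simp
  have "L2_norm M (\<lambda>x. gs n x - z * us n x) \<le> 1 + cmod (-1 - z)" for n
  proof -
    have "(\<lambda>x. gs n x - z * us n x) = (\<lambda>x. f n x + (-1 - z) * us n x)" by (auto simp: gs_def algebra_simps)
    then have "L2_norm M (\<lambda>x. gs n x - z * us n x) \<le> sqrt (N2 (f n)) + sqrt (N2 (\<lambda>x. (-1 - z) * us n x))"
      using L2.triangle[OF fL L2.scale[OF uL, of "-1 - z"], of n n] by (simp add: L2_norm_eq)
    also have "sqrt (N2 (\<lambda>x. (-1 - z) * us n x)) = cmod (-1 - z) * sqrt (N2 (us n))"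
      unfolding L2.sq_scale[OF uL] by (simp add: real_sqrt_mult)
    also have "\<dots> \<le> cmod (-1 - z) * 1" using u1[of n] by (intro mult_left_mono) auto
    finally show ?thesis using f(2)[of n] by simp
  qed
  moreover have "(us n, gs n) \<in> T" for n using S[of n] unfolding gs_def by (simp add: Sh_def)
  ultimately obtain r u where r: "strict_mono r" and lim: "L2_tendsto M (us \<circ> r) u" using comp[of us gs] by blast
  have uL': "u \<in> L2 M" and l: "(\<lambda>n. N2 (\<lambda>x. us (r n) x - u x)) \<longlonglongrightarrow> 0"
    using lim tendsto_power[of "\<lambda>n. L2_norm M (\<lambda>x. us (r n) x - u x)" 0 sequentially 2]
    by (auto simp: L2_tendsto_def L2_norm_power2)
  have m0: "\<mu> \<ge> 0" using form.ip_nonneg[OF f(1), of 0] f(3)[of 0] by linarith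
  \<comment> \<open>It leads to \<open>a1.sq ?u < 1 / (\<mu> + 1)\<close>; multiplied by the bound
    \<open>4 * (\<mu> + 1)\<close> for \<open>a1.sq ?f\<close> this stays below 4, the square of
    \<open>cmod (a1 ?u ?f)\<close>.\<close>
  define \<epsilon> where "\<epsilon> = 1 / (2 * (\<mu> + 1)\<^sup>2)"
  have eps: "\<epsilon> > 0" using m0 by (simp add: \<epsilon>_def)
  have "\<forall>\<^sub>F n in sequentially. N2 (\<lambda>x. us (r n) x - u x) < \<epsilon> / 4" using l eps by (intro order_tendstoD) auto
  then obtain N where N: "\<And>n. n \<ge> N \<Longrightarrow> N2 (\<lambda>x. us (r n) x - u x) < \<epsilon> / 4" using eventually_sequentially by auto
  define i j where "i = r N" and "j = r (Suc N)"
  have ij: "i \<noteq> j" using r unfolding i_def j_def by (metis strict_monoD lessI less_irrefl)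
  let ?u = "\<lambda>x. us i x - us j x" and ?f = "\<lambda>x. f i x - f j x"
  have Nu: "N2 ?u < \<epsilon>"
    using L2.sq_triangle[OF uL uL' uL, of i j] N[of N] N[of "Suc N"] L2.sq_diff_commute[OF uL' uL, of j]
    by (simp add: i_def j_def)
  have Sd: "Sh (-1) ?u ?f" by (rule Sh_diff[OF S S])
  have fV': "?f \<in> V" by (intro cl.diff fV)
  have Nf: "N2 ?f = 2" using L2.sq_diff[OF fL fL, of i j] o[OF ij] f(2) by simp
  have af: "a1.sq ?f \<le> 4 * (\<mu> + 1)"
  proof -
    have "a1.sq (f n) \<le> \<mu> + 1" for n using f(2,3)[of n] cf_D[OF f(1) f(1), of n n] by (simp add: a1_sq)
    from this[of i] this[of j] a1.sq_diff_le[OF fV fV, of i j] show ?thesis by argo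
  qed
  have au: "a1.sq ?u = Re (ip ?f ?u)" using Sh_neg1_a1[OF Sd Sh_V[OF Sd]] by simp
  have "a1.sq ?u \<le> sqrt (N2 ?f) * sqrt (N2 ?u)"
    unfolding au using L2.cauchy_schwarz_sqrt[OF Sh_L2'[OF Sd] Sh_L2[OF Sd]] complex_Re_le_cmod[of "ip ?f ?u"] by linarith
  also have "\<dots> = sqrt (2 * N2 ?u)" unfolding Nf by (simp add: real_sqrt_mult)
  also have "\<dots> < sqrt (2 * \<epsilon>)" using Nu by simp
  also have "2 * \<epsilon> = (1 / (\<mu> + 1))\<^sup>2" by (simp add: \<epsilon>_def power_divide)
  also have "sqrt ((1 / (\<mu> + 1))\<^sup>2) = 1 / (\<mu> + 1)" using m0 by simp
  finally have au': "a1.sq ?u < 1 / (\<mu> + 1)" .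
  have "a1 ?u ?f = ip ?f ?f" by (rule Sh_neg1_a1[OF Sd fV'])
  then have "cmod (a1 ?u ?f) = 2" using L2.ip_self[OF Sh_L2'[OF Sd]] Nf by simp
  then have "4 \<le> a1.sq ?u * a1.sq ?f" using a1.cauchy_schwarz[OF Sh_V[OF Sd] fV'] by simp
  also have "\<dots> \<le> a1.sq ?u * (4 * (\<mu> + 1))" by (intro mult_left_mono af a1.ip_nonneg Sh_V[OF Sd])
  also have "\<dots> < 1 / (\<mu> + 1) * (4 * (\<mu> + 1))" using au' m0 by (intro mult_strict_right_mono) auto
  also have "\<dots> = 4" using m0 by (simp add: field_simps)
  finally show False by simp
qed

end

section \<open>Multiplication by a positive function as a unitary equivalence\<close>

text \<open>As \<open>k\<close> is positive everywhere, the multiplication is a bijection on all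
  functions and not merely on classes. Quantifiers over functions, sequences and sets of functions
  can be transported literally through the definitions; for this reason \<open>L2_iff\<close> and
  \<open>inner\<close> carry no membership assumption. The forms have to agree on the cores
  only.\<close>

locale mult_equiv =
  fixes k :: "'x \<Rightarrow> real" and M1 M2 :: "'x measure" and D1 D2 :: "('x \<Rightarrow> complex) set" and q1 q2 :: "'x form"
  assumes k: "\<And>x. k x > 0"
    and L2_iff: "\<And>u. (\<lambda>x. of_real (k x) * u x) \<in> L2 M2 \<longleftrightarrow> u \<in> L2 M1"
    and inner: "\<And>u v. L2_inner M2 (\<lambda>x. of_real (k x) * u x) (\<lambda>x. of_real (k x) * v x) = L2_inner M1 u v"
    and D_iff: "\<And>u. (\<lambda>x. of_real (k x) * u x) \<in> D2 \<longleftrightarrow> u \<in> D1"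
    and D_diff: "\<And>u v. u \<in> D1 \<Longrightarrow> v \<in> D1 \<Longrightarrow> (\<lambda>x. u x - v x) \<in> D1"
    and form: "\<And>u v. u \<in> D1 \<Longrightarrow> v \<in> D1 \<Longrightarrow> q2 (\<lambda>x. of_real (k x) * u x) (\<lambda>x. of_real (k x) * v x) = q1 u v"
    and AE_iff: "\<And>P. (AE x in M2. P x) \<longleftrightarrow> (AE x in M1. P x)"
begin

definition U :: "('x \<Rightarrow> complex) \<Rightarrow> 'x \<Rightarrow> complex" where "U u = (\<lambda>x. of_real (k x) * u x)"
definition U' :: "('x \<Rightarrow> complex) \<Rightarrow> 'x \<Rightarrow> complex" where "U' u = (\<lambda>x. u x / of_real (k x))"

lemma k_nz [simp]: "k x \<noteq> 0"
  using k[of x] by simp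

lemma UU' [simp]: "U (U' u) = u" "U' (U u) = u"
  by (auto simp: U_def U'_def)

lemma bij_U: "bij U"
  by (rule bij_betw_byWitness[where f' = U']) auto

lemma inj_U: "U u = U v \<longleftrightarrow> u = v"
  using bij_U by (auto simp: bij_def inj_eq)

lemma all_U: "(\<forall>u. P u) \<longleftrightarrow> (\<forall>u. P (U u))"
  by (metis UU'(1))

lemma ex_U: "(\<exists>u. P u) \<longleftrightarrow> (\<exists>u. P (U u))"
  by (metis UU'(1))

lemma all_seq_U: "(\<forall>us :: nat \<Rightarrow> _. P us) \<longleftrightarrow> (\<forall>us. P (\<lambda>n. U (us n)))"
proof
  assume *: "\<forall>us. P (\<lambda>n. U (us n))"
  show "\<forall>us. P us"
  proof
    fix us :: "nat \<Rightarrow> _"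
    show "P us" using *[THEN spec, of "\<lambda>n. U' (us n)"] by simp
  qed
qed blast

lemma ex_seq_U: "(\<exists>us :: nat \<Rightarrow> _. P us) \<longleftrightarrow> (\<exists>us. P (\<lambda>n. U (us n)))"
  using all_seq_U[of "\<lambda>us. \<not> P us"] by blast

lemma U_lin: "(\<lambda>x. U f x - z * U g x) = U (\<lambda>x. f x - z * g x)" "(\<lambda>x. U f x - U g x) = U (\<lambda>x. f x - g x)"
  by (auto simp: U_def algebra_simps)

lemma L2_U: "U u \<in> L2 M2 \<longleftrightarrow> u \<in> L2 M1"
  using L2_iff by (simp add: U_def)

lemma inner_U: "L2_inner M2 (U u) (U v) = L2_inner M1 u v"
  using inner by (simp add: U_def)

lemma norm_U: "L2_norm M2 (U u) = L2_norm M1 u"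
  unfolding L2_norm_eq inner_U ..

lemma D_U: "U u \<in> D2 \<longleftrightarrow> u \<in> D1"
  using D_iff by (simp add: U_def)

lemma form_U: "u \<in> D1 \<Longrightarrow> v \<in> D1 \<Longrightarrow> q2 (U u) (U v) = q1 u v"
  using form by (simp add: U_def)

lemma L2_tendsto_U: "L2_tendsto M2 (\<lambda>n. U (us n)) (U u) \<longleftrightarrow> L2_tendsto M1 us u"
  by (simp add: L2_tendsto_def L2_U U_lin norm_U)

lemma form_tendsto_U: "form_tendsto M2 D2 q2 (\<lambda>n. U (us n)) (U u) \<longleftrightarrow> form_tendsto M1 D1 q1 us u"
proof (cases "\<forall>n. us n \<in> D1")
  case True
  have "q2 (U (\<lambda>x. us m x - us n x)) (U (\<lambda>x. us m x - us n x)) = q1 (\<lambda>x. us m x - us n x) (\<lambda>x. us m x - us n x)" for m n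
    using True by (intro form_U D_diff) auto
  then show ?thesis unfolding form_tendsto_def L2_tendsto_U by (simp add: D_U U_lin)
next
  case False
  then have "\<not> form_tendsto M1 D1 q1 us u" "\<not> form_tendsto M2 D2 q2 (\<lambda>n. U (us n)) (U u)"
    unfolding form_tendsto_def D_U by blast+
  then show ?thesis by blast
qed

lemma closure_dom_U: "U u \<in> closure_dom M2 D2 q2 \<longleftrightarrow> u \<in> closure_dom M1 D1 q1"
  unfolding closure_dom_def mem_Collect_eq by (subst ex_seq_U) (simp add: form_tendsto_U)

lemma closure_form_U: "closure_form M2 D2 q2 (U u) (U v) = closure_form M1 D1 q1 u v"
proof -
  have "(\<forall>us vs. form_tendsto M2 D2 q2 us (U u) \<longrightarrow> form_tendsto M2 D2 q2 vs (U v) \<longrightarrow> (\<lambda>n. q2 (us n) (vs n)) \<longlonglongrightarrow> c) \<longleftrightarrow>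
        (\<forall>us vs. form_tendsto M1 D1 q1 us u \<longrightarrow> form_tendsto M1 D1 q1 vs v \<longrightarrow> (\<lambda>n. q1 (us n) (vs n)) \<longlonglongrightarrow> c)" for c
  proof -
    have "(\<lambda>n. q2 (U (us n)) (U (vs n))) = (\<lambda>n. q1 (us n) (vs n))"
      if "form_tendsto M1 D1 q1 us u" "form_tendsto M1 D1 q1 vs v" for us vs
      using that by (intro ext form_U) (auto simp: form_tendsto_def)
    then show ?thesis
      by (subst all_seq_U, subst (2) all_seq_U) (simp add: form_tendsto_U cong: imp_cong)
  qed
  then show ?thesis by (simp add: closure_form_def)
qed

abbreviation "T1 \<equiv> form_operator M1 D1 q1"
abbreviation "T2 \<equiv> form_operator M2 D2 q2"

lemma operator_U: "(U u, U f) \<in> T2 \<longleftrightarrow> (u, f) \<in> T1"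
proof -
  have "(\<forall>v. v \<in> closure_dom M2 D2 q2 \<longrightarrow> closure_form M2 D2 q2 (U u) v = L2_inner M2 (U f) v) \<longleftrightarrow>
        (\<forall>v. v \<in> closure_dom M1 D1 q1 \<longrightarrow> closure_form M1 D1 q1 u v = L2_inner M1 f v)"
    by (subst all_U) (simp add: closure_dom_U closure_form_U inner_U)
  then show ?thesis unfolding form_operator_def by (simp add: closure_dom_U L2_U Ball_def)
qed

lemma resolvent_U: "resolvent_set M2 T2 = resolvent_set M1 T1"
proof -
  have 1: "(\<forall>f. f \<in> L2 M2 \<longrightarrow> (\<exists>u g. (u, g) \<in> T2 \<and> (AE x in M2. g x - z * u x = f x))) \<longleftrightarrow>
      (\<forall>f. f \<in> L2 M1 \<longrightarrow> (\<exists>u g. (u, g) \<in> T1 \<and> (AE x in M1. g x - z * u x = f x)))" for z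
  proof -
    have "(AE x in M1. U g x - z * U u x = U f x) \<longleftrightarrow> (AE x in M1. g x - z * u x = f x)" for f u g
    proof -
      have "U g x - z * U u x = U f x \<longleftrightarrow> g x - z * u x = f x" for x
      proof -
        have "U g x - z * U u x = U f x \<longleftrightarrow> complex_of_real (k x) * (g x - z * u x) = complex_of_real (k x) * f x"
          by (simp add: U_def algebra_simps)
        then show ?thesis by simp
      qed
      then show ?thesis by simp
    qed
    then show ?thesis
      by (subst all_U, subst ex_U, subst (2) ex_U) (simp add: L2_U operator_U AE_iff)
  qed
  have 2: "(\<forall>u g. (u, g) \<in> T2 \<longrightarrow> L2_norm M2 u \<le> C * L2_norm M2 (\<lambda>x. g x - z * u x)) \<longleftrightarrow>
      (\<forall>u g. (u, g) \<in> T1 \<longrightarrow> L2_norm M1 u \<le> C * L2_norm M1 (\<lambda>x. g x - z * u x))" for z C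
    by (subst all_U, subst (2) all_U) (simp add: operator_U U_lin norm_U)
  have 0: "z \<in> resolvent_set M T \<longleftrightarrow> (\<forall>f. f \<in> L2 M \<longrightarrow> (\<exists>u g. (u, g) \<in> T \<and> (AE x in M. g x - z * u x = f x))) \<and>
     (\<exists>C. \<forall>u g. (u, g) \<in> T \<longrightarrow> L2_norm M u \<le> C * L2_norm M (\<lambda>x. g x - z * u x))" for M :: "'x measure" and T z
    unfolding resolvent_set_def by (simp add: Ball_def Bex_def)
  show ?thesis by (rule set_eqI) (unfold 0 1 2, rule refl)
qed

lemma spectrum_U: "spectrum M2 T2 = spectrum M1 T1"
  unfolding spectrum_def resolvent_U ..

lemma eigenspace_U: "U u \<in> eigenspace M2 T2 z \<longleftrightarrow> u \<in> eigenspace M1 T1 z"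
proof -
  have "U g x = z * U u x \<longleftrightarrow> g x = z * u x" for g x
    by (simp add: U_def)
  then show ?thesis
    unfolding eigenspace_def mem_Collect_eq by (subst ex_U) (simp add: operator_U AE_iff)
qed

lemma finite_dim_U: "finite_dim_AE M2 (eigenspace M2 T2 z) \<longleftrightarrow> finite_dim_AE M1 (eigenspace M1 T1 z)"
proof -
  have comb: "(AE x in M2. U u x = (\<Sum>v\<in>U ` F. c v * v x)) \<longleftrightarrow> (AE x in M1. u x = (\<Sum>v\<in>F. c (U v) * v x))" for u F c
  proof -
    have "(\<Sum>v\<in>U ` F. c v * v x) = (\<Sum>v\<in>F. c (U v) * U v x)" for x
      using inj_U by (subst sum.reindex) (auto intro: inj_onI)
    also have "\<dots> x = of_real (k x) * (\<Sum>v\<in>F. c (U v) * v x)" for x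
      by (simp add: U_def sum_distrib_left algebra_simps)
    finally show ?thesis by (simp add: AE_iff) (simp add: U_def)
  qed
  have coef: "(\<exists>c. AE x in M2. U u x = (\<Sum>v\<in>U ` F. c v * v x)) \<longleftrightarrow> (\<exists>c. AE x in M1. u x = (\<Sum>v\<in>F. c v * v x))" for u F
  proof
    assume "\<exists>c. AE x in M1. u x = (\<Sum>v\<in>F. c v * v x)"
    then obtain c where c: "AE x in M1. u x = (\<Sum>v\<in>F. c v * v x)" ..
    have "AE x in M2. U u x = (\<Sum>v\<in>U ` F. (c \<circ> U') v * v x)" unfolding comb using c by simp
    then show "\<exists>c. AE x in M2. U u x = (\<Sum>v\<in>U ` F. c v * v x)" by blast
  next
    assume "\<exists>c. AE x in M2. U u x = (\<Sum>v\<in>U ` F. c v * v x)"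
    then show "\<exists>c. AE x in M1. u x = (\<Sum>v\<in>F. c v * v x)" unfolding comb by (elim exE) (rule exI)
  qed
  have exF: "(\<exists>F. P F) \<longleftrightarrow> (\<exists>F. P (U ` F))" for P :: "('x \<Rightarrow> complex) set \<Rightarrow> bool"
  proof
    assume "\<exists>F. P F"
    then obtain F where "P F" ..
    moreover have "U ` U' ` F = F" by (simp add: image_image)
    ultimately show "\<exists>F. P (U ` F)" by metis
  qed blast
  have fin: "finite (U ` F) \<longleftrightarrow> finite F" for F
    using inj_U by (intro finite_image_iff inj_onI) auto
  have sub: "U ` F \<subseteq> eigenspace M2 T2 z \<longleftrightarrow> F \<subseteq> eigenspace M1 T1 z" for F
    by (auto simp: eigenspace_U)
  have all: "(\<forall>u\<in>eigenspace M2 T2 z. Q u) \<longleftrightarrow> (\<forall>u\<in>eigenspace M1 T1 z. Q (U u))" for Q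
    unfolding Ball_def by (subst all_U) (simp add: eigenspace_U)
  show ?thesis unfolding finite_dim_AE_def by (subst exF) (simp add: fin sub all coef)
qed

lemma ess_spectrum_U: "ess_spectrum M2 T2 = ess_spectrum M1 T1"
proof -
  have "(\<exists>u\<in>eigenspace M2 T2 z. \<not> (AE x in M2. u x = 0)) \<longleftrightarrow> (\<exists>u\<in>eigenspace M1 T1 z. \<not> (AE x in M1. u x = 0))" for z
    unfolding Bex_def by (subst ex_U) (simp add: eigenspace_U AE_iff, simp add: U_def)
  then show ?thesis
    unfolding ess_spectrum_def discrete_spectrum_def spectrum_U finite_dim_U by simp
qed

lemma compact_resolvent_U: "compact_resolvent M2 T2 \<longleftrightarrow> compact_resolvent M1 T1"
proof -
  have comp: "(\<lambda>n. U (us n)) \<circ> r = (\<lambda>n. U ((us \<circ> r) n))" for us :: "nat \<Rightarrow> _" and r :: "nat \<Rightarrow> nat" by auto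
  have lim: "(\<exists>(r :: nat \<Rightarrow> nat) u. strict_mono r \<and> L2_tendsto M2 ((\<lambda>n. U (us n)) \<circ> r) u) \<longleftrightarrow>
    (\<exists>(r :: nat \<Rightarrow> nat) u. strict_mono r \<and> L2_tendsto M1 (us \<circ> r) u)" for us
    by (subst ex_U) (simp add: comp L2_tendsto_U, simp add: comp_def)
  show ?thesis
    unfolding compact_resolvent_def resolvent_U
    by (subst all_seq_U, subst (2) all_seq_U) (simp only: lim operator_U U_lin norm_U)
qed

end

text \<open>No measurability of \<open>f\<close> is assumed: dividing by the positive
  \<open>g\<close> shows that both sides fail to be integrable together, and then both integrals
  have the default value 0. This provides \<open>inner\<close> of \<open>mult_equiv\<close> for
  arbitrary functions.\<close>

lemma integral_density_pos:
  fixes f :: "'a \<Rightarrow> 'b::{banach, second_countable_topology}" and g :: "'a \<Rightarrow> real"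
  assumes g: "g \<in> borel_measurable M" and pos: "\<And>x. x \<in> space M \<Longrightarrow> 0 < g x"
  shows "integral\<^sup>L (density M g) f = integral\<^sup>L M (\<lambda>x. g x *\<^sub>R f x)"
    and "integrable (density M g) f \<longleftrightarrow> integrable M (\<lambda>x. g x *\<^sub>R f x)"
proof -
  have AE: "AE x in M. 0 \<le> g x" using pos by (intro AE_I2) (simp add: less_imp_le)
  have meas: "f \<in> borel_measurable M" if "(\<lambda>x. g x *\<^sub>R f x) \<in> borel_measurable M"
  proof -
    have "(\<lambda>x. (1 / g x) *\<^sub>R (g x *\<^sub>R f x)) \<in> borel_measurable M" using that g by measurable
    also have "?this \<longleftrightarrow> ?thesis" using pos by (intro measurable_cong) (auto simp: less_le)
    finally show ?thesis .
  qed
  show int: "integrable (density M g) f \<longleftrightarrow> integrable M (\<lambda>x. g x *\<^sub>R f x)"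
  proof (cases "f \<in> borel_measurable M")
    case True then show ?thesis using integrable_density[OF True g AE] by simp
  next
    case False
    then have "\<not> integrable (density M g) f" using borel_measurable_integrable by force
    moreover have "\<not> integrable M (\<lambda>x. g x *\<^sub>R f x)" using False meas borel_measurable_integrable by blast
    ultimately show ?thesis by blast
  qed
  show "integral\<^sup>L (density M g) f = integral\<^sup>L M (\<lambda>x. g x *\<^sub>R f x)"
  proof (cases "f \<in> borel_measurable M")
    case True then show ?thesis using integral_density[OF True g AE] by simp
  next
    case False
    then have n: "\<not> integrable M (\<lambda>x. g x *\<^sub>R f x)" using meas borel_measurable_integrable by blast
    then show ?thesis using int by (simp add: not_integrable_integral_eq)
  qed
qed

section \<open>Compactly supported functions on the half-line\<close>

abbreviation vd :: "(real \<Rightarrow> complex) \<Rightarrow> real \<Rightarrow> complex" where "vd f x \<equiv> vector_derivative f (at x)"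

lemma C1_cs_deriv:
  assumes "f \<in> C1_compact_support" "0 < x"
  shows "(f has_vector_derivative vd f x) (at x)"
proof -
  obtain f' where "\<forall>x\<in>{0<..}. (f has_vector_derivative f' x) (at x within {0<..})"
    using assms(1) by (auto simp: C1_compact_support_def C1_on_def)
  then have "(f has_vector_derivative f' x) (at x)"
    using assms(2) by (metis at_within_open greaterThan_iff open_greaterThan)
  then show ?thesis by (simp add: vector_derivative_at)
qed

lemma C1_cs_cont:
  assumes "f \<in> C1_compact_support"
  shows "continuous_on {0<..} (vd f)"
proof -
  obtain f' where f': "\<forall>x\<in>{0<..}. (f has_vector_derivative f' x) (at x within {0<..})" "continuous_on {0<..} f'"
    using assms(1) by (auto simp: C1_compact_support_def C1_on_def)
  have "vd f x = f' x" if "x \<in> {0<..}" for x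
    using f'(1) that by (metis at_within_open open_greaterThan vector_derivative_at)
  then show ?thesis by (intro continuous_on_eq[OF f'(2)]) auto
qed

lemma C1_cs_cont0: "f \<in> C1_compact_support \<Longrightarrow> continuous_on {0<..} f"
  by (intro continuous_at_imp_continuous_on ballI has_vector_derivative_continuous[OF C1_cs_deriv]) auto

lemma C1_csI:
  assumes d: "\<And>x. 0 < x \<Longrightarrow> (f has_vector_derivative f' x) (at x)" and c: "continuous_on {0<..} f'"
    and "0 < \<alpha>" and z: "\<And>x. 0 < x \<Longrightarrow> x < \<alpha> \<or> \<beta> < x \<Longrightarrow> f x = 0"
  shows "f \<in> C1_compact_support"
proof -
  have "C1_on {0<..} f" unfolding C1_on_def
    using d c by (intro exI[of _ f']) (auto intro: has_vector_derivative_at_within)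
  moreover have "compact {\<alpha>..\<beta>} \<and> {\<alpha>..\<beta>} \<subseteq> {0<..} \<and> (\<forall>x\<in>{0<..} - {\<alpha>..\<beta>}. f x = 0)"
    using assms(3) z by auto
  ultimately show ?thesis unfolding C1_compact_support_def by blast
qed

text \<open>The endpoints belong to the zero region, for \<open>f\<close> and for its derivative, so
  that boundary terms vanish there. Points outside the half-line are left out because
  representatives may take any values there.\<close>

definition supp_in :: "(real \<Rightarrow> complex) \<Rightarrow> real \<Rightarrow> real \<Rightarrow> bool" where
  "supp_in f \<alpha> \<beta> \<longleftrightarrow> 0 < \<alpha> \<and> \<alpha> < \<beta> \<and> (\<forall>x>0. x \<le> \<alpha> \<or> \<beta> \<le> x \<longrightarrow> f x = 0 \<and> vd f x = 0)"

lemma supp_in_mono: "supp_in f \<alpha> \<beta> \<Longrightarrow> 0 < \<alpha>' \<Longrightarrow> \<alpha>' \<le> \<alpha> \<Longrightarrow> \<beta> \<le> \<beta>' \<Longrightarrow> supp_in f \<alpha>' \<beta>'"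
  unfolding supp_in_def by fastforce

lemma vd_zero_open:
  assumes "open S" "x \<in> S" "\<And>y. y \<in> S \<Longrightarrow> f y = 0"
  shows "vd f x = 0"
proof -
  have "(f has_vector_derivative 0) (at x)"
    by (rule has_vector_derivative_transform_within_open[OF has_vector_derivative_const[of 0] assms(1,2)])
      (use assms(3) in auto)
  then show ?thesis by (rule vector_derivative_at)
qed

lemma C1_cs_supp:
  assumes "f \<in> C1_compact_support"
  shows "\<exists>\<alpha> \<beta>. supp_in f \<alpha> \<beta>"
proof -
  obtain K where K: "compact K" "K \<subseteq> {0<..}" "\<And>x. x \<in> {0<..} - K \<Longrightarrow> f x = 0"
    using assms by (auto simp: C1_compact_support_def)
  have "\<exists>l u. 0 < l \<and> l \<le> u \<and> K \<subseteq> {l..u}"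
  proof (cases "K = {}")
    case True then show ?thesis by (intro exI[of _ 1]) auto
  next
    case False
    obtain l where l: "l \<in> K" "\<And>t. t \<in> K \<Longrightarrow> l \<le> t" using compact_attains_inf[OF K(1) False] by blast
    obtain u where u: "u \<in> K" "\<And>t. t \<in> K \<Longrightarrow> t \<le> u" using compact_attains_sup[OF K(1) False] by blast
    show ?thesis using l u K(2) by (intro exI[of _ l] exI[of _ u]) auto
  qed
  then obtain l u where lu: "0 < l" "l \<le> u" "K \<subseteq> {l..u}" by blast
  have z: "f x = 0" if "x \<in> {0<..<l} \<union> {u<..}" for x
    using that lu by (intro K(3)) auto
  \<comment> \<open>Widening the interval places both endpoints in an open set on which
    \<open>f\<close> vanishes, so the derivative is zero there too.\<close>
  have "supp_in f (l / 2) (u + 1)"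
    unfolding supp_in_def
  proof (intro conjI allI impI)
    fix x :: real assume x: "0 < x" "x \<le> l / 2 \<or> u + 1 \<le> x"
    have xS: "x \<in> {0<..<l} \<union> {u<..}" using x lu by auto
    show "f x = 0" by (rule z[OF xS])
    show "vd f x = 0" by (rule vd_zero_open[OF _ xS z]) (intro open_Un open_greaterThan open_greaterThanLessThan)
  qed (use lu in auto)
  then show ?thesis by blast
qed

lemma C1_cs_supp2:
  assumes "f \<in> C1_compact_support" "g \<in> C1_compact_support"
  shows "\<exists>\<alpha> \<beta>. supp_in f \<alpha> \<beta> \<and> supp_in g \<alpha> \<beta>"
proof -
  obtain \<alpha> \<beta> \<alpha>' \<beta>' where *: "supp_in f \<alpha> \<beta>" "supp_in g \<alpha>' \<beta>'" using assms C1_cs_supp by metis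
  have p: "0 < min \<alpha> \<alpha>'" using * by (auto simp: supp_in_def)
  have "supp_in f (min \<alpha> \<alpha>') (max \<beta> \<beta>')" by (rule supp_in_mono[OF *(1) p]) auto
  moreover have "supp_in g (min \<alpha> \<alpha>') (max \<beta> \<beta>')" by (rule supp_in_mono[OF *(2) p]) auto
  ultimately show ?thesis by blast
qed

lemma vd_lin:
  assumes "f \<in> C1_compact_support" "g \<in> C1_compact_support" "0 < x"
  shows "((\<lambda>x. f x + c * g x) has_vector_derivative vd f x + c * vd g x) (at x)"
    "vd (\<lambda>x. f x + c * g x) x = vd f x + c * vd g x"
proof -
  show "((\<lambda>x. f x + c * g x) has_vector_derivative vd f x + c * vd g x) (at x)"
    by (intro has_vector_derivative_add has_vector_derivative_mult_right C1_cs_deriv assms)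
  then show "vd (\<lambda>x. f x + c * g x) x = vd f x + c * vd g x" by (rule vector_derivative_at)
qed

lemma C1_cs_lin:
  assumes f: "f \<in> C1_compact_support" and g: "g \<in> C1_compact_support"
  shows "(\<lambda>x. f x + c * g x) \<in> C1_compact_support"
proof -
  obtain \<alpha> \<beta> where s: "supp_in f \<alpha> \<beta>" "supp_in g \<alpha> \<beta>" using C1_cs_supp2[OF f g] by blast
  show ?thesis
    by (rule C1_csI[where f' = "\<lambda>x. vd f x + c * vd g x" and \<alpha> = \<alpha> and \<beta> = \<beta>])
      (use vd_lin(1)[OF f g] C1_cs_cont[OF f] C1_cs_cont[OF g] s in \<open>auto simp: supp_in_def intro!: continuous_intros\<close>)
qed

lemma supp_in_lin:
  assumes "f \<in> C1_compact_support" "g \<in> C1_compact_support" "supp_in f \<alpha> \<beta>" "supp_in g \<alpha> \<beta>"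
  shows "supp_in (\<lambda>x. f x + c * g x) \<alpha> \<beta>"
  using assms vd_lin(2)[OF assms(1,2)] by (simp add: supp_in_def)

text \<open>The bridge from the Lebesgue integrals of the definitions to integrals over compact
  intervals, where the fundamental theorem of calculus applies.\<close>

lemma integral_reduce:
  fixes F :: "real \<Rightarrow> 'a::euclidean_space"
  assumes "0 < \<alpha>" "continuous_on {\<alpha>..\<beta>} F" "\<And>x. 0 < x \<Longrightarrow> x < \<alpha> \<or> \<beta> < x \<Longrightarrow> F x = 0"
  shows "set_integrable lborel {0<..} F" "(LINT x:{0<..}|lborel. F x) = integral {\<alpha>..\<beta>} F"
proof -
  have eq: "indicator {0<..} x *\<^sub>R F x = indicator {\<alpha>..\<beta>} x *\<^sub>R F x" for x
    using assms by (auto simp: indicator_def)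
  have i: "set_integrable lborel {\<alpha>..\<beta>} F" by (rule borel_integrable_atLeastAtMost'[OF assms(2)])
  then show "set_integrable lborel {0<..} F" unfolding set_integrable_def eq .
  have "(LINT x:{0<..}|lborel. F x) = (LINT x:{\<alpha>..\<beta>}|lborel. F x)" unfolding set_lebesgue_integral_def eq ..
  also have "\<dots> = integral {\<alpha>..\<beta>} F" by (rule set_borel_integral_eq_integral(2)[OF i])
  finally show "(LINT x:{0<..}|lborel. F x) = integral {\<alpha>..\<beta>} F" .
qed

lemma integral_from_0:
  fixes g :: "real \<Rightarrow> real"
  assumes g: "continuous_on {0..} g"
  shows "continuous_on {0..} (\<lambda>x. integral {0..x} g)"
    and "0 < x \<Longrightarrow> ((\<lambda>x. integral {0..x} g) has_real_derivative g x) (at x)"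
proof -
  have c: "continuous_on {0..X} g" for X by (rule continuous_on_subset[OF g]) auto
  show "continuous_on {0..} (\<lambda>x. integral {0..x} g)"
    unfolding continuous_on_eq_continuous_within
  proof
    fix x :: real assume x: "x \<in> {0..}"
    have "continuous_on {0..x+1} (\<lambda>x. integral {0..x} g)"
      by (intro indefinite_integral_continuous_1 integrable_continuous_interval c)
    then have "continuous (at x within {0..x+1}) (\<lambda>x. integral {0..x} g)"
      using x by (simp add: continuous_on_eq_continuous_within)
    moreover have "at x within {0..x+1} = at x within {0..}"
      using x by (intro at_within_nhd[of x "{..<x+1}"]) auto
    ultimately show "continuous (at x within {0..}) (\<lambda>x. integral {0..x} g)" by simp
  qed
  assume x: "0 < x"
  have "((\<lambda>x. integral {0..x} g) has_real_derivative g x) (at x within {0..x+1})"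
    using x by (intro integral_has_real_derivative c) auto
  then show "((\<lambda>x. integral {0..x} g) has_real_derivative g x) (at x)"
    using x at_within_Icc_at[of 0 x "x+1"] by simp
qed

lemma at_pos_within: "0 < x \<Longrightarrow> at x within {0<..} = at (x::real)"
  by (rule at_within_open) auto

lemma borel_measurable_restrict_lborel:
  "borel_measurable (restrict_space lborel A) = borel_measurable (restrict_space borel A)"
  by (intro measurable_cong_sets sets_restrict_space_cong) simp_all

section \<open>The diffusion form: pointwise estimates and closability\<close>

locale diffusion =
  fixes a b :: "real \<Rightarrow> real"
  assumes a_cont: "continuous_on {0..} a" and a_pos: "\<And>x. 0 \<le> x \<Longrightarrow> 0 < a x"
    and b_cont: "continuous_on {0..} b"
begin

abbreviation B :: "real \<Rightarrow> real" where "B \<equiv> BB a b"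
definition E :: "real \<Rightarrow> real" where "E x = exp (2 * B x)"
definition aE :: "real \<Rightarrow> real" where "aE x = a x * E x"
definition s :: "real \<Rightarrow> real" where "s x = scale_dens a b x"
definition S :: "real \<Rightarrow> real" where "S x = integral {0..x} s"

abbreviation Q :: "real form" where "Q \<equiv> Q_D a b"
abbreviation M :: "real measure" where "M \<equiv> M_D a b"
abbreviation cs :: "(real \<Rightarrow> complex) set" where "cs \<equiv> C1_compact_support"

lemma ba_cont: "continuous_on {0..} (\<lambda>y. b y / a y)"
  using a_cont b_cont a_pos by (intro continuous_intros) (auto simp: less_le)

lemma B_cont: "continuous_on {0..} B"
  unfolding BB_def using integral_from_0(1)[OF ba_cont] .

lemma B_deriv: "0 < x \<Longrightarrow> (B has_real_derivative b x / a x) (at x)"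
  unfolding BB_def using integral_from_0(2)[OF ba_cont] .

lemma E_pos: "0 < E x" by (simp add: E_def)

lemma E_cont: "continuous_on {0..} E"
  unfolding E_def by (intro continuous_intros B_cont)

lemma aE_pos: "0 \<le> x \<Longrightarrow> 0 < aE x" by (simp add: aE_def a_pos E_pos)

lemma aE_cont: "continuous_on {0..} aE"
  unfolding aE_def by (intro continuous_intros E_cont a_cont)

lemma s_eq: "s x = 1 / aE x"
  by (simp add: s_def scale_dens_def aE_def E_def exp_minus field_simps)

lemma s_pos: "0 \<le> x \<Longrightarrow> 0 < s x" by (simp add: s_eq aE_pos)

lemma s_cont: "continuous_on {0..} s"
proof -
  have "continuous_on {0..} (\<lambda>x. 1 / aE x)" using aE_cont aE_pos by (intro continuous_intros) (auto simp: less_le)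
  then show ?thesis by (simp add: s_eq[abs_def])
qed

lemma S_cont: "continuous_on {0..} S"
  unfolding S_def using integral_from_0(1)[OF s_cont] .

lemma S_deriv: "0 < x \<Longrightarrow> (S has_real_derivative s x) (at x)"
  unfolding S_def using integral_from_0(2)[OF s_cont] .

lemma S_integral:
  assumes "0 \<le> x" "x \<le> y"
  shows "integral {x..y} s = S y - S x"
proof -
  have "s integrable_on {0..y}" using s_cont by (intro integrable_continuous_interval) (auto intro: continuous_on_subset)
  from Henstock_Kurzweil_Integration.integral_combine[OF assms this] show ?thesis by (simp add: S_def)
qed

lemma S_mono: "0 \<le> x \<Longrightarrow> x \<le> y \<Longrightarrow> S x \<le> S y"
  using S_integral[of x y] Henstock_Kurzweil_Integration.integral_nonneg[of s "{x..y}"] s_pos s_cont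
  by (force intro: integrable_continuous_interval continuous_on_subset less_imp_le)

lemma cont_sub: "continuous_on {0..} F \<Longrightarrow> 0 < \<alpha> \<Longrightarrow> continuous_on {\<alpha>..\<beta>} (F :: real \<Rightarrow> real)"
  by (erule continuous_on_subset) auto

lemma cs_cont:
  assumes "f \<in> cs" "0 < \<alpha>"
  shows "continuous_on {\<alpha>..\<beta>} f" "continuous_on {\<alpha>..\<beta>} (vd f)"
  using C1_cs_cont0[OF assms(1)] C1_cs_cont[OF assms(1)] assms(2) by (auto elim!: continuous_on_subset)

lemma E_meas: "E \<in> borel_measurable (restrict_space lborel {0<..})"
proof -
  have "continuous_on {0<..} E" by (rule continuous_on_subset[OF E_cont]) auto
  then show ?thesis unfolding borel_measurable_restrict_lborel by (rule borel_measurable_continuous_on_restrict)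
qed

lemma M_eq: "M = density (restrict_space lborel {0<..}) (\<lambda>x. ennreal (E x))"
  by (simp add: M_D_def E_def)

lemma M_integral:
  fixes F :: "real \<Rightarrow> 'a::{banach, second_countable_topology}"
  shows "integral\<^sup>L M F = (LINT x:{0<..}|lborel. E x *\<^sub>R F x)"
    and "integrable M F \<longleftrightarrow> set_integrable lborel {0<..} (\<lambda>x. E x *\<^sub>R F x)"
  unfolding M_eq using integral_density_pos[OF E_meas E_pos, of F]
  by (simp_all add: integral_restrict_space integrable_restrict_space set_lebesgue_integral_def set_integrable_def)

lemma M_sets: "borel_measurable M = borel_measurable (restrict_space lborel {0<..})"
  by (rule measurable_cong_sets) (simp_all add: M_eq)

lemma cont_meas_M: "continuous_on {0<..} F \<Longrightarrow> (F :: real \<Rightarrow> complex) \<in> borel_measurable M"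
  unfolding M_sets borel_measurable_restrict_lborel by (rule borel_measurable_continuous_on_restrict)

lemma cs_L2:
  assumes f: "f \<in> cs"
  shows "f \<in> L2 M"
proof -
  obtain \<alpha> \<beta> where s: "supp_in f \<alpha> \<beta>" using C1_cs_supp[OF f] by blast
  have p: "0 < \<alpha>" using s by (simp add: supp_in_def)
  have "set_integrable lborel {0<..} (\<lambda>x. E x *\<^sub>R (cmod (f x))\<^sup>2)"
    by (rule integral_reduce(1)[OF p, of \<beta>]) (use s p in \<open>auto simp: supp_in_def intro!: continuous_intros cs_cont[OF f] cont_sub[OF E_cont]\<close>)
  then show ?thesis unfolding L2_def using cont_meas_M[OF C1_cs_cont0[OF f]] M_integral(2) by blast
qed

lemma inner_cs:
  assumes f: "f \<in> cs" and g: "g \<in> cs" and s: "supp_in f \<alpha> \<beta>"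
  shows "L2_inner M f g = integral {\<alpha>..\<beta>} (\<lambda>x. E x *\<^sub>R (f x * cnj (g x)))"
proof -
  have p: "0 < \<alpha>" using s by (simp add: supp_in_def)
  show ?thesis unfolding L2_inner_def M_integral(1)
    by (rule integral_reduce(2)[OF p]) (use s p in \<open>auto simp: supp_in_def intro!: continuous_intros cs_cont[OF f] cs_cont[OF g] cont_sub[OF E_cont]\<close>)
qed

lemma Q_cs:
  assumes f: "f \<in> cs" and g: "g \<in> cs" and s: "supp_in f \<alpha> \<beta>"
  shows "Q f g = 1/2 * integral {\<alpha>..\<beta>} (\<lambda>x. aE x *\<^sub>R (vd f x * cnj (vd g x)))"
proof -
  have p: "0 < \<alpha>" using s by (simp add: supp_in_def)
  have "(LINT x:{0<..}|lborel. of_real (a x) * vd f x * cnj (vd g x) * of_real (exp (2 * B x)))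
      = (LINT x:{0<..}|lborel. aE x *\<^sub>R (vd f x * cnj (vd g x)))"
    unfolding aE_def E_def by (simp add: scaleR_conv_of_real mult_ac)
  also have "\<dots> = integral {\<alpha>..\<beta>} (\<lambda>x. aE x *\<^sub>R (vd f x * cnj (vd g x)))"
    by (rule integral_reduce(2)[OF p]) (use s p in \<open>auto simp: supp_in_def intro!: continuous_intros cs_cont[OF f] cs_cont[OF g] cont_sub[OF aE_cont]\<close>)
  finally show ?thesis by (simp add: Q_D_def)
qed

lemma integral_of_real_cont:
  fixes F :: "real \<Rightarrow> real"
  assumes "continuous_on {\<alpha>..\<beta>} F"
  shows "integral {\<alpha>..\<beta>} (\<lambda>x. complex_of_real (F x)) = of_real (integral {\<alpha>..\<beta>} F)"
  by (rule integral_unique[OF has_integral_of_real[OF integrable_integral]]) (rule integrable_continuous_interval[OF assms])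

lemma N2_cs:
  assumes f: "f \<in> cs" and s: "supp_in f \<alpha> \<beta>"
  shows "Re (L2_inner M f f) = integral {\<alpha>..\<beta>} (\<lambda>x. E x * (cmod (f x))\<^sup>2)"
proof -
  have p: "0 < \<alpha>" using s by (simp add: supp_in_def)
  have eq: "E x *\<^sub>R (f x * cnj (f x)) = of_real (E x * (cmod (f x))\<^sup>2)" for x
    by (simp only: scaleR_conv_of_real of_real_mult complex_norm_square)
  have i: "integral {\<alpha>..\<beta>} (\<lambda>x. complex_of_real (E x * (cmod (f x))\<^sup>2)) = of_real (integral {\<alpha>..\<beta>} (\<lambda>x. E x * (cmod (f x))\<^sup>2))"
    by (rule integral_of_real_cont) (use p in \<open>auto intro!: continuous_intros cs_cont[OF f] cont_sub[OF E_cont]\<close>)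
  show ?thesis unfolding inner_cs[OF f f s] eq i by (rule Re_complex_of_real)
qed

lemma sqQ_cs:
  assumes f: "f \<in> cs" and s: "supp_in f \<alpha> \<beta>"
  shows "Re (Q f f) = 1/2 * integral {\<alpha>..\<beta>} (\<lambda>x. aE x * (cmod (vd f x))\<^sup>2)"
proof -
  have p: "0 < \<alpha>" using s by (simp add: supp_in_def)
  have eq: "aE x *\<^sub>R (vd f x * cnj (vd f x)) = of_real (aE x * (cmod (vd f x))\<^sup>2)" for x
    by (simp only: scaleR_conv_of_real of_real_mult complex_norm_square)
  have i: "integral {\<alpha>..\<beta>} (\<lambda>x. complex_of_real (aE x * (cmod (vd f x))\<^sup>2)) = of_real (integral {\<alpha>..\<beta>} (\<lambda>x. aE x * (cmod (vd f x))\<^sup>2))"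
    by (rule integral_of_real_cont) (use p in \<open>auto intro!: continuous_intros cs_cont[OF f] cont_sub[OF aE_cont]\<close>)
  show ?thesis unfolding Q_cs[OF f f s] eq i by simp
qed

lemma energy_sub:
  assumes f: "f \<in> cs" and xy: "0 < x" "x \<le> y"
  shows "integral {x..y} (\<lambda>x. aE x * (cmod (vd f x))\<^sup>2) \<le> 2 * Re (Q f f)"
    and "integral {x..y} (\<lambda>x. E x * (cmod (f x))\<^sup>2) \<le> Re (L2_inner M f f)"
proof -
  obtain \<alpha> \<beta> where s0: "supp_in f \<alpha> \<beta>" using C1_cs_supp[OF f] by blast
  have "0 < \<alpha>" using s0 by (simp add: supp_in_def)
  then have s: "supp_in f (min x \<alpha>) (max y \<beta>)" using xy(1) by (intro supp_in_mono[OF s0]) auto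
  have p: "0 < min x \<alpha>" using s by (simp add: supp_in_def)
  have "integral {x..y} (\<lambda>x. aE x * (cmod (vd f x))\<^sup>2) \<le> integral {min x \<alpha>..max y \<beta>} (\<lambda>x. aE x * (cmod (vd f x))\<^sup>2)"
    by (intro integral_subset_le integrable_continuous_interval)
      (use p xy in \<open>auto intro!: continuous_intros cs_cont[OF f] cont_sub[OF aE_cont] mult_nonneg_nonneg less_imp_le[OF aE_pos]\<close>)
  then show "integral {x..y} (\<lambda>x. aE x * (cmod (vd f x))\<^sup>2) \<le> 2 * Re (Q f f)" unfolding sqQ_cs[OF f s] by simp
  have "integral {x..y} (\<lambda>x. E x * (cmod (f x))\<^sup>2) \<le> integral {min x \<alpha>..max y \<beta>} (\<lambda>x. E x * (cmod (f x))\<^sup>2)"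
    by (intro integral_subset_le integrable_continuous_interval)
      (use p xy in \<open>auto intro!: continuous_intros cs_cont[OF f] cont_sub[OF E_cont] mult_nonneg_nonneg less_imp_le[OF E_pos]\<close>)
  then show "integral {x..y} (\<lambda>x. E x * (cmod (f x))\<^sup>2) \<le> Re (L2_inner M f f)" unfolding N2_cs[OF f s] .
qed

lemma semi_ip_Q: "semi_ip cs Q"
proof
  show "cs \<noteq> {}" using C1_csI[of "\<lambda>_. 0" "\<lambda>_. 0" 1 1] by auto
  show "(\<lambda>x. f x + c * g x) \<in> cs" if "f \<in> cs" "g \<in> cs" for f g c using that by (rule C1_cs_lin)
  show "Q (\<lambda>x. f x + c * g x) h = Q f h + c * Q g h" if f: "f \<in> cs" and g: "g \<in> cs" and h: "h \<in> cs" for f g h c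
  proof -
    obtain \<alpha> \<beta> where s: "supp_in f \<alpha> \<beta>" "supp_in g \<alpha> \<beta>" using C1_cs_supp2[OF f g] by blast
    have p: "0 < \<alpha>" using s by (simp add: supp_in_def)
    have i: "(\<lambda>x. aE x *\<^sub>R (vd k x * cnj (vd h x))) integrable_on {\<alpha>..\<beta>}" if "k \<in> cs" for k
      using p by (intro integrable_continuous_interval) (auto intro!: continuous_intros cs_cont[OF that] cs_cont[OF h] cont_sub[OF aE_cont])
    have "integral {\<alpha>..\<beta>} (\<lambda>x. aE x *\<^sub>R (vd (\<lambda>x. f x + c * g x) x * cnj (vd h x)))
        = integral {\<alpha>..\<beta>} (\<lambda>x. aE x *\<^sub>R (vd f x * cnj (vd h x)) + c * (aE x *\<^sub>R (vd g x * cnj (vd h x))))"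
      by (rule Henstock_Kurzweil_Integration.integral_cong)
        (use p in \<open>auto simp: vd_lin(2)[OF f g] algebra_simps\<close>)
    also have "\<dots> = integral {\<alpha>..\<beta>} (\<lambda>x. aE x *\<^sub>R (vd f x * cnj (vd h x))) + c * integral {\<alpha>..\<beta>} (\<lambda>x. aE x *\<^sub>R (vd g x * cnj (vd h x)))"
      by (intro integral_unique has_integral_add has_integral_mult_right integrable_integral i f g)
    finally show ?thesis
      unfolding Q_cs[OF C1_cs_lin[OF f g] h supp_in_lin[OF f g s]] Q_cs[OF f h s(1)] Q_cs[OF g h s(2)]
      by (simp add: algebra_simps)
  qed
  show "Q g f = cnj (Q f g)" if f: "f \<in> cs" and g: "g \<in> cs" for f g
  proof -
    obtain \<alpha> \<beta> where s: "supp_in f \<alpha> \<beta>" "supp_in g \<alpha> \<beta>" using C1_cs_supp2[OF f g] by blast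
    show ?thesis
      unfolding Q_cs[OF f g s(1)] Q_cs[OF g f s(2)]
      by (simp add: Henstock_Kurzweil_Integration.integral_cnj mult.commute)
  qed
  show "0 \<le> Re (Q f f)" if f: "f \<in> cs" for f
  proof -
    obtain \<alpha> \<beta> where s: "supp_in f \<alpha> \<beta>" using C1_cs_supp[OF f] by blast
    have p: "0 < \<alpha>" using s by (simp add: supp_in_def)
    have "0 \<le> integral {\<alpha>..\<beta>} (\<lambda>x. aE x * (cmod (vd f x))\<^sup>2)"
      by (intro Henstock_Kurzweil_Integration.integral_nonneg integrable_continuous_interval)
        (use p in \<open>auto intro!: continuous_intros cs_cont[OF f] cont_sub[OF aE_cont] mult_nonneg_nonneg less_imp_le[OF aE_pos]\<close>)
    then show ?thesis unfolding sqQ_cs[OF f s] by simp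
  qed
qed

text \<open>Cauchy-Schwarz in additive form: \<open>aE * s = 1\<close> gives
  \<open>2 * |f'| \<le> t * s + aE * |f'|^2 / t\<close>. The value \<open>t = 1\<close> serves for
  boundedness, a large \<open>t\<close> for equicontinuity.\<close>

lemma pointwise_bound:
  assumes f: "f \<in> cs" and xy: "0 < x" "x \<le> y" and t: "0 < t"
  shows "integral {x..y} (\<lambda>r. cmod (vd f r)) \<le> (t * (S y - S x) + 2 * Re (Q f f) / t) / 2"
    and "cmod (f y - f x) \<le> (t * (S y - S x) + 2 * Re (Q f f) / t) / 2"
proof -
  have i: "(\<lambda>r. cmod (vd f r)) integrable_on {x..y}" "vd f integrable_on {x..y}"
    "(\<lambda>r. aE r * (cmod (vd f r))\<^sup>2) integrable_on {x..y}" "s integrable_on {x..y}"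
    by (intro integrable_continuous_interval; use xy in \<open>auto intro!: continuous_intros cs_cont[OF f] cont_sub[OF aE_cont] cont_sub[OF s_cont]\<close>)+
  let ?F = "\<lambda>r. t / 2 * s r + 1 / (2 * t) * (aE r * (cmod (vd f r))\<^sup>2)"
  have hi: "(?F has_integral t / 2 * integral {x..y} s + 1 / (2 * t) * integral {x..y} (\<lambda>r. aE r * (cmod (vd f r))\<^sup>2)) {x..y}"
    by (intro has_integral_add has_integral_mult_right integrable_integral i)
  have "integral {x..y} (\<lambda>r. cmod (vd f r)) \<le> integral {x..y} ?F"
  proof (rule Henstock_Kurzweil_Integration.integral_le[OF i(1)])
    show "?F integrable_on {x..y}" using hi by blast
    fix r assume "r \<in> {x..y}"
    then have p: "aE r > 0" using xy by (intro aE_pos) auto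
    have "0 \<le> (t - aE r * cmod (vd f r))\<^sup>2" by simp
    then have "2 * t * aE r * cmod (vd f r) \<le> t * t + aE r * aE r * (cmod (vd f r))\<^sup>2"
      by (simp add: power2_eq_square algebra_simps)
    then have "(2 * t * aE r * cmod (vd f r)) / (2 * t * aE r) \<le> (t * t + aE r * aE r * (cmod (vd f r))\<^sup>2) / (2 * t * aE r)"
      using t p by (intro divide_right_mono) auto
    then show "cmod (vd f r) \<le> ?F r" using t p by (simp add: s_eq add_divide_distrib)
  qed
  also have "\<dots> = t / 2 * integral {x..y} s + 1 / (2 * t) * integral {x..y} (\<lambda>r. aE r * (cmod (vd f r))\<^sup>2)"
    by (rule integral_unique[OF hi])
  also have "\<dots> \<le> t / 2 * (S y - S x) + 1 / (2 * t) * (2 * Re (Q f f))"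
    using energy_sub(1)[OF f xy] S_integral[of x y] xy t by (intro add_mono mult_left_mono) auto
  also have "\<dots> = (t * (S y - S x) + 2 * Re (Q f f) / t) / 2" by (simp add: field_simps)
  finally show 1: "integral {x..y} (\<lambda>r. cmod (vd f r)) \<le> (t * (S y - S x) + 2 * Re (Q f f) / t) / 2" .
  have "(vd f has_integral f y - f x) {x..y}"
    by (rule fundamental_theorem_of_calculus[OF xy(2) has_vector_derivative_at_within[OF C1_cs_deriv[OF f]]])
      (use xy in auto)
  then have "cmod (f y - f x) = cmod (integral {x..y} (vd f))" by (simp add: integral_unique)
  also have "\<dots> \<le> integral {x..y} (\<lambda>r. cmod (vd f r))"
    by (rule Henstock_Kurzweil_Integration.integral_norm_bound_integral[OF i(2,1)]) simp
  finally show "cmod (f y - f x) \<le> (t * (S y - S x) + 2 * Re (Q f f) / t) / 2" using 1 by linarith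
qed

text \<open>The factor \<open>aE * cnj (vd g)\<close> is merely continuous, so the derivative cannot
  be moved off \<open>us n\<close> directly. A polynomial approximation of the factor can be
  differentiated; its error is multiplied by the integral of \<open>cmod (vd (us n))\<close>, which
  the form bounds.\<close>

lemma Q_weak_null:
  assumes u: "\<And>n. us n \<in> cs" and g: "g \<in> cs" and bd: "\<And>n. Re (Q (us n) (us n)) \<le> C"
    and null: "(\<lambda>n. Re (L2_inner M (us n) (us n))) \<longlonglongrightarrow> 0"
  shows "(\<lambda>n. Q (us n) g) \<longlonglongrightarrow> 0"
proof (rule LIMSEQ_I)
  fix e :: real assume e: "e > 0"
  interpret Q: semi_ip cs Q by (rule semi_ip_Q)
  obtain \<alpha> \<beta> where sg: "supp_in g \<alpha> \<beta>" using C1_cs_supp[OF g] by blast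
  have p: "0 < \<alpha>" "\<alpha> < \<beta>" and zg: "vd g \<alpha> = 0" "vd g \<beta> = 0" using sg by (auto simp: supp_in_def)
  define \<psi> where "\<psi> x = aE x *\<^sub>R cnj (vd g x)" for x
  have psi_cont: "continuous_on {\<alpha>..\<beta>} \<psi>" unfolding \<psi>_def
    using p by (auto intro!: continuous_intros cs_cont[OF g] cont_sub[OF aE_cont])
  have psi0: "\<psi> \<alpha> = 0" "\<psi> \<beta> = 0" using zg by (simp_all add: \<psi>_def)
  \<comment> \<open>A bound, uniform in \<open>n\<close>, for the integral of
    \<open>cmod (vd (us n))\<close>; the last 1 makes it positive. The corrected polynomial has
    error \<open>4 * \<epsilon>\<close>, so \<open>\<epsilon> = e / (8 * L)\<close> leaves
    \<open>e / 2\<close> for this part.\<close>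
  define L where "L = (S \<beta> - S \<alpha> + 2 * C) / 2 + 1"
  have C0: "C \<ge> 0" using bd[of 0] Q.ip_nonneg[OF u, of 0] by linarith
  have L: "L > 0" using S_mono[of \<alpha> \<beta>] p C0 by (simp add: L_def add_nonneg_pos)
  define \<epsilon> where "\<epsilon> = e / (8 * L)"
  have eps: "\<epsilon> > 0" using e L by (simp add: \<epsilon>_def)
  obtain p0 where p0: "polynomial_function p0" "\<And>x. x \<in> {\<alpha>..\<beta>} \<Longrightarrow> norm (\<psi> x - p0 x) < \<epsilon>"
    using Stone_Weierstrass_polynomial_function[OF compact_Icc psi_cont eps] by blast
  obtain p0' where p0': "polynomial_function p0'" "\<And>x. (p0 has_vector_derivative p0' x) (at x)"
    using has_vector_derivative_polynomial_function[OF p0(1)] by blast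
  text \<open>Subtracting the linear interpolation of the boundary values avoids boundary terms below.\<close>
  define c where "c = (1 / (\<beta> - \<alpha>)) *\<^sub>R (p0 \<beta> - p0 \<alpha>)"
  define P where "P x = p0 x - (p0 \<alpha> + (x - \<alpha>) *\<^sub>R c)" for x
  define P' where "P' x = p0' x - c" for x
  have P_deriv: "(P has_vector_derivative P' x) (at x)" for x
    unfolding P_def P'_def by (auto intro!: derivative_eq_intros p0'(2))
  have P_cont: "continuous_on {\<alpha>..\<beta>} P"
    by (intro continuous_at_imp_continuous_on ballI has_vector_derivative_continuous[OF P_deriv])
  have P'_cont: "continuous_on {\<alpha>..\<beta>} P'"
    unfolding P'_def by (intro continuous_intros continuous_on_polymonial_function p0')
  have P0: "P \<alpha> = 0" "P \<beta> = 0" using p by (simp_all add: P_def c_def)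
  have Pclose: "cmod (\<psi> x - P x) \<le> 4 * \<epsilon>" if x: "x \<in> {\<alpha>..\<beta>}" for x
  proof -
    have b: "cmod (p0 \<alpha>) \<le> \<epsilon>" "cmod (p0 \<beta>) \<le> \<epsilon>"
      using p0(2)[of \<alpha>] p0(2)[of \<beta>] psi0 p by auto
    have "cmod ((x - \<alpha>) *\<^sub>R c) = (x - \<alpha>) / (\<beta> - \<alpha>) * cmod (p0 \<beta> - p0 \<alpha>)"
      using x p by (simp add: c_def)
    also have "\<dots> \<le> 1 * (2 * \<epsilon>)"
      using x p b norm_triangle_ineq4[of "p0 \<beta>" "p0 \<alpha>"] by (intro mult_mono) auto
    finally have 1: "cmod ((x - \<alpha>) *\<^sub>R c) \<le> 2 * \<epsilon>" by simp
    have eq: "\<psi> x - P x = (\<psi> x - p0 x) + (p0 \<alpha> + (x - \<alpha>) *\<^sub>R c)" by (simp add: P_def)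
    have "cmod (\<psi> x - P x) \<le> cmod (\<psi> x - p0 x) + (cmod (p0 \<alpha>) + cmod ((x - \<alpha>) *\<^sub>R c))"
      unfolding eq by (intro order_trans[OF norm_triangle_ineq] add_left_mono norm_triangle_ineq)
    then show ?thesis using p0(2)[OF x] b(1) 1 by linarith
  qed
  obtain m where m: "m > 0" "\<And>x. x \<in> {\<alpha>..\<beta>} \<Longrightarrow> cmod (P' x) \<le> m"
  proof -
    have "bounded (P' ` {\<alpha>..\<beta>})" by (intro compact_imp_bounded compact_continuous_image P'_cont compact_Icc)
    then show thesis using that unfolding bounded_pos by auto
  qed
  obtain e0 where e0: "e0 > 0" "\<And>x. x \<in> {\<alpha>..\<beta>} \<Longrightarrow> e0 \<le> E x"
  proof -
    have ne: "{\<alpha>..\<beta>} \<noteq> {}" using p by auto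
    obtain x where "x \<in> {\<alpha>..\<beta>}" "\<And>y. y \<in> {\<alpha>..\<beta>} \<Longrightarrow> E x \<le> E y"
      using continuous_attains_inf[OF compact_Icc ne cont_sub[OF E_cont p(1)]] by blast
    then show thesis using that[of "E x"] E_pos by blast
  qed
  \<comment> \<open>\<open>cmod (us n x)\<close> is again split additively. This \<open>t\<close>
    makes the constant part \<open>e / 4\<close>, and the threshold for \<open>N\<close> makes the
    L2 part \<open>e / 4\<close> as well.\<close>
  define t where "t = e / (2 * m * (\<beta> - \<alpha>))"
  have t: "t > 0" using e m p by (simp add: t_def)
  have "\<forall>\<^sub>F n in sequentially. Re (L2_inner M (us n) (us n)) < e * t * e0 / (2 * m)"
    using null e t e0(1) m(1) by (intro order_tendstoD) auto
  then obtain N where N: "\<And>n. n \<ge> N \<Longrightarrow> Re (L2_inner M (us n) (us n)) < e * t * e0 / (2 * m)"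
    using eventually_sequentially by auto
  have "norm (Q (us n) g - 0) < e" if n: "n \<ge> N" for n
  proof -
    let ?u = "us n"
    have i: "(\<lambda>x. (\<psi> x - P x) * vd ?u x) integrable_on {\<alpha>..\<beta>}" "(\<lambda>x. P x * vd ?u x) integrable_on {\<alpha>..\<beta>}"
      "(\<lambda>x. P' x * ?u x) integrable_on {\<alpha>..\<beta>}" "(\<lambda>x. 4 * \<epsilon> * cmod (vd ?u x)) integrable_on {\<alpha>..\<beta>}"
      "(\<lambda>x. cmod (vd ?u x)) integrable_on {\<alpha>..\<beta>}" "(\<lambda>x. E x * (cmod (?u x))\<^sup>2) integrable_on {\<alpha>..\<beta>}"
      by (intro integrable_continuous_interval; use p in \<open>auto intro!: continuous_intros cs_cont[OF u] psi_cont P_cont P'_cont cont_sub[OF E_cont]\<close>)+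
    have "Q ?u g = cnj (Q g ?u)" by (rule Q.ip_sym[OF g u])
    also have "\<dots> = 1/2 * integral {\<alpha>..\<beta>} (\<lambda>x. \<psi> x * vd ?u x)"
      unfolding Q_cs[OF g u sg] by (simp add: Henstock_Kurzweil_Integration.integral_cnj \<psi>_def)
    also have "integral {\<alpha>..\<beta>} (\<lambda>x. \<psi> x * vd ?u x) = integral {\<alpha>..\<beta>} (\<lambda>x. (\<psi> x - P x) * vd ?u x + P x * vd ?u x)"
      by (simp add: algebra_simps)
    also have "\<dots> = integral {\<alpha>..\<beta>} (\<lambda>x. (\<psi> x - P x) * vd ?u x) + integral {\<alpha>..\<beta>} (\<lambda>x. P x * vd ?u x)"
      by (rule Henstock_Kurzweil_Integration.integral_add[OF i(1,2)])
    also have "integral {\<alpha>..\<beta>} (\<lambda>x. P x * vd ?u x) = - integral {\<alpha>..\<beta>} (\<lambda>x. P' x * ?u x)"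
    proof -
      have "((\<lambda>x. P x * vd ?u x + P' x * ?u x) has_integral P \<beta> * ?u \<beta> - P \<alpha> * ?u \<alpha>) {\<alpha>..\<beta>}"
        by (rule fundamental_theorem_of_calculus[OF less_imp_le[OF p(2)]
              has_vector_derivative_at_within[OF has_vector_derivative_mult[OF P_deriv C1_cs_deriv[OF u]]]])
          (use p in auto)
      then have "integral {\<alpha>..\<beta>} (\<lambda>x. P x * vd ?u x + P' x * ?u x) = 0" using P0 by (simp add: integral_unique)
      then show ?thesis
        unfolding Henstock_Kurzweil_Integration.integral_add[OF i(2,3)] by (simp add: add_eq_0_iff)
    qed
    finally have eq: "Q ?u g = 1/2 * (integral {\<alpha>..\<beta>} (\<lambda>x. (\<psi> x - P x) * vd ?u x) + - integral {\<alpha>..\<beta>} (\<lambda>x. P' x * ?u x))" .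
    have "cmod (Q ?u g) \<le> 1/2 * (cmod (integral {\<alpha>..\<beta>} (\<lambda>x. (\<psi> x - P x) * vd ?u x)) + cmod (integral {\<alpha>..\<beta>} (\<lambda>x. P' x * ?u x)))"
      unfolding eq norm_mult using norm_triangle_ineq4[of "integral {\<alpha>..\<beta>} (\<lambda>x. (\<psi> x - P x) * vd ?u x)" "integral {\<alpha>..\<beta>} (\<lambda>x. P' x * ?u x)"] by simp
    moreover have "cmod (integral {\<alpha>..\<beta>} (\<lambda>x. (\<psi> x - P x) * vd ?u x)) \<le> e / 2"
    proof -
      have "cmod (integral {\<alpha>..\<beta>} (\<lambda>x. (\<psi> x - P x) * vd ?u x)) \<le> integral {\<alpha>..\<beta>} (\<lambda>x. 4 * \<epsilon> * cmod (vd ?u x))"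
        by (rule Henstock_Kurzweil_Integration.integral_norm_bound_integral[OF i(1,4)])
          (auto simp: norm_mult intro!: mult_right_mono Pclose)
      also have "\<dots> = 4 * \<epsilon> * integral {\<alpha>..\<beta>} (\<lambda>x. cmod (vd ?u x))"
        by (rule integral_unique[OF has_integral_mult_right[OF integrable_integral[OF i(5)]]])
      also have "\<dots> \<le> 4 * \<epsilon> * L"
      proof (rule mult_left_mono)
        show "integral {\<alpha>..\<beta>} (\<lambda>x. cmod (vd ?u x)) \<le> L"
          using pointwise_bound(1)[OF u p(1) less_imp_le[OF p(2)], of 1 n] bd[of n]
          unfolding L_def by (simp add: field_simps)
      qed (use eps in simp)
      also have "\<dots> = e / 2" using L by (simp add: \<epsilon>_def)
      finally show ?thesis .
    qed
    moreover have "cmod (integral {\<alpha>..\<beta>} (\<lambda>x. P' x * ?u x)) \<le> e / 2"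
    proof -
      let ?F = "\<lambda>x. m / 2 * t + m / (2 * t * e0) * (E x * (cmod (?u x))\<^sup>2)"
      have hi: "(?F has_integral (\<beta> - \<alpha>) * (m / 2 * t) + m / (2 * t * e0) * integral {\<alpha>..\<beta>} (\<lambda>x. E x * (cmod (?u x))\<^sup>2)) {\<alpha>..\<beta>}"
        using has_integral_const_real[of "m / 2 * t" \<alpha> \<beta>] p
        by (intro has_integral_add has_integral_mult_right integrable_integral i) simp
      have "cmod (integral {\<alpha>..\<beta>} (\<lambda>x. P' x * ?u x)) \<le> integral {\<alpha>..\<beta>} ?F"
      proof (rule Henstock_Kurzweil_Integration.integral_norm_bound_integral[OF i(3)])
        show "?F integrable_on {\<alpha>..\<beta>}" using hi by blast
        fix x assume x: "x \<in> {\<alpha>..\<beta>}"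
        have "2 * t * cmod (?u x) \<le> t * t + (cmod (?u x))\<^sup>2"
          using sum_squares_bound[of t "cmod (?u x)"] by (simp add: power2_eq_square)
        then have "cmod (?u x) \<le> (t * t + (cmod (?u x))\<^sup>2) / (2 * t)" using t by (simp add: pos_le_divide_eq mult.commute)
        also have "\<dots> \<le> (t * t + (E x * (cmod (?u x))\<^sup>2) / e0) / (2 * t)"
        proof (intro divide_right_mono add_left_mono)
          have "(cmod (?u x))\<^sup>2 * e0 \<le> (cmod (?u x))\<^sup>2 * E x" using e0(2)[OF x] by (intro mult_left_mono) auto
          then show "(cmod (?u x))\<^sup>2 \<le> E x * (cmod (?u x))\<^sup>2 / e0" using e0(1) by (simp add: pos_le_divide_eq mult.commute)
        qed (use t in simp)
        finally have "m * cmod (?u x) \<le> m * ((t * t + (E x * (cmod (?u x))\<^sup>2) / e0) / (2 * t))"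
          using m(1) by (intro mult_left_mono) auto
        also have "\<dots> = ?F x" using t e0(1) by (simp add: field_simps)
        finally have "m * cmod (?u x) \<le> ?F x" .
        then show "norm (P' x * ?u x) \<le> ?F x"
          using mult_right_mono[OF m(2)[OF x], of "cmod (?u x)"] by (simp add: norm_mult)
      qed
      also have "\<dots> = (\<beta> - \<alpha>) * (m / 2 * t) + m / (2 * t * e0) * integral {\<alpha>..\<beta>} (\<lambda>x. E x * (cmod (?u x))\<^sup>2)"
        by (rule integral_unique[OF hi])
      also have "\<dots> \<le> (\<beta> - \<alpha>) * (m / 2 * t) + m / (2 * t * e0) * (e * t * e0 / (2 * m))"
      proof (intro add_left_mono mult_left_mono)
        show "integral {\<alpha>..\<beta>} (\<lambda>x. E x * (cmod (?u x))\<^sup>2) \<le> e * t * e0 / (2 * m)"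
          using energy_sub(2)[OF u p(1), of \<beta> n] N[OF n] p by simp
      qed (use m t e0 in simp)
      also have "(\<beta> - \<alpha>) * (m / 2 * t) = (t * (2 * m * (\<beta> - \<alpha>))) / 4" by simp
      also have "t * (2 * m * (\<beta> - \<alpha>)) = e"
        using nonzero_eq_divide_eq[of "2 * m * (\<beta> - \<alpha>)" t e] m(1) p(2) t_def by simp
      also have "m / (2 * t * e0) * (e * t * e0 / (2 * m)) = e / 4" using m(1) t e0(1) by simp
      finally show ?thesis by simp
    qed
    ultimately show ?thesis using e by simp
  qed
  then show "\<exists>no. \<forall>n\<ge>no. norm (Q (us n) g - 0) < e" by blast
qed

text \<open>Expand the square of \<open>us n - us N\<close> for a fixed large \<open>N\<close>: the
  mixed term tends to 0 by \<open>Q_weak_null\<close>, so the small square dominates the form of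
  \<open>us n\<close>.\<close>

lemma closable_Q:
  assumes u: "\<And>n. us n \<in> cs" and null: "(\<lambda>n. Re (L2_inner M (us n) (us n))) \<longlonglongrightarrow> 0"
    and cau: "\<forall>e>0. \<exists>N. \<forall>m\<ge>N. \<forall>n\<ge>N. Re (Q (\<lambda>x. us m x - us n x) (\<lambda>x. us m x - us n x)) < e"
  shows "(\<lambda>n. Re (Q (us n) (us n))) \<longlonglongrightarrow> 0"
proof (rule LIMSEQ_I)
  fix e :: real assume e: "e > 0"
  interpret Q: semi_ip cs Q by (rule semi_ip_Q)
  obtain N where N: "\<And>m n. m \<ge> N \<Longrightarrow> n \<ge> N \<Longrightarrow> Q.sq (\<lambda>x. us m x - us n x) < e / 2"
    using cau e by (metis half_gt_zero)
  have bd: "Q.sq (us (N + n)) \<le> 2 * (e / 2) + 2 * Q.sq (us N)" for n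
    using Q.sq_add_le[OF Q.diff[OF u u] u, of "N + n" N N] N[of "N + n" N] by simp
  have "(\<lambda>n. Q (us (N + n)) (us N)) \<longlonglongrightarrow> 0"
    by (rule Q_weak_null[OF u u bd]) (use LIMSEQ_ignore_initial_segment[OF null, of N] in \<open>simp add: add.commute\<close>)
  then have "\<forall>\<^sub>F n in sequentially. norm (Q (us (N + n)) (us N)) < e / 4"
    using e tendsto_norm[of "\<lambda>n. Q (us (N + n)) (us N)" 0] by (intro order_tendstoD) auto
  then obtain K where K: "\<And>n. n \<ge> K \<Longrightarrow> norm (Q (us (N + n)) (us N)) < e / 4" using eventually_sequentially by auto
  have "norm (Q.sq (us n) - 0) < e" if n: "n \<ge> N + K" for n
  proof -
    have k: "cmod (Q (us n) (us N)) < e / 4" using K[of "n - N"] n by simp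
    have "Q.sq (\<lambda>x. us n x - us N x) = Q.sq (us n) - 2 * Re (Q (us n) (us N)) + Q.sq (us N)" by (rule Q.sq_diff[OF u u])
    moreover have "Q.sq (\<lambda>x. us n x - us N x) < e / 2" using N[of n N] n by simp
    ultimately have "Q.sq (us n) < e"
      using k complex_Re_le_cmod[of "Q (us n) (us N)"] Q.ip_nonneg[OF u, of N] by linarith
    then show ?thesis using Q.ip_nonneg[OF u, of n] by simp
  qed
  then show "\<exists>no. \<forall>n\<ge>no. norm (Q.sq (us n) - 0) < e" by blast
qed

lemma closable_form_Q: "closable_form cs Q M"
proof -
  interpret Q: semi_ip cs Q by (rule semi_ip_Q)
  show ?thesis by unfold_locales (use cs_L2 closable_Q in auto)
qed

end

section \<open>A Riccati inequality and test functions\<close>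

text \<open>Here \<open>m'\<close> is the derivative of \<open>m\<close> for
  \<open>W' = - h^2 * E\<close>, \<open>P' = s / h^2\<close> and \<open>h' = \<kappa> * s\<close>.
  All mixed terms with \<open>\<kappa>\<close> cancel and \<open>(X^2 - (2 * A / P)^2) / h^4\<close>
  remains, which is non-positive because \<open>W \<le> A / P\<close>.\<close>

lemma riccati_algebra:
  fixes s h P A W X E m m' \<kappa> :: real
  assumes pos: "s > 0" "h > 0" "P > 0" "A > 0" and W: "W \<ge> 0" "P * W \<le> A" and X: "X = W + A / P"
    and m: "m = X / h\<^sup>2 + 4 * A * \<kappa> / h"
    and m': "m' = (- (h\<^sup>2 * E) - A * (s / h\<^sup>2) / P\<^sup>2) / h\<^sup>2 - 2 * X * (\<kappa> * s) / h ^ 3 - 4 * A * \<kappa> * (\<kappa> * s) / h\<^sup>2"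
  shows "4 * A / s * (m' + E) + m\<^sup>2 \<le> 0"
proof -
  have "m' + E = - s * (A / (P\<^sup>2 * h ^ 4) + 2 * X * \<kappa> / h ^ 3 + 4 * A * \<kappa>\<^sup>2 / h\<^sup>2)"
    unfolding m' using pos by (simp add: field_simps power2_eq_square power3_eq_cube power4_eq_xxxx)
  then have "4 * A / s * (m' + E) = - 4 * A * (A / (P\<^sup>2 * h ^ 4) + 2 * X * \<kappa> / h ^ 3 + 4 * A * \<kappa>\<^sup>2 / h\<^sup>2)"
    using pos by simp
  also have "\<dots> = - (2 * A / P)\<^sup>2 / h ^ 4 - 8 * A * X * \<kappa> / h ^ 3 - 16 * A\<^sup>2 * \<kappa>\<^sup>2 / h\<^sup>2"
    using pos by (simp add: field_simps power2_eq_square power3_eq_cube power4_eq_xxxx)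
  moreover have "m\<^sup>2 = X\<^sup>2 / h ^ 4 + 8 * A * X * \<kappa> / h ^ 3 + 16 * A\<^sup>2 * \<kappa>\<^sup>2 / h\<^sup>2"
    unfolding m using pos by (simp add: field_simps power2_eq_square power3_eq_cube power4_eq_xxxx)
  ultimately have eq: "4 * A / s * (m' + E) + m\<^sup>2 = (X\<^sup>2 - (2 * A / P)\<^sup>2) / h ^ 4" by (simp add: diff_divide_distrib)
  have "W \<le> A / P" using W(2) pos(3) by (simp add: pos_le_divide_eq mult.commute)
  then have "X \<le> 2 * A / P" "0 \<le> X" using W(1) pos by (auto simp: X)
  then have "X\<^sup>2 \<le> (2 * A / P)\<^sup>2" by (intro power_mono)
  then show ?thesis unfolding eq using pos by (intro divide_nonpos_nonneg) auto
qed

lemma norm_diff_scaled: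
  fixes u v :: "'a::real_inner"
  shows "(norm (c *\<^sub>R v - m *\<^sub>R u))\<^sup>2 = c\<^sup>2 * (norm v)\<^sup>2 - 2 * c * m * (u \<bullet> v) + m\<^sup>2 * (norm u)\<^sup>2"
  unfolding power2_norm_eq_inner
  by (simp only: inner_diff_left inner_diff_right inner_scaleR_left inner_scaleR_right inner_commute[of v u])
    (simp add: power2_eq_square algebra_simps)

lemma pos_part_square_deriv: "((\<lambda>t. (max 0 t)\<^sup>2) has_real_derivative 2 * max 0 t) (at (t :: real))"
proof (cases t "0 :: real" rule: linorder_cases)
  case less
  have "((\<lambda>t. 0 :: real) has_real_derivative 0) (at t)" by simp
  then have "((\<lambda>t. (max 0 t)\<^sup>2) has_real_derivative 0) (at t)"
    by (rule has_field_derivative_transform_within_open[of _ _ _ "{..<0}"]) (use less in auto)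
  then show ?thesis using less by simp
next
  case greater
  have "((\<lambda>t. t\<^sup>2) has_real_derivative 2 * t) (at t)" by (auto intro!: derivative_eq_intros)
  then have "((\<lambda>t. (max 0 t)\<^sup>2) has_real_derivative 2 * t) (at t)"
    by (rule has_field_derivative_transform_within_open[of _ _ _ "{0<..}"]) (use greater in auto)
  then show ?thesis using greater by simp
next
  case equal
  have "((\<lambda>h. (max 0 h)\<^sup>2 / h) \<longlongrightarrow> 0) (at (0::real))"
  proof (rule Lim_null_comparison)
    show "\<forall>\<^sub>F h in at (0::real). norm ((max 0 h)\<^sup>2 / h) \<le> \<bar>h\<bar>"
      by (intro always_eventually allI) (auto simp: max_def power2_eq_square)
    show "((\<lambda>h. \<bar>h\<bar>) \<longlongrightarrow> 0) (at (0::real))" by (intro tendsto_eq_intros) auto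
  qed
  then show ?thesis using equal by (simp add: DERIV_def)
qed

text \<open>A primitive of a normalised trapezoid, climbing from 0 at \<open>\<alpha>\<close> to 1
  at \<open>\<beta>\<close>. Rounding the corners over the length \<open>\<eta>\<close> makes it
  continuously differentiable, as the core requires, and raises the slope only from
  \<open>1 / (\<beta> - \<alpha>)\<close> to at most
  \<open>1 / (\<beta> - \<alpha> - \<eta>)\<close>.\<close>

definition ramp :: "real \<Rightarrow> real \<Rightarrow> real \<Rightarrow> real \<Rightarrow> real" where
  "ramp \<alpha> \<beta> \<eta> t = ((max 0 (t - \<alpha>))\<^sup>2 - (max 0 (t - (\<alpha> + \<eta>)))\<^sup>2 - (max 0 (t - (\<beta> - \<eta>)))\<^sup>2 + (max 0 (t - \<beta>))\<^sup>2) /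
     (2 * \<eta> * (\<beta> - \<alpha> - \<eta>))"

definition ramp' :: "real \<Rightarrow> real \<Rightarrow> real \<Rightarrow> real \<Rightarrow> real" where
  "ramp' \<alpha> \<beta> \<eta> t = (max 0 (t - \<alpha>) - max 0 (t - (\<alpha> + \<eta>)) - max 0 (t - (\<beta> - \<eta>)) + max 0 (t - \<beta>)) /
     (\<eta> * (\<beta> - \<alpha> - \<eta>))"

lemma ramp_deriv: "(ramp \<alpha> \<beta> \<eta> has_real_derivative ramp' \<alpha> \<beta> \<eta> t) (at t)"
proof -
  have d: "((\<lambda>t. (max 0 (t - c))\<^sup>2) has_real_derivative 2 * max 0 (t - c)) (at t)" for c
  proof -
    have "((\<lambda>t. t - c) has_real_derivative 1) (at t)" by (auto intro!: derivative_eq_intros)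
    from DERIV_chain2[OF pos_part_square_deriv this] show ?thesis by simp
  qed
  have "((\<lambda>t. ramp \<alpha> \<beta> \<eta> t) has_real_derivative (2 * max 0 (t - \<alpha>) - 2 * max 0 (t - (\<alpha> + \<eta>)) - 2 * max 0 (t - (\<beta> - \<eta>)) + 2 * max 0 (t - \<beta>)) /
     (2 * \<eta> * (\<beta> - \<alpha> - \<eta>))) (at t)"
    unfolding ramp_def by (intro DERIV_cdivide DERIV_add DERIV_diff d)
  moreover have "(2 * max 0 (t - \<alpha>) - 2 * max 0 (t - (\<alpha> + \<eta>)) - 2 * max 0 (t - (\<beta> - \<eta>)) + 2 * max 0 (t - \<beta>)) /
     (2 * \<eta> * (\<beta> - \<alpha> - \<eta>)) = ramp' \<alpha> \<beta> \<eta> t"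
  proof -
    have "2 * max 0 (t - \<alpha>) - 2 * max 0 (t - (\<alpha> + \<eta>)) - 2 * max 0 (t - (\<beta> - \<eta>)) + 2 * max 0 (t - \<beta>) =
       2 * (max 0 (t - \<alpha>) - max 0 (t - (\<alpha> + \<eta>)) - max 0 (t - (\<beta> - \<eta>)) + max 0 (t - \<beta>))" by argo
    then show ?thesis unfolding ramp'_def by (simp only: mult.assoc mult_divide_mult_cancel_left[of 2])
  qed
  ultimately show ?thesis by simp
qed

lemma ramp'_cont: "continuous_on A (ramp' \<alpha> \<beta> \<eta>)"
  unfolding ramp'_def divide_inverse by (intro continuous_intros)

lemma ramp_cont: "continuous_on A (ramp \<alpha> \<beta> \<eta>)"
  unfolding ramp_def divide_inverse by (intro continuous_intros)

lemma ramp'_bounds: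
  assumes "0 < \<eta>" "\<eta> < \<beta> - \<alpha>"
  shows "0 \<le> ramp' \<alpha> \<beta> \<eta> t" "ramp' \<alpha> \<beta> \<eta> t \<le> 1 / (\<beta> - \<alpha> - \<eta>)"
proof -
  let ?n = "max 0 (t - \<alpha>) - max 0 (t - (\<alpha> + \<eta>)) - max 0 (t - (\<beta> - \<eta>)) + max 0 (t - \<beta>)"
  have n: "0 \<le> ?n" "?n \<le> \<eta>" using assms by (auto simp: max_def)
  have d: "0 < \<eta> * (\<beta> - \<alpha> - \<eta>)" using assms by simp
  show "0 \<le> ramp' \<alpha> \<beta> \<eta> t" unfolding ramp'_def using n(1) d by (intro divide_nonneg_nonneg) auto
  have "ramp' \<alpha> \<beta> \<eta> t \<le> \<eta> / (\<eta> * (\<beta> - \<alpha> - \<eta>))" unfolding ramp'_def using n(2) d by (intro divide_right_mono) auto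
  then show "ramp' \<alpha> \<beta> \<eta> t \<le> 1 / (\<beta> - \<alpha> - \<eta>)" using assms by simp
qed

lemma ramp_left: "0 < \<eta> \<Longrightarrow> \<eta> < \<beta> - \<alpha> \<Longrightarrow> t \<le> \<alpha> \<Longrightarrow> ramp \<alpha> \<beta> \<eta> t = 0"
  by (simp add: ramp_def max_def)

lemma ramp_right:
  assumes "0 < \<eta>" "\<eta> < \<beta> - \<alpha>" "\<beta> \<le> t"
  shows "ramp \<alpha> \<beta> \<eta> t = 1"
proof -
  have eq: "(max 0 (t - \<alpha>))\<^sup>2 - (max 0 (t - (\<alpha> + \<eta>)))\<^sup>2 - (max 0 (t - (\<beta> - \<eta>)))\<^sup>2 + (max 0 (t - \<beta>))\<^sup>2 = 2 * \<eta> * (\<beta> - \<alpha> - \<eta>)"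
    using assms by (simp add: power2_eq_square algebra_simps)
  have "2 * \<eta> * (\<beta> - \<alpha> - \<eta>) \<noteq> 0" using assms by simp
  then show ?thesis unfolding ramp_def eq by (rule divide_self)
qed

section \<open>Tail integrals\<close>

text \<open>Instances are the weight \<open>w\<close>, the scale density \<open>s\<close> and the
  transformed density \<open>s / h^2\<close>. Tails are of type \<open>ennreal\<close> because they
  may be infinite.\<close>

locale half_line_weight =
  fixes u :: "real \<Rightarrow> real"
  assumes u_cont: "continuous_on {0..} u" and u_pos: "\<And>x. 0 \<le> x \<Longrightarrow> 0 < u x"
begin

definition tail :: "real \<Rightarrow> ennreal" where "tail x = (\<integral>\<^sup>+y\<in>{x..}. ennreal (u y) \<partial>lborel)"

lemma u_integrable: "0 \<le> x \<Longrightarrow> u integrable_on {x..y}"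
  by (intro integrable_continuous_interval continuous_on_subset[OF u_cont]) auto

lemma integral_u_nonneg: "0 \<le> x \<Longrightarrow> 0 \<le> integral {x..y} u"
  using u_pos by (intro Henstock_Kurzweil_Integration.integral_nonneg u_integrable) (auto intro: less_imp_le)

lemma u_meas:
  assumes "A \<in> sets borel" "A \<subseteq> {0..}"
  shows "(\<lambda>y. ennreal (u y) * indicator A y) \<in> borel_measurable borel"
proof -
  have "(\<lambda>y. indicator A y *\<^sub>R u y) \<in> borel_measurable borel"
    by (intro borel_measurable_continuous_on_indicator assms continuous_on_subset[OF u_cont])
  then have "(\<lambda>y. ennreal (indicator A y *\<^sub>R u y)) \<in> borel_measurable borel" by measurable
  also have "(\<lambda>y. ennreal (indicator A y *\<^sub>R u y)) = (\<lambda>y. ennreal (u y) * indicator A y)"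
    by (auto simp: indicator_def)
  finally show ?thesis .
qed

lemma nn_integral_u:
  assumes "0 \<le> x" "x \<le> y"
  shows "(\<integral>\<^sup>+t\<in>{x..y}. ennreal (u t) \<partial>lborel) = ennreal (integral {x..y} u)"
proof -
  have c: "continuous_on {x..y} u" using assms by (intro continuous_on_subset[OF u_cont]) auto
  have i: "set_integrable lborel {x..y} u" by (rule borel_integrable_atLeastAtMost'[OF c])
  have "(\<integral>\<^sup>+t\<in>{x..y}. ennreal (u t) \<partial>lborel) = (\<integral>\<^sup>+t. ennreal (indicator {x..y} t *\<^sub>R u t) \<partial>lborel)"
    by (intro nn_integral_cong) (auto simp: indicator_def)
  also have "\<dots> = ennreal (LINT t:{x..y}|lborel. u t)"
    unfolding set_lebesgue_integral_def
  proof (rule nn_integral_eq_integral)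
    show "integrable lborel (\<lambda>t. indicator {x..y} t *\<^sub>R u t)" using i by (simp only: set_integrable_def)
    have "0 \<le> indicator {x..y} t *\<^sub>R u t" for t
      using u_pos[of t] assms(1) by (cases "t \<in> {x..y}") auto
    then show "AE t in lborel. 0 \<le> indicator {x..y} t *\<^sub>R u t" by simp
  qed
  also have "(LINT t:{x..y}|lborel. u t) = integral {x..y} u" by (rule set_borel_integral_eq_integral(2)[OF i])
  finally show ?thesis .
qed

lemma tail_split:
  assumes "0 \<le> x" "x \<le> y"
  shows "tail x = ennreal (integral {x..y} u) + tail y"
proof -
  have "tail x = (\<integral>\<^sup>+t. ennreal (u t) * indicator {x..y} t + ennreal (u t) * indicator {y..} t \<partial>lborel)"
    unfolding tail_def
  proof (rule nn_integral_cong_AE)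
    show "AE t in lborel. ennreal (u t) * indicator {x..} t = ennreal (u t) * indicator {x..y} t + ennreal (u t) * indicator {y..} t"
      using AE_lborel_singleton[of y] by eventually_elim (use assms in \<open>auto simp: indicator_def\<close>)
  qed
  also have "\<dots> = ennreal (integral {x..y} u) + tail y"
    using assms by (subst nn_integral_add) (auto intro!: u_meas simp: nn_integral_u tail_def)
  finally show ?thesis .
qed

text \<open>Monotone convergence over the windows \<open>{x..x + n}\<close>; passing to a finite
  window also covers an infinite tail.\<close>

lemma tail_exists:
  assumes x: "0 \<le> x" and A: "0 \<le> A" and c: "0 \<le> c" and lt: "ennreal A < ennreal c * tail x"
  shows "\<exists>y>x. A < c * integral {x..y} u"
proof (rule ccontr)
  assume neg: "\<not> ?thesis"
  have inc: "incseq (\<lambda>n::nat. \<lambda>t. ennreal (u t) * indicator {x..x + real n} t)"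
    by (rule incseq_SucI) (auto simp: le_fun_def indicator_def)
  have "tail x = (\<integral>\<^sup>+t. (SUP n::nat. ennreal (u t) * indicator {x..x + real n} t) \<partial>lborel)"
    unfolding tail_def
  proof (rule nn_integral_cong)
    fix t :: real
    show "ennreal (u t) * indicator {x..} t = (SUP n::nat. ennreal (u t) * indicator {x..x + real n} t)"
    proof (cases "x \<le> t")
      case True
      obtain n :: nat where n: "t - x \<le> real n" using real_arch_simple by blast
      have "ennreal (u t) \<le> (SUP n::nat. ennreal (u t) * indicator {x..x + real n} t)"
        using True n by (intro SUP_upper2[of n]) auto
      moreover have "(SUP n::nat. ennreal (u t) * indicator {x..x + real n} t) \<le> ennreal (u t)"
        by (intro SUP_least) (auto simp: indicator_def)
      ultimately show ?thesis using True by (simp add: antisym)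
    qed simp
  qed
  also have "\<dots> = (SUP n::nat. \<integral>\<^sup>+t\<in>{x..x + real n}. ennreal (u t) \<partial>lborel)"
    by (rule nn_integral_monotone_convergence_SUP[OF inc]) (use x in \<open>auto intro!: u_meas\<close>)
  also have "ennreal c * \<dots> = (SUP n::nat. ennreal c * (\<integral>\<^sup>+t\<in>{x..x + real n}. ennreal (u t) \<partial>lborel))"
    by (rule SUP_mult_left_ennreal)
  also have "\<dots> \<le> ennreal A"
  proof (rule SUP_least)
    fix n :: nat
    have sub: "c * integral {x..x + real n} u \<le> A"
    proof (cases "n = 0")
      case True then show ?thesis using A by simp
    next
      case False
      then have "x < x + real n" by simp
      then have "\<not> A < c * integral {x..x + real n} u" using neg by (metis (no_types))
      then show ?thesis by (simp only: not_less)
    qed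
    have "ennreal c * (\<integral>\<^sup>+t\<in>{x..x + real n}. ennreal (u t) \<partial>lborel) = ennreal (c * integral {x..x + real n} u)"
      using x c by (subst nn_integral_u) (auto simp: ennreal_mult')
    also have "\<dots> \<le> ennreal A" by (rule ennreal_leI[OF sub])
    finally show "ennreal c * (\<integral>\<^sup>+t\<in>{x..x + real n}. ennreal (u t) \<partial>lborel) \<le> ennreal A" .
  qed
  finally show False using lt by simp
qed

end

section \<open>Lower bounds and test functions for the transformed problem\<close>

lemma (in diffusion) pointwise_bound0:
  assumes f: "f \<in> cs" and xy: "0 \<le> x" "x \<le> y" and t: "0 < t"
  defines "F \<equiv> \<lambda>x. if 0 < x then f x else 0"
  shows "cmod (F y - F x) \<le> (t * (S y - S x) + 2 * Re (Q f f) / t) / 2"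
proof -
  interpret Q: semi_ip cs Q by (rule semi_ip_Q)
  have q: "0 \<le> 2 * Re (Q f f) / t" using Q.ip_nonneg[OF f] t by simp
  show ?thesis
  proof (cases "0 < x")
    case True
    then show ?thesis using pointwise_bound(2)[OF f True xy(2) t] xy by (simp add: F_def)
  next
    case x0: False
    show ?thesis
    proof (cases "0 < y")
      case False
      then have "x = 0" "y = 0" using xy by auto
      then show ?thesis using q by (simp add: F_def)
    next
      case True
      obtain \<alpha> \<beta> where s: "supp_in f \<alpha> \<beta>" using C1_cs_supp[OF f] by blast
      \<comment> \<open>Below its support \<open>f\<close> vanishes, so the left endpoint 0 can be
        moved to a positive point where \<open>pointwise_bound\<close> applies.\<close>
      define x' where "x' = min \<alpha> y"
      have x': "0 < x'" "x' \<le> y" "x' \<le> \<alpha>" using s True by (auto simp: x'_def supp_in_def)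
      have "f x' = 0" using s x' by (simp add: supp_in_def)
      then have "cmod (F y - F x) = cmod (f y - f x')" using x0 True by (simp add: F_def)
      also have "\<dots> \<le> (t * (S y - S x') + 2 * Re (Q f f) / t) / 2" by (rule pointwise_bound(2)[OF f x'(1,2) t])
      also have "\<dots> \<le> (t * (S y - S x) + 2 * Re (Q f f) / t) / 2"
        using S_mono[of x x'] x' x0 xy t by (intro divide_right_mono add_right_mono mult_left_mono) auto
      finally show ?thesis .
    qed
  qed
qed

text \<open>\<open>h\<close> solves \<open>(aE * h')' = 0\<close> with constant flux
  \<open>\<kappa>\<close>, and \<open>P\<close> is the scale function of the transform by
  \<open>h\<close>. The instances are \<open>h = 1\<close>, \<open>P = S\<close>,
  \<open>\<kappa> = 0\<close> and \<open>h = hh a b\<close>, \<open>P = 1 / h - 1 / h(0)\<close>,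
  \<open>\<kappa> = -1\<close>.\<close>

locale doob = diffusion +
  fixes h P :: "real \<Rightarrow> real" and \<kappa> :: real
  assumes h_pos: "\<And>x. 0 \<le> x \<Longrightarrow> 0 < h x" and h_cont: "continuous_on {0..} h"
    and h_deriv: "\<And>x. 0 < x \<Longrightarrow> (h has_real_derivative \<kappa> * s x) (at x)"
    and P_0: "P 0 = 0" and P_cont: "continuous_on {0..} P"
    and P_deriv: "\<And>x. 0 < x \<Longrightarrow> (P has_real_derivative s x / (h x)\<^sup>2) (at x)"
    and P_unbounded: "\<And>R. \<exists>x>0. R < P x"
begin

definition w :: "real \<Rightarrow> real" where "w x = (h x)\<^sup>2 * E x"
definition Wn :: "real \<Rightarrow> ennreal" where "Wn x = (\<integral>\<^sup>+y\<in>{x..}. ennreal (w y) \<partial>lborel)"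

lemma w_pos: "0 \<le> x \<Longrightarrow> 0 < w x"
  using h_pos[of x] by (simp add: w_def E_pos)

lemma w_cont: "continuous_on {0..} w"
  unfolding w_def by (intro continuous_intros h_cont E_cont)

lemma P'_pos: "0 \<le> x \<Longrightarrow> 0 < s x / (h x)\<^sup>2"
  using h_pos[of x] s_pos[of x] by simp

lemma P_strict_mono:
  assumes "0 \<le> x" "x < y"
  shows "P x < P y"
proof (rule DERIV_pos_imp_increasing_open[OF assms(2)])
  show "\<exists>r. (P has_real_derivative r) (at t) \<and> 0 < r" if "x < t" "t < y" for t
    using P_deriv[of t] P'_pos[of t] that assms by auto
  show "continuous_on {x..y} P" using assms by (intro continuous_on_subset[OF P_cont]) auto
qed

lemma P_mono: "0 \<le> x \<Longrightarrow> x \<le> y \<Longrightarrow> P x \<le> P y"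
  using P_strict_mono[of x y] by (cases "x = y") auto

lemma P_pos: "0 < x \<Longrightarrow> 0 < P x"
  using P_strict_mono[of 0 x] P_0 by simp

lemma w_weight: "half_line_weight w"
  by unfold_locales (use w_cont w_pos in auto)

lemmas Wn_tail = half_line_weight.tail_def[OF w_weight, folded Wn_def]
lemmas Wn_split = half_line_weight.tail_split[OF w_weight, unfolded Wn_tail]
lemmas Wn_exists_y = half_line_weight.tail_exists[OF w_weight, unfolded Wn_tail]

text \<open>Substituting \<open>f = h g\<close> turns the classical proof of Muckenhoupt's inequality into the statement that
  \<open>m = (W + A / P) / h\<^sup>2 + 4 A \<kappa> / h\<close>, where \<open>W\<close> is the tail integral of \<open>w\<close>, is a solution of the Riccati
  inequality \<open>m\<^sup>2 + 4 A aE (m' + E) \<le> 0\<close>.\<close>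

lemma riccati_bound:
  assumes A: "0 < A" and l: "0 < l" and bd: "\<And>x. l \<le> x \<Longrightarrow> ennreal (P x) * Wn x \<le> ennreal A"
  shows "\<exists>K. \<forall>f\<in>cs. \<forall>\<beta>>l. f \<beta> = 0 \<longrightarrow>
    integral {l..\<beta>} (\<lambda>x. E x * (cmod (f x))\<^sup>2) \<le>
      4 * A * integral {l..\<beta>} (\<lambda>x. aE x * (cmod (vd f x))\<^sup>2) + (cmod (f l))\<^sup>2 * K"
proof -
  have "ennreal (P l) * Wn l < top" using bd[of l] le_less_trans[OF _ ennreal_less_top] by auto
  then have fin: "Wn l < top"
    using P_pos[OF l] by (auto simp: ennreal_mult_less_top)
  \<comment> \<open>The tail of \<open>w\<close> as a real function, written through its value at
    \<open>l\<close> so that its derivative is visibly \<open>- w\<close>.\<close>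
  define W where "W x = enn2real (Wn l) - integral {l..x} w" for x
  have WW: "Wn x = ennreal (W x) \<and> 0 \<le> W x" if "l \<le> x" for x
  proof -
    have sp: "Wn l = ennreal (integral {l..x} w) + Wn x" using l that by (intro Wn_split) auto
    have "Wn x < top" using fin unfolding sp by simp
    then have x: "Wn x = ennreal (enn2real (Wn x))" by simp
    have i0: "0 \<le> integral {l..x} w"
      using l that w_pos by (intro Henstock_Kurzweil_Integration.integral_nonneg integrable_continuous_interval)
        (auto intro: continuous_on_subset[OF w_cont] less_imp_le)
    have "enn2real (Wn l) = integral {l..x} w + enn2real (Wn x)"
      unfolding sp using i0 \<open>Wn x < top\<close> by (simp add: enn2real_plus)
    then have "W x = enn2real (Wn x)" by (simp add: W_def)
    then show ?thesis using x by simp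
  qed
  have PW: "P x * W x \<le> A" if "l \<le> x" for x
  proof -
    have "ennreal (P x * W x) \<le> ennreal A"
      using bd[OF that] WW[OF that] P_pos[of x] l that by (simp add: ennreal_mult)
    then show ?thesis using A by (simp add: ennreal_le_iff)
  qed
  define X where "X x = W x + A / P x" for x
  define m where "m x = X x / (h x)\<^sup>2 + 4 * A * \<kappa> / h x" for x
  define m' where "m' x = (- ((h x)\<^sup>2 * E x) - A * (s x / (h x)\<^sup>2) / (P x)\<^sup>2) / (h x)\<^sup>2
      - 2 * X x * (\<kappa> * s x) / h x ^ 3 - 4 * A * \<kappa> * (\<kappa> * s x) / (h x)\<^sup>2" for x
  have ric: "4 * A * aE x * (m' x + E x) + (m x)\<^sup>2 \<le> 0" if x: "l \<le> x" for x
  proof -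
    have "4 * A / s x * (m' x + E x) + (m x)\<^sup>2 \<le> 0"
      by (rule riccati_algebra[OF s_pos h_pos P_pos A _ PW[OF x] X_def m_def m'_def])
        (use l x WW in auto)
    moreover have "4 * A / s x = 4 * A * aE x" by (simp add: s_eq)
    ultimately show ?thesis by simp
  qed
  have "integral {l..\<beta>} (\<lambda>x. E x * (cmod (f x))\<^sup>2) \<le>
      4 * A * integral {l..\<beta>} (\<lambda>x. aE x * (cmod (vd f x))\<^sup>2) + (cmod (f l))\<^sup>2 * m l"
    if f: "f \<in> cs" and b: "l < \<beta>" and f0: "f \<beta> = 0" for f \<beta>
  proof -
    have m_deriv: "(m has_real_derivative m' x) (at x within {l..\<beta>})" if x: "x \<in> {l..\<beta>}" for x
    proof -
      have xp: "0 < x" using x l by auto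
      have "(W has_real_derivative - w x) (at x within {l..\<beta>})"
        unfolding W_def using x l
        by (auto intro!: derivative_eq_intros integral_has_real_derivative continuous_on_subset[OF w_cont])
      moreover have "(P has_real_derivative s x / (h x)\<^sup>2) (at x within {l..\<beta>})"
        by (rule has_field_derivative_at_within[OF P_deriv[OF xp]])
      moreover have "(h has_real_derivative \<kappa> * s x) (at x within {l..\<beta>})"
        by (rule has_field_derivative_at_within[OF h_deriv[OF xp]])
      moreover have "P x \<noteq> 0" "h x \<noteq> 0" using P_pos[OF xp] h_pos[of x] xp by auto
      ultimately show ?thesis
        unfolding m_def X_def m'_def
        by (auto intro!: derivative_eq_intros simp: w_def field_simps power2_eq_square power3_eq_cube)
    qed
    have n_deriv: "((\<lambda>x. (cmod (f x))\<^sup>2) has_real_derivative 2 * (f x \<bullet> vd f x)) (at x within {l..\<beta>})" if x: "x \<in> {l..\<beta>}" for x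
    proof -
      have d: "(f has_vector_derivative vd f x) (at x within {l..\<beta>})"
        using x l by (intro has_vector_derivative_at_within[OF C1_cs_deriv[OF f]]) auto
      have "((\<lambda>x. f x \<bullet> f x) has_vector_derivative f x \<bullet> vd f x + vd f x \<bullet> f x) (at x within {l..\<beta>})"
        by (rule bounded_bilinear.has_vector_derivative[OF bounded_bilinear_inner d d])
      then show ?thesis
        by (simp add: power2_norm_eq_inner has_real_derivative_iff_has_vector_derivative inner_commute)
    qed
    let ?G = "\<lambda>x. 2 * (f x \<bullet> vd f x) * m x + m' x * (cmod (f x))\<^sup>2"
    have ftc: "(?G has_integral (cmod (f \<beta>))\<^sup>2 * m \<beta> - (cmod (f l))\<^sup>2 * m l) {l..\<beta>}"
      by (rule fundamental_theorem_of_calculus)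
        (use b DERIV_mult'[OF n_deriv m_deriv] in \<open>auto simp: has_real_derivative_iff_has_vector_derivative algebra_simps\<close>)
    have i1: "(\<lambda>x. E x * (cmod (f x))\<^sup>2) integrable_on {l..\<beta>}" "(\<lambda>x. aE x * (cmod (vd f x))\<^sup>2) integrable_on {l..\<beta>}"
      by (intro integrable_continuous_interval; use l in \<open>auto intro!: continuous_intros cs_cont[OF f] cont_sub[OF E_cont] cont_sub[OF aE_cont]\<close>)+
    have hi: "((\<lambda>x. 4 * A * (aE x * (cmod (vd f x))\<^sup>2) - ?G x) has_integral
        4 * A * integral {l..\<beta>} (\<lambda>x. aE x * (cmod (vd f x))\<^sup>2) - ((cmod (f \<beta>))\<^sup>2 * m \<beta> - (cmod (f l))\<^sup>2 * m l)) {l..\<beta>}"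
      by (intro has_integral_diff has_integral_mult_right integrable_integral i1 ftc)
    have "integral {l..\<beta>} (\<lambda>x. E x * (cmod (f x))\<^sup>2) \<le> integral {l..\<beta>} (\<lambda>x. 4 * A * (aE x * (cmod (vd f x))\<^sup>2) - ?G x)"
    proof (rule Henstock_Kurzweil_Integration.integral_le[OF i1(1)])
      show "(\<lambda>x. 4 * A * (aE x * (cmod (vd f x))\<^sup>2) - ?G x) integrable_on {l..\<beta>}" using hi by blast
      fix x assume x: "x \<in> {l..\<beta>}"
      define c where "c = 4 * A * aE x"
      have c: "c > 0" using A aE_pos[of x] x l by (simp add: c_def)
      let ?i = "f x \<bullet> vd f x" and ?u = "(cmod (f x))\<^sup>2" and ?v = "(cmod (vd f x))\<^sup>2"
      \<comment> \<open>Completing the square with \<open>c = 4 * A * aE\<close>: the Riccati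
        inequality bounds \<open>m^2\<close> by \<open>- c * (m' + E)\<close>, and dividing by
        \<open>c\<close> leaves the comparison of the integrands. The remaining terms with
        \<open>m\<close> and \<open>m'\<close> form the derivative of
        \<open>m * |f|^2\<close>.\<close>
      have "0 \<le> (norm (c *\<^sub>R vd f x - m x *\<^sub>R f x))\<^sup>2" by simp
      also have "\<dots> = c\<^sup>2 * ?v - 2 * c * m x * ?i + (m x)\<^sup>2 * ?u"
        by (rule norm_diff_scaled)
      also have "(m x)\<^sup>2 * ?u \<le> - (c * (m' x + E x)) * ?u"
        using ric[of x] x by (intro mult_right_mono) (auto simp: c_def)
      finally have "0 \<le> c * (c * ?v - 2 * m x * ?i - (m' x + E x) * ?u)"
        by (simp add: algebra_simps power2_eq_square)
      then have "0 \<le> c * ?v - 2 * m x * ?i - (m' x + E x) * ?u" using c by (simp add: zero_le_mult_iff)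
      then show "E x * ?u \<le> 4 * A * (aE x * ?v) - (2 * ?i * m x + m' x * ?u)"
        by (simp add: c_def algebra_simps)
    qed
    also have "\<dots> = 4 * A * integral {l..\<beta>} (\<lambda>x. aE x * (cmod (vd f x))\<^sup>2) - ((cmod (f \<beta>))\<^sup>2 * m \<beta> - (cmod (f l))\<^sup>2 * m l)"
      by (rule integral_unique[OF hi])
    finally show ?thesis using f0 by simp
  qed
  then show ?thesis by blast
qed

text \<open>Starting at the left end of the support removes the boundary term. The 8 is the 4 of
  Hardy's inequality times the 2 from the factor 1/2 in \<open>Q\<close>.\<close>

lemma form_lower:
  assumes A: "0 < A" and bd: "\<And>x. 0 < x \<Longrightarrow> ennreal (P x) * Wn x \<le> ennreal A" and f: "f \<in> cs"
  shows "1 / (8 * A) * Re (L2_inner M f f) \<le> Re (Q f f)"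
proof -
  obtain \<alpha> \<beta> where sp: "supp_in f \<alpha> \<beta>" using C1_cs_supp[OF f] by blast
  have p: "0 < \<alpha>" "\<alpha> < \<beta>" "f \<alpha> = 0" "f \<beta> = 0" using sp by (auto simp: supp_in_def)
  obtain K where "\<forall>f\<in>cs. \<forall>\<beta>>\<alpha>. f \<beta> = 0 \<longrightarrow> integral {\<alpha>..\<beta>} (\<lambda>x. E x * (cmod (f x))\<^sup>2) \<le>
      4 * A * integral {\<alpha>..\<beta>} (\<lambda>x. aE x * (cmod (vd f x))\<^sup>2) + (cmod (f \<alpha>))\<^sup>2 * K"
    using riccati_bound[OF A p(1)] bd p(1) by (meson less_le_trans)
  then have "Re (L2_inner M f f) \<le> 4 * A * (2 * Re (Q f f))"
    using f p unfolding N2_cs[OF f sp] sqQ_cs[OF f sp] by auto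
  then show ?thesis using A by (simp add: field_simps)
qed

text \<open>Extended by zero at 0, a form-bounded sequence is equicontinuous on
  \<open>{0..l}\<close>, so by Arzela-Ascoli a subsequence converges uniformly there. For its
  differences the mass on \<open>{0..l}\<close> and the boundary term of
  \<open>riccati_bound\<close> become arbitrarily small.\<close>

lemma ess_lower_Q:
  assumes A: "0 < A" and l: "0 < l" and bd: "\<And>x. l \<le> x \<Longrightarrow> ennreal (P x) * Wn x \<le> ennreal A"
    and nu: "\<nu> \<le> 1 / (8 * A)"
  shows "ess_lower M cs Q \<nu>"
  unfolding ess_lower_def
proof (intro allI impI)
  fix f :: "nat \<Rightarrow> real \<Rightarrow> complex"
  assume f: "\<forall>n. f n \<in> cs" and "\<exists>C. \<forall>n. Re (Q (f n) (f n)) + Re (L2_inner M (f n) (f n)) \<le> C"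
  then obtain C where C: "\<And>n. Re (Q (f n) (f n)) + Re (L2_inner M (f n) (f n)) \<le> C" by blast
  interpret Q: semi_ip cs Q by (rule semi_ip_Q)
  have q: "Q.sq (f n) \<le> C" for n using C[of n] L2.ip_nonneg[OF cs_L2, of "f n"] f by auto
  have C0: "0 \<le> C" using q[of 0] Q.ip_nonneg[of "f 0"] f by auto
  define F where "F n x = (if 0 < x then f n x else 0)" for n x
  have Fb: "cmod (F n y - F n x) \<le> (t * (S y - S x) + 2 * C / t) / 2" if "0 \<le> x" "x \<le> y" "0 < t" for n x y t
  proof -
    have "cmod (F n y - F n x) \<le> (t * (S y - S x) + 2 * Q.sq (f n) / t) / 2"
      using pointwise_bound0[of "f n" x y t] f that by (simp add: F_def)
    also have "\<dots> \<le> (t * (S y - S x) + 2 * C / t) / 2"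
      using q[of n] that by (intro divide_right_mono add_left_mono) auto
    finally show ?thesis .
  qed
  obtain g :: "real \<Rightarrow> complex" and r :: "nat \<Rightarrow> nat" where r: "strict_mono r"
    and unif: "\<And>e. 0 < e \<Longrightarrow> \<exists>N. \<forall>n x. N \<le> n \<and> x \<in> {0..l} \<longrightarrow> norm (F (r n) x - g x) < e"
  proof (rule Arzela_Ascoli[of "{0..l}" F "(S l - S 0 + 2 * C) / 2"])
    show "compact {0..l}" by (rule compact_Icc)
    show "norm (F n x) \<le> (S l - S 0 + 2 * C) / 2" if "x \<in> {0..l}" for n x
      using Fb[of 0 x 1 n] S_mono[of x l] that by (auto simp: F_def)
    show "\<exists>d>0. \<forall>n y. y \<in> {0..l} \<and> norm (x - y) < d \<longrightarrow> norm (F n x - F n y) < e" if x: "x \<in> {0..l}" and e: "0 < e" for x e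
    proof -
      \<comment> \<open>Large enough for the energy part \<open>2 * C / t\<close> to stay below
        \<open>e\<close>; the continuity of \<open>S\<close> takes care of the other part.\<close>
      define t where "t = 2 * (C + 1) / e"
      have t: "0 < t" using C0 e by (simp add: t_def)
      have Ce: "2 * C / t < e" using C0 e by (simp add: t_def field_simps)
      have "isCont S x \<or> x = 0" using x S_deriv[of x] DERIV_isCont by force
      obtain d where d: "0 < d" "\<And>y. y \<in> {0..} \<Longrightarrow> dist y x < d \<Longrightarrow> dist (S y) (S x) < e / t"
        using S_cont x e t unfolding continuous_on_iff by (metis atLeastAtMost_iff atLeast_iff divide_pos_pos)
      have "norm (F n x - F n y) < e" if y: "y \<in> {0..l}" "norm (x - y) < d" for n y
      proof -
        have dS: "\<bar>S y - S x\<bar> < e / t" using d(2)[of y] y by (simp add: dist_norm norm_minus_commute)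
        then have tS: "t * \<bar>S y - S x\<bar> < e" using t by (simp add: pos_less_divide_eq mult.commute)
        have "norm (F n x - F n y) \<le> (t * \<bar>S y - S x\<bar> + 2 * C / t) / 2"
        proof (cases "x \<le> y")
          case True
          have "norm (F n y - F n x) \<le> (t * (S y - S x) + 2 * C / t) / 2" using x True t by (intro Fb) auto
          also have "\<dots> \<le> (t * \<bar>S y - S x\<bar> + 2 * C / t) / 2" using t by (intro divide_right_mono add_right_mono mult_left_mono) auto
          finally show ?thesis by (simp add: norm_minus_commute)
        next
          case False
          have "norm (F n x - F n y) \<le> (t * (S x - S y) + 2 * C / t) / 2" using y False t by (intro Fb) auto
          also have "\<dots> \<le> (t * \<bar>S y - S x\<bar> + 2 * C / t) / 2" using t by (intro divide_right_mono add_right_mono mult_left_mono) auto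
          finally show ?thesis .
        qed
        also have "\<dots> < e"
        proof -
          have "(u + v) / 2 < e" if "u < e" "v < e" for u v :: real using that by simp
          from this[OF tS Ce] show ?thesis .
        qed
        finally show ?thesis .
      qed
      then show ?thesis using d(1) by blast
    qed
  qed blast
  obtain K where K: "\<And>f \<beta>. f \<in> cs \<Longrightarrow> l < \<beta> \<Longrightarrow> f \<beta> = 0 \<Longrightarrow> integral {l..\<beta>} (\<lambda>x. E x * (cmod (f x))\<^sup>2) \<le>
      4 * A * integral {l..\<beta>} (\<lambda>x. aE x * (cmod (vd f x))\<^sup>2) + (cmod (f l))\<^sup>2 * K"
    using riccati_bound[OF A l bd] by auto
  \<comment> \<open>The factor of \<open>\<eta>^2\<close> in both errors: the mass of
    \<open>E\<close> on \<open>{0..l}\<close> and the boundary coefficient \<open>K\<close>,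
    enlarged by 1 to be positive.\<close>
  define L where "L = integral {0..l} E + \<bar>K\<bar> + 1"
  have EI: "E integrable_on {x..l}" if "0 \<le> x" for x
    using that by (intro integrable_continuous_interval continuous_on_subset[OF E_cont]) auto
  have L: "L > 0" using Henstock_Kurzweil_Integration.integral_nonneg[OF EI[of 0]] E_pos
    unfolding L_def by (smt (verit) less_imp_le)
  have key: "\<nu> * Re (L2_inner M d d) \<le> Q.sq d + \<eta>\<^sup>2 * L / (8 * A)"
    if d: "d \<in> cs" and \<eta>: "\<And>x. x \<in> {0<..l} \<Longrightarrow> cmod (d x) \<le> \<eta>" for d \<eta>
  proof -
    obtain \<alpha>0 \<beta>0 where s0: "supp_in d \<alpha>0 \<beta>0" using C1_cs_supp[OF d] by blast
    define \<alpha> \<beta> where "\<alpha> = min \<alpha>0 (l/2)" and "\<beta> = max \<beta>0 (l+1)"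
    have a0: "0 < \<alpha>" using s0 l by (simp add: \<alpha>_def supp_in_def)
    have sp: "supp_in d \<alpha> \<beta>" by (rule supp_in_mono[OF s0 a0]) (auto simp: \<alpha>_def \<beta>_def)
    have al: "\<alpha> \<le> l" "\<alpha> < l" and lb: "l < \<beta>" using l by (auto simp: \<alpha>_def \<beta>_def)
    have d0: "d \<beta> = 0" using sp by (auto simp: supp_in_def)
    have i: "(\<lambda>x. E x * (cmod (d x))\<^sup>2) integrable_on {x..y}" if "0 < x" for x y
      using that by (intro integrable_continuous_interval) (auto intro!: continuous_intros cs_cont[OF d] cont_sub[OF E_cont])
    have "integral {\<alpha>..l} (\<lambda>x. E x * (cmod (d x))\<^sup>2) \<le> integral {\<alpha>..l} (\<lambda>x. \<eta>\<^sup>2 * E x)"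
    proof (rule Henstock_Kurzweil_Integration.integral_le[OF i[OF a0]])
      show "(\<lambda>x. \<eta>\<^sup>2 * E x) integrable_on {\<alpha>..l}" using EI[of \<alpha>] a0 by (intro integrable_on_mult_right) auto
      fix x assume x: "x \<in> {\<alpha>..l}"
      have "(cmod (d x))\<^sup>2 \<le> \<eta>\<^sup>2" using \<eta>[of x] x a0 by (intro power_mono) auto
      then show "E x * (cmod (d x))\<^sup>2 \<le> \<eta>\<^sup>2 * E x" using E_pos[of x] by (simp add: mult.commute)
    qed
    also have "\<dots> = \<eta>\<^sup>2 * integral {\<alpha>..l} E" by (rule integral_unique[OF has_integral_mult_right[OF integrable_integral[OF EI]]]) (use a0 in simp)
    also have "\<dots> \<le> \<eta>\<^sup>2 * integral {0..l} E"
      using a0 E_pos by (intro mult_left_mono integral_subset_le EI) (auto intro: less_imp_le)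
    finally have 1: "integral {\<alpha>..l} (\<lambda>x. E x * (cmod (d x))\<^sup>2) \<le> \<eta>\<^sup>2 * integral {0..l} E" .
    have 2: "integral {l..\<beta>} (\<lambda>x. E x * (cmod (d x))\<^sup>2) \<le> 4 * A * (2 * Q.sq d) + \<eta>\<^sup>2 * \<bar>K\<bar>"
    proof -
      have "(cmod (d l))\<^sup>2 * K \<le> \<eta>\<^sup>2 * \<bar>K\<bar>"
      proof -
        have "(cmod (d l))\<^sup>2 \<le> \<eta>\<^sup>2" using \<eta>[of l] l by (intro power_mono) auto
        then have "(cmod (d l))\<^sup>2 * \<bar>K\<bar> \<le> \<eta>\<^sup>2 * \<bar>K\<bar>" by (intro mult_right_mono) auto
        moreover have "(cmod (d l))\<^sup>2 * K \<le> (cmod (d l))\<^sup>2 * \<bar>K\<bar>" by (intro mult_left_mono) auto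
        ultimately show ?thesis by linarith
      qed
      moreover have "4 * A * integral {l..\<beta>} (\<lambda>x. aE x * (cmod (vd d x))\<^sup>2) \<le> 4 * A * (2 * Q.sq d)"
        using energy_sub(1)[OF d l, of \<beta>] lb A by (intro mult_left_mono) auto
      ultimately show ?thesis using K[OF d lb d0] by linarith
    qed
    have "Re (L2_inner M d d) = integral {\<alpha>..l} (\<lambda>x. E x * (cmod (d x))\<^sup>2) + integral {l..\<beta>} (\<lambda>x. E x * (cmod (d x))\<^sup>2)"
      unfolding N2_cs[OF d sp] using al lb i[OF a0] by (subst Henstock_Kurzweil_Integration.integral_combine) auto
    also have "\<dots> \<le> 8 * A * Q.sq d + \<eta>\<^sup>2 * (integral {0..l} E + \<bar>K\<bar>)" using 1 2 by (simp add: algebra_simps)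
    also have "\<dots> \<le> 8 * A * Q.sq d + \<eta>\<^sup>2 * L" by (intro add_left_mono mult_left_mono) (auto simp: L_def)
    finally have "Re (L2_inner M d d) / (8 * A) \<le> (8 * A * Q.sq d + \<eta>\<^sup>2 * L) / (8 * A)" using A by (intro divide_right_mono) auto
    also have "\<dots> = Q.sq d + \<eta>\<^sup>2 * L / (8 * A)" using A by (simp add: add_divide_distrib)
    finally have "Re (L2_inner M d d) / (8 * A) \<le> Q.sq d + \<eta>\<^sup>2 * L / (8 * A)" .
    moreover have "\<nu> * Re (L2_inner M d d) \<le> 1 / (8 * A) * Re (L2_inner M d d)"
      by (rule mult_right_mono[OF nu L2.ip_nonneg[OF cs_L2[OF d]]])
    ultimately show ?thesis by simp
  qed
  show "\<exists>r :: nat \<Rightarrow> nat. strict_mono r \<and> (\<forall>e>0. \<exists>N. \<forall>m\<ge>N. \<forall>n\<ge>N.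
           \<nu> * Re (L2_inner M (\<lambda>x. f (r m) x - f (r n) x) (\<lambda>x. f (r m) x - f (r n) x)) \<le>
             Re (Q (\<lambda>x. f (r m) x - f (r n) x) (\<lambda>x. f (r m) x - f (r n) x)) + e)"
  proof (intro exI[of _ r] conjI r allI impI)
    fix e :: real assume e: "e > 0"
    define \<eta> where "\<eta> = sqrt (8 * A * e / L)"
    have \<eta>: "\<eta> > 0" "\<eta>\<^sup>2 * L / (8 * A) = e" using A e L by (auto simp: \<eta>_def)
    obtain N where N: "\<And>n x. N \<le> n \<Longrightarrow> x \<in> {0..l} \<Longrightarrow> norm (F (r n) x - g x) < \<eta> / 2"
      using unif[of "\<eta> / 2"] \<eta>(1) by auto
    have "\<nu> * Re (L2_inner M (\<lambda>x. f (r m) x - f (r n) x) (\<lambda>x. f (r m) x - f (r n) x)) \<le>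
        Q.sq (\<lambda>x. f (r m) x - f (r n) x) + e" if mn: "m \<ge> N" "n \<ge> N" for m n
    proof -
      have "cmod (f (r m) x - f (r n) x) \<le> \<eta>" if x: "x \<in> {0<..l}" for x
      proof -
        have x': "x \<in> {0..l}" using x by auto
        have "norm (f (r m) x - f (r n) x) = norm ((F (r m) x - g x) - (F (r n) x - g x))" using x by (simp add: F_def)
        also have "\<dots> \<le> norm (F (r m) x - g x) + norm (F (r n) x - g x)" by (rule norm_triangle_ineq4)
        finally show ?thesis using N[OF mn(1) x'] N[OF mn(2) x'] by linarith
      qed
      from key[OF Q.diff this] f \<eta>(2) show ?thesis by auto
    qed
    then show "\<exists>N. \<forall>m\<ge>N. \<forall>n\<ge>N. \<nu> * Re (L2_inner M (\<lambda>x. f (r m) x - f (r n) x) (\<lambda>x. f (r m) x - f (r n) x)) \<le>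
        Q.sq (\<lambda>x. f (r m) x - f (r n) x) + e" by blast
  qed
qed

text \<open>The profile \<open>\<phi>\<close> rises between \<open>P x1\<close> and
  \<open>P x\<close>, equals 1 up to \<open>P y\<close>, and falls towards a level so remote that
  the descent uses up only the slack of the strict inequality. Twice the form is then at most
  \<open>mass / A\<close>, and the squared norm is at least \<open>mass\<close>.\<close>

lemma test_function:
  assumes x1: "0 < x1" "x1 < x" and y: "x < y" and A: "0 < A" and lt: "A < (P x - P x1) * integral {x..y} w"
  shows "\<exists>f X. f \<in> cs \<and> x1 < X \<and> (\<forall>t>0. t \<le> x1 \<or> X \<le> t \<longrightarrow> f t = 0) \<and>
    Re (L2_inner M f f) = 1 \<and> Re (Q f f) \<le> 1 / (2 * A)"
proof -
  interpret Q: semi_ip cs Q by (rule semi_ip_Q)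
  define mass where "mass = integral {x..y} w"
  have T: "P x1 < P x" "P x < P y" using P_strict_mono x1 y by auto
  have mass: "mass > 0"
  proof -
    have "0 < (P x - P x1) * mass" using lt A by (simp add: mass_def)
    then show ?thesis using T by (simp add: zero_less_mult_iff)
  qed
  define d where "d = P x - P x1"
  have Ad: "A / mass < d" using lt mass by (simp add: d_def mass_def pos_divide_less_eq)
  have Am: "A / mass > 0" using A mass by simp
  \<comment> \<open>A rounding width small enough to preserve the strict inequality.\<close>
  obtain \<eta> where eta: "0 < \<eta>" "\<eta> < d" "A / mass < d - \<eta>"
  proof -
    have "\<exists>\<eta>>0. \<eta> < d \<and> r < d - \<eta>" if "r < d" "0 < r" for r
      using that by (intro exI[of _ "(d - r) / 2"]) (auto simp: field_simps)
    from this[OF Ad Am] that show thesis by blast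
  qed
  define c1 where "c1 = 1 / (d - \<eta>)"
  \<comment> \<open>The energy budget: the ascent costs \<open>c1\<close>, and
    \<open>mass / A - c1\<close> is left for the descent. Below, \<open>R\<close> is the level for
    which a ramp with rounding width 1 has slope bound exactly \<open>c2\<close>.\<close>
  define c2 where "c2 = mass / A - c1"
  have c1: "0 < c1" using eta by (simp add: c1_def)
  have "c1 < 1 / (A / mass)" unfolding c1_def
    by (rule divide_strict_left_mono[OF eta(3)]) (use eta Am in \<open>auto intro!: mult_pos_pos simp del: times_divide_eq_right\<close>)
  then have c2: "0 < c2" by (simp add: c2_def)
  define R where "R = P y + 1 + 1 / c2"
  have R: "1 < R - P y" "1 / (R - P y - 1) = c2" using c2 by (auto simp: R_def)
  obtain X where X: "0 < X" "R < P X" using P_unbounded by blast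
  have yX: "y < X"
  proof (rule ccontr)
    assume "\<not> y < X"
    then have "P X \<le> P y" using X by (intro P_mono) auto
    then show False using X R by linarith
  qed
  define r1 where "r1 = ramp (P x1) (P x) \<eta>"
  define r2 where "r2 = ramp (P y) R 1"
  define r1' where "r1' = ramp' (P x1) (P x) \<eta>"
  define r2' where "r2' = ramp' (P y) R 1"
  have e1: "0 < \<eta>" "\<eta> < P x - P x1" and e2: "0 < (1::real)" "1 < R - P y" using eta R by (auto simp: d_def)
  have d1: "(r1 has_real_derivative r1' t) (at t)" and d2: "(r2 has_real_derivative r2' t) (at t)" for t
    unfolding r1_def r1'_def r2_def r2'_def by (rule ramp_deriv)+
  have b1: "0 \<le> r1' t" "r1' t \<le> c1" and b2: "0 \<le> r2' t" "r2' t \<le> c2" for t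
    using ramp'_bounds[OF e1] ramp'_bounds[OF e2] R(2) unfolding r1'_def r2'_def c1_def d_def by auto
  define \<phi> where "\<phi> t = r1 t - r2 t" for t
  define \<phi>' where "\<phi>' t = r1' t - r2' t" for t
  have dphi: "(\<phi> has_real_derivative \<phi>' t) (at t)" for t
    unfolding \<phi>_def \<phi>'_def by (intro DERIV_diff d1 d2)
  define P' where "P' t = s t / (h t)\<^sup>2" for t
  have dP: "(P has_real_derivative P' t) (at t)" if "0 < t" for t unfolding P'_def by (rule P_deriv[OF that])
  define f0 where "f0 t = complex_of_real (h t * \<phi> (P t))" for t
  define f0' where "f0' t = \<kappa> * s t * \<phi> (P t) + h t * (\<phi>' (P t) * P' t)" for t
  have phiP: "((\<lambda>t. \<phi> (P t)) has_real_derivative \<phi>' (P t) * P' t) (at t)" if "0 < t" for t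
    by (rule DERIV_chain2[OF dphi dP[OF that]])
  have df0: "(f0 has_vector_derivative complex_of_real (f0' t)) (at t)" if "0 < t" for t
  proof -
    have "((\<lambda>t. h t * \<phi> (P t)) has_real_derivative f0' t) (at t)"
      unfolding f0'_def using DERIV_mult[OF h_deriv[OF that] phiP[OF that]] by (simp add: mult.commute)
    then show ?thesis unfolding f0_def
      by (intro has_vector_derivative_of_real) (simp add: has_real_derivative_iff_has_vector_derivative)
  qed
  have zero: "f0 t = 0" if "0 < t" "t \<le> x1 \<or> X \<le> t" for t
    using that(2)
  proof
    assume "t \<le> x1"
    then have "P t \<le> P x1" using that by (intro P_mono) auto
    then show "f0 t = 0" using T unfolding f0_def \<phi>_def r1_def r2_def by (simp add: ramp_left[OF e1] ramp_left[OF e2])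
  next
    assume "X \<le> t"
    then have "P X \<le> P t" using X by (intro P_mono) auto
    then show "f0 t = 0" using T X R unfolding f0_def \<phi>_def r1_def r2_def by (simp add: ramp_right[OF e1] ramp_right[OF e2])
  qed
  have pc: "continuous_on {0<..} P" "continuous_on {0<..} h" "continuous_on {0<..} s"
    using P_cont h_cont s_cont by (auto elim: continuous_on_subset)
  have cont_comp: "continuous_on {0<..} (\<lambda>t. \<phi> (P t))" "continuous_on {0<..} (\<lambda>t. \<phi>' (P t))"
    unfolding \<phi>_def \<phi>'_def r1_def r2_def r1'_def r2'_def
    by (intro continuous_on_diff continuous_on_compose2[OF ramp_cont[of UNIV] pc(1) subset_UNIV]
        continuous_on_compose2[OF ramp'_cont[of UNIV] pc(1) subset_UNIV])+
  have h_nz: "\<forall>t\<in>{0<..}. (h t)\<^sup>2 \<noteq> 0" using h_pos by (auto simp: less_le)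
  have cP': "continuous_on {0<..} P'" unfolding P'_def by (intro continuous_intros pc h_nz)
  have cf0': "continuous_on {0<..} (\<lambda>t. complex_of_real (f0' t))"
    unfolding f0'_def by (intro continuous_intros pc cont_comp cP')
  have f0: "f0 \<in> cs"
    by (rule C1_csI[OF df0 cf0' x1(1), of X]) (use zero in auto)
  have vdf: "vd f0 t = of_real (f0' t)" if "0 < t" for t using df0[OF that] by (rule vector_derivative_at)
  obtain \<alpha>0 \<beta>0 where s0: "supp_in f0 \<alpha>0 \<beta>0" using C1_cs_supp[OF f0] by blast
  define \<alpha> \<beta> where "\<alpha> = min \<alpha>0 x1" and "\<beta> = max \<beta>0 X"
  have a0: "0 < \<alpha>" using s0 x1 by (simp add: \<alpha>_def supp_in_def)
  have sp: "supp_in f0 \<alpha> \<beta>" by (rule supp_in_mono[OF s0 a0]) (auto simp: \<alpha>_def \<beta>_def)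
  have ab: "\<alpha> \<le> x1" "X \<le> \<beta>" "\<alpha> < \<beta>" using sp by (auto simp: \<alpha>_def \<beta>_def supp_in_def)
  have en: "Re (Q f0 f0) \<le> mass / (2 * A)"
  proof -
    \<comment> \<open>\<open>aE * |f0'|^2\<close> is the derivative of \<open>?G\<close> plus
      \<open>\<phi>'(P)^2 * P'\<close>. The former contributes nothing, as \<open>\<phi>\<close>
      vanishes at both ends; the latter is dominated by the derivative of \<open>?H\<close>, which
      grows by \<open>c1 + c2\<close> in total.\<close>
    let ?G = "\<lambda>t. \<kappa> * (h t * (\<phi> (P t))\<^sup>2)" and ?H = "\<lambda>t. c1 * r1 (P t) + c2 * r2 (P t)"
    let ?g = "\<lambda>t. \<kappa> * (\<kappa> * s t * (\<phi> (P t))\<^sup>2 + h t * (2 * \<phi> (P t) * (\<phi>' (P t) * P' t))) + (c1 * r1' (P t) + c2 * r2' (P t)) * P' t"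
    have dGH: "((\<lambda>t. ?G t + ?H t) has_real_derivative ?g t) (at t)" if "0 < t" for t
    proof -
      have sq: "((\<lambda>t. (\<phi> (P t))\<^sup>2) has_real_derivative 2 * \<phi> (P t) * (\<phi>' (P t) * P' t)) (at t)"
        using DERIV_power[OF phiP[OF that], of 2] by (simp add: mult_ac)
      have 1: "(?G has_real_derivative \<kappa> * (\<kappa> * s t * (\<phi> (P t))\<^sup>2 + h t * (2 * \<phi> (P t) * (\<phi>' (P t) * P' t)))) (at t)"
        using DERIV_cmult[OF DERIV_mult[OF h_deriv[OF that] sq], of \<kappa>] by (simp add: mult_ac)
      have 2: "(?H has_real_derivative c1 * (r1' (P t) * P' t) + c2 * (r2' (P t) * P' t)) (at t)"
        by (intro DERIV_add DERIV_cmult DERIV_chain2[OF d1 dP[OF that]] DERIV_chain2[OF d2 dP[OF that]])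
      show ?thesis using DERIV_add[OF 1 2] by (simp add: algebra_simps)
    qed
    have ftc: "(?g has_integral (?G \<beta> + ?H \<beta>) - (?G \<alpha> + ?H \<alpha>)) {\<alpha>..\<beta>}"
    proof (rule fundamental_theorem_of_calculus)
      fix t assume "t \<in> {\<alpha>..\<beta>}"
      then have "0 < t" using a0 by auto
      from has_field_derivative_at_within[OF dGH[OF this]]
      show "((\<lambda>t. ?G t + ?H t) has_vector_derivative ?g t) (at t within {\<alpha>..\<beta>})"
        by (simp add: has_real_derivative_iff_has_vector_derivative)
    qed (use ab in simp)
    have bound: "aE t * (cmod (vd f0 t))\<^sup>2 \<le> ?g t" if t: "0 < t" for t
    proof -
      have ht: "h t > 0" and st: "s t > 0" and as: "aE t * s t = 1" and P't: "P' t > 0"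
        using h_pos[of t] s_pos[of t] aE_pos[of t] t by (auto simp: s_eq P'_def)
      have aP: "aE t * (h t)\<^sup>2 * P' t = 1" using ht as by (simp add: P'_def)
      have "aE t * (f0' t)\<^sup>2 = (aE t * s t) * (\<kappa> * \<kappa> * s t * (\<phi> (P t))\<^sup>2) + (aE t * s t) * (2 * \<kappa> * h t * \<phi> (P t) * \<phi>' (P t) * P' t)
          + (aE t * (h t)\<^sup>2 * P' t) * ((\<phi>' (P t))\<^sup>2 * P' t)"
        unfolding f0'_def by (simp add: power2_eq_square algebra_simps)
      also have "\<dots> = \<kappa> * (\<kappa> * s t * (\<phi> (P t))\<^sup>2 + h t * (2 * \<phi> (P t) * (\<phi>' (P t) * P' t))) + (\<phi>' (P t))\<^sup>2 * P' t"
        unfolding as aP by (simp add: algebra_simps)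
      also have "(\<phi>' (P t))\<^sup>2 * P' t \<le> (c1 * r1' (P t) + c2 * r2' (P t)) * P' t"
      proof (rule mult_right_mono)
        \<comment> \<open>The mixed term has the favourable sign, since both slopes are
          non-negative.\<close>
        have "(\<phi>' (P t))\<^sup>2 \<le> r1' (P t) * r1' (P t) + r2' (P t) * r2' (P t)"
          unfolding \<phi>'_def using mult_nonneg_nonneg[OF b1(1) b2(1), of "P t" "P t"] by (simp add: power2_eq_square algebra_simps)
        also have "\<dots> \<le> c1 * r1' (P t) + c2 * r2' (P t)"
          by (intro add_mono mult_right_mono b1 b2)
        finally show "(\<phi>' (P t))\<^sup>2 \<le> c1 * r1' (P t) + c2 * r2' (P t)" .
      qed (use P't in simp)
      finally show ?thesis unfolding vdf[OF t] by simp
    qed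
    have "integral {\<alpha>..\<beta>} (\<lambda>t. aE t * (cmod (vd f0 t))\<^sup>2) \<le> integral {\<alpha>..\<beta>} ?g"
    proof (rule Henstock_Kurzweil_Integration.integral_le)
      show "(\<lambda>t. aE t * (cmod (vd f0 t))\<^sup>2) integrable_on {\<alpha>..\<beta>}"
        using a0 by (intro integrable_continuous_interval) (auto intro!: continuous_intros cs_cont[OF f0] cont_sub[OF aE_cont])
      show "?g integrable_on {\<alpha>..\<beta>}" using ftc by blast
    qed (use bound a0 in auto)
    also have "\<dots> = (?G \<beta> + ?H \<beta>) - (?G \<alpha> + ?H \<alpha>)" by (rule integral_unique[OF ftc])
    also have "\<dots> = c1 + c2"
    proof -
      have l: "P \<alpha> \<le> P x1" using a0 ab by (intro P_mono) auto
      have r: "P X \<le> P \<beta>" using X ab by (intro P_mono) auto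
      have "r1 (P \<alpha>) = 0" "r2 (P \<alpha>) = 0" "r1 (P \<beta>) = 1" "r2 (P \<beta>) = 1"
        using l r T X R unfolding r1_def r2_def
        by (simp_all add: ramp_left[OF e1] ramp_left[OF e2] ramp_right[OF e1] ramp_right[OF e2])
      then show ?thesis by (simp add: \<phi>_def)
    qed
    also have "\<dots> = mass / A" by (simp add: c2_def)
    finally show ?thesis unfolding sqQ_cs[OF f0 sp] using A by (simp add: field_simps)
  qed
  define n where "n = Re (L2_inner M f0 f0)"
  have n: "mass \<le> n"
  proof -
    have "mass = integral {x..y} (\<lambda>t. E t * (cmod (f0 t))\<^sup>2)"
      unfolding mass_def
    proof (rule Henstock_Kurzweil_Integration.integral_cong)
      fix t assume t: "t \<in> {x..y}"
      have "P x \<le> P t" "P t \<le> P y" using t x1 by (auto intro!: P_mono)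
      then have "\<phi> (P t) = 1" unfolding \<phi>_def r1_def r2_def by (simp add: ramp_left[OF e2] ramp_right[OF e1])
      then show "w t = E t * (cmod (f0 t))\<^sup>2" by (simp add: w_def f0_def mult.commute)
    qed
    also have "\<dots> \<le> n" unfolding n_def using x1 y by (intro energy_sub(2)[OF f0]) auto
    finally show ?thesis .
  qed
  then have np: "n > 0" using mass by linarith
  define c where "c = complex_of_real (1 / sqrt n)"
  have cn: "(cmod c)\<^sup>2 = 1 / n" using np by (simp add: c_def power_divide norm_divide)
  show ?thesis
  proof (intro exI conjI allI impI)
    show "(\<lambda>t. c * f0 t) \<in> cs" by (rule Q.scale[OF f0])
    show "x1 < X" using x1 y yX by linarith
    show "c * f0 t = 0" if "0 < t" "t \<le> x1 \<or> X \<le> t" for t using zero[OF that] by simp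
    show "Re (L2_inner M (\<lambda>t. c * f0 t) (\<lambda>t. c * f0 t)) = 1"
      unfolding L2.sq_scale[OF cs_L2[OF f0]] cn using np by (simp add: n_def)
    have "Re (Q (\<lambda>t. c * f0 t) (\<lambda>t. c * f0 t)) = 1 / n * Re (Q f0 f0)" unfolding Q.sq_scale[OF f0] cn ..
    also have "\<dots> \<le> 1 / n * (mass / (2 * A))" using en np by (intro mult_left_mono) auto
    also have "\<dots> \<le> 1 / n * (n / (2 * A))" using n A np by (intro mult_left_mono divide_right_mono) auto
    also have "\<dots> = 1 / (2 * A)" using np by simp
    finally show "Re (Q (\<lambda>t. c * f0 t) (\<lambda>t. c * f0 t)) \<le> 1 / (2 * A)" .
  qed
qed

end

section \<open>Spectral bounds\<close>

text \<open>An infinite \<open>\<Omega>\<close> gives the bound 0, and \<open>\<Omega> = 0\<close>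
  cannot occur, because small \<open>A\<close> would force arbitrarily large lower bounds on the
  real number \<open>r\<close>.\<close>

lemma enn2ereal_inverse_lower:
  fixes \<Omega> :: ennreal
  assumes r: "0 \<le> r" and le: "\<And>A. 0 < A \<Longrightarrow> \<Omega> < ennreal A \<Longrightarrow> 1 / (8 * A) \<le> r"
  shows "enn2ereal (1 / (8 * \<Omega>)) \<le> ereal r"
proof (cases \<Omega>)
  case top
  then show ?thesis using r by (simp add: ennreal_mult_top zero_ennreal.rep_eq)
next
  case (real w)
  have "0 < w"
  proof (rule ccontr)
    assume "\<not> 0 < w"
    then have "\<Omega> < ennreal (1 / (8 * (r + 1)))" using real r by (simp add: ennreal_less_iff)
    from le[OF _ this] show False using r by simp
  qed
  have "1 / (8 * w) \<le> r"
  proof (rule ccontr)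
    assume n: "\<not> 1 / (8 * w) \<le> r"
    obtain t where t: "r < t" "t < 1 / (8 * w)" using n dense[of r "1 / (8 * w)"] by auto
    have tp: "0 < t" using r t by linarith
    have "w < 1 / (8 * t)" using t(2) tp \<open>0 < w\<close> by (simp add: field_simps)
    then have "\<Omega> < ennreal (1 / (8 * t))" using real tp by (simp add: ennreal_less_iff)
    from le[OF _ this] show False using t tp by simp
  qed
  moreover have "1 / (8 * \<Omega>) = ennreal (1 / (8 * w))"
  proof -
    have "8 * \<Omega> = ennreal (8 * w)" using real by (simp add: ennreal_mult')
    then show ?thesis using \<open>0 < w\<close> by (simp add: divide_ennreal flip: ennreal_1)
  qed
  ultimately show ?thesis using \<open>0 < w\<close> by (simp add: enn2ereal_ennreal)
qed

text \<open>\<open>I\<close> is extended real because an essential spectrum may be empty, with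
  infimum infinity; for \<open>\<Omega> = 0\<close> the bound is infinite too.\<close>

lemma enn2ereal_inverse_upper:
  fixes \<Omega> :: ennreal and I :: ereal
  assumes le: "\<And>A. 0 < A \<Longrightarrow> ennreal A < \<Omega> \<Longrightarrow> I \<le> ereal (1 / (2 * A))"
  shows "I \<le> enn2ereal (1 / (2 * \<Omega>))"
proof (cases "\<Omega> = 0")
  case True
  then show ?thesis by simp
next
  case False
  show ?thesis
  proof (rule ccontr)
    assume "\<not> ?thesis"
    then have lt: "enn2ereal (1 / (2 * \<Omega>)) < I" by simp
    obtain t where t: "enn2ereal (1 / (2 * \<Omega>)) < ereal t" "ereal t < I" using ereal_dense2[OF lt] by blast
    have tp: "0 < t" using t(1) enn2ereal_nonneg[of "1 / (2 * \<Omega>)"] by (metis ereal_less(2) le_less_trans)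
    have "ennreal (1 / (2 * t)) < \<Omega>"
    proof (cases \<Omega>)
      case top then show ?thesis by simp
    next
      case (real w)
      then have w: "0 < w" using False by (cases "w = 0") auto
      have "2 * \<Omega> = ennreal (2 * w)" using real by (simp add: ennreal_mult')
      then have "1 / (2 * \<Omega>) = ennreal (1 / (2 * w))" using w by (simp add: divide_ennreal flip: ennreal_1)
      then have "1 / (2 * w) < t" using t(1) w by (simp add: enn2ereal_ennreal)
      then have "1 / (2 * t) < w" using w tp by (simp add: field_simps)
      then show ?thesis using real tp by (simp add: ennreal_less_iff)
    qed
    from le[OF _ this] t(2) tp show False by simp
  qed
qed

locale doob_Omega = doob +
  assumes Omega_fun_eq: "\<And>x. 0 < x \<Longrightarrow> Omega_fun a b x = ennreal (P x) * Wn x"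
begin

sublocale cf: closable_form cs Q M
  by (rule closable_form_Q)

lemma H_D_eq: "H_D a b = cf.T"
  by (simp add: H_D_def)

lemma spectrum_ge:
  assumes z: "z \<in> spectrum M (H_D a b)" and A: "0 < A" "Omega a b < ennreal A"
  shows "1 / (8 * A) \<le> Re z"
proof (rule cf.spectrum_lower[OF _ z[unfolded H_D_eq]])
  fix f assume f: "f \<in> cs"
  show "1 / (8 * A) * cf.N2 f \<le> Re (Q f f)"
  proof (rule form_lower[OF A(1) _ f])
    fix x :: real assume x: "0 < x"
    have "Omega_fun a b x \<le> Omega a b" unfolding Omega_def using x by (intro SUP_upper) auto
    then show "ennreal (P x) * Wn x \<le> ennreal A" using A(2) by (simp add: Omega_fun_eq[OF x])
  qed
qed

lemma spectrum_le:
  assumes A: "0 < A" "ennreal A < Omega a b"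
  shows "\<exists>z\<in>spectrum M (H_D a b). Re z \<le> 1 / (2 * A)"
proof -
  obtain x where x: "0 < x" "ennreal A < ennreal (P x) * Wn x"
    using A(2) unfolding Omega_def less_SUP_iff by (auto simp: Omega_fun_eq)
  obtain y where y: "x < y" "A < P x * integral {x..y} w"
    using Wn_exists_y[of x A "P x"] x A P_pos[of x] by auto
  define mass where "mass = integral {x..y} w"
  have Pm: "0 < P x * mass" using y(2) A(1) by (simp add: mass_def)
  then have mass: "mass > 0" using P_pos[OF x(1)] by (simp add: zero_less_mult_iff)
  \<comment> \<open>Test functions vanish near 0, so the ascent has to start at some
    \<open>x1 > 0\<close>. By continuity of \<open>P\<close> at 0 the loss \<open>P x1\<close> can
    be kept below \<open>d\<close>, the slack in the strict inequality.\<close>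
  define d where "d = P x - A / mass"
  have d: "d > 0" using y(2) mass by (simp add: d_def mass_def pos_divide_less_eq)
  obtain e where e: "e > 0" "\<And>t. t \<in> {0..} \<Longrightarrow> dist t 0 < e \<Longrightarrow> dist (P t) (P 0) < d"
    using P_cont d unfolding continuous_on_iff by (metis atLeast_iff order_refl)
  define x1 where "x1 = min (e / 2) (x / 2)"
  have x1: "0 < x1" "x1 < x" "x1 < e" using e(1) x(1) by (auto simp: x1_def)
  have "P x1 < d" using e(2)[of x1] x1 P_0 P_pos[OF x1(1)] by (simp add: dist_norm)
  then have "A / mass < P x - P x1" by (simp add: d_def)
  then have "A < (P x - P x1) * integral {x..y} w" using mass by (simp add: pos_divide_less_eq mass_def)
  then obtain f X where f: "f \<in> cs" "cf.N2 f = 1" "Re (Q f f) \<le> 1 / (2 * A)"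
    using test_function[OF x1(1,2) y(1) A(1)] by blast
  show ?thesis unfolding H_D_eq by (rule cf.spectrum_upper[OF f(1)]) (use f in auto)
qed

lemma ess_lower_of_Omega_hat:
  assumes A: "0 < A" "Omega_hat a b < ennreal A" and nu: "\<nu> \<le> 1 / (8 * A)"
  shows "ess_lower M cs Q \<nu>"
proof -
  have "\<forall>\<^sub>F x in at_top. Omega_fun a b x < ennreal A"
    using A(2) unfolding Omega_hat_def by (rule Limsup_lessD)
  then obtain l where l: "\<And>x. l \<le> x \<Longrightarrow> Omega_fun a b x < ennreal A" unfolding eventually_at_top_linorder by auto
  show ?thesis
  proof (rule ess_lower_Q[OF A(1) _ _ nu, of "max l 1"])
    fix x assume x: "max l 1 \<le> x"
    then show "ennreal (P x) * Wn x \<le> ennreal A" using l[of x] Omega_fun_eq[of x] by simp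
  qed simp
qed

text \<open>Replacing \<open>P x\<close> by \<open>P x - P x1\<close> costs a factor close to 1 for
  large \<open>x\<close>, because \<open>P\<close> is unbounded; the margin between \<open>A\<close>
  and an intermediate \<open>A1\<close> pays for it.\<close>

lemma escaping_test_interval:
  assumes A: "0 < A" "ennreal A < Omega_hat a b" and x1: "0 < x1"
  shows "\<exists>x>x1. \<exists>y>x. A < (P x - P x1) * integral {x..y} w"
proof -
  obtain c where c: "ennreal A < c" "c < Omega_hat a b" using dense[OF A(2)] by blast
  have "c < top" by (rule less_le_trans[OF c(2) top_greatest])
  then obtain A1 where A1: "c = ennreal A1" "0 \<le> A1" by (cases c) auto
  have AA: "A < A1" using c(1) A1 A(1) by (simp add: ennreal_less_iff)
  have freq: "\<exists>x\<ge>N. ennreal A1 < Omega_fun a b x" for N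
  proof (rule ccontr)
    assume "\<not> ?thesis"
    then have "\<forall>\<^sub>F x in at_top. Omega_fun a b x \<le> ennreal A1"
      by (intro eventually_at_top_linorderI[of N]) (auto simp: not_less)
    then have "Omega_hat a b \<le> ennreal A1" unfolding Omega_hat_def by (rule Limsup_bounded)
    then show False using c(2) A1 by simp
  qed
  obtain x0 where x0: "0 < x0" "P x1 * A1 / (A1 - A) < P x0" using P_unbounded by blast
  obtain x where x: "max x0 (x1 + 1) \<le> x" "ennreal A1 < Omega_fun a b x" using freq by blast
  have xp: "0 < x" "x1 < x" using x(1) x1 by auto
  have "P x0 \<le> P x" using x(1) x0(1) by (intro P_mono) auto
  then have "P x1 * A1 / (A1 - A) < P x" using x0(2) by linarith
  then have "P x1 * A1 < P x * (A1 - A)" using AA by (simp add: pos_divide_less_eq)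
  then have PA: "A * P x < A1 * (P x - P x1)" by (simp add: algebra_simps)
  obtain y where y: "x < y" "A1 < P x * integral {x..y} w"
    using Wn_exists_y[of x A1 "P x"] x(2) xp A1 P_pos[of x] by (auto simp: Omega_fun_eq)
  have m: "0 < integral {x..y} w"
  proof -
    have "0 < P x * integral {x..y} w" using y(2) A1(2) by linarith
    then show ?thesis using P_pos[OF xp(1)] by (simp add: zero_less_mult_iff)
  qed
  have "A * A1 < A * (P x * integral {x..y} w)" using y(2) A(1) by simp
  also have "\<dots> = (A * P x) * integral {x..y} w" by simp
  also have "\<dots> < (A1 * (P x - P x1)) * integral {x..y} w" using PA m by (rule mult_strict_right_mono)
  finally have "A1 * A < A1 * ((P x - P x1) * integral {x..y} w)" by (simp add: mult_ac)
  then have "A < (P x - P x1) * integral {x..y} w" using AA A(1) by simp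
  then show ?thesis using xp y(1) by blast
qed

lemma escaping_sequence:
  assumes A: "0 < A" "ennreal A < Omega_hat a b"
  shows "\<exists>f :: nat \<Rightarrow> real \<Rightarrow> complex. (\<forall>n. f n \<in> cs \<and> cf.N2 (f n) = 1 \<and> Re (Q (f n) (f n)) \<le> 1 / (2 * A)) \<and>
    (\<forall>m n. m \<noteq> n \<longrightarrow> L2_inner M (f m) (f n) = 0 \<and> Q (f m) (f n) = 0)"
proof -
  have "\<forall>x1. \<exists>f X. 0 < x1 \<longrightarrow> f \<in> cs \<and> x1 < X \<and> (\<forall>t>0. t \<le> x1 \<or> X \<le> t \<longrightarrow> f t = 0) \<and> cf.N2 f = 1 \<and> Re (Q f f) \<le> 1 / (2 * A)"
  proof
    fix x1 :: real
    show "\<exists>f X. 0 < x1 \<longrightarrow> f \<in> cs \<and> x1 < X \<and> (\<forall>t>0. t \<le> x1 \<or> X \<le> t \<longrightarrow> f t = 0) \<and> cf.N2 f = 1 \<and> Re (Q f f) \<le> 1 / (2 * A)"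
    proof (cases "0 < x1")
      case True
      obtain x y where xy: "x1 < x" "x < y" "A < (P x - P x1) * integral {x..y} w"
        using escaping_test_interval[OF A True] by blast
      show ?thesis using test_function[OF True xy(1,2) A(1) xy(3)] by blast
    qed simp
  qed
  from choice[OF this] obtain F where "\<forall>x1. \<exists>X. 0 < x1 \<longrightarrow> F x1 \<in> cs \<and> x1 < X \<and> (\<forall>t>0. t \<le> x1 \<or> X \<le> t \<longrightarrow> F x1 t = 0) \<and>
      cf.N2 (F x1) = 1 \<and> Re (Q (F x1) (F x1)) \<le> 1 / (2 * A)" ..
  from choice[OF this] obtain G where FG: "\<forall>x1. 0 < x1 \<longrightarrow> F x1 \<in> cs \<and> x1 < G x1 \<and> (\<forall>t>0. t \<le> x1 \<or> G x1 \<le> t \<longrightarrow> F x1 t = 0) \<and>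
      cf.N2 (F x1) = 1 \<and> Re (Q (F x1) (F x1)) \<le> 1 / (2 * A)" ..
  \<comment> \<open>Each function starts beyond the end of the previous support. The gap of length 1
    separates the supports strictly, so that at every point one of the two functions vanishes on a
    neighbourhood and its derivative vanishes as well.\<close>
  define Y where "Y = rec_nat (1::real) (\<lambda>_ y. G y + 1)"
  have Y0: "Y 0 = 1" and YS: "Y (Suc n) = G (Y n) + 1" for n by (simp_all add: Y_def)
  have Yp: "0 < Y n" for n
  proof (induction n)
    case (Suc n) then show ?case using FG[THEN spec, of "Y n"] by (simp add: YS)
  qed (simp add: Y0)
  define f where "f n = F (Y n)" for n
  have f: "f n \<in> cs" "Y n < G (Y n)" "cf.N2 (f n) = 1" "Re (Q (f n) (f n)) \<le> 1 / (2 * A)"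
    and fz: "\<And>t. 0 < t \<Longrightarrow> t \<le> Y n \<or> G (Y n) \<le> t \<Longrightarrow> f n t = 0" for n
    using FG[THEN spec, of "Y n"] Yp[of n] by (auto simp: f_def)
  have Ymono: "G (Y m) < Y n" if "m < n" for m n
  proof -
    have "Y k \<le> Y (Suc k)" for k using f(2)[of k] by (simp add: YS)
    then have "Y (Suc m) \<le> Y n" by (rule lift_Suc_mono_le[of Y]) (use that in simp)
    then show ?thesis by (simp add: YS)
  qed
  have orth: "L2_inner M (f m) (f n) = 0 \<and> Q (f m) (f n) = 0" if mn: "m < n" for m n
  proof -
    obtain \<alpha> \<beta> where sp: "supp_in (f m) \<alpha> \<beta>" using C1_cs_supp[OF f(1)] by blast
    have p: "0 < \<alpha>" using sp by (simp add: supp_in_def)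
    have z: "f m t * cnj (f n t) = 0 \<and> vd (f m) t * cnj (vd (f n) t) = 0" if t: "0 < t" for t
    proof (cases "t < Y n")
      case True
      then have "f n t = 0" using fz[OF t, of n] by simp
      moreover have "vd (f n) t = 0"
        by (rule vd_zero_open[of "{0<..<Y n}"]) (use t True fz[of _ n] in auto)
      ultimately show ?thesis by simp
    next
      case False
      then have g: "G (Y m) < t" using Ymono[OF mn] by simp
      then have "f m t = 0" using fz[OF t, of m] by simp
      moreover have "vd (f m) t = 0"
        by (rule vd_zero_open[of "{G (Y m)<..}"]) (use g fz[of _ m] f(2)[of m] Yp[of m] in auto)
      ultimately show ?thesis by simp
    qed
    have "integral {\<alpha>..\<beta>} (\<lambda>t. E t *\<^sub>R (f m t * cnj (f n t))) = integral {\<alpha>..\<beta>} (\<lambda>t. 0)"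
      "integral {\<alpha>..\<beta>} (\<lambda>t. aE t *\<^sub>R (vd (f m) t * cnj (vd (f n) t))) = integral {\<alpha>..\<beta>} (\<lambda>t. 0)"
      by (rule Henstock_Kurzweil_Integration.integral_cong; use z p in auto)+
    then show ?thesis unfolding inner_cs[OF f(1) f(1) sp] Q_cs[OF f(1) f(1) sp] by simp
  qed
  have fL: "f n \<in> L2 M" for n by (rule cs_L2[OF f(1)])
  have "L2_inner M (f m) (f n) = 0 \<and> Q (f m) (f n) = 0" if "m \<noteq> n" for m n
  proof (cases "m < n")
    case True then show ?thesis by (rule orth)
  next
    case False
    then have "L2_inner M (f n) (f m) = 0" "Q (f n) (f m) = 0" using orth[of n m] that by auto
    then show ?thesis using L2.ip_sym[OF fL fL, of n m] cf.form.ip_sym[OF f(1) f(1), of n m] by simp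
  qed
  then show ?thesis using f by blast
qed

lemma ess_spectrum_ge:
  assumes z: "z \<in> ess_spectrum M (H_D a b)" and A: "0 < A" "Omega_hat a b < ennreal A"
  shows "1 / (8 * A) \<le> Re z"
  by (rule cf.ess_spectrum_lower[OF ess_lower_of_Omega_hat[OF A order_refl] z[unfolded H_D_eq]])

lemma ess_spectrum_le:
  assumes A: "0 < A" "ennreal A < Omega_hat a b"
  shows "\<exists>z\<in>ess_spectrum M (H_D a b). Re z \<le> 1 / (2 * A)"
proof -
  obtain f :: "nat \<Rightarrow> real \<Rightarrow> complex" where f: "\<forall>n. f n \<in> cs \<and> cf.N2 (f n) = 1 \<and> Re (Q (f n) (f n)) \<le> 1 / (2 * A)"
    "\<forall>m n. m \<noteq> n \<longrightarrow> L2_inner M (f m) (f n) = 0 \<and> Q (f m) (f n) = 0" using escaping_sequence[OF A] by blast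
  show ?thesis unfolding H_D_eq by (rule cf.ess_spectrum_upper[of f]) (use f in auto)
qed

lemma compact_iff: "compact_resolvent M (H_D a b) \<longleftrightarrow> Omega_hat a b = 0"
proof
  assume c: "compact_resolvent M (H_D a b)"
  show "Omega_hat a b = 0"
  proof (rule ccontr)
    assume "Omega_hat a b \<noteq> 0"
    then have "0 < Omega_hat a b" by (simp add: zero_less_iff_neq_zero)
    then obtain c' where c': "0 < c'" "c' < Omega_hat a b" using dense by blast
    have "c' < top" by (rule less_le_trans[OF c'(2) top_greatest])
    then obtain A where A: "c' = ennreal A" "0 \<le> A" by (cases c') auto
    have A': "0 < A" "ennreal A < Omega_hat a b" using c' A by auto
    obtain f :: "nat \<Rightarrow> real \<Rightarrow> complex" where f: "\<forall>n. f n \<in> cs \<and> cf.N2 (f n) = 1 \<and> Re (Q (f n) (f n)) \<le> 1 / (2 * A)"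
      "\<forall>m n. m \<noteq> n \<longrightarrow> L2_inner M (f m) (f n) = 0 \<and> Q (f m) (f n) = 0" using escaping_sequence[OF A'] by blast
    have "\<not> compact_resolvent M cf.T" by (rule cf.not_compact_resolvent[of f]) (use f in auto)
    then show False using c unfolding H_D_eq by blast
  qed
next
  assume z: "Omega_hat a b = 0"
  show "compact_resolvent M (H_D a b)"
    unfolding H_D_eq
  proof (rule cf.compact_resolventI)
    fix k :: nat
    \<comment> \<open>With this \<open>A\<close> the level \<open>1 / (8 * A)\<close> is
      \<open>k + 1\<close>; the added 1 avoids a division by zero at \<open>k = 0\<close>.\<close>
    show "ess_lower M cs Q (real k)"
      by (rule ess_lower_of_Omega_hat[of "1 / (8 * (real k + 1))"]) (use z in \<open>auto simp: ennreal_less_zero_iff\<close>)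
  qed
qed

lemma inf_bounds:
  "enn2ereal (1 / (8 * Omega a b)) \<le> inf_real (spectrum M (H_D a b))"
  "inf_real (spectrum M (H_D a b)) \<le> enn2ereal (1 / (2 * Omega a b))"
  "enn2ereal (1 / (8 * Omega_hat a b)) \<le> inf_real (ess_spectrum M (H_D a b))"
  "inf_real (ess_spectrum M (H_D a b)) \<le> enn2ereal (1 / (2 * Omega_hat a b))"
proof -
  have nn: "0 \<le> Re z" if "z \<in> spectrum M (H_D a b)" for z using that unfolding H_D_eq by (rule cf.spectrum_real)
  have sub: "z \<in> spectrum M (H_D a b)" if "z \<in> ess_spectrum M (H_D a b)" for z using that by (simp add: ess_spectrum_def)
  show "enn2ereal (1 / (8 * Omega a b)) \<le> inf_real (spectrum M (H_D a b))"
    unfolding inf_real_def by (intro INF_greatest enn2ereal_inverse_lower nn spectrum_ge)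
  show "enn2ereal (1 / (8 * Omega_hat a b)) \<le> inf_real (ess_spectrum M (H_D a b))"
    unfolding inf_real_def by (intro INF_greatest enn2ereal_inverse_lower nn sub ess_spectrum_ge)
  show "inf_real (spectrum M (H_D a b)) \<le> enn2ereal (1 / (2 * Omega a b))"
  proof (rule enn2ereal_inverse_upper)
    fix A :: real assume A: "0 < A" "ennreal A < Omega a b"
    obtain z where z: "z \<in> spectrum M (H_D a b)" "Re z \<le> 1 / (2 * A)" using spectrum_le[OF A] by blast
    show "inf_real (spectrum M (H_D a b)) \<le> ereal (1 / (2 * A))"
      unfolding inf_real_def by (rule INF_lower2[OF z(1)]) (use z in simp)
  qed
  show "inf_real (ess_spectrum M (H_D a b)) \<le> enn2ereal (1 / (2 * Omega_hat a b))"
  proof (rule enn2ereal_inverse_upper)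
    fix A :: real assume A: "0 < A" "ennreal A < Omega_hat a b"
    obtain z where z: "z \<in> ess_spectrum M (H_D a b)" "Re z \<le> 1 / (2 * A)" using ess_spectrum_le[OF A] by blast
    show "inf_real (ess_spectrum M (H_D a b)) \<le> ereal (1 / (2 * A))"
      unfolding inf_real_def by (rule INF_lower2[OF z(1)]) (use z in simp)
  qed
qed

end

section \<open>The recurrent and the transient case\<close>

context diffusion
begin

lemma s_weight: "half_line_weight s"
  by unfold_locales (use s_cont s_pos in auto)

sublocale sw: half_line_weight s by (rule s_weight)

lemma sw_tail: "0 \<le> x \<Longrightarrow> sw.tail 0 = ennreal (S x) + sw.tail x"
  using sw.tail_split[of 0 x] by (simp add: S_def)

lemma S_nonneg: "0 \<le> S x"
  using sw.integral_u_nonneg[of 0 x] by (simp add: S_def)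

lemma sw_tail_le:
  assumes "0 \<le> R" "\<And>x. 0 < x \<Longrightarrow> S x \<le> R"
  shows "sw.tail 0 \<le> ennreal R"
proof (rule ccontr)
  assume "\<not> ?thesis"
  then have "ennreal R < ennreal 1 * sw.tail 0" by simp
  from sw.tail_exists[OF _ assms(1) _ this] obtain y where "0 < y" "R < 1 * integral {0..y} s" by auto
  then show False using assms(2)[of y] by (simp add: S_def)
qed

text \<open>The integral over \<open>{0..c}\<close> is finite by continuity, so the tail at 0
  decides for every \<open>c\<close>.\<close>

lemma tail_infinite_s: "tail_infinite (scale_dens a b) \<longleftrightarrow> sw.tail 0 = \<infinity>"
proof -
  have t: "(\<integral>\<^sup>+x\<in>{c..}. ennreal (scale_dens a b x) \<partial>lborel) = sw.tail c" for c
    by (simp add: sw.tail_def s_def)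
  have "sw.tail c = \<infinity> \<longleftrightarrow> sw.tail 0 = \<infinity>" if "0 < c" for c
    using sw_tail[of c] that by (simp add: ennreal_add_eq_top)
  then show ?thesis unfolding tail_infinite_def t by (metis zero_less_one)
qed

lemma recurrent:
  assumes "tail_infinite (scale_dens a b)"
  shows "doob_Omega a b (\<lambda>_. 1) S 0"
proof -
  have inf: "sw.tail 0 = \<infinity>" using assms tail_infinite_s by blast
  have unb: "\<exists>x>0. R < S x" for R
  proof (rule ccontr)
    assume "\<not> ?thesis"
    then have "S x \<le> max R 0" if "0 < x" for x using that by (meson le_max_iff_disj not_less)
    then have "sw.tail 0 \<le> ennreal (max R 0)" by (intro sw_tail_le) auto
    then show False using inf by (simp add: top_unique)
  qed
  interpret d: doob a b "\<lambda>_. 1" S 0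
    by unfold_locales (use S_cont S_deriv unb in \<open>auto simp: S_def\<close>)
  show ?thesis
  proof
    fix x :: real assume x: "0 < x"
    have "(\<integral>\<^sup>+y\<in>{0..x}. ennreal (scale_dens a b y) \<partial>lborel) = ennreal (S x)"
      using sw.nn_integral_u[of 0 x] x by (simp add: S_def s_def)
    moreover have "(\<integral>\<^sup>+y\<in>{x..}. ennreal (exp (2 * B y)) \<partial>lborel) = d.Wn x"
      by (simp add: d.Wn_def d.w_def E_def)
    ultimately show "Omega_fun a b x = ennreal (S x) * d.Wn x" using assms by (simp add: Omega_fun_def)
  qed
qed

text \<open>Finiteness of the tail gives \<open>hh = hh(0) - S\<close>, and positivity follows from
  the strict growth of \<open>S\<close>. Arbitrarily small values occur, since otherwise
  \<open>S\<close>, and with it the whole integral, would stay below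
  \<open>hh(0) - e\<close>.\<close>

lemma hh_props:
  assumes "\<not> tail_infinite (scale_dens a b)"
  shows "\<And>x. 0 \<le> x \<Longrightarrow> hh a b x = hh a b 0 - S x" and "\<And>x. 0 \<le> x \<Longrightarrow> 0 < hh a b x"
    and "\<And>e. 0 < e \<Longrightarrow> \<exists>x>0. hh a b x < e"
proof -
  have fin: "sw.tail 0 < top" using assms tail_infinite_s by (simp add: less_top)
  have hh_tail: "hh a b x = enn2real (sw.tail x)" if "0 \<le> x" for x
  proof -
    have "hh a b x = (LINT y|lborel. s y * indicator {x..} y)"
      unfolding hh_def set_lebesgue_integral_def s_def by (simp add: mult.commute)
    also have "\<dots> = enn2real (\<integral>\<^sup>+y. ennreal (s y * indicator {x..} y) \<partial>lborel)"
    proof (rule integral_eq_nn_integral)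
      have "(\<lambda>y. indicator {x..} y *\<^sub>R s y) \<in> borel_measurable borel"
        using that by (intro borel_measurable_continuous_on_indicator continuous_on_subset[OF s_cont]) auto
      then show "(\<lambda>y. s y * indicator {x..} y) \<in> borel_measurable lborel" by (simp add: mult.commute)
      show "AE y in lborel. 0 \<le> s y * indicator {x..} y"
        using s_pos that by (intro AE_I2) (auto simp: indicator_def intro: less_imp_le)
    qed
    also have "(\<integral>\<^sup>+y. ennreal (s y * indicator {x..} y) \<partial>lborel) = sw.tail x"
      unfolding sw.tail_def by (intro nn_integral_cong) (auto simp: indicator_def)
    finally show ?thesis .
  qed
  have tf: "sw.tail x < top" if "0 \<le> x" for x using fin sw_tail[OF that] by simp
  show eq: "hh a b x = hh a b 0 - S x" if "0 \<le> x" for x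
  proof -
    have "enn2real (sw.tail 0) = S x + enn2real (sw.tail x)"
      unfolding sw_tail[OF that] using tf[OF that] S_nonneg[of x] by (simp add: enn2real_plus)
    then show ?thesis using that by (simp add: hh_tail)
  qed
  have nn: "0 \<le> hh a b x" if "0 \<le> x" for x using that by (simp add: hh_tail)
  show "0 < hh a b x" if x: "0 \<le> x" for x
  proof -
    have "0 < S (x + 1) - S x"
    proof -
      have "S x < S (x + 1)"
      proof (rule DERIV_pos_imp_increasing_open[of x "x + 1" S])
        show "\<exists>r. (S has_real_derivative r) (at t) \<and> 0 < r" if "x < t" "t < x + 1" for t
          using S_deriv[of t] s_pos[of t] x that by auto
        show "continuous_on {x..x+1} S" using x by (intro continuous_on_subset[OF S_cont]) auto
      qed simp
      then show ?thesis by simp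
    qed
    then show ?thesis using eq[OF x] eq[of "x + 1"] nn[of "x + 1"] x by simp
  qed
  show "\<exists>x>0. hh a b x < e" if e: "0 < e" for e
  proof (rule ccontr)
    assume "\<not> ?thesis"
    then have ge: "e \<le> hh a b x" if "0 < x" for x using that by (meson not_less)
    have S: "S x \<le> hh a b 0 - e" if "0 < x" for x using ge[OF that] eq[of x] that by simp
    have he: "0 \<le> hh a b 0 - e" using S[of 1] S_nonneg[of 1] by simp
    then have "sw.tail 0 \<le> ennreal (hh a b 0 - e)" using S he by (intro sw_tail_le) auto
    moreover have "sw.tail 0 = ennreal (hh a b 0)" using fin by (simp add: hh_tail)
    ultimately show False using e he by (simp add: ennreal_le_iff2)
  qed
qed

text \<open>\<open>hh' = - s\<close> gives \<open>(1 / hh)' = s / hh^2\<close>, so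
  \<open>1 / hh - 1 / hh(0)\<close> is the required primitive; it is unbounded because
  \<open>hh\<close> takes arbitrarily small values.\<close>

lemma transient:
  assumes nt: "\<not> tail_infinite (scale_dens a b)"
  shows "doob_Omega a b (hh a b) (\<lambda>x. 1 / hh a b x - 1 / hh a b 0) (-1)"
    and "\<And>x. 0 < x \<Longrightarrow> Omega_fun a b x = ennreal (1 / hh a b x - 1 / hh a b 0) *
         (\<integral>\<^sup>+y\<in>{x..}. ennreal ((hh a b y)\<^sup>2 * exp (2 * B y)) \<partial>lborel)"
proof -
  note hp = hh_props[OF nt]
  let ?h = "hh a b" and ?P = "\<lambda>x. 1 / hh a b x - 1 / hh a b 0"
  have h_cont: "continuous_on {0..} ?h"
  proof (rule continuous_on_eq)
    show "continuous_on {0..} (\<lambda>x. hh a b 0 - S x)" by (intro continuous_intros S_cont)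
    show "hh a b 0 - S x = hh a b x" if "x \<in> {0..}" for x using hp(1)[of x] that by simp
  qed
  have h_deriv: "(?h has_real_derivative - 1 * s x) (at x)" if x: "0 < x" for x
  proof -
    have 1: "((\<lambda>x. hh a b 0 - S x) has_real_derivative - 1 * s x) (at x)"
      using S_deriv[OF x] by (auto intro!: derivative_eq_intros)
    have 2: "hh a b 0 - S t = hh a b t" if "t \<in> {0<..}" for t using hp(1)[of t] that by simp
    have "x \<in> {0<..}" using x by simp
    from has_field_derivative_transform_within_open[OF 1 open_greaterThan this 2] show ?thesis .
  qed
  have P_cont: "continuous_on {0..} ?P"
    using hp(2) by (intro continuous_intros h_cont) (auto simp: less_le)
  have P_deriv: "(?P has_real_derivative s x / (?h x)\<^sup>2) (at x)" if x: "0 < x" for x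
    using h_deriv[OF x] hp(2)[of x] x by (auto intro!: derivative_eq_intros simp: power2_eq_square)
  have unb: "\<exists>x>0. R < ?P x" for R
  proof -
    define R' where "R' = max R 0 + 1 + 1 / hh a b 0"
    have R': "R' > 0" using hp(2)[of 0] by (simp add: R'_def add_nonneg_pos add_pos_pos)
    obtain x where x: "0 < x" "hh a b x < 1 / R'" using hp(3)[of "1 / R'"] R' by auto
    have "R' < 1 / hh a b x" using x hp(2)[of x] R' by (simp add: field_simps)
    then show ?thesis using x(1) by (intro exI[of _ x]) (auto simp: R'_def)
  qed
  interpret d: doob a b ?h ?P "-1"
    by unfold_locales (use hp(2) h_cont h_deriv P_cont P_deriv unb in auto)
  have Wn: "(\<integral>\<^sup>+y\<in>{x..}. ennreal ((hh a b y)\<^sup>2 * exp (2 * B y)) \<partial>lborel) = d.Wn x" for x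
    by (simp add: d.Wn_def d.w_def E_def)
  have eq: "Omega_fun a b x = ennreal (?P x) * d.Wn x" if x: "0 < x" for x
  proof -
    define u where "u y = 1 / (?h y)\<^sup>2 * s y" for y
    have "continuous_on {0..} (\<lambda>y. 1 / (?h y)\<^sup>2 * s y)"
      using hp(2) by (intro continuous_intros h_cont s_cont) (auto simp: less_le)
    then have "continuous_on {0..} u" by (simp add: u_def[abs_def])
    moreover have "0 < u y" if "0 \<le> y" for y using hp(2)[OF that] s_pos[OF that] by (simp add: u_def)
    ultimately interpret u: half_line_weight u by unfold_locales auto
    \<comment> \<open>At 0 only continuity of the primitive is at hand, hence the interior version
      of the fundamental theorem.\<close>
    have "(u has_integral ?P x - ?P 0) {0..x}"
    proof (rule fundamental_theorem_of_calculus_interior)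
      show "continuous_on {0..x} ?P" using x by (intro continuous_on_subset[OF P_cont]) auto
      fix t assume "t \<in> {0<..<x}"
      then have "(?P has_real_derivative u t) (at t)" using P_deriv[of t] by (simp add: u_def)
      then show "(?P has_vector_derivative u t) (at t)" by (simp add: has_real_derivative_iff_has_vector_derivative)
    qed (use x in simp)
    then have "integral {0..x} u = ?P x" by (simp add: integral_unique)
    then have "(\<integral>\<^sup>+y\<in>{0..x}. ennreal (1 / (?h y)\<^sup>2 * scale_dens a b y) \<partial>lborel) = ennreal (?P x)"
      using u.nn_integral_u[of 0 x] x by (simp add: u_def s_def)
    then show ?thesis using nt Wn[of x] by (simp add: Omega_fun_def)
  qed
  show "doob_Omega a b ?h ?P (-1)" by unfold_locales (rule eq)
  show "Omega_fun a b x = ennreal (?P x) * (\<integral>\<^sup>+y\<in>{x..}. ennreal ((hh a b y)\<^sup>2 * exp (2 * B y)) \<partial>lborel)" if "0 < x" for x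
    unfolding Wn by (rule eq[OF that])
qed

lemma H_D_bounds:
  "enn2ereal (1 / (8 * Omega a b)) \<le> inf_real (spectrum M (H_D a b))"
  "inf_real (spectrum M (H_D a b)) \<le> enn2ereal (1 / (2 * Omega a b))"
  "enn2ereal (1 / (8 * Omega_hat a b)) \<le> inf_real (ess_spectrum M (H_D a b))"
  "inf_real (ess_spectrum M (H_D a b)) \<le> enn2ereal (1 / (2 * Omega_hat a b))"
  "compact_resolvent M (H_D a b) \<longleftrightarrow> Omega_hat a b = 0"
proof -
  have "\<exists>h P \<kappa>. doob_Omega a b h P \<kappa>" using recurrent transient(1) by blast
  then obtain h P \<kappa> where "doob_Omega a b h P \<kappa>" by blast
  then interpret d: doob_Omega a b h P \<kappa> .
  show "enn2ereal (1 / (8 * Omega a b)) \<le> inf_real (spectrum M (H_D a b))"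
    "inf_real (spectrum M (H_D a b)) \<le> enn2ereal (1 / (2 * Omega a b))"
    "enn2ereal (1 / (8 * Omega_hat a b)) \<le> inf_real (ess_spectrum M (H_D a b))"
    "inf_real (ess_spectrum M (H_D a b)) \<le> enn2ereal (1 / (2 * Omega_hat a b))"
    "compact_resolvent M (H_D a b) \<longleftrightarrow> Omega_hat a b = 0"
    by (rule d.inf_bounds d.compact_iff)+
qed

lemma Omega_transient:
  assumes "\<not> tail_infinite (scale_dens a b)"
  shows "Omega a b = (SUP x\<in>{0<..}. ennreal (1 / hh a b x - 1 / hh a b 0) *
         (\<integral>\<^sup>+y\<in>{x..}. ennreal ((hh a b y)\<^sup>2 * exp (2 * B y)) \<partial>lborel))"
    and "Omega_hat a b = Limsup at_top (\<lambda>x. ennreal (1 / hh a b x - 1 / hh a b 0) *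
         (\<integral>\<^sup>+y\<in>{x..}. ennreal ((hh a b y)\<^sup>2 * exp (2 * B y)) \<partial>lborel))"
proof -
  show "Omega a b = (SUP x\<in>{0<..}. ennreal (1 / hh a b x - 1 / hh a b 0) *
         (\<integral>\<^sup>+y\<in>{x..}. ennreal ((hh a b y)\<^sup>2 * exp (2 * B y)) \<partial>lborel))"
    unfolding Omega_def by (rule SUP_cong[OF refl]) (use transient(2)[OF assms] in simp)
  show "Omega_hat a b = Limsup at_top (\<lambda>x. ennreal (1 / hh a b x - 1 / hh a b 0) *
         (\<integral>\<^sup>+y\<in>{x..}. ennreal ((hh a b y)\<^sup>2 * exp (2 * B y)) \<partial>lborel))"
    unfolding Omega_hat_def
    by (rule Limsup_eq[OF eventually_mono[OF eventually_gt_at_top[of 0] transient(2)[OF assms]]])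
qed

section \<open>The Schroedinger operator\<close>

text \<open>The exponent carries a parameter \<open>c\<close> because both the multiplication,
  \<open>c = 1\<close>, and its inverse, \<open>c = -1\<close>, must preserve the core.\<close>

lemma cs_exp:
  assumes f: "f \<in> cs"
  shows "0 < x \<Longrightarrow> ((\<lambda>x. of_real (exp (c * B x)) * f x) has_vector_derivative
      of_real (exp (c * B x)) * (of_real (c * (b x / a x)) * f x + vd f x)) (at x)"
    and "(\<lambda>x. of_real (exp (c * B x)) * f x) \<in> cs"
proof -
  have d: "((\<lambda>x. of_real (exp (c * B x)) * f x) has_vector_derivative
      of_real (exp (c * B x)) * (of_real (c * (b x / a x)) * f x + vd f x)) (at x)" if x: "0 < x" for x
  proof -
    have "((\<lambda>x. exp (c * B x)) has_real_derivative exp (c * B x) * (c * (b x / a x))) (at x)"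
      using B_deriv[OF x] by (auto intro!: derivative_eq_intros)
    then have e: "((\<lambda>x. complex_of_real (exp (c * B x))) has_vector_derivative of_real (exp (c * B x) * (c * (b x / a x)))) (at x)"
      by (intro has_vector_derivative_of_real) (simp add: has_real_derivative_iff_has_vector_derivative)
    show ?thesis
      using has_vector_derivative_mult[OF e C1_cs_deriv[OF f x]] by (simp add: algebra_simps)
  qed
  show "0 < x \<Longrightarrow> ((\<lambda>x. of_real (exp (c * B x)) * f x) has_vector_derivative
      of_real (exp (c * B x)) * (of_real (c * (b x / a x)) * f x + vd f x)) (at x)" by (rule d)
  obtain \<alpha> \<beta> where sp: "supp_in f \<alpha> \<beta>" using C1_cs_supp[OF f] by blast
  have sub: "continuous_on {0<..} B" "continuous_on {0<..} (\<lambda>x. b x / a x)"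
    using B_cont ba_cont by (auto elim: continuous_on_subset)
  show "(\<lambda>x. of_real (exp (c * B x)) * f x) \<in> cs"
  proof (rule C1_csI[OF d])
    show "continuous_on {0<..} (\<lambda>x. complex_of_real (exp (c * B x)) * (of_real (c * (b x / a x)) * f x + vd f x))"
      by (intro continuous_intros sub C1_cs_cont0[OF f] C1_cs_cont[OF f])
    show "0 < \<alpha>" using sp by (simp add: supp_in_def)
    show "complex_of_real (exp (c * B x)) * f x = 0" if "0 < x" "x < \<alpha> \<or> \<beta> < x" for x
      using sp that by (auto simp: supp_in_def)
  qed auto
qed

text \<open>To be read with \<open>A = a\<close>, \<open>e = E\<close>, \<open>p = b\<close>,
  \<open>c = b / a\<close>, and \<open>g\<close>, \<open>g'\<close> standing for conjugates: the
  left side is the integrand of \<open>Q_S\<close>, and the last bracket is the derivative of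
  \<open>E * b * f * g\<close>.\<close>

lemma schroedinger_algebra:
  fixes A e c p p' f f' g g' :: complex
  assumes "p = A * c"
  shows "1/2 * (A * e * ((c * f + f') * (c * g + g'))) + 1/2 * (p * c + p') * e * (f * g) =
    1/2 * (A * e * (f' * g')) + 1/2 * (e * p * (f * g' + f' * g) + (2 * c * e * p + e * p') * (f * g))"
  unfolding assms by (simp add: field_simps)

text \<open>Integration by parts turns the potential of \<open>Q_S\<close> into the cross terms of the product rule.\<close>

lemma Q_S_mult:
  assumes b: "C1_on {0<..} b" and f: "f \<in> cs" and g: "g \<in> cs"
  shows "Q_S a b (\<lambda>x. of_real (exp (B x)) * f x) (\<lambda>x. of_real (exp (B x)) * g x) = Q f g"
proof -
  obtain b' where b': "\<forall>x\<in>{0<..}. (b has_vector_derivative b' x) (at x within {0<..})" "continuous_on {0<..} b'"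
    using b by (auto simp: C1_on_def)
  have db: "(b has_real_derivative b' x) (at x)" if "0 < x" for x
    using b'(1) that by (simp add: at_pos_within has_real_derivative_iff_has_vector_derivative)
  have deriv_b: "deriv b x = b' x" if "0 < x" for x using db[OF that] by (rule DERIV_imp_deriv)
  let ?F = "\<lambda>x. complex_of_real (exp (B x)) * f x" and ?G = "\<lambda>x. complex_of_real (exp (B x)) * g x"
  let ?c = "\<lambda>x. complex_of_real (b x / a x)"
  have F: "?F \<in> cs" "?G \<in> cs" using cs_exp(2)[OF f, of 1] cs_exp(2)[OF g, of 1] by simp_all
  have vF: "vd ?F x = of_real (exp (B x)) * (?c x * f x + vd f x)" "vd ?G x = of_real (exp (B x)) * (?c x * g x + vd g x)" if "0 < x" for x
    using vector_derivative_at[OF cs_exp(1)[OF f that, of 1]] vector_derivative_at[OF cs_exp(1)[OF g that, of 1]] by simp_all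
  obtain \<alpha> \<beta> where sp: "supp_in f \<alpha> \<beta>" using C1_cs_supp[OF f] by blast
  have p: "0 < \<alpha>" "\<alpha> < \<beta>" and z: "f \<alpha> = 0" "f \<beta> = 0" using sp by (auto simp: supp_in_def)
  have fz: "f x = 0" "vd f x = 0" if "0 < x" "x < \<alpha> \<or> \<beta> < x" for x using sp that by (auto simp: supp_in_def)
  have cab: "continuous_on {\<alpha>..\<beta>} a" "continuous_on {\<alpha>..\<beta>} b" "continuous_on {\<alpha>..\<beta>} b'" "continuous_on {\<alpha>..\<beta>} B"
    using a_cont b_cont b'(2) B_cont p by (auto elim!: continuous_on_subset)
  have anz: "\<forall>x\<in>{\<alpha>..\<beta>}. a x \<noteq> 0" using a_pos p by (auto simp: less_le)
  have cV: "continuous_on {\<alpha>..\<beta>} (V_S a b)"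
  proof (rule continuous_on_eq)
    show "continuous_on {\<alpha>..\<beta>} (\<lambda>x. (b x)\<^sup>2 / a x + b' x)" by (intro continuous_intros cab anz)
    show "(b x)\<^sup>2 / a x + b' x = V_S a b x" if "x \<in> {\<alpha>..\<beta>}" for x using that p deriv_b[of x] by (simp add: V_S_def)
  qed
  let ?I1 = "\<lambda>x. of_real (a x) * vd ?F x * cnj (vd ?G x)" and ?I2 = "\<lambda>x. of_real (1/2 * V_S a b x) * ?F x * cnj (?G x)"
  let ?I3 = "\<lambda>x. aE x *\<^sub>R (vd f x * cnj (vd g x))"
  have cI: "continuous_on {\<alpha>..\<beta>} ?I1" "continuous_on {\<alpha>..\<beta>} ?I2" "continuous_on {\<alpha>..\<beta>} ?I3"
    by (intro continuous_intros cab cV cs_cont[OF F(1) p(1)] cs_cont[OF F(2) p(1)] cs_cont[OF f p(1)] cs_cont[OF g p(1)] cont_sub[OF aE_cont p(1)])+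
  have "Q_S a b ?F ?G = 1/2 * integral {\<alpha>..\<beta>} ?I1 + integral {\<alpha>..\<beta>} ?I2"
  proof -
    have "(LINT x:{0<..}|lborel. ?I1 x) = integral {\<alpha>..\<beta>} ?I1"
      by (rule integral_reduce(2)[OF p(1) cI(1)]) (simp add: vF fz)
    moreover have "(LINT x:{0<..}|lborel. ?I2 x) = integral {\<alpha>..\<beta>} ?I2"
      by (rule integral_reduce(2)[OF p(1) cI(2)]) (simp add: fz)
    ultimately show ?thesis unfolding Q_S_def by simp
  qed
  also have "\<dots> = integral {\<alpha>..\<beta>} (\<lambda>x. 1/2 * ?I1 x + ?I2 x)"
    by (rule integral_unique[symmetric]) (intro has_integral_add has_integral_mult_right integrable_integral integrable_continuous_interval cI)
  also have "\<dots> = integral {\<alpha>..\<beta>} ?I3 / 2"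
  proof -
    \<comment> \<open>This product vanishes at both ends of the support, so its derivative drops out
      of the integral.\<close>
    let ?h = "\<lambda>x. complex_of_real (E x * b x) * (f x * cnj (g x))"
    let ?h' = "\<lambda>x. complex_of_real (E x * b x) * (f x * cnj (vd g x) + vd f x * cnj (g x))
      + complex_of_real (2 * (b x / a x) * E x * b x + E x * b' x) * (f x * cnj (g x))"
    have hd: "(?h has_vector_derivative ?h' x) (at x)" if x: "0 < x" for x
    proof -
      have "(E has_real_derivative 2 * (b x / a x) * E x) (at x)"
        unfolding E_def using B_deriv[OF x] by (auto intro!: derivative_eq_intros)
      then have "((\<lambda>x. E x * b x) has_real_derivative 2 * (b x / a x) * E x * b x + E x * b' x) (at x)"
        by (rule DERIV_cong[OF DERIV_mult[OF _ db[OF x]]]) simp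
      then have e: "((\<lambda>x. complex_of_real (E x * b x)) has_vector_derivative of_real (2 * (b x / a x) * E x * b x + E x * b' x)) (at x)"
        by (intro has_vector_derivative_of_real) (simp add: has_real_derivative_iff_has_vector_derivative)
      have fg: "((\<lambda>x. f x * cnj (g x)) has_vector_derivative f x * cnj (vd g x) + vd f x * cnj (g x)) (at x)"
        by (intro has_vector_derivative_mult C1_cs_deriv f x has_vector_derivative_cnj g)
      show ?thesis by (rule has_vector_derivative_mult[OF e fg])
    qed
    have ftc: "(?h' has_integral ?h \<beta> - ?h \<alpha>) {\<alpha>..\<beta>}"
      by (rule fundamental_theorem_of_calculus[OF less_imp_le[OF p(2)] has_vector_derivative_at_within[OF hd]]) (use p in auto)
    have pw: "1/2 * ?I1 x + ?I2 x = 1/2 * ?I3 x + 1/2 * ?h' x" if x: "x \<in> {\<alpha>..\<beta>}" for x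
    proof -
      have xp: "0 < x" using x p by auto
      have ax: "a x \<noteq> 0" using anz x by blast
      have ee: "complex_of_real (exp (B x)) * of_real (exp (B x)) = of_real (E x)"
        unfolding of_real_mult[symmetric] E_def by (simp flip: exp_add)
      have 1: "?I1 x = of_real (a x) * of_real (E x) * ((?c x * f x + vd f x) * (?c x * cnj (g x) + cnj (vd g x)))"
        unfolding vF[OF xp] ee[symmetric] by (simp add: mult_ac)
      have 2: "?I2 x = 1/2 * (of_real (b x) * ?c x + of_real (b' x)) * of_real (E x) * (f x * cnj (g x))"
        unfolding ee[symmetric] using deriv_b[OF xp] by (simp add: V_S_def power2_eq_square)
      have 3: "?I3 x = of_real (a x) * of_real (E x) * (vd f x * cnj (vd g x))"
        by (simp add: aE_def scaleR_conv_of_real)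
      have 4: "?h' x = of_real (E x) * of_real (b x) * (f x * cnj (vd g x) + vd f x * cnj (g x))
          + (2 * ?c x * of_real (E x) * of_real (b x) + of_real (E x) * of_real (b' x)) * (f x * cnj (g x))"
        by simp
      show ?thesis unfolding 1 2 3 4 by (rule schroedinger_algebra) (use ax in simp)
    qed
    have "integral {\<alpha>..\<beta>} (\<lambda>x. 1/2 * ?I1 x + ?I2 x) = integral {\<alpha>..\<beta>} (\<lambda>x. 1/2 * ?I3 x + 1/2 * ?h' x)"
      by (rule Henstock_Kurzweil_Integration.integral_cong[OF pw])
    also have "\<dots> = 1/2 * integral {\<alpha>..\<beta>} ?I3 + 1/2 * (?h \<beta> - ?h \<alpha>)"
      by (rule integral_unique) (intro has_integral_add has_integral_mult_right ftc integrable_integral integrable_continuous_interval cI(3))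
    finally show ?thesis using z by simp
  qed
  also have "\<dots> = Q f g" unfolding Q_cs[OF f g sp] by simp
  finally show ?thesis .
qed

text \<open>The density of \<open>M\<close> is the square of \<open>exp (B x)\<close>, which makes
  the multiplication isometric. Together with the form identity on the core, it yields the closure
  of \<open>Q_S\<close> and its operator without a separate study of \<open>Q_S\<close>.\<close>

lemma mult_equiv_exp:
  assumes b: "C1_on {0<..} b"
  shows "mult_equiv (\<lambda>x. exp (B x)) M M_S cs cs Q (Q_S a b)"
proof
  show "0 < exp (B x)" for x by simp
  have Em: "(\<lambda>x. exp (c * B x)) \<in> borel_measurable M_S" for c
  proof -
    have "continuous_on {0<..} B" using B_cont by (rule continuous_on_subset) auto
    then show ?thesis unfolding M_S_def borel_measurable_restrict_lborel
      by (intro borel_measurable_continuous_on_restrict continuous_intros)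
  qed
  have M_S: "M = density M_S (\<lambda>x. ennreal (E x))" by (simp add: M_eq M_S_def)
  have EM: "E \<in> borel_measurable M_S" unfolding E_def using Em[of 2] by simp
  have Msets: "borel_measurable M = borel_measurable M_S" by (simp add: M_sets M_S_def)
  have ee: "exp (B x) * exp (B x) = E x" for x by (simp add: E_def flip: exp_add)
  have meas: "(\<lambda>x. complex_of_real (exp (B x)) * u x) \<in> borel_measurable M_S \<longleftrightarrow> u \<in> borel_measurable M_S" for u :: "real \<Rightarrow> complex"
  proof
    assume "u \<in> borel_measurable M_S"
    then show "(\<lambda>x. complex_of_real (exp (B x)) * u x) \<in> borel_measurable M_S" using Em[of 1] by simp
  next
    assume m: "(\<lambda>x. complex_of_real (exp (B x)) * u x) \<in> borel_measurable M_S"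
    have "(\<lambda>x. complex_of_real (exp (- 1 * B x)) * (complex_of_real (exp (B x)) * u x)) \<in> borel_measurable M_S"
      by (rule borel_measurable_times[OF measurable_compose[OF Em borel_measurable_of_real] m])
    also have "(\<lambda>x. complex_of_real (exp (- 1 * B x)) * (complex_of_real (exp (B x)) * u x)) = u"
    proof
      fix x
      have "complex_of_real (exp (- 1 * B x)) * of_real (exp (B x)) = of_real (exp (- 1 * B x + B x))"
        unfolding exp_add of_real_mult ..
      then show "complex_of_real (exp (- 1 * B x)) * (complex_of_real (exp (B x)) * u x) = u x"
        by (simp flip: mult.assoc)
    qed
    finally show "u \<in> borel_measurable M_S" .
  qed
  show "(\<lambda>x. complex_of_real (exp (B x)) * u x) \<in> L2 M_S \<longleftrightarrow> u \<in> L2 M" for u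
  proof -
    have "(cmod (complex_of_real (exp (B x)) * u x))\<^sup>2 = E x *\<^sub>R (cmod (u x))\<^sup>2" for x
      unfolding ee[symmetric] by (simp add: norm_mult power_mult_distrib power2_eq_square)
    then show ?thesis unfolding L2_def mem_Collect_eq meas Msets
      using integral_density_pos(2)[OF EM E_pos, of "\<lambda>x. (cmod (u x))\<^sup>2"] by (simp add: M_S)
  qed
  show "L2_inner M_S (\<lambda>x. complex_of_real (exp (B x)) * u x) (\<lambda>x. complex_of_real (exp (B x)) * v x) = L2_inner M u v" for u v
  proof -
    have "(complex_of_real (exp (B x)) * u x) * cnj (complex_of_real (exp (B x)) * v x) = E x *\<^sub>R (u x * cnj (v x))" for x
      unfolding ee[symmetric] by (simp add: scaleR_conv_of_real mult_ac)
    then show ?thesis unfolding L2_inner_def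
      using integral_density_pos(1)[OF EM E_pos, of "\<lambda>x. u x * cnj (v x)"] by (simp add: M_S)
  qed
  show "(\<lambda>x. complex_of_real (exp (B x)) * u x) \<in> cs \<longleftrightarrow> u \<in> cs" for u
  proof
    assume "u \<in> cs"
    then show "(\<lambda>x. complex_of_real (exp (B x)) * u x) \<in> cs" using cs_exp(2)[of u 1] by simp
  next
    assume "(\<lambda>x. complex_of_real (exp (B x)) * u x) \<in> cs"
    from cs_exp(2)[OF this, of "-1"]
    have "(\<lambda>x. complex_of_real (exp (- 1 * B x)) * (complex_of_real (exp (B x)) * u x)) \<in> cs" .
    also have "(\<lambda>x. complex_of_real (exp (- 1 * B x)) * (complex_of_real (exp (B x)) * u x)) = u"
    proof
      fix x
      have "complex_of_real (exp (- 1 * B x)) * of_real (exp (B x)) = of_real (exp (- 1 * B x + B x))"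
        unfolding exp_add of_real_mult ..
      then show "complex_of_real (exp (- 1 * B x)) * (complex_of_real (exp (B x)) * u x) = u x"
        by (simp flip: mult.assoc)
    qed
    finally show "u \<in> cs" .
  qed
  show "(\<lambda>x. u x - v x) \<in> cs" if "u \<in> cs" "v \<in> cs" for u v using C1_cs_lin[OF that, of "-1"] by simp
  show "Q_S a b (\<lambda>x. complex_of_real (exp (B x)) * u x) (\<lambda>x. complex_of_real (exp (B x)) * v x) = Q u v"
    if "u \<in> cs" "v \<in> cs" for u v by (rule Q_S_mult[OF b that])
  show "(AE x in M_S. R x) \<longleftrightarrow> (AE x in M. R x)" for R
    unfolding M_S using EM E_pos by (subst AE_density) auto
qed

end

theorem theorem1:
  fixes a b :: "real \<Rightarrow> real"
  assumes "C1_on {0..} a" and "\<forall>x\<ge>0. a x > 0" and "continuous_on {0..} b"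
  shows
    "(\<not> tail_infinite (scale_dens a b) \<longrightarrow>
       Omega a b = (SUP x\<in>{0<..}. ennreal (1 / hh a b x - 1 / hh a b 0) *
         (\<integral>\<^sup>+y\<in>{x..}. ennreal ((hh a b y)\<^sup>2 * exp (2 * BB a b y)) \<partial>lborel)) \<and>
       Omega_hat a b = Limsup at_top (\<lambda>x. ennreal (1 / hh a b x - 1 / hh a b 0) *
         (\<integral>\<^sup>+y\<in>{x..}. ennreal ((hh a b y)\<^sup>2 * exp (2 * BB a b y)) \<partial>lborel))) \<and>
     enn2ereal (1 / (8 * Omega a b)) \<le> inf_real (spectrum (M_D a b) (H_D a b)) \<and>
     inf_real (spectrum (M_D a b) (H_D a b)) \<le> enn2ereal (1 / (2 * Omega a b)) \<and>
     enn2ereal (1 / (8 * Omega_hat a b)) \<le> inf_real (ess_spectrum (M_D a b) (H_D a b)) \<and>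
     inf_real (ess_spectrum (M_D a b) (H_D a b)) \<le> enn2ereal (1 / (2 * Omega_hat a b)) \<and>
     (compact_resolvent (M_D a b) (H_D a b) \<longleftrightarrow> Omega_hat a b = 0) \<and>
     (C1_on {0<..} b \<and> (\<exists>m. \<forall>x>0. m \<le> V_S a b x) \<and> tail_infinite a \<longrightarrow>
       inf_real (spectrum (M_D a b) (H_D a b)) = inf_real (spectrum M_S (H_S a b)) \<and>
       inf_real (ess_spectrum (M_D a b) (H_D a b)) = inf_real (ess_spectrum M_S (H_S a b)) \<and>
       (compact_resolvent M_S (H_S a b) \<longleftrightarrow> Omega_hat a b = 0))"
proof -
  have "continuous_on {0..} a"
    using assms(1) unfolding C1_on_def continuous_on_eq_continuous_within
    by (meson has_vector_derivative_continuous)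
  then interpret diffusion a b using assms(2,3) by unfold_locales auto
  have "inf_real (spectrum M (H_D a b)) = inf_real (spectrum M_S (H_S a b)) \<and>
       inf_real (ess_spectrum M (H_D a b)) = inf_real (ess_spectrum M_S (H_S a b)) \<and>
       (compact_resolvent M_S (H_S a b) \<longleftrightarrow> Omega_hat a b = 0)" if "C1_on {0<..} b"
  proof -
    interpret u: mult_equiv "\<lambda>x. exp (B x)" M M_S cs cs Q "Q_S a b" by (rule mult_equiv_exp[OF that])
    show ?thesis
      using u.spectrum_U u.ess_spectrum_U u.compact_resolvent_U H_D_bounds(5) unfolding H_D_def H_S_def by simp
  qed
  then show ?thesis using Omega_transient H_D_bounds by blast
qed

end
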